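(* In the setting of the context, let $\varepsilon\in(0,1)$ and assume $$\delta=\min\Big\{1,\tfrac{\varepsilon^2}{9\left((L_1^0+\|h_1\|_\infty)\operatorname{diam}(D)+L_2^0d^{1/2}\operatorname{diam}(D)^{1/2}\right)^2}\Big\},$$ $$M=\max\Big\{1,\Big\lceil\tfrac{\log\left(6(2\|h_0\|_\infty d+\operatorname{diam}(D)^2\|h_1\|_\infty)\right)-\log(d)+\log(\varepsilon^{-1})}{\log\left(1+\frac{\beta^2\delta^2}{2\operatorname{diam}(D)^2}\right)}\Big\rceil\Big\},$$ and $$n=\max\{1,\lceil 9\,C^2\varepsilon^{-2}\rceil^2\},$$ where $$\begin{aligned} C&=\Big(L_2^0+\tfrac{2L_1^0\operatorname{diam}(D)}{d}+\tfrac1d\Big(2\operatorname{diam}(D)\|h_1\|_\infty+\operatorname{diam}(D)^2\big(L_2^1+\tfrac{2L_1^1\operatorname{diam}(D)}{d}\big)\Big)\Big)d^{1/2}\operatorname{diam}(D)\\ &\quad+\Big(L_2^0+\tfrac{2M\operatorname{diam}(D)\|h_1\|_\infty+L_2^1M\operatorname{diam}(D)^2}{d}\Big)\tfrac{d^{1/2}\operatorname{diam}(D)}{M^2}\\ &\quad+3\sqrt2\Big(1+\sqrt d+\sqrt{d(2\log M+M\log(1+L))+\log2}\Big)\Big(\|h_0\|_\infty+\tfrac{M\operatorname{diam}(D)^2\|h_1\|_\infty}{d}\Big)\\ &\quad+\tfrac{12\operatorname{diam}(D)^2(L_1^0d+L_1^1\operatorname{diam}(D)^2M)(\log6+3+\log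 M)}{d^{3/2}M}. \end{aligned}$$ Then $\mathbb{E}\big[\sup_{x\in D}|w(x)-\bar w(x)|\big]\le\varepsilon$, and there exist $c,q\in(0,\infty)$ such that $\max\{n,M\}\le c\,d^q\varepsilon^{-q}$, where $q$ is an absolute constant and $c$ depends only on $L$, $L_1^0$, $L_2^0$, $L_1^1$, $L_2^1$, $\|h_0\|_\infty$, $\|h_1\|_\infty$, $\beta^{-1}$, $\operatorname{diam}(D)$, and $d$, and this dependency is at most polynomial.
   Context: Let $d\in\mathbb{N}=\{1,2,\dots\}$, $\mathbb{N}_0=\mathbb{N}\cup\{0\}$, let $\|\cdot\|$ be the Euclidean norm, and let $D\subseteq\mathbb{R}^d$ be nonempty, open, bounded, and convex. Let $(\Omega,\mathcal{F},\mathbb{P})$ be a probability space carrying all random variables and $B\colon[0,\infty)\times\Omega\to\mathbb{R}^d$ a standard Brownian motion with $B_0=0$. Let $r(x)=\inf\{\|x-y\|\colon y\in\partial D\}$ and, for $x\in\overline D$, $\tau^x=\inf\{t\ge0\colon x+B_t\in\partial D\}$. $(\beta,\varepsilon)$-distance: for $\beta\in(0,1]$, $\varepsilon\in[0,\infty)$, a Lipschitz continuous $\tilde r\colon D\to[0,\infty)$ is a $(\beta,\varepsilon)$-distance on $D$ if $\tilde r(y)\le r(y)$ for all $y\in D$ and $\tilde r(x)\ge\beta r(x)$ for all $x\in D$ with $r(x)\ge\varepsilon$. Let $\beta\in(0,1]$, $\delta\in(0,\infty)$, and let $\bar r$ be a $(\beta,\delta)$-distance on $D$, extended to $\overline D$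 by $\bar r=0$ on $\partial D$. Walk-on-Spheres process: let $\zeta=\inf\{t\ge0\colon\|B_t\|\ge1\}$; let $\rho_k^j$, $j,k\in\mathbb{N}$, be i.i.d. copies of $\zeta$; let $Z_k^j$, $j,k\in\mathbb{N}$, be standard normal in $\mathbb{R}^d$; all $\rho_k^j,Z_k^j$, $j,k\in\mathbb{N}$, are independent; $\xi_k^j=\|Z_k^j\|^{-1}Z_k^j$. For $x\in\overline D$, $j,k\in\mathbb{N}$: $\bar X_0^{x,j}=x$, $\bar X_k^{x,j}=\bar X_{k-1}^{x,j}+\bar r(\bar X_{k-1}^{x,j})\xi_k^j$, $\bar\tau_0^{x,j}=0$, $\bar\tau_k^{x,j}=\bar\tau_{k-1}^{x,j}+\bar r(\bar X_{k-1}^{x,j})^2\rho_k^j$. Let $U=\{x\in\mathbb{R}^d\colon\|x\|\le1\}$ and let $\mu$ be the probability measure on the Borel sets of $[0,\infty)\times U$ given by $\mu(A)=d\,\mathbb{E}[\int_0^\zeta \mathbf 1_A(s,B_s)\,ds]$. Let $(V_k^i,Y_k^i)$, $i,k\in\mathbb{N}$, be i.i.d. with distribution $\mu$, and assume that $(V_k^i,Y_k^i)$, $\rho_k^i$, $Z_k^i$, $i,k\in\mathbb{N}$, and $B$ are independent. Let $h_0,h_1\colon[0,\infty)\times\overline D\to\mathbb{R}$ be measurable and bounded; $\|F\|_\infty$ denotes the supremum of $|F|$ over the domain of $F$. Let $L,L_j^i\in[0,\infty)$, $i\in\{0,1\}$, $j\in\{1,2\}$, with $|h_i(s,x)-h_i(t,y)|\le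 L_1^i|s-t|+L_2^i\|x-y\|$ for all $s,t\in[0,\infty)$, $x,y\in\overline D$, $i\in\{0,1\}$, and $|\bar r(x)-\bar r(y)|\le L\|x-y\|$ for all $x,y\in D$. Let $w\colon D\to\mathbb{R}$ be continuous with $w(x)=\mathbb{E}[h_0(\tau^x,x+B_{\tau^x})]+\mathbb{E}[\int_0^{\tau^x}h_1(s,x+B_s)\,ds]$ for all $x\in D$. For $n,M\in\mathbb{N}$ let $\bar w\colon D\times\Omega\to\mathbb{R}$ satisfy for all $x\in D$ $$\bar w(x)=\frac1n\sum_{i=1}^n\Big[h_0(\bar\tau_M^{x,i},\bar X_M^{x,i})+\frac1d\sum_{k=1}^M \bar r(\bar X_{k-1}^{x,i})^2\, h_1\big(\bar\tau_{k-1}^{x,i}+\bar r(\bar X_{k-1}^{x,i})^2V_k^i,\ \bar X_{k-1}^{x,i}+\bar r(\bar X_{k-1}^{x,i})Y_k^i\big)\Big].$$ Terminology: a real number is an absolute constant if it does not depend on any variables or parameters of the problem. A quantity $Q$ depends only on $q_1,\dots,q_m$ if it is an explicit function of $q_1,\dots,q_m$ with no other dependencies; this dependency is at most polynomial if there is an absolute constant $a\in[0,\infty)$ with $Q\le a(1+|q_1|+\dots+|q_m|)^a$. Conventions in degenerate cases: $\varepsilon^2/0=+\infty$ and $\log 0=-\infty$ (so that then $\delta=1$, respectively $M=1$). *)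

theory Defs
  imports "HOL-Probability.Probability"
begin

definition std_brownian_motion :: "'w measure \<Rightarrow> (real \<Rightarrow> 'w \<Rightarrow> real ^ 'd) \<Rightarrow> bool" where
  "std_brownian_motion P B \<longleftrightarrow>
     prob_space P \<and>
     (\<forall>t\<ge>0. B t \<in> borel_measurable P) \<and>
     (\<forall>\<omega>\<in>space P. B 0 \<omega> = 0) \<and>
     (\<forall>\<omega>\<in>space P. continuous_on {0..} (\<lambda>t. B t \<omega>)) \<and>
     (\<forall>s t. 0 \<le> s \<and> s < t \<longrightarrow>
        distributed P lborel (\<lambda>\<omega>. B t \<omega> - B s \<omega>)
          (\<lambda>x. ennreal (\<Prod>i\<in>UNIV. normal_density 0 (sqrt (t - s)) (x $ i)))) \<and>
     (\<forall>(t :: nat \<Rightarrow> real) m. 0 \<le> t 0 \<and> mono t \<longrightarrow>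
        prob_space.indep_vars P (\<lambda>_. borel) (\<lambda>i \<omega>. B (t (Suc i)) \<omega> - B (t i) \<omega>) {..<m})"

definition std_normal_vector :: "'w measure \<Rightarrow> ('w \<Rightarrow> real ^ 'd) \<Rightarrow> bool" where
  "std_normal_vector P Z \<longleftrightarrow>
     distributed P lborel Z (\<lambda>x. ennreal (\<Prod>i\<in>UNIV. std_normal_density (x $ i)))"

text \<open>
  The infimum is taken in the extended nonnegative reals, so it is infinite if the set is never hit.
  The two hitting times needed below are almost surely finite; on the exceptional null set
  the real value is \<open>0\<close>.
\<close>

definition hitting_time :: "(real \<Rightarrow> 'w \<Rightarrow> 'a) \<Rightarrow> 'a set \<Rightarrow> 'w \<Rightarrow> real" where
  "hitting_time X A \<omega> = enn2real (INF t \<in> {t. 0 \<le> t \<and> X t \<omega> \<in> A}. ennreal t)"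

definition boundary_time ::
    "(real \<Rightarrow> 'w \<Rightarrow> real ^ 'd) \<Rightarrow> (real ^ 'd) set \<Rightarrow> real ^ 'd \<Rightarrow> 'w \<Rightarrow> real" where
  "boundary_time B D x = hitting_time (\<lambda>t \<omega>. x + B t \<omega>) (frontier D)"

definition ball_exit_time :: "(real \<Rightarrow> 'w \<Rightarrow> real ^ 'd) \<Rightarrow> 'w \<Rightarrow> real" where
  "ball_exit_time B = hitting_time B {y. 1 \<le> norm y}"

text \<open>
  The measure \<open>\<mu>\<close> as a set function on the Borel sets of the ambient space; it is concentrated
  on \<open>[0, \<infinity>)\<close> times the closed unit ball.
\<close>

definition occupation_law ::
    "'w measure \<Rightarrow> (real \<Rightarrow> 'w \<Rightarrow> real ^ 'd) \<Rightarrow> (real \<times> (real ^ 'd)) set \<Rightarrow> ennreal" where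
  "occupation_law P B A =
     of_nat CARD('d) *
     (\<integral>\<^sup>+ \<omega>. (\<integral>\<^sup>+ s. indicator {0..ball_exit_time B \<omega>} s * indicator A (s, B s \<omega>) \<partial>lborel) \<partial>P)"

definition is_distance :: "real \<Rightarrow> real \<Rightarrow> (real ^ 'd) set \<Rightarrow> (real ^ 'd \<Rightarrow> real) \<Rightarrow> bool" where
  "is_distance \<beta> \<epsilon> D r \<longleftrightarrow>
     (\<exists>K. K-lipschitz_on D r) \<and>
     (\<forall>x\<in>D. 0 \<le> r x) \<and>
     (\<forall>x\<in>D. r x \<le> infdist x (frontier D)) \<and>
     (\<forall>x\<in>D. \<epsilon> \<le> infdist x (frontier D) \<longrightarrow> \<beta> * infdist x (frontier D) \<le> r x)"

text \<open>
  One realisation of the walk; \<open>z\<close> lists the Gaussian vectors and \<open>sgn\<close> projects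
  them to the unit sphere.
\<close>

primrec wos_pos :: "(real ^ 'd \<Rightarrow> real) \<Rightarrow> (nat \<Rightarrow> real ^ 'd) \<Rightarrow> real ^ 'd \<Rightarrow> nat \<Rightarrow> real ^ 'd" where
  "wos_pos r z x 0 = x"
| "wos_pos r z x (Suc k) = wos_pos r z x k + r (wos_pos r z x k) *\<^sub>R sgn (z (Suc k))"

primrec wos_time ::
    "(real ^ 'd \<Rightarrow> real) \<Rightarrow> (nat \<Rightarrow> real ^ 'd) \<Rightarrow> (nat \<Rightarrow> real) \<Rightarrow> real ^ 'd \<Rightarrow> nat \<Rightarrow> real" where
  "wos_time r z \<rho> x 0 = 0"
| "wos_time r z \<rho> x (Suc k) = wos_time r z \<rho> x k + (r (wos_pos r z x k))\<^sup>2 * \<rho> (Suc k)"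

text \<open>
  The sources of randomness take values in different spaces, so their joint independence
  is expressed through the generated \<open>\<sigma>\<close>-algebras. The Brownian motion enters as a single
  source, viewed as a random element of the product space over all times.
  In \<open>V i k\<close> etc. the first index is the sample, the second the step; both start at \<open>1\<close>.
\<close>

datatype source = Path | Occupation nat nat | Exit_Time nat nat | Gaussian nat nat

definition source_events ::
    "'w measure \<Rightarrow> (real \<Rightarrow> 'w \<Rightarrow> real ^ 'd) \<Rightarrow> (nat \<Rightarrow> nat \<Rightarrow> 'w \<Rightarrow> real) \<Rightarrow>
     (nat \<Rightarrow> nat \<Rightarrow> 'w \<Rightarrow> real ^ 'd) \<Rightarrow> (nat \<Rightarrow> nat \<Rightarrow> 'w \<Rightarrow> real) \<Rightarrow>
     (nat \<Rightarrow> nat \<Rightarrow> 'w \<Rightarrow> real ^ 'd) \<Rightarrow> source \<Rightarrow> 'w set set" where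
  "source_events P B V Y \<rho> Z s = (case s of
     Path \<Rightarrow> sets (vimage_algebra (space P) (\<lambda>\<omega>. \<lambda>t\<in>{0..}. B t \<omega>) (PiM {0..} (\<lambda>_. borel)))
   | Occupation i k \<Rightarrow> sets (vimage_algebra (space P) (\<lambda>\<omega>. (V i k \<omega>, Y i k \<omega>)) borel)
   | Exit_Time i k \<Rightarrow> sets (vimage_algebra (space P) (\<rho> i k) borel)
   | Gaussian i k \<Rightarrow> sets (vimage_algebra (space P) (Z i k) borel))"

definition sources_independent ::
    "'w measure \<Rightarrow> (real \<Rightarrow> 'w \<Rightarrow> real ^ 'd) \<Rightarrow> (nat \<Rightarrow> nat \<Rightarrow> 'w \<Rightarrow> real) \<Rightarrow>
     (nat \<Rightarrow> nat \<Rightarrow> 'w \<Rightarrow> real ^ 'd) \<Rightarrow> (nat \<Rightarrow> nat \<Rightarrow> 'w \<Rightarrow> real) \<Rightarrow>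
     (nat \<Rightarrow> nat \<Rightarrow> 'w \<Rightarrow> real ^ 'd) \<Rightarrow> bool" where
  "sources_independent P B V Y \<rho> Z \<longleftrightarrow>
     prob_space.indep_sets P (source_events P B V Y \<rho> Z)
       ({Path} \<union> (\<Union>i\<in>{1..}. \<Union>k\<in>{1..}. {Occupation i k, Exit_Time i k, Gaussian i k}))"

definition sup_norm_on :: "(real \<times> (real ^ 'd)) set \<Rightarrow> (real \<Rightarrow> real ^ 'd \<Rightarrow> real) \<Rightarrow> real" where
  "sup_norm_on A h = (SUP (t, x)\<in>A. \<bar>h t x\<bar>)"

text \<open>
  Parameters of the algorithm. Throughout, \<open>d\<close> is the dimension, \<open>R\<close> the diameter of the domain,
  \<open>H0\<close> and \<open>H1\<close> are the sup norms of \<open>h0\<close> and \<open>h1\<close>, \<open>L\<close> is the Lipschitz constant of the distance,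
  and \<open>L10\<close>, \<open>L20\<close> (\<open>L11\<close>, \<open>L21\<close>) are the time and space Lipschitz constants
  of \<open>h0\<close> (of \<open>h1\<close>). The case distinctions implement the conventions
  \<open>\<epsilon>\<^sup>2 / 0 = \<infinity>\<close> and \<open>log 0 = -\<infinity>\<close>.
\<close>

definition wos_delta :: "nat \<Rightarrow> real \<Rightarrow> real \<Rightarrow> real \<Rightarrow> real \<Rightarrow> real \<Rightarrow> real" where
  "wos_delta d L10 L20 H1 R \<epsilon> =
     (let a = 9 * ((L10 + H1) * R + L20 * sqrt (real d) * sqrt R)\<^sup>2
      in if a = 0 then 1 else min 1 (\<epsilon>\<^sup>2 / a))"

definition wos_steps :: "nat \<Rightarrow> real \<Rightarrow> real \<Rightarrow> real \<Rightarrow> real \<Rightarrow> real \<Rightarrow> real \<Rightarrow> nat" where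
  "wos_steps d H0 H1 \<beta> R \<delta> \<epsilon> =
     (let a = 6 * (2 * H0 * real d + R\<^sup>2 * H1)
      in if a = 0 then 1
         else max 1 (nat \<lceil>(ln a - ln (real d) + ln (1 / \<epsilon>)) / ln (1 + \<beta>\<^sup>2 * \<delta>\<^sup>2 / (2 * R\<^sup>2))\<rceil>))"

definition wos_C ::
    "nat \<Rightarrow> nat \<Rightarrow> real \<Rightarrow> real \<Rightarrow> real \<Rightarrow> real \<Rightarrow> real \<Rightarrow> real \<Rightarrow> real \<Rightarrow> real \<Rightarrow> real" where
  "wos_C d M L L10 L20 L11 L21 H0 H1 R =
     (L20 + 2 * L10 * R / real d
        + 1 / real d * (2 * R * H1 + R\<^sup>2 * (L21 + 2 * L11 * R / real d))) * sqrt (real d) * R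
   + (L20 + (2 * real M * R * H1 + L21 * real M * R\<^sup>2) / real d) * (sqrt (real d) * R / (real M)\<^sup>2)
   + 3 * sqrt 2
        * (1 + sqrt (real d)
             + sqrt (real d * (2 * ln (real M) + real M * ln (1 + L)) + ln 2))
        * (H0 + real M * R\<^sup>2 * H1 / real d)
   + 12 * R\<^sup>2 * (L10 * real d + L11 * R\<^sup>2 * real M) * (ln 6 + 3 + ln (real M))
        / (real d powr (3 / 2) * real M)"

definition wos_samples :: "real \<Rightarrow> real \<Rightarrow> nat" where
  "wos_samples C \<epsilon> = max 1 ((nat \<lceil>9 * C\<^sup>2 / \<epsilon>\<^sup>2\<rceil>)\<^sup>2)"

text \<open>
  \<open>c\<close> is a positive quantity depending only on \<open>m\<close> real quantities, at most polynomially.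
\<close>

definition at_most_polynomial :: "nat \<Rightarrow> (real list \<Rightarrow> real) \<Rightarrow> bool" where
  "at_most_polynomial m c \<longleftrightarrow>
     (\<exists>a\<ge>0. \<forall>qs. length qs = m \<longrightarrow> 0 < c qs \<and> c qs \<le> a * (1 + (\<Sum>q\<leftarrow>qs. \<bar>q\<bar>)) powr a)"

end

theory Submission
  imports Defs
begin

text \<open>
  By the strong Markov property the walk on spheres samples Brownian motion at successive exit times
  of balls, and an exit from a ball has a uniformly distributed direction that is independent of the exit time, because both
  laws are rotation invariant. Hence the expectation of one sample differs from \<open>w\<close> only through
  stopping after \<open>M\<close> steps. The probability that the walk is then still at distance \<open>\<delta>\<close>
  from the boundary decays geometrically, and from distance less than \<open>\<delta>\<close> the remaining exit time
  has mean at most \<open>\<delta> R\<close> by comparison with a slab, which is where convexity enters.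

  The samples are Lipschitz in the starting point with an integrable constant, so the supremum over \<open>D\<close>
  reduces to a maximum over a finite grid, which is controlled by Hoeffding's lemma and a union bound
  for exponential moments. The grid may be exponentially fine in \<open>M\<close>, since only the logarithm of its size matters.
\<close>

section \<open>Gaussian measures and determining classes\<close>

text \<open>No filtration and no martingale theory enter. Everything needed from Brownian motion is
  a statement about laws on a countable path encoding: stopping events are Borel events of the
  stopped path, the strong Markov property is an identity of laws, and Wald's identities follow by
  comparing \<open>B\<close> at a bounded stopping time with \<open>B\<close> at a fixed later time.
  Exit times and payoffs are therefore written as Borel functionals of encoded paths.

  The budget is three times \<open>\<epsilon> / 3\<close>: for walks that have come within
  \<open>\<delta>\<close> of the boundary, for walks that never did, and for the fluctuation.
  \<open>\<delta>\<close> and the number of steps are solved from the first two shares. In the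
  third, the Lipschitz constant of a sample grows like \<open>(1 + L) ^ M\<close>; a grid fine
  enough to beat it contributes the term \<open>M * ln (1 + L)\<close> under the root in
  \<open>wos_C\<close>. The sample number is essentially a square \<open>s\<^sup>2\<close>: the
  fluctuation has order \<open>1 / s\<close> but only \<open>1 / sqrt s\<close> is required, and the
  spare factor \<open>sqrt s\<close> absorbs the logarithm of a further refinement by
  \<open>s\<close>.\<close>

lemma nn_integral_lborel_translate:
  fixes g :: "'a::euclidean_space => ennreal"
  assumes [measurable]: "g \<in> borel_measurable borel"
  shows "(\<integral>\<^sup>+x. g (x + a) \<partial>lborel) = (\<integral>\<^sup>+x. g x \<partial>lborel)"
proof -
  have "(\<integral>\<^sup>+x. g x \<partial>lborel) = (\<integral>\<^sup>+x. g x \<partial>distr lborel borel ((+) a))"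
    by (simp add: lborel_distr_plus)
  also have "... = (\<integral>\<^sup>+x. g (x + a) \<partial>lborel)"
    by (subst nn_integral_distr) (auto simp: add.commute)
  finally show ?thesis by simp
qed

lemma orthogonal_transformation_measurable:
  fixes f :: "'a::euclidean_space => 'a"
  assumes "orthogonal_transformation f"
  shows "f \<in> borel_measurable borel"
  using assms
  by (intro borel_measurable_continuous_onI linear_continuous_on linear_linear[THEN iffD1])
     (auto simp: orthogonal_transformation_linear linear_conv_bounded_linear[symmetric])

text \<open>Uniqueness of translation-invariant measures: evaluate
  \<open>\<integral>\<integral> 1\<^sub>A(f x + y) 1\<^sub>C(y) dx dy\<close> in both orders, \<open>C\<close> being the unit ball.\<close>

lemma lborel_distr_orthogonal:
  fixes f :: "'a::euclidean_space => 'a"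
  assumes f: "orthogonal_transformation f"
  shows "distr lborel borel f = lborel"
proof (rule measure_eqI)
  fix A assume "A \<in> sets (distr lborel borel f)"
  then have [measurable]: "A \<in> sets borel" by simp
  have [measurable]: "f \<in> borel_measurable borel"
    by (rule orthogonal_transformation_measurable[OF f])
  have lin: "linear f" using f by (rule orthogonal_transformation_linear)
  have surj: "surj f" by (rule orthogonal_transformation_surj[OF f])
  let ?C = "ball (0::'a) 1"
  have C [measurable]: "?C \<in> sets borel" by (rule borel_open) simp
  let ?i = "%A x. indicator A x :: ennreal"
  have inv: "f (inv f y) = y" for y by (rule surj_f_inv_f[OF surj])
  have 1: "(\<integral>\<^sup>+x. ?i A (f x + y) \<partial>lborel) = (\<integral>\<^sup>+x. ?i A (f x) \<partial>lborel)" for y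
  proof -
    have "(\<integral>\<^sup>+x. ?i A (f x + y) \<partial>lborel) = (\<integral>\<^sup>+x. ?i A (f (x + inv f y)) \<partial>lborel)"
      by (simp add: linear_add[OF lin] inv)
    also have "... = (\<integral>\<^sup>+x. ?i A (f x) \<partial>lborel)"
      by (rule nn_integral_lborel_translate) simp
    finally show ?thesis .
  qed
  have 2: "(\<integral>\<^sup>+x. ?i ?C (y - f x) \<partial>lborel) = emeasure lborel ?C" for y
  proof -
    have "y - f x \<in> ?C \<longleftrightarrow> x + - inv f y \<in> ?C" for x
    proof -
      have "norm (y - f x) = norm (f (inv f y - x))" by (simp add: linear_diff[OF lin] inv)
      also have "... = norm (inv f y - x)" by (rule orthogonal_transformation_norm[OF f])
      finally show ?thesis by (simp add: norm_minus_commute)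
    qed
    then have "(\<integral>\<^sup>+x. ?i ?C (y - f x) \<partial>lborel) = (\<integral>\<^sup>+x. ?i ?C (x + - inv f y) \<partial>lborel)"
      by (intro nn_integral_cong) (simp only: indicator_def)
    also have "... = (\<integral>\<^sup>+x. ?i ?C x \<partial>lborel)"
      by (rule nn_integral_lborel_translate) (auto intro!: borel_measurable_indicator borel_open)
    finally show ?thesis by simp
  qed
  have "emeasure (distr lborel borel f) A * emeasure lborel ?C
      = (\<integral>\<^sup>+y. (\<integral>\<^sup>+x. ?i A (f x) \<partial>lborel) * ?i ?C y \<partial>lborel)"
  proof -
    have "emeasure (distr lborel borel f) A = (\<integral>\<^sup>+x. ?i A x \<partial>distr lborel borel f)"
      by simp
    also have "... = (\<integral>\<^sup>+x. ?i A (f x) \<partial>lborel)"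
      by (rule nn_integral_distr) auto
    finally show ?thesis by (simp add: nn_integral_cmult C)
  qed
  also have "... = (\<integral>\<^sup>+y. (\<integral>\<^sup>+x. ?i A (f x + y) * ?i ?C y \<partial>lborel) \<partial>lborel)"
    by (simp add: nn_integral_multc 1)
  also have "... = (\<integral>\<^sup>+x. (\<integral>\<^sup>+y. ?i A (f x + y) * ?i ?C y \<partial>lborel) \<partial>lborel)"
    by (rule lborel_pair.Fubini') measurable
  also have "... = (\<integral>\<^sup>+x. (\<integral>\<^sup>+y. ?i A y * ?i ?C (y - f x) \<partial>lborel) \<partial>lborel)"
  proof (rule nn_integral_cong)
    fix x
    have "(\<integral>\<^sup>+y. (%y. ?i A y * ?i ?C (y - f x)) (y + f x) \<partial>lborel)
        = (\<integral>\<^sup>+y. ?i A y * ?i ?C (y - f x) \<partial>lborel)"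
      by (rule nn_integral_lborel_translate) simp
    then show "(\<integral>\<^sup>+y. ?i A (f x + y) * ?i ?C y \<partial>lborel) = (\<integral>\<^sup>+y. ?i A y * ?i ?C (y - f x) \<partial>lborel)"
      by (simp add: add.commute)
  qed
  also have "... = (\<integral>\<^sup>+y. (\<integral>\<^sup>+x. ?i A y * ?i ?C (y - f x) \<partial>lborel) \<partial>lborel)"
    by (rule lborel_pair.Fubini') measurable
  also have "... = emeasure lborel A * emeasure lborel ?C"
    by (simp add: nn_integral_cmult 2 nn_integral_multc)
  finally have "emeasure (distr lborel borel f) A * emeasure lborel ?C = emeasure lborel A * emeasure lborel ?C" .
  moreover have "emeasure lborel ?C \<noteq> 0"
    using content_ball_pos[of 1 "0::'a"] by (auto simp: measure_def)
  moreover have "emeasure lborel ?C \<noteq> \<infinity>"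
    using emeasure_bounded_finite[OF bounded_ball[of "0::'a" 1]] by auto
  ultimately show "emeasure (distr lborel borel f) A = emeasure lborel A"
    by (metis ennreal_mult_divide_eq infinity_ennreal_def)
qed simp

text \<open>Centred Gaussian law with covariance \<open>s\<close> times the identity. The degenerate
  case is split off as a point mass, because monotone time sequences may repeat a time and such an
  increment must still have a law.\<close>

definition gauss :: "real => (real ^ 'd) measure" where
  "gauss s = (if s = 0 then return borel 0
     else density lborel (%x. ennreal (\<Prod>i\<in>UNIV. normal_density 0 (sqrt s) (x $ i))))"

lemma sets_gauss [simp, measurable_cong]: "sets (gauss s) = sets borel"
  and space_gauss [simp]: "space (gauss s) = UNIV"
  by (auto simp: gauss_def)

text \<open>The density depends on the norm alone, which is the source of both the rotation
  invariance and the scaling of \<open>gauss\<close>.\<close>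

lemma normal_density_prod_eq:
  fixes x :: "real ^ 'd"
  assumes "0 < s"
  shows "(\<Prod>i\<in>UNIV. normal_density 0 (sqrt s) (x $ i))
       = (1 / sqrt (2 * pi * s)) ^ CARD('d) * exp (- (norm x)\<^sup>2 / (2 * s))"
proof -
  have "(\<Prod>i\<in>UNIV. normal_density 0 (sqrt s) (x $ i))
      = (1 / sqrt (2 * pi * s)) ^ CARD('d) * exp (\<Sum>i\<in>UNIV. - (x $ i)\<^sup>2 / (2 * s))"
    using assms by (simp add: normal_density_def prod.distrib exp_sum prod_dividef power_divide)
  also have "(\<Sum>i\<in>UNIV. - (x $ i)\<^sup>2 / (2 * s)) = - (norm x)\<^sup>2 / (2 * s)"
    by (simp add: norm_vec_def L2_set_def sum_nonneg sum_negf sum_divide_distrib)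
  finally show ?thesis .
qed

lemma gauss_orthogonal:
  fixes f :: "real ^ 'd => real ^ 'd"
  assumes f: "orthogonal_transformation f" and s: "0 <= s"
  shows "distr (gauss s) borel f = gauss s"
proof (cases "s = 0")
  case True
  have "f 0 = 0" using orthogonal_transformation_linear[OF f] by (rule linear_0)
  then show ?thesis using True orthogonal_transformation_measurable[OF f]
    by (simp add: gauss_def distr_return)
next
  case False
  then have s: "0 < s" using s by simp
  have [measurable]: "f \<in> borel_measurable borel"
    by (rule orthogonal_transformation_measurable[OF f])
  let ?g = "%x::real^'d. ennreal ((1 / sqrt (2 * pi * s)) ^ CARD('d) * exp (- (norm x)\<^sup>2 / (2 * s)))"
  have g: "gauss s = density lborel ?g"
    using s by (simp add: gauss_def normal_density_prod_eq)
  show ?thesis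
  proof (rule measure_eqI)
    fix A :: "(real ^ 'd) set" assume "A \<in> sets (distr (gauss s) borel f)"
    then have [measurable]: "A \<in> sets borel" by simp
    have [measurable]: "f -` A \<in> sets borel" by (rule measurable_sets_borel[of _ borel]) measurable
    have "emeasure (distr (gauss s) borel f) A = (\<integral>\<^sup>+x. ?g x * indicator (f -` A) x \<partial>lborel)"
      by (subst emeasure_distr) (auto simp: g emeasure_density)
    also have "... = (\<integral>\<^sup>+x. ?g (f x) * indicator A (f x) \<partial>lborel)"
      by (intro nn_integral_cong) (simp add: orthogonal_transformation_norm[OF f] indicator_def)
    also have "... = (\<integral>\<^sup>+x. ?g x * indicator A x \<partial>distr lborel borel f)"
      by (subst nn_integral_distr) auto
    also have "... = emeasure (gauss s) A"
      by (simp add: g emeasure_density lborel_distr_orthogonal[OF f])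
    finally show "emeasure (distr (gauss s) borel f) A = emeasure (gauss s) A" .
  qed simp
qed

lemma gauss_scale:
  fixes r :: real
  assumes r: "0 < r" and s: "0 <= s"
  shows "distr (gauss s :: (real ^ 'd) measure) borel ((*\<^sub>R) r) = gauss (r\<^sup>2 * s)"
proof (cases "s = 0")
  case True
  then show ?thesis by (simp add: gauss_def distr_return)
next
  case False
  then have s: "0 < s" using s by simp
  let ?g = "%s. %x::real^'d. ennreal ((1 / sqrt (2 * pi * s)) ^ CARD('d) * exp (- (norm x)\<^sup>2 / (2 * s)))"
  have g: "gauss s = density lborel (?g s)" "gauss (r\<^sup>2 * s) = density lborel (?g (r\<^sup>2 * s))"
    using s r by (simp_all add: gauss_def normal_density_prod_eq)
  show ?thesis
  proof (rule measure_eqI)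
    fix A :: "(real ^ 'd) set" assume "A \<in> sets (distr (gauss s) borel ((*\<^sub>R) r))"
    then have [measurable]: "A \<in> sets borel" by simp
    have [measurable]: "(*\<^sub>R) r -` A \<in> sets borel" by (rule measurable_sets_borel[of _ borel]) measurable
    \<comment> \<open>The Jacobian of the dilation cancels against the change of the normalising
      constant, so the densities match pointwise.\<close>
    have *: "ennreal (\<bar>r\<bar> ^ CARD('d)) * ?g (r\<^sup>2 * s) (r *\<^sub>R x) = ?g s x" for x
    proof -
      have "\<bar>r\<bar> ^ CARD('d) * (1 / sqrt (2 * pi * (r\<^sup>2 * s))) ^ CARD('d) = (1 / sqrt (2 * pi * s)) ^ CARD('d)"
        using r s by (simp add: real_sqrt_mult power_mult_distrib power_divide)
      moreover have "- (norm (r *\<^sub>R x))\<^sup>2 / (2 * (r\<^sup>2 * s)) = - (norm x)\<^sup>2 / (2 * s)"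
        using r s by (simp add: power_mult_distrib)
      ultimately have "\<bar>r\<bar> ^ CARD('d) * ((1 / sqrt (2 * pi * (r\<^sup>2 * s))) ^ CARD('d) * exp (- (norm (r *\<^sub>R x))\<^sup>2 / (2 * (r\<^sup>2 * s))))
         = (1 / sqrt (2 * pi * s)) ^ CARD('d) * exp (- (norm x)\<^sup>2 / (2 * s))"
        by (simp only: mult.assoc[symmetric])
      then show ?thesis
        by (subst ennreal_mult[symmetric]) (use s in \<open>auto intro!: mult_nonneg_nonneg zero_le_power simp del: times_divide_eq_left\<close>)
    qed
    have "emeasure (gauss (r\<^sup>2 * s)) A = (\<integral>\<^sup>+x. ?g (r\<^sup>2 * s) x * indicator A x \<partial>lborel)"
      by (simp add: g emeasure_density)
    also have "... = (\<integral>\<^sup>+x. ennreal (\<bar>r\<bar> ^ CARD('d)) * (?g (r\<^sup>2 * s) (r *\<^sub>R x) * indicator A (r *\<^sub>R x)) \<partial>lborel)"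
      using r by (subst lborel_affine[of r 0]) (simp_all add: nn_integral_density nn_integral_distr ennreal_power)
    also have "... = (\<integral>\<^sup>+x. ?g s x * indicator ((*\<^sub>R) r -` A) x \<partial>lborel)"
    proof (intro nn_integral_cong)
      fix x :: "real^'d"
      show "ennreal (\<bar>r\<bar> ^ CARD('d)) * (?g (r\<^sup>2 * s) (r *\<^sub>R x) * indicator A (r *\<^sub>R x)) = ?g s x * indicator ((*\<^sub>R) r -` A) x"
        by (subst *[symmetric]) (simp only: mult.assoc indicator_def vimage_eq)
    qed
    also have "... = emeasure (distr (gauss s) borel ((*\<^sub>R) r)) A"
      by (subst emeasure_distr) (auto simp: g emeasure_density)
    finally show "emeasure (distr (gauss s) borel ((*\<^sub>R) r)) A = emeasure (gauss (r\<^sup>2 * s)) A" by simp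
  qed simp
qed

lemma nn_integral_gauss_component:
  fixes i :: "'d::finite"
  assumes s: "0 <= s"
  shows "(\<integral>\<^sup>+x. ennreal ((x $ i)\<^sup>2) \<partial>(gauss s :: (real ^ 'd) measure)) = ennreal s"
proof (cases "s = 0")
  case True
  then show ?thesis by (simp add: gauss_def nn_integral_return)
next
  case False
  then have s: "0 < s" using s by simp
  let ?b = "axis i (1::real)"
  \<comment> \<open>Only the factor belonging to coordinate \<open>i\<close> carries the square, so
    Tonelli leaves one second moment and total masses \<open>1\<close>.\<close>
  define f :: "real^'d => real => ennreal" where
    "f b u = ennreal (normal_density 0 (sqrt s) u) * (if b = ?b then ennreal (u\<^sup>2) else 1)" for b u
  have basis: "(\<Prod>b\<in>Basis. h b) = (\<Prod>j\<in>UNIV. h (axis j 1))" for h :: "real^'d => ennreal"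
  proof -
    have "Basis = range (%j. axis j 1 :: real^'d)" by (auto simp: Basis_vec_def)
    moreover have inj: "inj (%j. axis j 1 :: real^'d)" by (auto simp: inj_on_def axis_eq_axis)
    ultimately show ?thesis using prod.reindex[OF inj, of h] by (metis (no_types, lifting) comp_apply prod.cong)
  qed
  have 1: "(\<Prod>b\<in>Basis. f b (x \<bullet> b)) = ennreal (\<Prod>j\<in>UNIV. normal_density 0 (sqrt s) (x $ j)) * ennreal ((x $ i)\<^sup>2)" for x
    by (simp add: basis f_def prod.distrib inner_axis axis_eq_axis prod.delta prod_ennreal)
  have n1: "(\<integral>\<^sup>+u. ennreal (normal_density 0 (sqrt s) u) \<partial>lborel) = 1"
    using prob_space.emeasure_space_1[OF prob_space_normal_density[of "sqrt s" 0]] s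
    by (simp add: emeasure_density)
  have n2: "(\<integral>\<^sup>+u. ennreal (normal_density 0 (sqrt s) u) * ennreal (u\<^sup>2) \<partial>lborel) = ennreal s"
  proof -
    have "has_bochner_integral lborel (%u. normal_density 0 (sqrt s) u * (u - 0)^(2*1)) (fact (2*1) / ((2 / (sqrt s)\<^sup>2)^1 * fact 1))"
      using s by (intro normal_moment_even) simp
    then have "has_bochner_integral lborel (%u. normal_density 0 (sqrt s) u * u\<^sup>2) s"
      using s by (simp add: fact_numeral)
    then have "(\<integral>\<^sup>+u. ennreal (normal_density 0 (sqrt s) u * u\<^sup>2) \<partial>lborel) = ennreal s"
      by (simp add: has_bochner_integral_iff nn_integral_eq_integral)
    then show ?thesis by (simp add: ennreal_mult)
  qed
  have "(\<integral>\<^sup>+x. ennreal ((x $ i)\<^sup>2) \<partial>(gauss s :: (real ^ 'd) measure)) = (\<integral>\<^sup>+x. (\<Prod>b\<in>Basis. f b (x \<bullet> b)) \<partial>lborel)"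
    using s by (simp add: gauss_def nn_integral_density 1)
  also have "... = (\<Prod>b\<in>Basis. (\<integral>\<^sup>+u. f b u \<partial>lborel))"
    by (rule nn_integral_lborel_prod) (auto simp: f_def)
  also have "... = (\<Prod>j\<in>UNIV. if j = i then ennreal s else 1)"
    unfolding basis by (intro prod.cong refl) (auto simp: f_def[abs_def] axis_eq_axis n1 n2)
  also have "... = ennreal s" by simp
  finally show ?thesis .
qed

lemma nn_integral_gauss_inner:
  fixes e :: "real ^ 'd"
  assumes s: "0 <= s"
  shows "(\<integral>\<^sup>+x. ennreal ((x \<bullet> e)\<^sup>2) \<partial>(gauss s :: (real ^ 'd) measure)) = ennreal ((norm e)\<^sup>2 * s)"
proof -
  \<comment> \<open>An arbitrary axis: \<open>e\<close> is rotated onto it, and the answer does not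
    depend on the choice.\<close>
  fix i :: 'd
  have n: "norm e = norm (norm e *\<^sub>R axis i (1::real))" by simp
  obtain f where f: "orthogonal_transformation f" "f e = norm e *\<^sub>R axis i (1::real)"
    by (rule orthogonal_transformation_exists[OF n]) (rule that)
  note [measurable] = orthogonal_transformation_measurable[OF f(1)]
  have "(\<integral>\<^sup>+x. ennreal ((x \<bullet> e)\<^sup>2) \<partial>gauss s) = (\<integral>\<^sup>+x. ennreal ((f x \<bullet> f e)\<^sup>2) \<partial>gauss s)"
    using f(1) by (simp add: orthogonal_transformation_def)
  also have "... = (\<integral>\<^sup>+x. ennreal ((x \<bullet> f e)\<^sup>2) \<partial>distr (gauss s) borel f)"
    by (subst nn_integral_distr) auto
  also have "... = (\<integral>\<^sup>+x. ennreal ((norm e)\<^sup>2) * ennreal ((x $ i)\<^sup>2) \<partial>gauss s)"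
    using s f by (simp add: gauss_orthogonal inner_axis power_mult_distrib ennreal_mult[symmetric])
  also have "... = ennreal ((norm e)\<^sup>2 * s)"
    by (subst nn_integral_cmult) (use s in \<open>auto simp: nn_integral_gauss_component ennreal_mult\<close>)
  finally show ?thesis .
qed

lemma integral_gauss_inner:
  fixes e :: "real ^ 'd"
  assumes s: "0 <= s"
  shows "(\<integral>x. x \<bullet> e \<partial>(gauss s :: (real ^ 'd) measure)) = 0"
proof -
  have o: "orthogonal_transformation (uminus :: real^'d => _)"
    by (simp add: orthogonal_transformation_neg orthogonal_transformation_id[unfolded id_def])
  have "(\<integral>x. x \<bullet> e \<partial>gauss s) = (\<integral>x. x \<bullet> e \<partial>distr (gauss s) borel uminus)"
    using s by (simp add: gauss_orthogonal[OF o])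
  also have "... = - (\<integral>x. x \<bullet> e \<partial>gauss s)"
    by (subst integral_distr) auto
  finally show ?thesis by simp
qed

text \<open>Cylinder sets generate the product \<open>\<sigma>\<close>-algebra, and over a countable
  index set this is the Borel \<open>\<sigma>\<close>-algebra of the product topology. Identities
  between path laws are reduced here to finitely many times.\<close>

lemma measure_eqI_borel_fun:
  fixes M N :: "('i::countable => 'a::second_countable_topology) measure"
  assumes sets: "sets M = sets borel" "sets N = sets borel"
    and eq: "\<And>J A. finite J ==> (\<And>i. i \<in> J ==> A i \<in> sets borel) ==>
      emeasure M {b. \<forall>i\<in>J. b i \<in> A i} = emeasure N {b. \<forall>i\<in>J. b i \<in> A i}"
    and fin: "finite_measure M"
  shows "M = N"
proof (rule measure_eqI_PiM_infinite[where I=UNIV and M="%_. borel"])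
  fix A :: "'i => 'a set" and J :: "'i set"
  assume J: "finite J" "\<And>i. i \<in> J ==> A i \<in> sets borel"
  have "prod_emb UNIV (%_. borel) J (Pi\<^sub>E J A) = {b. \<forall>i\<in>J. b i \<in> A i}"
    by (auto simp: prod_emb_def PiE_def Pi_def)
  then show "emeasure M (prod_emb UNIV (%_. borel) J (Pi\<^sub>E J A)) = emeasure N (prod_emb UNIV (%_. borel) J (Pi\<^sub>E J A))"
    using eq[OF J] by simp
qed (simp_all add: sets sets_PiM_equal_borel fin)

lemma cylinder_measurable:
  fixes A :: "'i::countable => 'a::second_countable_topology set"
  assumes "finite J" "\<And>i. i \<in> J ==> A i \<in> sets borel"
  shows "{b. \<forall>i\<in>J. b i \<in> A i} \<in> sets borel"
proof -
  have "{b \<in> space borel. \<forall>i\<in>J. b i \<in> A i} \<in> sets borel"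
  proof (rule sets.sets_Collect_finite_All)
    fix i assume "i \<in> J"
    then have [measurable]: "A i \<in> sets borel" by (rule assms)
    have [measurable]: "(%b::'i => 'a. b i) \<in> borel_measurable borel"
      by (intro borel_measurable_continuous_onI continuous_on_product_coordinates)
    show "{b \<in> space borel. b i \<in> A i} \<in> sets borel" by measurable
  qed (simp_all add: assms)
  then show ?thesis by simp
qed

text \<open>The indicator of an open set \<open>U\<close> is the pointwise limit of
  \<open>min 1 (k * infdist x (- U))\<close>, and open sets form an intersection-stable generator.
  Lipschitz test functions are chosen because they survive limits of random variables and oscillate
  little on small balls.\<close>

lemma measure_eqI_lipschitz:
  fixes M N :: "'a::metric_space measure"
  assumes sets: "sets M = sets borel" "sets N = sets borel"
    and fin: "finite_measure M" "finite_measure N"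
    and eq: "\<And>f k. k-lipschitz_on UNIV f ==> (\<And>x. 0 <= f x \<and> f x <= 1) ==>
      (\<integral>x. f x \<partial>M) = (\<integral>x. f x \<partial>N :: real)"
  shows "M = N"
proof -
  interpret M: finite_measure M by fact
  interpret N: finite_measure N by fact
  note [measurable_cong] = sets
  have spc: "space M = UNIV" "space N = UNIV"
    using sets_eq_imp_space_eq[OF sets(1)] sets_eq_imp_space_eq[OF sets(2)] by simp_all
  have U: "measure M U = measure N U" if U: "open U" for U
  proof (cases "U = UNIV")
    \<comment> \<open>The approximants below do not cover the whole space: its complement is empty,
      and \<open>infdist\<close> to the empty set is \<open>0\<close>.\<close>
    case True
    show ?thesis using eq[of 0 "%_. 1"] True spc by (simp add: lipschitz_on_constant)
  next
    case False
    define f where "f k x = min 1 (real k * infdist x (- U))" for k x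
    have [measurable]: "U \<in> sets borel" using U by simp
    have lip: "(real k)-lipschitz_on UNIV (f k)" for k
    proof (rule lipschitz_onI)
      fix x y
      have "\<bar>f k x - f k y\<bar> <= \<bar>real k * infdist x (- U) - real k * infdist y (- U)\<bar>"
        unfolding f_def by linarith
      also have "... = real k * \<bar>infdist x (- U) - infdist y (- U)\<bar>"
        by (simp add: abs_mult flip: right_diff_distrib)
      also have "... <= real k * dist x y"
        by (intro mult_left_mono infdist_triangle_abs) simp
      finally show "dist (f k x) (f k y) <= real k * dist x y" by (simp add: dist_real_def)
    qed simp
    have bnd: "0 <= f k x \<and> f k x <= 1" for k x
      by (auto simp: f_def infdist_nonneg)
    have meas: "f k \<in> borel_measurable borel" for k
      using lip[of k] by (intro borel_measurable_continuous_onI lipschitz_on_continuous_on) auto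
    have lim: "(%k. f k x) \<longlonglongrightarrow> indicator U x" for x
    proof (cases "x \<in> U")
      case True
      then have "infdist x (- U) > 0"
        using False U by (intro infdist_pos_not_in_closed) auto
      then obtain k0 :: nat where "1 / infdist x (- U) < k0" using reals_Archimedean2 by blast
      then have k0: "1 < k0 * infdist x (- U)" using \<open>infdist x (- U) > 0\<close> by (simp add: field_simps)
      have "f k x = 1" if "k >= k0" for k
      proof -
        have "real k0 * infdist x (- U) <= real k * infdist x (- U)"
          using that by (intro mult_right_mono) (auto simp: infdist_nonneg)
        then show ?thesis using k0 by (simp add: f_def)
      qed
      then show ?thesis using True
        by (intro tendsto_eventually) (auto simp: eventually_sequentially)
    next
      case False
      then show ?thesis by (simp add: f_def)
    qed
    have "(%k. \<integral>x. f k x \<partial>M) \<longlonglongrightarrow> (\<integral>x. indicator U x \<partial>M)"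
      by (rule integral_dominated_convergence[where w="%_. 1"]) (use bnd meas lim in \<open>auto simp: abs_le_iff\<close>)
    moreover have "(%k. \<integral>x. f k x \<partial>N) \<longlonglongrightarrow> (\<integral>x. indicator U x \<partial>N)"
      by (rule integral_dominated_convergence[where w="%_. 1"]) (use bnd meas lim in \<open>auto simp: abs_le_iff\<close>)
    moreover have "(\<integral>x. f k x \<partial>M) = (\<integral>x. f k x \<partial>N)" for k
      using lip bnd by (rule eq)
    ultimately have "(\<integral>x. indicator U x \<partial>M) = (\<integral>x. indicator U x \<partial>N :: real)"
      using LIMSEQ_unique by force
    then show ?thesis by (simp add: spc)
  qed
  show ?thesis
  proof (rule measure_eqI_generator_eq[where E="Collect open" and \<Omega>=UNIV and A="%_. UNIV"])
    show "Int_stable (Collect (open :: 'a set => bool))" by (auto simp: Int_stable_def)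
    show "emeasure M X = emeasure N X" if "X \<in> Collect open" for X
      using U[of X] that by (simp add: M.emeasure_eq_measure N.emeasure_eq_measure)
  qed (auto simp: sets borel_def)
qed

text \<open>Dominated convergence against Lipschitz test functions. It lets identities of laws
  proved for dyadic stopping times pass to general ones.\<close>

lemma distr_eq_limit:
  fixes X :: "nat => 'v => 'a::metric_space" and X' :: "nat => 'w => 'a"
  assumes M: "prob_space M" and M': "prob_space M'"
    and meas: "\<And>n. X n \<in> borel_measurable M" "\<And>n. X' n \<in> borel_measurable M'"
      "Y \<in> borel_measurable M" "Y' \<in> borel_measurable M'"
    and lim: "\<And>x. x \<in> space M ==> (%n. X n x) \<longlonglongrightarrow> Y x"
      "\<And>x. x \<in> space M' ==> (%n. X' n x) \<longlonglongrightarrow> Y' x"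
    and eq: "\<And>n. distr M borel (X n) = distr M' borel (X' n)"
  shows "distr M borel Y = distr M' borel Y'"
proof (rule measure_eqI_lipschitz)
  interpret M: prob_space M by fact
  interpret M': prob_space M' by fact
  show "finite_measure (distr M borel Y)" "finite_measure (distr M' borel Y')"
    by (intro M.finite_measure_distr M'.finite_measure_distr meas)+
  fix f :: "'a => real" and k
  assume lip: "k-lipschitz_on UNIV f" and bnd: "\<And>x. 0 <= f x \<and> f x <= 1"
  have cont: "continuous_on UNIV f" using lip by (rule lipschitz_on_continuous_on)
  then have [measurable]: "f \<in> borel_measurable borel" by (rule borel_measurable_continuous_onI)
  have cl: "(%n. f (g n)) \<longlonglongrightarrow> f l" if "g \<longlonglongrightarrow> l" for g l
    using cont that by (auto simp: continuous_on_eq_continuous_at isCont_tendsto_compose)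
  have "(%n. \<integral>x. f (X n x) \<partial>M) \<longlonglongrightarrow> (\<integral>x. f (Y x) \<partial>M)"
    by (rule integral_dominated_convergence[where w="%_. 1"])
       (use bnd meas lim cl in \<open>auto simp: abs_le_iff intro: measurable_compose\<close>)
  moreover have "(%n. \<integral>x. f (X' n x) \<partial>M') \<longlonglongrightarrow> (\<integral>x. f (Y' x) \<partial>M')"
    by (rule integral_dominated_convergence[where w="%_. 1"])
       (use bnd meas lim cl in \<open>auto simp: abs_le_iff intro: measurable_compose\<close>)
  moreover have "(\<integral>x. f (X n x) \<partial>M) = (\<integral>x. f (X' n x) \<partial>M')" for n
    using arg_cong[OF eq[of n], of "%\<mu>. \<integral>x. f x \<partial>\<mu>"] meas by (simp add: integral_distr)
  ultimately have "(\<integral>x. f (Y x) \<partial>M) = (\<integral>x. f (Y' x) \<partial>M')"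
    using LIMSEQ_unique by force
  then show "(\<integral>x. f x \<partial>distr M borel Y) = (\<integral>x. f x \<partial>distr M' borel Y')"
    using meas by (simp add: integral_distr)
qed simp_all

lemma tendsto_fun_iff:
  fixes F :: "'b => 'i => 'a::topological_space"
  shows "(F \<longlongrightarrow> l) A \<longleftrightarrow> (\<forall>i. ((%n. F n i) \<longlongrightarrow> l i) A)"
  using limitin_componentwise[of "%_. euclidean" UNIV F l A]
  by (simp add: euclidean_product_topology)

text \<open>Independence of increments is stated along monotone sequences of times, so a finite set
  of times has to be embedded in such a sequence; it starts at \<open>0\<close>, where the value of
  the motion is known.\<close>

lemma finite_times_enumeration:
  assumes J: "finite J" "J \<subseteq> {0::real..}"
  obtains t :: "nat => real" and m where "t 0 = 0" "mono t" "J \<subseteq> t ` {..m}" "0 < m"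
proof -
  define xs where "xs = sorted_list_of_set (insert 0 J)"
  define m where "m = length xs - 1"
  have set: "set xs = insert 0 J" and s: "sorted xs" unfolding xs_def
    using J set_sorted_list_of_set[of "insert 0 J"] sorted_sorted_list_of_set[of "insert 0 J"] by blast+
  then have len: "0 < length xs" by (metis insert_not_empty length_greater_0_conv list.set(1))
  have m: "min i m < length xs" for i using len unfolding m_def by linarith
  \<comment> \<open>Beyond index \<open>m\<close> the sequence is frozen at the largest time, hence
    only weakly monotone; those increments vanish.\<close>
  define t where "t i = xs ! min i m" for i
  have mono: "mono t"
    unfolding t_def by (intro monoI sorted_nth_mono s m) auto
  have "\<exists>i\<le>m. t i = x" if "x \<in> insert 0 J" for x
  proof -
    have "x \<in> set xs" using that set by simp
    then obtain i where "i < length xs" "xs ! i = x" by (auto simp: in_set_conv_nth)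
    then show ?thesis by (intro exI[of _ i]) (auto simp: t_def m_def)
  qed
  then have sub: "insert 0 J \<subseteq> t ` {..m}" by force
  have "t 0 \<in> insert 0 J" using set m[of 0] by (metis nth_mem t_def)
  then have "0 <= t 0" using J by auto
  moreover obtain i where "t i = 0" using sub by force
  then have "t 0 <= 0" using mono by (metis le0 monoD)
  \<comment> \<open>\<open>Suc m\<close> makes the number of increments positive even if
    \<open>0\<close> is the only time.\<close>
  ultimately show ?thesis
    using sub mono by (intro that[of t "Suc m"]) (auto simp: subset_iff image_iff Bex_def le_Suc_eq)
qed

section \<open>Invariance of Brownian motion under rotation, scaling and time shift\<close>

lemma std_brownian_motionD:
  assumes "std_brownian_motion P B"
  shows "prob_space P" "\<And>t. 0 <= t ==> B t \<in> borel_measurable P" "\<And>w. w \<in> space P ==> B 0 w = 0"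
    "\<And>w. w \<in> space P ==> continuous_on {0..} (%t. B t w)"
    "\<And>t m. 0 <= t 0 ==> mono (t :: nat => real) ==>
        prob_space.indep_vars P (%_. borel) (%i w. B (t (Suc i)) w - B (t i) w) {..<m}"
  using assms by (auto simp: std_brownian_motion_def)

lemma std_brownian_motion_increment:
  assumes B: "std_brownian_motion P B" and st: "0 <= s" "s <= t"
  shows "distr P borel (%w. B t w - B s w) = gauss (t - s)"
proof (cases "s = t")
  case True
  then show ?thesis
    using std_brownian_motionD(1)[OF B] by (simp add: gauss_def prob_space.distr_const)
next
  case False
  then have "s < t" using st by simp
  then have "distributed P lborel (%w. B t w - B s w)
          (%x. ennreal (\<Prod>i\<in>UNIV. normal_density 0 (sqrt (t - s)) (x $ i)))"
    using B st by (auto simp: std_brownian_motion_def)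
  then have "distr P lborel (%w. B t w - B s w) = gauss (t - s)"
    using \<open>s < t\<close> by (simp add: distributed_def gauss_def)
  moreover have "distr P borel (%w. B t w - B s w) = distr P lborel (%w. B t w - B s w)"
    by (intro distr_cong) auto
  ultimately show ?thesis by simp
qed

lemma std_brownian_motionI:
  fixes B :: "real => 'w => real ^ 'd"
  assumes "prob_space P" and meas: "\<And>t. 0 <= t ==> B t \<in> borel_measurable P"
    and "\<And>w. w \<in> space P ==> B 0 w = 0"
    "\<And>w. w \<in> space P ==> continuous_on {0..} (%t. B t w)"
    and inc: "\<And>s t. 0 <= s ==> s <= t ==> distr P borel (%w. B t w - B s w) = gauss (t - s)"
    and "\<And>t m. 0 <= t 0 ==> mono (t :: nat => real) ==>
        prob_space.indep_vars P (%_. borel) (%i w. B (t (Suc i)) w - B (t i) w) {..<m}"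
  shows "std_brownian_motion P B"
  unfolding std_brownian_motion_def
proof (intro conjI allI impI ballI)
  fix s t :: real assume st: "0 <= s \<and> s < t"
  have [measurable]: "B s \<in> borel_measurable P" "B t \<in> borel_measurable P" using meas st by auto
  have "distr P lborel (%w. B t w - B s w) = distr P borel (%w. B t w - B s w)"
    by (intro distr_cong) auto
  then show "distributed P lborel (%w. B t w - B s w)
          (%x. ennreal (\<Prod>i\<in>UNIV. normal_density 0 (sqrt (t - s)) (x $ i)))"
    using inc[of s t] st by (simp add: distributed_def gauss_def)
qed (use assms in auto)

lemma std_brownian_motion_orthogonal:
  fixes B :: "real => 'w => real ^ 'd" and f :: "real ^ 'd => real ^ 'd"
  assumes B: "std_brownian_motion P B" and f: "orthogonal_transformation f"
  shows "std_brownian_motion P (%t w. f (B t w))"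
proof (rule std_brownian_motionI)
  note D = std_brownian_motionD[OF B]
  have lin: "linear f" using f by (rule orthogonal_transformation_linear)
  note fm [measurable] = orthogonal_transformation_measurable[OF f]
  interpret prob_space P by (rule D)
  show "prob_space P" by (rule D)
  show "(%w. f (B t w)) \<in> borel_measurable P" if "0 <= t" for t
    using D(2)[OF that] by simp
  show "f (B 0 w) = 0" if "w \<in> space P" for w
    using D(3)[OF that] linear_0[OF lin] by simp
  show "continuous_on {0..} (%t. f (B t w))" if "w \<in> space P" for w
    using linear_continuous_on_compose[OF D(4)[OF that] lin] .
  show "distr P borel (%w. f (B t w) - f (B s w)) = gauss (t - s)" if st: "0 <= s" "s <= t" for s t
  proof -
    have [measurable]: "B s \<in> borel_measurable P" "B t \<in> borel_measurable P" using D st by auto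
    have "distr P borel (%w. f (B t w) - f (B s w)) = distr (distr P borel (%w. B t w - B s w)) borel f"
      by (subst distr_distr) (auto simp: o_def linear_diff[OF lin])
    then show ?thesis using st
      by (simp add: std_brownian_motion_increment[OF B] gauss_orthogonal[OF f])
  qed
  show "indep_vars (%_. borel) (%i w. f (B (t (Suc i)) w) - f (B (t i) w)) {..<m}"
    if t: "0 <= t 0" "mono t" for t :: "nat => real" and m
    using indep_vars_compose2[OF D(5)[OF t, of m], of "%_. f" "%_. borel"] fm
    by (simp add: linear_diff[OF lin])
qed

lemma std_brownian_motion_scale:
  fixes B :: "real => 'w => real ^ 'd"
  assumes B: "std_brownian_motion P B" and r: "0 < r"
  shows "std_brownian_motion P (%t w. r *\<^sub>R B (t / r\<^sup>2) w)"
proof (rule std_brownian_motionI)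
  note D = std_brownian_motionD[OF B]
  interpret prob_space P by (rule D)
  show "prob_space P" by (rule D)
  show "(%w. r *\<^sub>R B (t / r\<^sup>2) w) \<in> borel_measurable P" if "0 <= t" for t
    using D(2)[of "t / r\<^sup>2"] that by simp
  show "r *\<^sub>R B (0 / r\<^sup>2) w = 0" if "w \<in> space P" for w
    using D(3)[OF that] by simp
  show "continuous_on {0..} (%t. r *\<^sub>R B (t / r\<^sup>2) w)" if "w \<in> space P" for w
    by (intro continuous_intros continuous_on_compose2[OF D(4)[OF that]]) (use r in auto)
  show "distr P borel (%w. r *\<^sub>R B (t / r\<^sup>2) w - r *\<^sub>R B (s / r\<^sup>2) w) = gauss (t - s)" if st: "0 <= s" "s <= t" for s t
  proof -
    have st': "0 <= s / r\<^sup>2" "s / r\<^sup>2 <= t / r\<^sup>2" using st by (auto intro: divide_right_mono)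
    then have [measurable]: "B (s / r\<^sup>2) \<in> borel_measurable P" "B (t / r\<^sup>2) \<in> borel_measurable P" using D by auto
    have "distr P borel (%w. r *\<^sub>R B (t / r\<^sup>2) w - r *\<^sub>R B (s / r\<^sup>2) w)
        = distr (distr P borel (%w. B (t / r\<^sup>2) w - B (s / r\<^sup>2) w)) borel ((*\<^sub>R) r)"
      by (subst distr_distr) (auto simp: o_def scaleR_diff_right)
    also have "... = gauss (r\<^sup>2 * (t / r\<^sup>2 - s / r\<^sup>2))"
      using st' r by (simp add: std_brownian_motion_increment[OF B] gauss_scale)
    also have "r\<^sup>2 * (t / r\<^sup>2 - s / r\<^sup>2) = t - s" using r by (simp add: field_simps)
    finally show ?thesis .
  qed
  show "indep_vars (%_. borel) (%i w. r *\<^sub>R B (t (Suc i) / r\<^sup>2) w - r *\<^sub>R B (t i / r\<^sup>2) w) {..<m}"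
    if t: "0 <= t 0" "mono t" for t :: "nat => real" and m
  proof -
    have "mono (%i. t i / r\<^sup>2)" using t by (auto simp: mono_def intro: divide_right_mono)
    then show ?thesis
      using indep_vars_compose2[OF D(5)[of "%i. t i / r\<^sup>2" m], of "%_. (*\<^sub>R) r" "%_. borel"] t
      by (simp add: scaleR_diff_right)
  qed
qed

lemma std_brownian_motion_shift:
  fixes B :: "real => 'w => real ^ 'd"
  assumes B: "std_brownian_motion P B" and u: "0 <= u"
  shows "std_brownian_motion P (%t w. B (u + t) w - B u w)"
proof (rule std_brownian_motionI)
  note D = std_brownian_motionD[OF B]
  interpret prob_space P by (rule D)
  show "prob_space P" by (rule D)
  show "(%w. B (u + t) w - B u w) \<in> borel_measurable P" if "0 <= t" for t
    using D(2)[of "u + t"] D(2)[of u] that u by simp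
  show "B (u + 0) w - B u w = 0" for w by simp
  show "continuous_on {0..} (%t. B (u + t) w - B u w)" if "w \<in> space P" for w
    by (intro continuous_intros continuous_on_compose2[OF D(4)[OF that]]) (use u in auto)
  show "distr P borel (%w. B (u + t) w - B u w - (B (u + s) w - B u w)) = gauss (t - s)" if "0 <= s" "s <= t" for s t
    using std_brownian_motion_increment[OF B, of "u + s" "u + t"] that u by simp
  show "indep_vars (%_. borel) (%i w. B (u + t (Suc i)) w - B u w - (B (u + t i) w - B u w)) {..<m}"
    if t: "0 <= t 0" "mono t" for t :: "nat => real" and m
    using D(5)[of "%i. u + t i" m] t u by (simp add: mono_def)
qed

section \<open>The strong Markov property\<close>

text \<open>A path is encoded by its values at rational times (the sign being ignored), so that path space
  is a countable product and its Borel sets are the usual ones.\<close>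

definition pth :: "(real => 'w => 'a) => 'w => rat => 'a" where
  "pth B w = (%q. B (real_of_rat \<bar>q\<bar>) w)"

lemma component_measurable:
  "(%b::'i::countable => 'a::second_countable_topology. b i) \<in> borel_measurable borel"
  by (intro borel_measurable_continuous_onI continuous_on_product_coordinates)

lemma pth_measurable:
  fixes B :: "real => 'w => 'a::second_countable_topology"
  assumes "\<And>t. 0 <= t ==> B t \<in> borel_measurable P"
  shows "pth B \<in> borel_measurable P"
  by (rule measurable_coordinatewise_then_product) (simp add: pth_def assms)

lemma std_brownian_motion_telescope:
  assumes "std_brownian_motion P B" "w \<in> space P" "t 0 = 0"
  shows "B (t i) w = (\<Sum>l<i. B (t (Suc l)) w - B (t l) w)"
  using std_brownian_motionD(3)[OF assms(1,2)] assms(3)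
    sum_lessThan_telescope[of "%l. B (t l) w" i] by simp

lemma std_brownian_motion_increments_law:
  fixes B :: "real => 'w => real ^ 'd"
  assumes B: "std_brownian_motion P B" and t: "t 0 = 0" "mono t" and m: "0 < m"
  shows "distr P (PiM {..<m} (%_. borel)) (%w. \<lambda>i\<in>{..<m}. B (t (Suc i)) w - B (t i) w)
       = PiM {..<m} (%i. gauss (t (Suc i) - t i))"
proof -
  note D = std_brownian_motionD[OF B]
  interpret prob_space P by (rule D)
  have t0: "0 <= t i" for i using t by (metis le0 monoD)
  have tS: "t i <= t (Suc i)" for i using t by (simp add: monoD)
  have "distr P (PiM {..<m} (%_. borel)) (%w. \<lambda>i\<in>{..<m}. B (t (Suc i)) w - B (t i) w)
     = PiM {..<m} (%i. distr P borel (%w. B (t (Suc i)) w - B (t i) w))"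
  proof (rule indep_vars_iff_distr_eq_PiM'[THEN iffD1])
    show "indep_vars (%_. borel) (%i w. B (t (Suc i)) w - B (t i) w) {..<m}"
      by (rule D(5)) (simp_all add: t)
    show "{..<m} \<noteq> {}" using m by auto
    show "(%w. B (t (Suc i)) w - B (t i) w) \<in> borel_measurable P" for i
      by (intro borel_measurable_diff D(2) t0)
  qed
  also have "... = PiM {..<m} (%i. gauss (t (Suc i) - t i))"
    by (intro PiM_cong refl) (simp add: std_brownian_motion_increment[OF B] t0 tS)
  finally show ?thesis .
qed

text \<open>A cylinder event concerns finitely many independent Gaussian increments, whose law does
  not mention the probability space. Hence Borel functionals of the encoded path have the same law
  for rotated, rescaled and restarted motions.\<close>

lemma std_brownian_motion_law:
  fixes B :: "real => 'w => real ^ 'd" and B' :: "real => 'v => real ^ 'd"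
  assumes B: "std_brownian_motion P B" and B': "std_brownian_motion P' B'"
  shows "distr P borel (pth B) = distr P' borel (pth B')"
proof (rule measure_eqI_borel_fun)
  note D = std_brownian_motionD[OF B] and D' = std_brownian_motionD[OF B']
  interpret P: prob_space P by (rule D)
  show "finite_measure (distr P borel (pth B))"
    by (rule P.finite_measure_distr[OF pth_measurable[OF D(2)]])
  fix J :: "rat set" and A :: "rat => (real^'d) set"
  assume J: "finite J" "\<And>i. i \<in> J ==> A i \<in> sets borel"
  obtain t :: "nat => real" and m where t: "t 0 = 0" "mono t" "(%q. real_of_rat \<bar>q\<bar>) ` J \<subseteq> t ` {..m}" "0 < m"
  proof (rule finite_times_enumeration[of "(%q. real_of_rat \<bar>q\<bar>) ` J"])
    show "finite ((%q. real_of_rat \<bar>q\<bar>) ` J)" "(%q. real_of_rat \<bar>q\<bar>) ` J \<subseteq> {0..}" using J by auto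
  qed (rule that)
  have t0: "0 <= t i" for i using t by (metis le0 monoD)
  have "\<forall>q\<in>J. \<exists>i\<le>m. t i = real_of_rat \<bar>q\<bar>"
  proof
    fix q assume "q \<in> J"
    then have "real_of_rat \<bar>q\<bar> \<in> t ` {..m}" using t(3) by blast
    then show "\<exists>i\<le>m. t i = real_of_rat \<bar>q\<bar>" by force
  qed
  then obtain k where k: "\<And>q. q \<in> J ==> k q <= m \<and> t (k q) = real_of_rat \<bar>q\<bar>" by metis
  \<comment> \<open>The cylinder rewritten for the vector of increments: the value at the time
    belonging to \<open>q\<close> is the sum of the first \<open>k q\<close> of them.\<close>
  define S where "S = {d \<in> space (PiM {..<m} (%_. borel :: (real^'d) measure)). \<forall>q\<in>J. (\<Sum>l<k q. d l) \<in> A q}"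
  have S: "S \<in> sets (PiM {..<m} (%_. borel))"
    unfolding S_def
  proof (rule sets.sets_Collect_finite_All)
    fix q assume "q \<in> J"
    then have [measurable]: "A q \<in> sets borel" and "k q <= m" using J k by auto
    then have [measurable]: "(%d. \<Sum>l<k q. d l) \<in> borel_measurable (PiM {..<m} (%_. borel :: (real^'d) measure))"
      by (intro borel_measurable_sum measurable_component_singleton) auto
    show "{d \<in> space (PiM {..<m} (%_. borel)). (\<Sum>l<k q. d l) \<in> A q} \<in> sets (PiM {..<m} (%_. borel))"
      by measurable
  qed (use J in auto)
  have main: "emeasure (distr Q borel (pth W)) {b. \<forall>i\<in>J. b i \<in> A i} = emeasure (PiM {..<m} (%i. gauss (t (Suc i) - t i))) S"
    if W: "std_brownian_motion Q W" for Q :: "'u measure" and W :: "real => 'u => real^'d"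
  proof -
    note E = std_brownian_motionD[OF W]
    have inc: "(%w. \<lambda>i\<in>{..<m}. W (t (Suc i)) w - W (t i) w) \<in> Q \<rightarrow>\<^sub>M PiM {..<m} (%_. borel)"
      using E(2) t0 by (intro measurable_restrict borel_measurable_diff) auto
    have "emeasure (distr Q borel (pth W)) {b. \<forall>i\<in>J. b i \<in> A i} = emeasure Q (pth W -` {b. \<forall>i\<in>J. b i \<in> A i} \<inter> space Q)"
      by (rule emeasure_distr) (auto intro!: pth_measurable E cylinder_measurable J)
    also have "pth W -` {b. \<forall>i\<in>J. b i \<in> A i} \<inter> space Q
        = (%w. \<lambda>i\<in>{..<m}. W (t (Suc i)) w - W (t i) w) -` S \<inter> space Q"
    proof -
      have "pth W w q = (\<Sum>l<k q. (\<lambda>i\<in>{..<m}. W (t (Suc i)) w - W (t i) w) l)"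
        if "w \<in> space Q" "q \<in> J" for w q
      proof -
        have "pth W w q = W (t (k q)) w" using k[OF that(2)] by (simp add: pth_def)
        also have "... = (\<Sum>l<k q. W (t (Suc l)) w - W (t l) w)"
          using std_brownian_motion_telescope[of _ _ _ t, OF W that(1) t(1)] .
        also have "... = (\<Sum>l<k q. (\<lambda>i\<in>{..<m}. W (t (Suc i)) w - W (t i) w) l)"
          by (intro sum.cong) (use k[OF that(2)] in auto)
        finally show ?thesis .
      qed
      moreover have "(\<lambda>i\<in>{..<m}. W (t (Suc i)) w - W (t i) w) \<in> space (PiM {..<m} (%_. borel))" for w
        by (auto simp: space_PiM)
      ultimately show ?thesis unfolding S_def by auto
    qed
    also have "emeasure Q ... = emeasure (distr Q (PiM {..<m} (%_. borel)) (%w. \<lambda>i\<in>{..<m}. W (t (Suc i)) w - W (t i) w)) S"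
      by (rule emeasure_distr[symmetric, OF inc S])
    finally show ?thesis by (simp add: std_brownian_motion_increments_law[OF W t(1,2,4)])
  qed
  show "emeasure (distr P borel (pth B)) {b. \<forall>i\<in>J. b i \<in> A i} = emeasure (distr P' borel (pth B')) {b. \<forall>i\<in>J. b i \<in> A i}"
    by (simp only: main[OF B] main[OF B'])
qed simp_all

text \<open>The path stopped at \<open>u\<close> plays the role of the
  \<open>\<sigma>\<close>-algebra of the past. Past and future are sums over disjoint blocks of
  increments, hence independent, and the future has the law of \<open>B\<close> by the time
  shift.\<close>

lemma std_brownian_motion_markov:
  fixes B :: "real => 'w => real ^ 'd"
  assumes B: "std_brownian_motion P B" and u: "0 <= u"
    and S: "S1 \<in> sets borel" "S2 \<in> sets borel"
  shows "emeasure P {w \<in> space P. pth (%t. B (min t u)) w \<in> S1 \<and> pth (%t w. B (u + t) w - B u w) w \<in> S2}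
       = emeasure P {w \<in> space P. pth (%t. B (min t u)) w \<in> S1} * emeasure P {w \<in> space P. pth B w \<in> S2}"
proof -
  note D = std_brownian_motionD[OF B]
  interpret P: prob_space P by (rule D)
  interpret PP: pair_prob_space P P by unfold_locales
  let ?F = "%t w. B (u + t) w - B u w"
  have shift: "std_brownian_motion P ?F" by (rule std_brownian_motion_shift[OF B u])
  define past where "past = pth (%t. B (min t u))"
  define fut where "fut = pth ?F"
  have past_m [measurable]: "past \<in> borel_measurable P"
    unfolding past_def by (intro pth_measurable D) (use u in auto)
  have fut_m [measurable]: "fut \<in> borel_measurable P"
    unfolding fut_def by (intro pth_measurable std_brownian_motionD(2)[OF shift])
  have past_q [measurable]: "(%w. past w q) \<in> borel_measurable P"
    and fut_q [measurable]: "(%w. fut w q) \<in> borel_measurable P" for q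
    by (rule measurable_compose[OF past_m component_measurable] measurable_compose[OF fut_m component_measurable])+
  \<comment> \<open>Past and future are merged into one function on \<open>rat + rat\<close>. A
    single comparison of cylinder probabilities with \<open>X'\<close>, where the future comes from
    an independent copy, then yields independence of the whole paths.\<close>
  define X where "X w i = (case i of Inl q => past w q | Inr q => fut w q)" for w and i :: "rat + rat"
  define X' where "X' = (%(w, w') i. case i of Inl q => past w q | Inr q => fut w' q)"
  have X_m [measurable]: "X \<in> borel_measurable P"
  proof (rule measurable_coordinatewise_then_product)
    fix i show "(%w. X w i) \<in> borel_measurable P"
      by (cases i) (simp_all add: X_def past_q fut_q)
  qed
  have X'_m [measurable]: "X' \<in> borel_measurable (P \<Otimes>\<^sub>M P)"
  proof (rule measurable_coordinatewise_then_product)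
    fix i show "(%x. X' x i) \<in> borel_measurable (P \<Otimes>\<^sub>M P)"
      by (cases i) (simp_all add: X'_def case_prod_beta measurable_compose[OF measurable_fst past_q] measurable_compose[OF measurable_snd fut_q])
  qed
  have law: "distr P borel X = distr (P \<Otimes>\<^sub>M P) borel X'"
  proof (rule measure_eqI_borel_fun)
    show "finite_measure (distr P borel X)" by (rule P.finite_measure_distr[OF X_m])
    fix J :: "(rat + rat) set" and A :: "rat + rat => (real^'d) set"
    assume J: "finite J" "\<And>i. i \<in> J ==> A i \<in> sets borel"
    define J1 where "J1 = {q. Inl q \<in> J}"
    define J2 where "J2 = {q. Inr q \<in> J}"
    have fin: "finite J1" "finite J2"
      unfolding J1_def J2_def using J(1)
      by (auto intro!: finite_vimageI[unfolded vimage_def])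
    \<comment> \<open>All times that the cylinder inspects, together with \<open>u\<close> itself,
      so that some index \<open>k0\<close> cuts the increments exactly at \<open>u\<close>.\<close>
    define T where "T = insert u ((%q. min (real_of_rat \<bar>q\<bar>) u) ` J1 \<union> (%q. u + real_of_rat \<bar>q\<bar>) ` J2)"
    obtain t :: "nat => real" and m where t: "t 0 = 0" "mono t" "T \<subseteq> t ` {..m}" "0 < m"
    proof (rule finite_times_enumeration[of T])
      show "finite T" "T \<subseteq> {0..}" using fin u by (auto simp: T_def)
    qed (rule that)
    have t0: "0 <= t i" for i using t by (metis le0 monoD)
    obtain k0 where k0: "k0 <= m" "t k0 = u" using t(3) unfolding T_def by force
    have "\<exists>i\<le>k0. t i = min (real_of_rat \<bar>q\<bar>) u" if "q \<in> J1" for q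
    proof -
      have "min (real_of_rat \<bar>q\<bar>) u \<in> t ` {..m}" using that t(3) unfolding T_def by blast
      then obtain i where i: "t i = min (real_of_rat \<bar>q\<bar>) u" by force
      show ?thesis
      proof (cases "i <= k0")
        case False
        then have "t k0 <= t i" using t(2) by (simp add: monoD)
        then have "t k0 = min (real_of_rat \<bar>q\<bar>) u" using i k0 by simp
        then show ?thesis by blast
      qed (use i in blast)
    qed
    then obtain k1 where k1: "\<And>q. q \<in> J1 ==> k1 q <= k0 \<and> t (k1 q) = min (real_of_rat \<bar>q\<bar>) u" by metis
    have "\<exists>i\<le>m. k0 <= i \<and> t i = u + real_of_rat \<bar>q\<bar>" if "q \<in> J2" for q
    proof -
      have "u + real_of_rat \<bar>q\<bar> \<in> t ` {..m}" using that t(3) unfolding T_def by blast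
      then obtain i where i: "t i = u + real_of_rat \<bar>q\<bar>" "i <= m" by force
      show ?thesis
      proof (cases "k0 <= i")
        case False
        then have "t i <= t k0" using t(2) by (simp add: monoD)
        then have "t k0 = u + real_of_rat \<bar>q\<bar>" using i k0 by simp
        then show ?thesis using k0 by blast
      qed (use i in blast)
    qed
    then obtain k2 where k2: "\<And>q. q \<in> J2 ==> k2 q <= m \<and> k0 <= k2 q \<and> t (k2 q) = u + real_of_rat \<bar>q\<bar>" by metis
    let ?I = "%i w. B (t (Suc i)) w - B (t i) w"
    let ?A = "{..<k0}" and ?C = "{k0..<m}"
    have "P.indep_vars (%_. borel) ?I {..<m}" using D(5)[of t m] t by simp
    then have ind: "P.indep_var (PiM ?A (%_. borel)) (%w. restrict (%i. ?I i w) ?A)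
        (PiM ?C (%_. borel)) (%w. restrict (%i. ?I i w) ?C)"
      by (rule P.indep_var_restrict) (use k0 in auto)
    define E1 where "E1 = {d \<in> space (PiM ?A (%_. borel :: (real^'d) measure)). \<forall>q\<in>J1. (\<Sum>l<k1 q. d l) \<in> A (Inl q)}"
    define E2 where "E2 = {d \<in> space (PiM ?C (%_. borel :: (real^'d) measure)). \<forall>q\<in>J2. (\<Sum>l=k0..<k2 q. d l) \<in> A (Inr q)}"
    have E1: "E1 \<in> sets (PiM ?A (%_. borel))"
      unfolding E1_def
    proof (rule sets.sets_Collect_finite_All)
      fix q assume q: "q \<in> J1"
      then have [measurable]: "A (Inl q) \<in> sets borel" using J(2) by (auto simp: J1_def)
      have [measurable]: "(%d. \<Sum>l<k1 q. d l) \<in> borel_measurable (PiM ?A (%_. borel :: (real^'d) measure))"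
        using k1[OF q] by (intro borel_measurable_sum measurable_component_singleton) auto
      show "{d \<in> space (PiM ?A (%_. borel)). (\<Sum>l<k1 q. d l) \<in> A (Inl q)} \<in> sets (PiM ?A (%_. borel))"
        by measurable
    qed (use fin in auto)
    have E2: "E2 \<in> sets (PiM ?C (%_. borel))"
      unfolding E2_def
    proof (rule sets.sets_Collect_finite_All)
      fix q assume q: "q \<in> J2"
      then have [measurable]: "A (Inr q) \<in> sets borel" using J(2) by (auto simp: J2_def)
      have [measurable]: "(%d. \<Sum>l=k0..<k2 q. d l) \<in> borel_measurable (PiM ?C (%_. borel :: (real^'d) measure))"
        using k2[OF q] by (intro borel_measurable_sum measurable_component_singleton) auto
      show "{d \<in> space (PiM ?C (%_. borel)). (\<Sum>l=k0..<k2 q. d l) \<in> A (Inr q)} \<in> sets (PiM ?C (%_. borel))"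
        by measurable
    qed (use fin in auto)
    have p1: "past w q = (\<Sum>l<k1 q. restrict (%i. ?I i w) ?A l)" if "w \<in> space P" "q \<in> J1" for w q
    proof -
      have "past w q = B (t (k1 q)) w" using k1[OF that(2)] by (simp add: past_def pth_def)
      also have "... = (\<Sum>l<k1 q. ?I l w)"
        using std_brownian_motion_telescope[of _ _ _ t, OF B that(1) t(1)] .
      also have "... = (\<Sum>l<k1 q. restrict (%i. ?I i w) ?A l)"
        by (intro sum.cong) (use k1[OF that(2)] in auto)
      finally show ?thesis .
    qed
    have p2: "fut w q = (\<Sum>l=k0..<k2 q. restrict (%i. ?I i w) ?C l)" if "q \<in> J2" for w q
    proof -
      have "fut w q = B (t (k2 q)) w - B (t k0) w" using k2[OF that] k0 by (simp add: fut_def pth_def)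
      also have "... = (\<Sum>l=k0..<k2 q. ?I l w)"
        using k2[OF that] sum_Suc_diff'[of k0 "k2 q" "%l. B (t l) w"] by simp
      also have "... = (\<Sum>l=k0..<k2 q. restrict (%i. ?I i w) ?C l)"
        by (intro sum.cong) (use k2[OF that] in auto)
      finally show ?thesis .
    qed
    let ?e1 = "{w\<in>space P. \<forall>q\<in>J1. past w q \<in> A (Inl q)}" and ?e2 = "{w\<in>space P. \<forall>q\<in>J2. fut w q \<in> A (Inr q)}"
    have i1: "?e1 = (%w. restrict (%i. ?I i w) ?A) -` E1 \<inter> space P"
      using p1 by (auto simp: E1_def space_PiM)
    have i2: "?e2 = (%w. restrict (%i. ?I i w) ?C) -` E2 \<inter> space P"
      using p2 by (auto simp: E2_def space_PiM)
    have split: "(\<forall>i\<in>J. f i \<in> A i) \<longleftrightarrow> (\<forall>q\<in>J1. f (Inl q) \<in> A (Inl q)) \<and> (\<forall>q\<in>J2. f (Inr q) \<in> A (Inr q))" for f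
      unfolding J1_def J2_def by (auto, metis sum.exhaust)
    have me1: "?e1 \<in> sets P" 
    proof (rule sets.sets_Collect_finite_All)
      fix q assume q: "q \<in> J1"
      then have [measurable]: "A (Inl q) \<in> sets borel" using J(2) by (auto simp: J1_def)
      show "{w \<in> space P. past w q \<in> A (Inl q)} \<in> sets P" by measurable
    qed (use fin in auto)
    have me2: "?e2 \<in> sets P" 
    proof (rule sets.sets_Collect_finite_All)
      fix q assume q: "q \<in> J2"
      then have [measurable]: "A (Inr q) \<in> sets borel" using J(2) by (auto simp: J2_def)
      show "{w \<in> space P. fut w q \<in> A (Inr q)} \<in> sets P" by measurable
    qed (use fin in auto)
    have "emeasure (distr P borel X) {b. \<forall>i\<in>J. b i \<in> A i} = emeasure P (X -` {b. \<forall>i\<in>J. b i \<in> A i} \<inter> space P)"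
      by (rule emeasure_distr) (auto intro: cylinder_measurable J)
    also have "X -` {b. \<forall>i\<in>J. b i \<in> A i} \<inter> space P = ?e1 \<inter> ?e2"
      by (auto simp: split X_def)
    also have "?e1 \<inter> ?e2 = (%w. (restrict (%i. ?I i w) ?A, restrict (%i. ?I i w) ?C)) -` (E1 \<times> E2) \<inter> space P"
      unfolding i1 i2 by auto
    also have "emeasure P ... = emeasure P ?e1 * emeasure P ?e2"
      using P.indep_varD[OF ind E1 E2] unfolding i1 i2
      by (simp add: P.emeasure_eq_measure ennreal_mult)
    also have "... = emeasure (P \<Otimes>\<^sub>M P) (?e1 \<times> ?e2)"
      using me1 me2 by (simp add: P.emeasure_pair_measure_Times)
    also have "?e1 \<times> ?e2 = X' -` {b. \<forall>i\<in>J. b i \<in> A i} \<inter> space (P \<Otimes>\<^sub>M P)"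
      by (auto simp: split X'_def space_pair_measure)
    also have "emeasure (P \<Otimes>\<^sub>M P) ... = emeasure (distr (P \<Otimes>\<^sub>M P) borel X') {b. \<forall>i\<in>J. b i \<in> A i}"
      by (rule emeasure_distr[symmetric]) (auto intro: cylinder_measurable J)
    finally show "emeasure (distr P borel X) {b. \<forall>i\<in>J. b i \<in> A i} = emeasure (distr (P \<Otimes>\<^sub>M P) borel X') {b. \<forall>i\<in>J. b i \<in> A i}" .
  qed simp_all
  note [measurable] = S
  define E where "E = {b :: rat + rat => real^'d. (%q. b (Inl q)) \<in> S1 \<and> (%q. b (Inr q)) \<in> S2}"
  have [measurable]: "(%b :: rat + rat => real^'d. (%q. b (Inl q))) \<in> borel_measurable borel"
     "(%b :: rat + rat => real^'d. (%q. b (Inr q))) \<in> borel_measurable borel"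
    by (rule measurable_coordinatewise_then_product, rule component_measurable)+
  have "{b \<in> space borel. (%q. b (Inl q)) \<in> S1 \<and> (%q. b (Inr q)) \<in> S2} \<in> sets (borel :: (rat + rat => real^'d) measure)"
    by measurable
  then have [measurable]: "E \<in> sets borel" by (simp add: E_def)
  let ?e1 = "{w\<in>space P. past w \<in> S1}" and ?e2 = "{w\<in>space P. fut w \<in> S2}"
  have "{w\<in>space P. past w \<in> S1 \<and> fut w \<in> S2} = X -` E \<inter> space P"
    by (auto simp: E_def X_def)
  then have "emeasure P {w\<in>space P. past w \<in> S1 \<and> fut w \<in> S2} = emeasure (distr P borel X) E"
    by (simp add: emeasure_distr)
  also have "... = emeasure (P \<Otimes>\<^sub>M P) (X' -` E \<inter> space (P \<Otimes>\<^sub>M P))"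
    by (simp add: law emeasure_distr)
  also have "X' -` E \<inter> space (P \<Otimes>\<^sub>M P) = ?e1 \<times> ?e2"
    by (auto simp: E_def X'_def space_pair_measure)
  also have "emeasure (P \<Otimes>\<^sub>M P) (?e1 \<times> ?e2) = emeasure P ?e1 * emeasure P ?e2"
    by (rule P.emeasure_pair_measure_Times) measurable
  also have "emeasure P ?e2 = emeasure (distr P borel fut) S2"
    by (simp add: emeasure_distr vimage_def Int_def conj_commute)
  also have "... = emeasure (distr P borel (pth B)) S2"
    unfolding fut_def by (simp add: std_brownian_motion_law[OF shift B])
  also have "... = emeasure P {w \<in> space P. pth B w \<in> S2}"
    using pth_measurable[OF D(2)] by (simp add: emeasure_distr vimage_def Int_def conj_commute)
  finally show ?thesis by (simp add: past_def fut_def)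
qed

text \<open>Rounding up: whether a rounded stopping time has occurred is decided by the path up to
  the rounded time. The values are rational so that an encoded path can be evaluated there; negative
  arguments give \<open>0\<close>.\<close>

definition dyad :: "nat => real => rat" where
  "dyad n s = of_nat (nat \<lceil>2 ^ n * s\<rceil>) / 2 ^ n"

lemma of_rat_dyad: "real_of_rat (dyad n s) = real (nat \<lceil>2 ^ n * s\<rceil>) / 2 ^ n"
  by (simp add: dyad_def of_rat_divide of_rat_power)

lemma dyad_nonneg: "0 <= dyad n s"
  by (simp add: dyad_def)

lemma dyad_bounds:
  assumes "0 <= s"
  shows "s <= real_of_rat (dyad n s)" "real_of_rat (dyad n s) <= s + 1 / 2 ^ n"
proof -
  have "2 ^ n * s <= real (nat \<lceil>2 ^ n * s\<rceil>)" "real (nat \<lceil>2 ^ n * s\<rceil>) <= 2 ^ n * s + 1"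
    using assms by (auto simp: of_nat_nat)
  then show "s <= real_of_rat (dyad n s)" "real_of_rat (dyad n s) <= s + 1 / 2 ^ n"
    by (simp_all add: of_rat_dyad field_simps)
qed

lemma dyad_tendsto:
  assumes "0 <= s"
  shows "(%n. real_of_rat (dyad n s)) \<longlonglongrightarrow> s"
proof (rule tendsto_sandwich[of "%_. s" _ _ "%n. s + 1 / 2 ^ n"])
  have "(%n. s + (1 / 2) ^ n) \<longlonglongrightarrow> s + 0"
    by (intro tendsto_intros LIMSEQ_power_zero) auto
  then show "(%n. s + 1 / 2 ^ n) \<longlonglongrightarrow> s" by (simp add: power_divide)
qed (use dyad_bounds[OF assms] in auto)

lemma continuous_dyad_tendsto:
  assumes "continuous_on {0..} f" "0 <= s"
  shows "(%n. f (real_of_rat (dyad n s))) \<longlonglongrightarrow> f s"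
  by (rule continuous_on_tendsto_compose[OF assms(1) dyad_tendsto[OF assms(2)]])
     (use assms dyad_nonneg in \<open>auto simp: zero_le_of_rat_iff\<close>)

lemma dyad_measurable [measurable]:
  "dyad n \<in> borel \<rightarrow>\<^sub>M count_space UNIV"
  unfolding dyad_def by measurable

text \<open>Value of an encoded path at a real time. For continuous paths it is the true value; on
  other elements of path space \<open>lim\<close> may return anything, but the map stays
  Borel.\<close>

definition ev :: "(rat => 'a::t2_space) => real => 'a" where
  "ev b s = lim (%n. b (dyad n s))"

lemma ev_pth:
  fixes B :: "real => 'w => 'a::t2_space"
  assumes "continuous_on {0..} (%t. B t w)" "0 <= s"
  shows "ev (pth B w) s = B s w"
  unfolding ev_def pth_def
  using continuous_dyad_tendsto[OF assms] by (intro limI) (simp add: dyad_nonneg)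

text \<open>\<open>dyad n\<close> takes countably many values, so evaluating there is measurable
  jointly in path and time.\<close>

lemma ev_measurable:
  fixes b :: "'v => rat => real ^ 'd"
  assumes b: "b \<in> borel_measurable M" and s: "s \<in> borel_measurable M"
  shows "(%x. ev (b x) (s x)) \<in> borel_measurable M"
  unfolding ev_def
proof (rule borel_measurable_lim_metric)
  fix n
  show "(%x. b x (dyad n (s x))) \<in> borel_measurable M"
  proof (rule measurable_compose_countable)
    show "(%x. b x q) \<in> borel_measurable M" for q
      by (rule measurable_compose[OF b component_measurable])
    show "(%x. dyad n (s x)) \<in> M \<rightarrow>\<^sub>M count_space UNIV"
      by (rule measurable_compose[OF s dyad_measurable])
  qed
qed

lemma std_brownian_motion_at_measurable:
  fixes B :: "real => 'w => real ^ 'd"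
  assumes B: "std_brownian_motion P B" and s: "s \<in> borel_measurable P" "\<And>w. w \<in> space P ==> 0 <= s w"
  shows "(%w. B (s w) w) \<in> borel_measurable P"
proof -
  note D = std_brownian_motionD[OF B]
  have "(%w. ev (pth B w) (s w)) \<in> borel_measurable P"
    by (intro ev_measurable pth_measurable D s)
  moreover have "ev (pth B w) (s w) = B (s w) w" if "w \<in> space P" for w
    by (intro ev_pth D s that)
  ultimately show ?thesis using measurable_cong by force
qed

text \<open>The filtration is replaced by Borel events of the path stopped at \<open>t\<close>.
  Agreement is demanded only almost everywhere, so that a hitting time which takes the default value
  \<open>0\<close> on a null set still qualifies.\<close>

definition stopping :: "'w measure => (real => 'w => real ^ 'd) => ('w => real) => bool" where
  "stopping P B \<sigma> \<longleftrightarrow> \<sigma> \<in> borel_measurable P \<and> (\<forall>w\<in>space P. 0 <= \<sigma> w) \<and>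
     (\<forall>t\<ge>0. \<exists>S\<in>sets borel. AE w in P. \<sigma> w <= t \<longleftrightarrow> pth (%s. B (min s t)) w \<in> S)"

text \<open>For positive \<open>k\<close>, the rounded time is \<open>k / 2 ^ n\<close> iff
  \<open>\<sigma>\<close> is at most \<open>k / 2 ^ n\<close> but not at most
  \<open>(k - 1) / 2 ^ n\<close>; both events are visible in the path stopped at
  \<open>k / 2 ^ n\<close>.\<close>

lemma stopping_dyadic_event:
  fixes B :: "real => 'w => real ^ 'd"
  assumes B: "std_brownian_motion P B" and \<sigma>: "stopping P B \<sigma>"
  shows "\<exists>S\<in>sets borel. AE w in P. nat \<lceil>2 ^ n * \<sigma> w\<rceil> = k \<longleftrightarrow> pth (%s. B (min s (real k / 2 ^ n))) w \<in> S"
proof -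
  obtain S1 where S1: "S1 \<in> sets borel" "AE w in P. \<sigma> w <= real k / 2 ^ n \<longleftrightarrow> pth (%s. B (min s (real k / 2 ^ n))) w \<in> S1"
  proof -
    have "0 <= real k / 2 ^ n" by simp
    then show ?thesis using \<sigma> that unfolding stopping_def by blast
  qed
  have nn: "AE w in P. 0 <= \<sigma> w" using \<sigma> by (auto simp: stopping_def)
  have le_iff: "nat \<lceil>2 ^ n * s\<rceil> <= j \<longleftrightarrow> s <= real j / 2 ^ n" for s :: real and j
    by (simp add: nat_le_iff ceiling_le_iff field_simps)
  show ?thesis
  proof (cases k)
    case 0
    show ?thesis
    proof (intro bexI[OF _ S1(1)])
      show "AE w in P. nat \<lceil>2 ^ n * \<sigma> w\<rceil> = k \<longleftrightarrow> pth (%s. B (min s (real k / 2 ^ n))) w \<in> S1"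
        using S1(2) by eventually_elim (metis 0 le_iff le_zero_eq)
    qed
  next
    case (Suc j)
    define q :: rat where "q = of_nat j / 2 ^ n"
    have q: "real_of_rat q = real j / 2 ^ n" "0 <= q" by (simp_all add: q_def of_rat_divide of_rat_power)
    obtain S0 where S0: "S0 \<in> sets borel" "AE w in P. \<sigma> w <= real j / 2 ^ n \<longleftrightarrow> pth (%s. B (min s (real j / 2 ^ n))) w \<in> S0"
    proof -
      have "0 <= real j / 2 ^ n" by simp
      then show ?thesis using \<sigma> that unfolding stopping_def by blast
    qed
    \<comment> \<open>Stopping once more at the earlier dyadic time. As that time is rational, this
      only rearranges coordinates and is Borel on encoded paths.\<close>
    define g where "g b p = b (min \<bar>p\<bar> q)" for b :: "rat => real^'d" and p
    have g: "g \<in> borel_measurable borel"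
      by (rule measurable_coordinatewise_then_product) (simp add: g_def component_measurable)
    have jk: "real j / 2 ^ n <= real k / 2 ^ n" using Suc by (simp add: divide_right_mono)
    have eq: "pth (%s. B (min s (real j / 2 ^ n))) w = g (pth (%s. B (min s (real k / 2 ^ n))) w)" for w
    proof
      fix p
      have "\<bar>min \<bar>p\<bar> q\<bar> = min \<bar>p\<bar> q" using q by simp
      moreover have "real_of_rat (min \<bar>p\<bar> q) = min (real_of_rat \<bar>p\<bar>) (real_of_rat q)"
        by (simp add: min_def of_rat_less_eq)
      ultimately show "pth (%s. B (min s (real j / 2 ^ n))) w p = g (pth (%s. B (min s (real k / 2 ^ n))) w) p"
        using jk q by (simp add: pth_def g_def min.assoc min_absorb1)
    qed
    have m: "g -` S0 \<in> sets borel" using measurable_sets[OF g S0(1)] by simp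
    show ?thesis
    proof (intro bexI[of _ "S1 - g -` S0"])
      show "AE w in P. nat \<lceil>2 ^ n * \<sigma> w\<rceil> = k \<longleftrightarrow> pth (%s. B (min s (real k / 2 ^ n))) w \<in> S1 - g -` S0"
        using S1(2) S0(2)
      proof eventually_elim
        case (elim w)
        have "nat \<lceil>2 ^ n * \<sigma> w\<rceil> = k \<longleftrightarrow> nat \<lceil>2 ^ n * \<sigma> w\<rceil> <= k \<and> \<not> nat \<lceil>2 ^ n * \<sigma> w\<rceil> <= j"
          unfolding Suc by linarith
        then show ?case using elim eq[of w] unfolding le_iff by auto
      qed
      show "S1 - g -` S0 \<in> sets borel" using S1(1) m by blast
    qed
  qed
qed

text \<open>The rounded time takes countably many values, and on each of them the Markov property at
  a fixed time applies. Continuity of paths makes both sides converge pointwise as the rounding is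
  refined, so the laws agree in the limit.\<close>

theorem strong_markov:
  fixes B :: "real => 'w => real ^ 'd"
  assumes B: "std_brownian_motion P B" and \<sigma>: "stopping P B \<sigma>"
  shows "distr P borel (%w. ((\<sigma> w, B (\<sigma> w) w), pth (%t w. B (\<sigma> w + t) w - B (\<sigma> w) w) w))
       = distr (P \<Otimes>\<^sub>M P) borel (%(w, w'). ((\<sigma> w, B (\<sigma> w) w), pth B w'))"
proof -
  note D = std_brownian_motionD[OF B]
  interpret P: prob_space P by (rule D)
  interpret PP: pair_prob_space P P by unfold_locales
  have \<sigma>_m [measurable]: "\<sigma> \<in> borel_measurable P" and \<sigma>0: "\<And>w. w \<in> space P ==> 0 <= \<sigma> w"
    using \<sigma> by (auto simp: stopping_def)
  have pB_m: "pth B \<in> borel_measurable P" by (intro pth_measurable D)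
  let ?s = "%n w. real_of_rat (dyad n (\<sigma> w))"
  have s_m [measurable]: "?s n \<in> borel_measurable P" for n
    unfolding of_rat_dyad by measurable
  have s0: "0 <= ?s n w" for n w by (simp add: dyad_nonneg zero_le_of_rat_iff)
  define a where "a s w = (s w, B (s w) w)" for s :: "'w => real" and w
  define f where "f s w = pth (%t w. B (s w + t) w - B (s w) w) w" for s :: "'w => real" and w
  have a_m: "a s \<in> borel_measurable P" if [measurable]: "s \<in> borel_measurable P" and "\<And>w. w \<in> space P ==> 0 <= s w" for s
  proof -
    have [measurable]: "(%w. B (s w) w) \<in> borel_measurable P"
      by (rule std_brownian_motion_at_measurable[OF B that])
    show ?thesis unfolding a_def by measurable
  qed
  have f_m: "f s \<in> borel_measurable P" if [measurable]: "s \<in> borel_measurable P" and "\<And>w. w \<in> space P ==> 0 <= s w" for s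
    unfolding f_def
  proof (rule measurable_coordinatewise_then_product)
    fix q
    show "(%w. pth (%t w. B (s w + t) w - B (s w) w) w q) \<in> borel_measurable P"
      unfolding pth_def using that
      by (intro borel_measurable_diff std_brownian_motion_at_measurable[OF B]) auto
  qed
  note af_m = a_m[OF s_m s0] f_m[OF s_m s0] a_m[OF \<sigma>_m \<sigma>0] f_m[OF \<sigma>_m \<sigma>0]
  have step: "distr P borel (%w. (a (?s n) w, f (?s n) w)) = distr (P \<Otimes>\<^sub>M P) borel (%(w, w'). (a (?s n) w, pth B w'))" for n
  proof -
    let ?a = "a (?s n)" and ?f = "f (?s n)"
    have "distr P borel ?a \<Otimes>\<^sub>M distr P borel (pth B) = distr P borel (%w. (?a w, ?f w))"
    proof (rule pair_measure_eqI)
      show "sigma_finite_measure (distr P borel ?a)" "sigma_finite_measure (distr P borel (pth B))"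
        by (intro prob_space_imp_sigma_finite P.prob_space_distr af_m pB_m)+
      show "sets (distr P borel ?a \<Otimes>\<^sub>M distr P borel (pth B)) = sets (distr P borel (%w. (?a w, ?f w)))"
        by (simp only: sets_distr borel_prod[symmetric]) (intro sets_pair_measure_cong; simp)
      fix A S assume "A \<in> sets (distr P borel ?a)" "S \<in> sets (distr P borel (pth B))"
      then have A [measurable]: "A \<in> sets borel" and S [measurable]: "S \<in> sets borel" by simp_all
      define K where "K w = nat \<lceil>2 ^ n * \<sigma> w\<rceil>" for w
      have K_m [measurable]: "K \<in> P \<rightarrow>\<^sub>M count_space UNIV" unfolding K_def by measurable
      have sK: "?s n w = real (K w) / 2 ^ n" for w by (simp add: of_rat_dyad K_def)
      define E where "E k = {w \<in> space P. K w = k \<and> ?a w \<in> A}" for k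
      define G where "G k = {w \<in> space P. K w = k \<and> ?a w \<in> A \<and> ?f w \<in> S}" for k
      note [measurable] = af_m(1,2)
      have E_m [measurable]: "E k \<in> sets P" and G_m [measurable]: "G k \<in> sets P" for k
        unfolding E_def G_def by measurable
      have EG: "emeasure P (G k) = emeasure P (E k) * emeasure P {w \<in> space P. pth B w \<in> S}" for k
      proof -
        let ?u = "real k / 2 ^ n"
        let ?past = "pth (%s. B (min s ?u))"
        define p :: rat where "p = of_nat k / 2 ^ n"
        have p: "real_of_rat p = ?u" "0 <= p" by (simp_all add: p_def of_rat_divide of_rat_power)
        obtain S0 where S0 [measurable]: "S0 \<in> sets borel" and S0': "AE w in P. K w = k \<longleftrightarrow> ?past w \<in> S0"
          unfolding K_def using stopping_dyadic_event[OF B \<sigma>] by blast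
        \<comment> \<open>The whole past event, including the position at time
          \<open>k / 2 ^ n\<close>, expressed through the stopped path.\<close>
        define S1 where "S1 = {b \<in> space borel. b \<in> S0 \<and> (?u, b p) \<in> A}"
        have S1 [measurable]: "S1 \<in> sets borel"
        proof -
          have [measurable]: "(%b::rat => real^'d. b p) \<in> borel_measurable borel"
            by (rule component_measurable)
          show ?thesis unfolding S1_def by measurable
        qed
        have pastp: "?past w p = B ?u w" for w using p by (simp add: pth_def)
        have past_m [measurable]: "?past \<in> borel_measurable P" by (intro pth_measurable D) auto
        have fut_m [measurable]: "pth (%t w. B (?u + t) w - B ?u w) \<in> borel_measurable P"
          by (intro pth_measurable borel_measurable_diff D) auto
        have "emeasure P (E k) = emeasure P {w \<in> space P. ?past w \<in> S1}"
        proof (rule emeasure_eq_AE)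
          show "AE w in P. w \<in> E k \<longleftrightarrow> w \<in> {w \<in> space P. ?past w \<in> S1}"
            using S0' AE_space
            by eventually_elim (auto simp: E_def S1_def a_def sK pastp)
        qed measurable
        moreover have "emeasure P (G k) = emeasure P {w \<in> space P. ?past w \<in> S1 \<and> pth (%t w. B (?u + t) w - B ?u w) w \<in> S}"
        proof (rule emeasure_eq_AE)
          show "AE w in P. w \<in> G k \<longleftrightarrow> w \<in> {w \<in> space P. ?past w \<in> S1 \<and> pth (%t w. B (?u + t) w - B ?u w) w \<in> S}"
            using S0' AE_space
          proof eventually_elim
            case (elim w)
            have "?f w = pth (%t w. B (?u + t) w - B ?u w) w" if "K w = k"
              by (simp add: f_def pth_def sK that)
            then show ?case using elim by (cases "K w = k") (simp_all add: G_def S1_def a_def sK pastp)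
          qed
        qed measurable
        ultimately show ?thesis
          using std_brownian_motion_markov[OF B _ S1 S, of ?u] by simp
      qed
      have "emeasure (distr P borel (%w. (?a w, ?f w))) (A \<times> S) = emeasure P {w \<in> space P. ?a w \<in> A \<and> ?f w \<in> S}"
      proof (subst emeasure_distr)
        show "(%w. (?a w, ?f w)) \<in> borel_measurable P" by (intro borel_measurable_Pair af_m)
        show "A \<times> S \<in> sets borel" by (subst borel_prod[symmetric]) (rule pair_measureI[OF A S])
      qed (auto intro!: arg_cong[where f="emeasure P"])
      also have "{w \<in> space P. ?a w \<in> A \<and> ?f w \<in> S} = (\<Union>k. G k)" by (auto simp: G_def)
      also have "emeasure P ... = (\<Sum>k. emeasure P (G k))"
        by (rule suminf_emeasure[symmetric]) (auto simp: disjoint_family_on_def G_def)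
      also have "... = (\<Sum>k. emeasure P (E k)) * emeasure P {w \<in> space P. pth B w \<in> S}"
        by (simp add: EG)
      also have "(\<Sum>k. emeasure P (E k)) = emeasure P (\<Union>k. E k)"
        by (rule suminf_emeasure) (auto simp: disjoint_family_on_def E_def)
      also have "(\<Union>k. E k) = ?a -` A \<inter> space P" by (auto simp: E_def)
      also have "emeasure P (?a -` A \<inter> space P) = emeasure (distr P borel ?a) A"
        by (rule emeasure_distr[symmetric]) simp_all
      also have "{w \<in> space P. pth B w \<in> S} = pth B -` S \<inter> space P" by auto
      also have "emeasure P (pth B -` S \<inter> space P) = emeasure (distr P borel (pth B)) S"
        by (rule emeasure_distr[symmetric]) (simp_all add: pB_m)
      finally show "emeasure (distr P borel ?a) A * emeasure (distr P borel (pth B)) S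
        = emeasure (distr P borel (%w. (?a w, ?f w))) (A \<times> S)" by simp
    qed
    moreover have "distr P borel ?a \<Otimes>\<^sub>M distr P borel (pth B) = distr (P \<Otimes>\<^sub>M P) (borel \<Otimes>\<^sub>M borel) (%(w, w'). (?a w, pth B w'))"
      by (intro pair_measure_distr af_m pB_m prob_space_imp_sigma_finite P.prob_space_distr)
    ultimately show ?thesis by (simp add: borel_prod)
  qed
  have "distr P borel (%w. (a \<sigma> w, f \<sigma> w)) = distr (P \<Otimes>\<^sub>M P) borel (%x. (a \<sigma> (fst x), pth B (snd x)))"
  proof (rule distr_eq_limit)
    show "prob_space P" "prob_space (P \<Otimes>\<^sub>M P)" by unfold_locales
    show "(%w. (a (?s n) w, f (?s n) w)) \<in> borel_measurable P" for n
      by (intro borel_measurable_Pair af_m)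
    show "(%w. (a \<sigma> w, f \<sigma> w)) \<in> borel_measurable P"
      by (intro borel_measurable_Pair af_m)
    show "(%x. (a (?s n) (fst x), pth B (snd x))) \<in> borel_measurable (P \<Otimes>\<^sub>M P)" for n
      by (intro borel_measurable_Pair measurable_compose[OF measurable_fst af_m(1)] measurable_compose[OF measurable_snd pB_m])
    show "(%x. (a \<sigma> (fst x), pth B (snd x))) \<in> borel_measurable (P \<Otimes>\<^sub>M P)"
      by (intro borel_measurable_Pair measurable_compose[OF measurable_fst af_m(3)] measurable_compose[OF measurable_snd pB_m])
    have al: "(%n. a (?s n) w) \<longlonglongrightarrow> a \<sigma> w" if "w \<in> space P" for w
      unfolding a_def by (intro tendsto_Pair dyad_tendsto continuous_dyad_tendsto D \<sigma>0 that)
    have fl: "(%n. f (?s n) w) \<longlonglongrightarrow> f \<sigma> w" if "w \<in> space P" for w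
      unfolding tendsto_fun_iff f_def pth_def
    proof (intro allI tendsto_diff continuous_dyad_tendsto D \<sigma>0 that)
      fix q :: rat
      have "continuous_on {0..} (%t. B (t + real_of_rat \<bar>q\<bar>) w)"
        by (intro continuous_on_compose2[OF D(4)[OF that]] continuous_intros) auto
      then show "continuous_on {0..} (%t. B (t + real_of_rat \<bar>q\<bar>) w)" .
    qed
    show "(%n. (a (?s n) w, f (?s n) w)) \<longlonglongrightarrow> (a \<sigma> w, f \<sigma> w)" if "w \<in> space P" for w
      by (intro tendsto_Pair al fl that)
    show "(%n. (a (?s n) (fst x), pth B (snd x))) \<longlonglongrightarrow> (a \<sigma> (fst x), pth B (snd x))" if "x \<in> space (P \<Otimes>\<^sub>M P)" for x
      using that by (intro tendsto_Pair al tendsto_const) (auto simp: space_pair_measure)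
    show "distr P borel (%w. (a (?s n) w, f (?s n) w)) = distr (P \<Otimes>\<^sub>M P) borel (%x. (a (?s n) (fst x), pth B (snd x)))" for n
      using step[of n] by (simp add: case_prod_beta')
  qed
  then show ?thesis by (simp add: a_def f_def case_prod_beta')
qed

text \<open>For closed \<open>C\<close> and continuous paths this is the hitting time, see
  \<open>hit_eq_INF\<close>, with value \<open>\<top>\<close> if \<open>C\<close> is never met. A
  path may meet \<open>C\<close> at irrational times only, hence the detour over rational times at
  which it is within \<open>1 / Suc n\<close> of \<open>C\<close>; countable operations keep the
  functional Borel.\<close>

definition hit :: "'a::metric_space set => (rat => 'a) => ennreal" where
  "hit C b = (SUP n. INF q. if infdist (b q) C < 1 / real (Suc n) then ennreal (real_of_rat \<bar>q\<bar>) else \<top>)"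

lemma hit_measurable:
  fixes b :: "'v => rat => 'a::{metric_space, second_countable_topology}"
  assumes b: "b \<in> borel_measurable M"
  shows "(%x. hit C (b x)) \<in> borel_measurable M"
proof -
  have [measurable]: "(%x. infdist (b x q) C) \<in> borel_measurable M" for q
    by (rule measurable_compose[OF measurable_compose[OF b component_measurable]])
       (intro borel_measurable_continuous_onI continuous_intros)
  show ?thesis unfolding hit_def
    by (intro borel_measurable_SUP borel_measurable_INF) measurable
qed

text \<open>If the value is at most \<open>t\<close>, there are rational times below
  \<open>t + 1 / Suc n\<close> at which the distance to \<open>C\<close> is below
  \<open>1 / Suc n\<close>; by compactness they accumulate at a time up to \<open>t\<close>, where
  the path lies in the closed set. Conversely, dyadic times approach a given hit from above and
  eventually satisfy each tolerance.\<close>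

lemma hit_le_iff:
  fixes f :: "real => 'a::metric_space"
  assumes C: "closed C" "C \<noteq> {}" and f: "continuous_on {0..} f" and t: "0 <= t"
  shows "hit C (%q. f (real_of_rat \<bar>q\<bar>)) <= ennreal t \<longleftrightarrow> (\<exists>s. 0 <= s \<and> s <= t \<and> f s \<in> C)"
proof
  let ?g = "%n q. if infdist (f (real_of_rat \<bar>q\<bar>)) C < 1 / real (Suc n) then ennreal (real_of_rat \<bar>q\<bar>) else \<top>"
  assume h: "hit C (%q. f (real_of_rat \<bar>q\<bar>)) <= ennreal t"
  have "\<exists>q. infdist (f (real_of_rat \<bar>q\<bar>)) C < 1 / real (Suc n) \<and> real_of_rat \<bar>q\<bar> < t + 1 / real (Suc n)" for n
  proof -
    have "(INF q. ?g n q) <= ennreal t"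
      using h unfolding hit_def by (meson SUP_upper UNIV_I order_trans)
    also have "ennreal t < ennreal (t + 1 / real (Suc n))" using t by (intro ennreal_lessI add_nonneg_pos) auto
    finally obtain q where "?g n q < ennreal (t + 1 / real (Suc n))" unfolding INF_less_iff by blast
    moreover have "0 < t + 1 / real (Suc n)" using t by (intro add_nonneg_pos) auto
    ultimately show ?thesis
      by (intro exI[of _ q]) (simp add: ennreal_less_iff split: if_splits)
  qed
  then obtain q where q: "\<And>n. infdist (f (real_of_rat \<bar>q n\<bar>)) C < 1 / real (Suc n)" "\<And>n. real_of_rat \<bar>q n\<bar> < t + 1 / real (Suc n)"
    by metis
  define x where "x n = real_of_rat \<bar>q n\<bar>" for n
  have x0: "0 <= x n" for n by (simp add: x_def)
  have "x n \<in> {0..t + 1}" for n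
  proof -
    have "1 / real (Suc n) <= 1" by simp
    then show ?thesis using q(2)[of n] x0[of n] unfolding x_def atLeastAtMost_iff by linarith
  qed
  then obtain l r where lr: "l \<in> {0..t + 1}" "strict_mono r" "(x \<circ> r) \<longlonglongrightarrow> l"
    using compact_imp_seq_compact[OF compact_Icc[of 0 "t + 1"]] unfolding seq_compact_def by metis
  have inv0: "(%n. 1 / real (Suc n)) \<longlonglongrightarrow> 0" by (rule LIMSEQ_Suc[OF lim_1_over_n])
  then have inv: "(%n. 1 / real (Suc (r n))) \<longlonglongrightarrow> 0"
    using LIMSEQ_subseq_LIMSEQ[OF _ lr(2)] by (simp add: o_def)
  have "l <= t + 0"
  proof (rule LIMSEQ_le[OF lr(3)])
    show "(%n. t + 1 / real (Suc (r n))) \<longlonglongrightarrow> t + 0" by (intro tendsto_intros inv)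
    show "\<exists>N. \<forall>n\<ge>N. (x \<circ> r) n <= t + 1 / real (Suc (r n))"
      using q(2) by (auto simp: x_def intro: less_imp_le)
  qed
  have lim: "(%n. infdist (f (x (r n))) C) \<longlonglongrightarrow> infdist (f l) C"
    using lr x0 by (intro tendsto_intros continuous_on_tendsto_compose[OF f]) (auto simp: o_def)
  have "infdist (f l) C <= 0"
    by (rule LIMSEQ_le[OF lim inv]) (use q(1) in \<open>auto simp: x_def intro: less_imp_le\<close>)
  then have "infdist (f l) C = 0" using infdist_nonneg[of "f l" C] by linarith
  then have "f l \<in> C" using in_closed_iff_infdist_zero[OF C] by simp
  then show "\<exists>s. 0 <= s \<and> s <= t \<and> f s \<in> C" using lr(1) \<open>l <= t + 0\<close> by auto
next
  assume "\<exists>s. 0 <= s \<and> s <= t \<and> f s \<in> C"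
  then obtain s where s: "0 <= s" "s <= t" "f s \<in> C" by blast
  show "hit C (%q. f (real_of_rat \<bar>q\<bar>)) <= ennreal t"
    unfolding hit_def
  proof (rule SUP_least)
    fix n
    let ?g = "%q. if infdist (f (real_of_rat \<bar>q\<bar>)) C < 1 / real (Suc n) then ennreal (real_of_rat \<bar>q\<bar>) else \<top>"
    have "(%k. infdist (f (real_of_rat (dyad k s))) C) \<longlonglongrightarrow> infdist (f s) C"
      by (intro tendsto_intros continuous_dyad_tendsto f s)
    then have "eventually (%k. infdist (f (real_of_rat (dyad k s))) C < 1 / real (Suc n)) sequentially"
      using s(3) by (intro order_tendstoD) auto
    then have "eventually (%k. (INF q. ?g q) <= ennreal (real_of_rat (dyad k s))) sequentially"
    proof eventually_elim
      case (elim k)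
      then show ?case by (intro INF_lower2[of "dyad k s"]) (auto simp: dyad_nonneg)
    qed
    moreover have "(%k. ennreal (real_of_rat (dyad k s))) \<longlonglongrightarrow> ennreal s"
      by (intro tendsto_intros dyad_tendsto s)
    ultimately have "(INF q. ?g q) <= ennreal s"
      by (intro tendsto_lowerbound) auto
    then show "(INF q. ?g q) <= ennreal t" using s(2) by (meson ennreal_leI order_trans)
  qed
qed

section \<open>Hitting times and optional stopping\<close>

lemma hit_eq_INF:
  fixes f :: "real => 'a::metric_space"
  assumes C: "closed C" "C \<noteq> {}" and f: "continuous_on {0..} f"
  shows "hit C (%q. f (real_of_rat \<bar>q\<bar>)) = (INF t\<in>{t. 0 <= t \<and> f t \<in> C}. ennreal t)"
proof (rule antisym)
  let ?h = "hit C (%q. f (real_of_rat \<bar>q\<bar>))"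
  show "?h <= (INF t\<in>{t. 0 <= t \<and> f t \<in> C}. ennreal t)"
    by (rule INF_greatest) (use hit_le_iff[OF C f] in auto)
  show "(INF t\<in>{t. 0 <= t \<and> f t \<in> C}. ennreal t) <= ?h"
  proof (cases ?h)
    case (real h)
    then obtain s where "0 <= s" "s <= h" "f s \<in> C" using hit_le_iff[OF C f, of h] by auto
    then have "(INF t\<in>{t. 0 <= t \<and> f t \<in> C}. ennreal t) <= ennreal s" by (intro INF_lower) auto
    also have "... <= ?h" using real \<open>s <= h\<close> by (simp add: ennreal_leI)
    finally show ?thesis .
  qed simp
qed

lemma hitting_time_eq_hit:
  fixes X :: "real => 'w => 'a::metric_space"
  assumes "closed C" "C \<noteq> {}" "continuous_on {0..} (%t. X t w)"
  shows "hitting_time X C w = enn2real (hit C (pth X w))"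
  using hit_eq_INF[OF assms] by (simp add: hitting_time_def pth_def)

lemma hit_finite:
  fixes f :: "real => 'a::metric_space"
  assumes C: "closed C" "C \<noteq> {}" and f: "continuous_on {0..} f"
    and fin: "hit C (%q. f (real_of_rat \<bar>q\<bar>)) < \<top>"
  defines "t \<equiv> enn2real (hit C (%q. f (real_of_rat \<bar>q\<bar>)))"
  shows "0 <= t" "hit C (%q. f (real_of_rat \<bar>q\<bar>)) = ennreal t" "f t \<in> C"
proof -
  show t: "0 <= t" by (simp add: t_def)
  show eq: "hit C (%q. f (real_of_rat \<bar>q\<bar>)) = ennreal t" using fin by (simp add: t_def)
  then obtain s where s: "0 <= s" "s <= t" "f s \<in> C" using hit_le_iff[OF C f t] by auto
  then have "hit C (%q. f (real_of_rat \<bar>q\<bar>)) <= ennreal s" using hit_le_iff[OF C f s(1)] by auto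
  then have "t <= s" using eq s by (simp add: ennreal_le_iff)
  then show "f t \<in> C" using s by simp
qed

lemma before_hit:
  fixes f :: "real => 'a::metric_space"
  assumes C: "closed C" "C \<noteq> {}" and f: "continuous_on {0..} f"
    and s: "0 <= s" "ennreal s < hit C (%q. f (real_of_rat \<bar>q\<bar>))"
  shows "f s \<notin> C"
proof
  assume "f s \<in> C"
  then have "hit C (%q. f (real_of_rat \<bar>q\<bar>)) <= ennreal s" using hit_le_iff[OF C f s(1)] s(1) by auto
  then show False using s(2) by simp
qed

text \<open>A connected set meeting both \<open>D\<close> and its complement meets the frontier;
  this is applied to the image of the times before \<open>t\<close>. At time \<open>t\<close> itself
  the path may touch the frontier, so only the closure can be claimed.\<close>

lemma in_closure_until_frontier:
  fixes f :: "real => 'a::metric_space"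
  assumes f: "continuous_on {0..} f" and y: "f 0 \<in> closure D" and t: "0 <= t"
    and no: "\<And>s. 0 <= s ==> s < t ==> f s \<notin> frontier D"
  shows "f t \<in> closure D"
proof (cases "t = 0")
  case False
  then have t: "0 < t" using t by simp
  have "f 0 \<notin> frontier D" using no[of 0] t by simp
  then have f0: "f 0 \<in> D" using y closure_Un_frontier by fastforce
  have "f ` {0..<t} \<subseteq> D"
  proof (rule ccontr)
    assume "\<not> ?thesis"
    then have "f ` {0..<t} - D \<noteq> {}" by blast
    moreover have "f 0 \<in> f ` {0..<t}" using t by auto
    then have "f ` {0..<t} \<inter> D \<noteq> {}" using f0 by blast
    moreover have "connected (f ` {0..<t})"
      by (intro connected_continuous_image continuous_on_subset[OF f]) auto
    ultimately have "f ` {0..<t} \<inter> frontier D \<noteq> {}" by (intro connected_Int_frontier)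
    then show False using no by auto
  qed
  then have "f ` {0..<t} \<subseteq> closure D" using closure_subset by blast
  then have "f ` closure {0..<t} \<subseteq> closure D"
    using t by (intro image_closure_subset continuous_on_subset[OF f]) auto
  then show ?thesis using t by auto
qed (use y in simp)

text \<open>Hitting time capped at \<open>T\<close>. Optional stopping is proved for bounded times,
  and the cap also makes \<open>enn2real\<close> lossless.\<close>

definition htr :: "real => 'a::metric_space set => (rat => 'a) => real" where
  "htr T C b = enn2real (min (hit C b) (ennreal T))"

lemma htr_bounds: "0 <= T ==> 0 <= htr T C b" "0 <= T ==> htr T C b <= T"
  and ennreal_htr: "ennreal (htr T C b) = min (hit C b) (ennreal T)"
proof -
  have *: "min (hit C b) (ennreal T) < \<top>" by (simp add: min_less_iff_disj)
  show "0 <= htr T C b" by (simp add: htr_def)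
  show eq: "ennreal (htr T C b) = min (hit C b) (ennreal T)" unfolding htr_def using * by simp
  show "htr T C b <= T" if "0 <= T"
    using that eq by (metis ennreal_le_iff min.cobounded2)
qed

lemma htr_le_iff:
  assumes "0 <= t"
  shows "htr T C b <= t \<longleftrightarrow> hit C b <= ennreal t \<or> T <= t"
proof -
  have "htr T C b <= t \<longleftrightarrow> ennreal (htr T C b) <= ennreal t" using assms by (simp add: ennreal_le_iff)
  also have "... \<longleftrightarrow> hit C b <= ennreal t \<or> ennreal T <= ennreal t" by (simp add: ennreal_htr min_le_iff_disj)
  finally show ?thesis using assms by (simp add: ennreal_le_iff)
qed

lemma htr_measurable:
  fixes b :: "'v => rat => 'a::{metric_space, second_countable_topology}"
  assumes b: "b \<in> borel_measurable M"
  shows "(%x. htr T C (b x)) \<in> borel_measurable M"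
proof -
  have [measurable]: "(%x. hit C (b x)) \<in> borel_measurable M" by (rule hit_measurable[OF b])
  show ?thesis unfolding htr_def by measurable
qed

lemma translate_measurable:
  fixes y :: "'v => real ^ 'd" and b :: "'v => rat => real ^ 'd"
  assumes "y \<in> borel_measurable M" "b \<in> borel_measurable M"
  shows "(%x q. y x + b x q) \<in> borel_measurable M"
  by (rule measurable_coordinatewise_then_product)
     (intro borel_measurable_add assms measurable_compose[OF assms(2) component_measurable])

lemma integral_gauss_quadratic:
  fixes e :: "real ^ 'd"
  assumes s: "0 <= s" and g: "prob_space (gauss s :: (real^'d) measure)"
  shows "(\<integral>\<^sup>+x. ennreal ((c + x \<bullet> e)\<^sup>2) \<partial>(gauss s :: (real ^ 'd) measure)) = ennreal (c\<^sup>2 + (norm e)\<^sup>2 * s)"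
    and "integrable (gauss s) (%x::real^'d. x \<bullet> e)"
proof -
  let ?G = "gauss s :: (real^'d) measure"
  interpret prob_space ?G by fact
  have i2: "integrable ?G (%x. (x \<bullet> e)\<^sup>2)" and v2: "(\<integral>x. (x \<bullet> e)\<^sup>2 \<partial>?G) = (norm e)\<^sup>2 * s"
    using nn_integral_gauss_inner[OF s, of e] s
    by (auto intro!: integrableI_nn_integral_finite integral_eq_nn_integral)
       (subst integral_eq_nn_integral; simp)+
  show i1: "integrable ?G (%x. x \<bullet> e)"
    by (rule square_integrable_imp_integrable[OF _ i2]) simp
  have eq: "(c + x \<bullet> e)\<^sup>2 = c\<^sup>2 + 2 * c * (x \<bullet> e) + (x \<bullet> e)\<^sup>2" for x
    by (simp add: power2_eq_square algebra_simps)
  have "integrable ?G (%x. (c + x \<bullet> e)\<^sup>2)" unfolding eq using i1 i2 by simp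
  moreover have "(\<integral>x. (c + x \<bullet> e)\<^sup>2 \<partial>?G) = c\<^sup>2 + (norm e)\<^sup>2 * s"
    unfolding eq using i1 i2 prob_space by (simp add: v2 integral_gauss_inner[OF s])
  ultimately show "(\<integral>\<^sup>+x. ennreal ((c + x \<bullet> e)\<^sup>2) \<partial>?G) = ennreal (c\<^sup>2 + (norm e)\<^sup>2 * s)"
    by (simp add: nn_integral_eq_integral)
qed

locale brownian =
  fixes P :: "'w measure" and B :: "real => 'w => real ^ 'd"
  assumes BM: "std_brownian_motion P B"
begin

lemma prob: "prob_space P" using BM by (rule std_brownian_motionD)

sublocale prob_space P by (rule prob)

sublocale PP: pair_prob_space P P by unfold_locales

lemmas B_measurable = std_brownian_motionD(2)[OF BM]
  and B_zero = std_brownian_motionD(3)[OF BM]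
  and B_continuous = std_brownian_motionD(4)[OF BM]
  and B_at_measurable = std_brownian_motion_at_measurable[OF BM]

lemma pth_B_measurable: "pth B \<in> borel_measurable P"
  by (intro pth_measurable B_measurable)

abbreviation spth :: "real ^ 'd => 'w => rat => real ^ 'd" where
  "spth y \<equiv> pth (%t w. y + B t w)"

lemma spth_eq: "spth y w = (%q. y + pth B w q)"
  by (simp add: pth_def)

lemma spth_measurable: "spth y \<in> borel_measurable P"
  by (intro pth_measurable borel_measurable_add B_measurable) auto

lemma spth_continuous: "w \<in> space P ==> continuous_on {0..} (%t. y + B t w)"
  by (intro continuous_intros B_continuous)

lemma gauss_eq_distr: "0 <= t ==> gauss t = distr P borel (B t)"
proof -
  assume t: "0 <= t"
  have "gauss t = distr P borel (%w. B t w - B 0 w)"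
    using std_brownian_motion_increment[OF BM, of 0 t] t by simp
  also have "... = distr P borel (B t)" by (intro distr_cong) (auto simp: B_zero)
  finally show ?thesis .
qed

lemma prob_space_gauss: "0 <= t ==> prob_space (gauss t :: (real^'d) measure)"
  by (simp add: gauss_eq_distr prob_space_distr B_measurable)

text \<open>Whether \<open>C\<close> has been met by time \<open>t\<close> is the same question for
  the path and for the path stopped at \<open>t\<close>, and \<open>hit\<close> answers it by a
  Borel function.\<close>

lemma stopping_htr:
  assumes C: "closed C" "C \<noteq> {}" and T: "0 <= T"
  shows "stopping P B (%w. htr T C (spth y w))"
  unfolding stopping_def
proof (intro conjI ballI allI impI)
  show "(%w. htr T C (spth y w)) \<in> borel_measurable P" by (intro htr_measurable spth_measurable)
  show "0 <= htr T C (spth y w)" for w using T by (rule htr_bounds)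
  fix t :: real assume t: "0 <= t"
  define S where "S = {b \<in> space borel. hit C (%q. y + b q) <= ennreal t \<or> T <= t}"
  have [measurable]: "(%b. hit C (%q. y + b q)) \<in> borel_measurable borel"
    by (intro hit_measurable translate_measurable) auto
  have S: "S \<in> sets borel" unfolding S_def by measurable
  show "\<exists>S\<in>sets borel. AE w in P. htr T C (spth y w) <= t \<longleftrightarrow> pth (%s. B (min s t)) w \<in> S"
  proof (intro bexI[OF _ S] AE_I2)
    fix w assume w: "w \<in> space P"
    have c: "continuous_on {0..} (%s. y + B (min s t) w)"
      by (intro continuous_intros continuous_on_compose2[OF B_continuous[OF w]]) (use t in auto)
    have "hit C (spth y w) <= ennreal t \<longleftrightarrow> (\<exists>s. 0 <= s \<and> s <= t \<and> y + B s w \<in> C)"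
      unfolding pth_def by (rule hit_le_iff[OF C spth_continuous[OF w] t])
    also have "... \<longleftrightarrow> (\<exists>s. 0 <= s \<and> s <= t \<and> y + B (min s t) w \<in> C)" by (auto simp: min_absorb1)
    also have "... \<longleftrightarrow> hit C (%q. y + pth (%s. B (min s t)) w q) <= ennreal t"
      unfolding pth_def by (rule hit_le_iff[OF C c t, symmetric])
    finally show "htr T C (spth y w) <= t \<longleftrightarrow> pth (%s. B (min s t)) w \<in> S"
      unfolding htr_le_iff[OF t] S_def by simp
  qed
qed

lemma stopping_hit:
  assumes C: "closed C" "C \<noteq> {}" and fin: "AE w in P. hit C (spth y w) < \<top>"
  shows "stopping P B (%w. enn2real (hit C (spth y w)))"
  unfolding stopping_def
proof (intro conjI ballI allI impI)
  have [measurable]: "(%w. hit C (spth y w)) \<in> borel_measurable P" by (intro hit_measurable spth_measurable)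
  show "(%w. enn2real (hit C (spth y w))) \<in> borel_measurable P" by measurable
  show "0 <= enn2real (hit C (spth y w))" for w by simp
  fix t :: real assume t: "0 <= t"
  \<comment> \<open>The cap \<open>t + 1\<close> lies above \<open>t\<close>, so it cannot trigger
    the event by itself.\<close>
  then obtain S where S: "S \<in> sets borel" "AE w in P. htr (t + 1) C (spth y w) <= t \<longleftrightarrow> pth (%s. B (min s t)) w \<in> S"
    using stopping_htr[OF C, of "t + 1" y] unfolding stopping_def by auto
  show "\<exists>S\<in>sets borel. AE w in P. enn2real (hit C (spth y w)) <= t \<longleftrightarrow> pth (%s. B (min s t)) w \<in> S"
  proof (intro bexI[OF _ S(1)])
    show "AE w in P. enn2real (hit C (spth y w)) <= t \<longleftrightarrow> pth (%s. B (min s t)) w \<in> S"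
      using S(2) fin
    proof eventually_elim
      case (elim w)
      then obtain h where h: "0 <= h" "hit C (spth y w) = ennreal h" by (cases "hit C (spth y w)") auto
      then show ?case using elim(1) t by (simp add: htr_le_iff ennreal_le_iff)
    qed
  qed
qed

lemma future_measurable:
  assumes "\<sigma> \<in> borel_measurable P" "\<And>w. w \<in> space P ==> 0 <= \<sigma> w"
  shows "pth (%t w. B (\<sigma> w + t) w - B (\<sigma> w) w) \<in> borel_measurable P"
  by (intro pth_measurable borel_measurable_diff B_at_measurable) (use assms in auto)

lemma ev_future:
  assumes "w \<in> space P" "0 <= \<sigma> w" "0 <= s"
  shows "ev (pth (%t w. B (\<sigma> w + t) w - B (\<sigma> w) w) w) s = B (\<sigma> w + s) w - B (\<sigma> w) w"
  by (rule ev_pth) (intro continuous_intros continuous_on_compose2[OF B_continuous[OF assms(1)]],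
    use assms in auto)

lemma strong_markov_nn_integral:
  fixes G :: "(real \<times> (real^'d)) \<times> (rat => real^'d) => ennreal"
  assumes \<sigma>: "stopping P B \<sigma>" and G [measurable]: "G \<in> borel_measurable borel"
  shows "(\<integral>\<^sup>+w. G ((\<sigma> w, B (\<sigma> w) w), pth (%t w. B (\<sigma> w + t) w - B (\<sigma> w) w) w) \<partial>P)
       = (\<integral>\<^sup>+w. \<integral>\<^sup>+w'. G ((\<sigma> w, B (\<sigma> w) w), pth B w') \<partial>P \<partial>P)"
proof -
  have s: "\<sigma> \<in> borel_measurable P" "\<And>w. w \<in> space P ==> 0 <= \<sigma> w" using \<sigma> by (auto simp: stopping_def)
  note Bs = B_at_measurable[OF s]
  have m1: "(%w. ((\<sigma> w, B (\<sigma> w) w), pth (%t w. B (\<sigma> w + t) w - B (\<sigma> w) w) w)) \<in> borel_measurable P"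
    by (intro borel_measurable_Pair s Bs future_measurable)
  have m2: "(%x. ((\<sigma> (fst x), B (\<sigma> (fst x)) (fst x)), pth B (snd x))) \<in> borel_measurable (P \<Otimes>\<^sub>M P)"
    by (intro borel_measurable_Pair measurable_compose[OF measurable_fst s(1)] measurable_compose[OF measurable_fst Bs]
       measurable_compose[OF measurable_snd pth_B_measurable])
  have "(\<integral>\<^sup>+w. G ((\<sigma> w, B (\<sigma> w) w), pth (%t w. B (\<sigma> w + t) w - B (\<sigma> w) w) w) \<partial>P)
     = (\<integral>\<^sup>+x. G x \<partial>distr P borel (%w. ((\<sigma> w, B (\<sigma> w) w), pth (%t w. B (\<sigma> w + t) w - B (\<sigma> w) w) w)))"
    by (rule nn_integral_distr[symmetric, OF m1]) simp
  also have "... = (\<integral>\<^sup>+x. G x \<partial>distr (P \<Otimes>\<^sub>M P) borel (%x. ((\<sigma> (fst x), B (\<sigma> (fst x)) (fst x)), pth B (snd x))))"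
    using strong_markov[OF BM \<sigma>] by (simp add: case_prod_beta')
  also have "... = (\<integral>\<^sup>+x. G ((\<sigma> (fst x), B (\<sigma> (fst x)) (fst x)), pth B (snd x)) \<partial>(P \<Otimes>\<^sub>M P))"
    by (rule nn_integral_distr[OF m2]) simp
  also have "... = (\<integral>\<^sup>+w. \<integral>\<^sup>+w'. G ((\<sigma> w, B (\<sigma> w) w), pth B w') \<partial>P \<partial>P)"
    using nn_integral_fst[OF measurable_compose[OF m2 G]] by simp
  finally show ?thesis .
qed

lemma strong_markov_integral:
  fixes G :: "(real \<times> (real^'d)) \<times> (rat => real^'d) => real"
  assumes \<sigma>: "stopping P B \<sigma>" and G [measurable]: "G \<in> borel_measurable borel"
    and int: "integrable P (%w. G ((\<sigma> w, B (\<sigma> w) w), pth (%t w. B (\<sigma> w + t) w - B (\<sigma> w) w) w))"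
  shows "(\<integral>w. G ((\<sigma> w, B (\<sigma> w) w), pth (%t w. B (\<sigma> w + t) w - B (\<sigma> w) w) w) \<partial>P)
       = (\<integral>w. \<integral>w'. G ((\<sigma> w, B (\<sigma> w) w), pth B w') \<partial>P \<partial>P)"
    and "integrable P (%w. \<integral>w'. G ((\<sigma> w, B (\<sigma> w) w), pth B w') \<partial>P)"
proof -
  have s: "\<sigma> \<in> borel_measurable P" "\<And>w. w \<in> space P ==> 0 <= \<sigma> w" using \<sigma> by (auto simp: stopping_def)
  note Bs = B_at_measurable[OF s]
  have m1: "(%w. ((\<sigma> w, B (\<sigma> w) w), pth (%t w. B (\<sigma> w + t) w - B (\<sigma> w) w) w)) \<in> borel_measurable P"
    by (intro borel_measurable_Pair s Bs future_measurable)
  have m2: "(%x. ((\<sigma> (fst x), B (\<sigma> (fst x)) (fst x)), pth B (snd x))) \<in> borel_measurable (P \<Otimes>\<^sub>M P)"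
    by (intro borel_measurable_Pair measurable_compose[OF measurable_fst s(1)] measurable_compose[OF measurable_fst Bs]
       measurable_compose[OF measurable_snd pth_B_measurable])
  have law: "distr P borel (%w. ((\<sigma> w, B (\<sigma> w) w), pth (%t w. B (\<sigma> w + t) w - B (\<sigma> w) w) w))
      = distr (P \<Otimes>\<^sub>M P) borel (%x. ((\<sigma> (fst x), B (\<sigma> (fst x)) (fst x)), pth B (snd x)))"
    using strong_markov[OF BM \<sigma>] by (simp add: case_prod_beta')
  have "integrable (distr P borel (%w. ((\<sigma> w, B (\<sigma> w) w), pth (%t w. B (\<sigma> w + t) w - B (\<sigma> w) w) w))) G"
    using int by (subst integrable_distr_eq[OF m1]) simp_all
  then have i2: "integrable (P \<Otimes>\<^sub>M P) (%x. G ((\<sigma> (fst x), B (\<sigma> (fst x)) (fst x)), pth B (snd x)))"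
    unfolding law by (subst (asm) integrable_distr_eq[OF m2]) simp_all
  have "(\<integral>w. G ((\<sigma> w, B (\<sigma> w) w), pth (%t w. B (\<sigma> w + t) w - B (\<sigma> w) w) w) \<partial>P)
     = (\<integral>x. G x \<partial>distr P borel (%w. ((\<sigma> w, B (\<sigma> w) w), pth (%t w. B (\<sigma> w + t) w - B (\<sigma> w) w) w)))"
    by (rule integral_distr[symmetric, OF m1]) simp
  also have "... = (\<integral>x. G ((\<sigma> (fst x), B (\<sigma> (fst x)) (fst x)), pth B (snd x)) \<partial>(P \<Otimes>\<^sub>M P))"
    unfolding law by (rule integral_distr[OF m2]) simp
  also have "... = (\<integral>w. \<integral>w'. G ((\<sigma> w, B (\<sigma> w) w), pth B w') \<partial>P \<partial>P)"
    using PP.integral_fst'[OF i2] by simp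
  finally show "(\<integral>w. G ((\<sigma> w, B (\<sigma> w) w), pth (%t w. B (\<sigma> w + t) w - B (\<sigma> w) w) w) \<partial>P)
       = (\<integral>w. \<integral>w'. G ((\<sigma> w, B (\<sigma> w) w), pth B w') \<partial>P \<partial>P)" .
  show "integrable P (%w. \<integral>w'. G ((\<sigma> w, B (\<sigma> w) w), pth B w') \<partial>P)"
    using PP.integrable_fst'[OF i2] by simp
qed

end

lemma ennreal_eqI_le:
  fixes a b :: ennreal
  assumes "\<And>t. 0 <= t ==> a <= ennreal t \<longleftrightarrow> b <= ennreal t"
  shows "a = b"
proof (rule antisym)
  show "a <= b" using assms[of "enn2real b"] by (cases b) auto
  show "b <= a" using assms[of "enn2real a"] by (cases a) auto
qed

text \<open>No hit occurs before \<open>s\<close>, so hits of the path and of its restart at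
  \<open>s\<close> correspond by a shift. It splits an exit time at an earlier stopping
  time.\<close>

lemma hit_shift:
  fixes f :: "real => 'a::metric_space"
  assumes C: "closed C" "C \<noteq> {}" and f: "continuous_on {0..} f" and s: "0 <= s"
    and le: "ennreal s <= hit C (%q. f (real_of_rat \<bar>q\<bar>))"
  shows "hit C (%q. f (real_of_rat \<bar>q\<bar>)) = ennreal s + hit C (%q. f (s + real_of_rat \<bar>q\<bar>))"
proof (rule ennreal_eqI_le)
  fix t :: real assume t: "0 <= t"
  have g: "continuous_on {0..} (%u. f (s + u))"
    by (intro continuous_on_compose2[OF f] continuous_intros) (use s in auto)
  have ge: "s <= u" if "0 <= u" "f u \<in> C" for u
  proof -
    have "hit C (%q. f (real_of_rat \<bar>q\<bar>)) <= ennreal u" using hit_le_iff[OF C f that(1)] that by auto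
    then have "ennreal s <= ennreal u" using le by order
    then show ?thesis using that by (simp add: ennreal_le_iff)
  qed
  show "hit C (%q. f (real_of_rat \<bar>q\<bar>)) <= ennreal t \<longleftrightarrow> ennreal s + hit C (%q. f (s + real_of_rat \<bar>q\<bar>)) <= ennreal t"
  proof (cases "s <= t")
    case True
    have eq: "ennreal t = ennreal s + ennreal (t - s)" using s True by (simp add: ennreal_plus[symmetric] del: ennreal_plus)
    have "ennreal s + hit C (%q. f (s + real_of_rat \<bar>q\<bar>)) <= ennreal t \<longleftrightarrow> hit C (%q. f (s + real_of_rat \<bar>q\<bar>)) <= ennreal (t - s)"
      unfolding eq by (subst ennreal_add_left_cancel_le) auto
    also have "... \<longleftrightarrow> (\<exists>u. 0 <= u \<and> u <= t - s \<and> f (s + u) \<in> C)"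
      using True by (intro hit_le_iff[OF C g]) simp
    also have "... \<longleftrightarrow> (\<exists>u. 0 <= u \<and> u <= t \<and> f u \<in> C)"
    proof
      assume "\<exists>u. 0 <= u \<and> u <= t \<and> f u \<in> C"
      then obtain u where "0 <= u" "u <= t" "f u \<in> C" by blast
      then show "\<exists>u. 0 <= u \<and> u <= t - s \<and> f (s + u) \<in> C"
        using ge[of u] by (intro exI[of _ "u - s"]) auto
    next
      assume "\<exists>u. 0 <= u \<and> u <= t - s \<and> f (s + u) \<in> C"
      then obtain u where "0 <= u" "u <= t - s" "f (s + u) \<in> C" by blast
      then show "\<exists>u. 0 <= u \<and> u <= t \<and> f u \<in> C"
        using s by (intro exI[of _ "s + u"]) auto
    qed
    also have "... \<longleftrightarrow> hit C (%q. f (real_of_rat \<bar>q\<bar>)) <= ennreal t"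
      by (rule hit_le_iff[OF C f t, symmetric])
    finally show ?thesis by simp
  next
    case False
    then have lt: "ennreal t < ennreal s" using t by (simp add: ennreal_less_iff)
    then have "\<not> hit C (%q. f (real_of_rat \<bar>q\<bar>)) <= ennreal t" using le by order
    moreover have "\<not> ennreal s + hit C (%q. f (s + real_of_rat \<bar>q\<bar>)) <= ennreal t"
      using lt by (meson le_iff_add not_le order_trans)
    ultimately show ?thesis by simp
  qed
qed

context brownian
begin

text \<open>Wald's identities: at the fixed time \<open>T\<close> the motion is its value at
  \<open>\<sigma>\<close> plus a restarted motion run for the time \<open>T - \<sigma>\<close>. By
  the strong Markov property the second part has conditional mean zero and variance proportional to
  \<open>T - \<sigma>\<close>; removing it from the known Gaussian moments at \<open>T\<close>
  leaves the moments at \<open>\<sigma>\<close>.\<close>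

lemma optional_stopping:
  assumes \<sigma>: "stopping P B \<sigma>" and T: "\<And>w. w \<in> space P ==> \<sigma> w <= T"
  shows "(\<integral>\<^sup>+w. ennreal ((B (\<sigma> w) w \<bullet> e)\<^sup>2) \<partial>P) = ennreal ((norm e)\<^sup>2) * (\<integral>\<^sup>+w. ennreal (\<sigma> w) \<partial>P)"
    and "integrable P (%w. B (\<sigma> w) w \<bullet> e)" and "(\<integral>w. B (\<sigma> w) w \<bullet> e \<partial>P) = 0"
proof -
  have s [measurable]: "\<sigma> \<in> borel_measurable P" and s0: "\<And>w. w \<in> space P ==> 0 <= \<sigma> w" using \<sigma> by (auto simp: stopping_def)
  note Bs [measurable] = B_at_measurable[OF s s0]
  obtain w0 where "w0 \<in> space P" using not_empty by auto
  then have T0: "0 <= T" using T s0 by (meson order_trans)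
  define F where "F w = pth (%t w. B (\<sigma> w + t) w - B (\<sigma> w) w) w" for w
  \<comment> \<open>The value at time \<open>T\<close> reconstructed from the time and place of
    stopping and the restarted path, the form in which the strong Markov property can be
    applied.\<close>
  define g where "g = (%((s, z), b). (z + ev b (T - s)) \<bullet> e :: real)"
  have g_m [measurable]: "g \<in> borel_measurable borel"
  proof -
    have "(%x::(real \<times> (real^'d)) \<times> (rat => real^'d). ev (snd x) (T - fst (fst x))) \<in> borel_measurable borel"
      by (intro ev_measurable borel_measurable_diff borel_measurable_const borel_measurable_continuous_onI continuous_intros)
    moreover have "(%x::(real \<times> (real^'d)) \<times> (rat => real^'d). snd (fst x)) \<in> borel_measurable borel"
      by (intro borel_measurable_continuous_onI continuous_intros)
    ultimately show ?thesis unfolding g_def case_prod_beta'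
      by (intro borel_measurable_inner borel_measurable_add borel_measurable_const)
  qed
  have gB: "g ((\<sigma> w, B (\<sigma> w) w), F w) = B T w \<bullet> e" if "w \<in> space P" for w
    unfolding g_def F_def using ev_future[of w \<sigma> "T - \<sigma> w"] that T s0 by simp
  have gB': "g ((\<sigma> w, B (\<sigma> w) w), pth B w') = B (\<sigma> w) w \<bullet> e + B (T - \<sigma> w) w' \<bullet> e"
    if "w \<in> space P" "w' \<in> space P" for w w'
    unfolding g_def using ev_pth[of B w' "T - \<sigma> w", OF B_continuous] that T by (simp add: inner_add_left)
  have gauss_nn: "(\<integral>\<^sup>+w. ennreal ((c + B t w \<bullet> e)\<^sup>2) \<partial>P) = ennreal (c\<^sup>2 + (norm e)\<^sup>2 * t)" if "0 <= t" for t c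
  proof -
    have [measurable]: "B t \<in> borel_measurable P" using that by (rule B_measurable)
    have "(\<integral>\<^sup>+w. ennreal ((c + B t w \<bullet> e)\<^sup>2) \<partial>P) = (\<integral>\<^sup>+x. ennreal ((c + x \<bullet> e)\<^sup>2) \<partial>distr P borel (B t))"
      by (subst nn_integral_distr) auto
    then show ?thesis using integral_gauss_quadratic(1)[OF that prob_space_gauss[OF that], of c e] that
      by (simp add: gauss_eq_distr)
  qed
  have gauss_i: "integrable P (%w. B t w \<bullet> e)" "(\<integral>w. B t w \<bullet> e \<partial>P) = 0" if "0 <= t" for t
  proof -
    have [measurable]: "B t \<in> borel_measurable P" using that by (rule B_measurable)
    show "integrable P (%w. B t w \<bullet> e)"
      using integral_gauss_quadratic(2)[OF that prob_space_gauss[OF that], of e] that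
      by (simp add: gauss_eq_distr integrable_distr_eq)
    show "(\<integral>w. B t w \<bullet> e \<partial>P) = 0"
      using integral_gauss_inner[OF that, of e] that by (simp add: gauss_eq_distr integral_distr)
  qed
  have nnT: "(\<integral>\<^sup>+w. ennreal ((norm e)\<^sup>2 * (T - \<sigma> w)) \<partial>P) + ennreal ((norm e)\<^sup>2) * (\<integral>\<^sup>+w. ennreal (\<sigma> w) \<partial>P) = ennreal ((norm e)\<^sup>2 * T)"
  proof -
    have "(\<integral>\<^sup>+w. ennreal ((norm e)\<^sup>2 * (T - \<sigma> w)) \<partial>P) + ennreal ((norm e)\<^sup>2) * (\<integral>\<^sup>+w. ennreal (\<sigma> w) \<partial>P)
      = (\<integral>\<^sup>+w. ennreal ((norm e)\<^sup>2 * (T - \<sigma> w)) + ennreal ((norm e)\<^sup>2) * ennreal (\<sigma> w) \<partial>P)"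
      by (simp add: nn_integral_add nn_integral_cmult)
    also have "... = (\<integral>\<^sup>+w. ennreal ((norm e)\<^sup>2 * T) \<partial>P)"
      using T s0 by (intro nn_integral_cong)
        (simp add: ennreal_mult[symmetric] ennreal_plus[symmetric] right_diff_distrib mult_left_mono del: ennreal_plus)
    finally show ?thesis by (simp add: emeasure_space_1)
  qed
  have nnS: "(\<integral>\<^sup>+w. ennreal ((B (\<sigma> w) w \<bullet> e)\<^sup>2) \<partial>P) + (\<integral>\<^sup>+w. ennreal ((norm e)\<^sup>2 * (T - \<sigma> w)) \<partial>P) = ennreal ((norm e)\<^sup>2 * T)"
  proof -
    have "ennreal ((norm e)\<^sup>2 * T) = (\<integral>\<^sup>+w. ennreal ((g ((\<sigma> w, B (\<sigma> w) w), F w))\<^sup>2) \<partial>P)"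
      using gauss_nn[OF T0, of 0] by (subst nn_integral_cong[OF arg_cong[OF gB]]) simp_all
    also have "... = (\<integral>\<^sup>+w. \<integral>\<^sup>+w'. ennreal ((g ((\<sigma> w, B (\<sigma> w) w), pth B w'))\<^sup>2) \<partial>P \<partial>P)"
      unfolding F_def by (rule strong_markov_nn_integral[OF \<sigma>, of "%x. ennreal ((g x)\<^sup>2)"]) simp
    also have "... = (\<integral>\<^sup>+w. ennreal ((B (\<sigma> w) w \<bullet> e)\<^sup>2 + (norm e)\<^sup>2 * (T - \<sigma> w)) \<partial>P)"
    proof (rule nn_integral_cong)
      fix w assume w: "w \<in> space P"
      have "(\<integral>\<^sup>+w'. ennreal ((g ((\<sigma> w, B (\<sigma> w) w), pth B w'))\<^sup>2) \<partial>P) = (\<integral>\<^sup>+w'. ennreal ((B (\<sigma> w) w \<bullet> e + B (T - \<sigma> w) w' \<bullet> e)\<^sup>2) \<partial>P)"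
        by (intro nn_integral_cong) (simp add: gB' w)
      then show "(\<integral>\<^sup>+w'. ennreal ((g ((\<sigma> w, B (\<sigma> w) w), pth B w'))\<^sup>2) \<partial>P) = ennreal ((B (\<sigma> w) w \<bullet> e)\<^sup>2 + (norm e)\<^sup>2 * (T - \<sigma> w))"
        using gauss_nn[of "T - \<sigma> w"] T w by simp
    qed
    also have "... = (\<integral>\<^sup>+w. ennreal ((B (\<sigma> w) w \<bullet> e)\<^sup>2) + ennreal ((norm e)\<^sup>2 * (T - \<sigma> w)) \<partial>P)"
      using T by (intro nn_integral_cong ennreal_plus) auto
    also have "... = (\<integral>\<^sup>+w. ennreal ((B (\<sigma> w) w \<bullet> e)\<^sup>2) \<partial>P) + (\<integral>\<^sup>+w. ennreal ((norm e)\<^sup>2 * (T - \<sigma> w)) \<partial>P)"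
      by (rule nn_integral_add) measurable
    finally show ?thesis by simp
  qed
  \<comment> \<open>Finiteness permits the cancellation in \<open>ennreal\<close>.\<close>
  have fin: "(\<integral>\<^sup>+w. ennreal ((norm e)\<^sup>2 * (T - \<sigma> w)) \<partial>P) \<noteq> \<top>"
    using nnS by (metis ennreal_add_eq_top ennreal_neq_top)
  show main: "(\<integral>\<^sup>+w. ennreal ((B (\<sigma> w) w \<bullet> e)\<^sup>2) \<partial>P) = ennreal ((norm e)\<^sup>2) * (\<integral>\<^sup>+w. ennreal (\<sigma> w) \<partial>P)"
  proof -
    have "(\<integral>\<^sup>+w. ennreal ((norm e)\<^sup>2 * (T - \<sigma> w)) \<partial>P) + (\<integral>\<^sup>+w. ennreal ((B (\<sigma> w) w \<bullet> e)\<^sup>2) \<partial>P)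
      = (\<integral>\<^sup>+w. ennreal ((norm e)\<^sup>2 * (T - \<sigma> w)) \<partial>P) + ennreal ((norm e)\<^sup>2) * (\<integral>\<^sup>+w. ennreal (\<sigma> w) \<partial>P)"
      unfolding nnT by (subst add.commute) (rule nnS)
    then show ?thesis using fin unfolding ennreal_add_left_cancel by simp
  qed
  have "(\<integral>\<^sup>+w. ennreal (\<sigma> w) \<partial>P) <= (\<integral>\<^sup>+w. ennreal T \<partial>P)"
    using T by (intro nn_integral_mono ennreal_leI) auto
  then have "(\<integral>\<^sup>+w. ennreal (\<sigma> w) \<partial>P) < \<top>" by (simp add: emeasure_space_1 order_le_less_trans)
  then have "(\<integral>\<^sup>+w. ennreal ((B (\<sigma> w) w \<bullet> e)\<^sup>2) \<partial>P) < \<top>"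
    unfolding main by (intro ennreal_mult_less_top[THEN iffD2]) auto
  then have i2: "integrable P (%w. (B (\<sigma> w) w \<bullet> e)\<^sup>2)"
    by (intro integrableI_bounded) auto
  show i: "integrable P (%w. B (\<sigma> w) w \<bullet> e)"
    by (rule square_integrable_imp_integrable[OF _ i2]) simp
  have iT: "integrable P (%w. g ((\<sigma> w, B (\<sigma> w) w), F w))"
    using gauss_i(1)[OF T0] by (subst Bochner_Integration.integrable_cong[OF refl gB])
  have "0 = (\<integral>w. g ((\<sigma> w, B (\<sigma> w) w), F w) \<partial>P)"
    using gauss_i(2)[OF T0] by (subst Bochner_Integration.integral_cong[OF refl gB]) simp_all
  also have "... = (\<integral>w. \<integral>w'. g ((\<sigma> w, B (\<sigma> w) w), pth B w') \<partial>P \<partial>P)"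
    using strong_markov_integral(1)[OF \<sigma> g_m] iT unfolding F_def by simp
  also have "... = (\<integral>w. B (\<sigma> w) w \<bullet> e \<partial>P)"
  proof (rule Bochner_Integration.integral_cong[OF refl])
    fix w assume w: "w \<in> space P"
    have "(\<integral>w'. g ((\<sigma> w, B (\<sigma> w) w), pth B w') \<partial>P) = (\<integral>w'. B (\<sigma> w) w \<bullet> e + B (T - \<sigma> w) w' \<bullet> e \<partial>P)"
      by (intro Bochner_Integration.integral_cong) (simp_all add: gB' w)
    also have "... = B (\<sigma> w) w \<bullet> e"
      using gauss_i[of "T - \<sigma> w"] T[OF w] prob_space by (simp add: Bochner_Integration.integral_add)
    finally show "(\<integral>w'. g ((\<sigma> w, B (\<sigma> w) w), pth B w') \<partial>P) = B (\<sigma> w) w \<bullet> e" .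
  qed
  finally show "(\<integral>w. B (\<sigma> w) w \<bullet> e \<partial>P) = 0" by simp
qed

lemma stopped_norm_sq:
  assumes \<sigma>: "stopping P B \<sigma>" and T: "\<And>w. w \<in> space P ==> \<sigma> w <= T"
  shows "(\<integral>\<^sup>+w. ennreal ((norm (B (\<sigma> w) w))\<^sup>2) \<partial>P) = of_nat CARD('d) * (\<integral>\<^sup>+w. ennreal (\<sigma> w) \<partial>P)"
proof -
  have s: "\<sigma> \<in> borel_measurable P" "\<And>w. w \<in> space P ==> 0 <= \<sigma> w" using \<sigma> by (auto simp: stopping_def)
  note Bs [measurable] = B_at_measurable[OF s]
  have "(norm x)\<^sup>2 = (\<Sum>i\<in>UNIV. (x \<bullet> axis i 1)\<^sup>2)" for x :: "real^'d"
    by (simp add: norm_vec_def L2_set_def sum_nonneg inner_axis)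
  then have "(\<integral>\<^sup>+w. ennreal ((norm (B (\<sigma> w) w))\<^sup>2) \<partial>P) = (\<integral>\<^sup>+w. (\<Sum>i\<in>UNIV. ennreal ((B (\<sigma> w) w \<bullet> axis i 1)\<^sup>2)) \<partial>P)"
    by (simp add: sum_ennreal)
  also have "... = (\<Sum>i\<in>UNIV. (\<integral>\<^sup>+w. ennreal ((B (\<sigma> w) w \<bullet> axis i 1)\<^sup>2) \<partial>P))"
    by (rule nn_integral_sum) measurable
  also have "... = of_nat CARD('d) * (\<integral>\<^sup>+w. ennreal (\<sigma> w) \<partial>P)"
    by (simp add: optional_stopping(1)[OF \<sigma> T])
  finally show ?thesis .
qed

lemma stopped_integrable:
  assumes \<sigma>: "stopping P B \<sigma>" and T: "\<And>w. w \<in> space P ==> \<sigma> w <= T"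
  shows "integrable P \<sigma>" "(\<integral>\<^sup>+w. ennreal (\<sigma> w) \<partial>P) = ennreal (expectation \<sigma>)" "0 <= expectation \<sigma>"
proof -
  have s: "\<sigma> \<in> borel_measurable P" "\<And>w. w \<in> space P ==> 0 <= \<sigma> w" using \<sigma> by (auto simp: stopping_def)
  show i: "integrable P \<sigma>" by (rule integrable_const_bound[of _ T]) (use s T in auto)
  show "(\<integral>\<^sup>+w. ennreal (\<sigma> w) \<partial>P) = ennreal (expectation \<sigma>)" by (rule nn_integral_eq_integral[OF i]) (use s in auto)
  show "0 <= expectation \<sigma>" using s by (intro integral_nonneg_AE) auto
qed

text \<open>Expanding the square, the cross term has mean zero, so the mean of
  \<open>(norm (v + B (\<sigma> w) w))\<^sup>2\<close> is \<open>(norm v)\<^sup>2\<close> plus the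
  dimension times the mean of \<open>\<sigma>\<close>; it is at most
  \<open>c\<^sup>2\<close>.\<close>

lemma stopped_mean_le_norm:
  assumes \<sigma>: "stopping P B \<sigma>" and T: "\<And>w. w \<in> space P ==> \<sigma> w <= T"
    and c: "\<And>w. w \<in> space P ==> norm (v + B (\<sigma> w) w) <= c"
  shows "(\<integral>\<^sup>+w. ennreal (\<sigma> w) \<partial>P) <= ennreal (c\<^sup>2 / CARD('d))"
proof -
  have s: "\<sigma> \<in> borel_measurable P" "\<And>w. w \<in> space P ==> 0 <= \<sigma> w" using \<sigma> by (auto simp: stopping_def)
  note Bs [measurable] = B_at_measurable[OF s]
  note I = stopped_integrable[OF \<sigma> T]
  let ?N = "%w. (norm (B (\<sigma> w) w))\<^sup>2"
  have nn: "(\<integral>\<^sup>+w. ennreal (?N w) \<partial>P) = ennreal (CARD('d) * expectation \<sigma>)"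
    using stopped_norm_sq[OF \<sigma> T] I by (simp add: ennreal_mult ennreal_of_nat_eq_real_of_nat)
  have iN: "integrable P ?N" by (rule integrableI_nn_integral_finite[OF _ _ nn]) (use I in auto)
  have eN: "expectation ?N = CARD('d) * expectation \<sigma>"
    by (rule integral_eq_nn_integral[THEN trans]) (use nn I in auto)
  note J = optional_stopping(2,3)[OF \<sigma> T, of v]
  have "(norm v)\<^sup>2 + CARD('d) * expectation \<sigma> = expectation (%w. (norm v)\<^sup>2 + 2 * (B (\<sigma> w) w \<bullet> v) + ?N w)"
    using J iN prob_space by (simp add: eN)
  also have "... = expectation (%w. (norm (v + B (\<sigma> w) w))\<^sup>2)"
    by (simp add: power2_norm_eq_inner inner_add inner_commute algebra_simps)
  also have "... <= expectation (%w. c\<^sup>2)"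
  proof (rule integral_mono')
    show "(norm (v + B (\<sigma> w) w))\<^sup>2 <= c\<^sup>2" if "w \<in> space P" for w
      using c[OF that] by (intro power_mono) auto
  qed auto
  also have "... = c\<^sup>2" using prob_space by simp
  finally have "CARD('d) * expectation \<sigma> <= c\<^sup>2" using zero_le_power2[of "norm v"] by linarith
  then have "expectation \<sigma> <= c\<^sup>2 / CARD('d)" by (simp add: field_simps)
  then show ?thesis using I(2) by (simp add: ennreal_leI)
qed

text \<open>The stopped coordinate lies between \<open>0\<close> and \<open>c\<close>, hence its
  square is at most \<open>c\<close> times itself. Its mean is \<open>v \<bullet> e\<close> and its
  second moment is \<open>(v \<bullet> e)\<^sup>2\<close> plus the mean of \<open>\<sigma>\<close>;
  so a start close to the face at \<open>0\<close> gives a short mean time.\<close>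

lemma stopped_mean_le_slab:
  assumes \<sigma>: "stopping P B \<sigma>" and T: "\<And>w. w \<in> space P ==> \<sigma> w <= T"
    and e: "norm e = 1" and c: "\<And>w. w \<in> space P ==> 0 <= (v + B (\<sigma> w) w) \<bullet> e \<and> (v + B (\<sigma> w) w) \<bullet> e <= c"
  shows "(\<integral>\<^sup>+w. ennreal (\<sigma> w) \<partial>P) <= ennreal (c * (v \<bullet> e))"
proof -
  have s: "\<sigma> \<in> borel_measurable P" "\<And>w. w \<in> space P ==> 0 <= \<sigma> w" using \<sigma> by (auto simp: stopping_def)
  note Bs [measurable] = B_at_measurable[OF s]
  note I = stopped_integrable[OF \<sigma> T]
  let ?X = "%w. B (\<sigma> w) w \<bullet> e"
  note J = optional_stopping[OF \<sigma> T, of e]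
  have nn: "(\<integral>\<^sup>+w. ennreal ((?X w)\<^sup>2) \<partial>P) = ennreal (expectation \<sigma>)" using J(1) I e by simp
  have iN: "integrable P (%w. (?X w)\<^sup>2)" by (rule integrableI_nn_integral_finite[OF _ _ nn]) (use I in auto)
  have eN: "expectation (%w. (?X w)\<^sup>2) = expectation \<sigma>"
    by (rule integral_eq_nn_integral[THEN trans]) (use nn I in auto)
  have "(v \<bullet> e)\<^sup>2 + expectation \<sigma> = expectation (%w. (v \<bullet> e)\<^sup>2 + 2 * (v \<bullet> e) * ?X w + (?X w)\<^sup>2)"
    using J(2,3) iN prob_space by (simp add: eN)
  also have "... <= expectation (%w. c * (v \<bullet> e) + c * ?X w)"
  proof (rule integral_mono)
    fix w assume w: "w \<in> space P"
    have "(v \<bullet> e + ?X w) * (v \<bullet> e + ?X w) <= c * (v \<bullet> e + ?X w)"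
      using c[OF w] by (intro mult_right_mono) (auto simp: inner_add_left)
    then show "(v \<bullet> e)\<^sup>2 + 2 * (v \<bullet> e) * ?X w + (?X w)\<^sup>2 <= c * (v \<bullet> e) + c * ?X w"
      by (simp add: power2_eq_square algebra_simps)
  qed (use J(2) iN in auto)
  also have "... = c * (v \<bullet> e)" using J(2,3) prob_space by simp
  finally have "expectation \<sigma> <= c * (v \<bullet> e)" using zero_le_power2[of "v \<bullet> e"] by linarith
  then show ?thesis using I(2) by (simp add: ennreal_leI)
qed

text \<open>Monotone convergence in the cap transfers bounds for the capped times to the hitting
  time itself, and shows in particular that it is almost surely finite.\<close>

lemma nn_integral_hit_le:
  assumes "\<And>n::nat. (\<integral>\<^sup>+w. ennreal (htr n C (spth y w)) \<partial>P) <= K"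
  shows "(\<integral>\<^sup>+w. hit C (spth y w) \<partial>P) <= K"
proof -
  have [measurable]: "(%w. hit C (spth y w)) \<in> borel_measurable P" by (intro hit_measurable spth_measurable)
  have SUP: "(SUP n::nat. min h (ennreal n)) = h" for h :: ennreal
  proof -
    have "(SUP n::nat. min h (ennreal n)) = min h (SUP n::nat. ennreal n)" 
      by (simp add: inf_min[symmetric] inf_SUP)
    then show ?thesis by (simp add: ennreal_SUP_of_nat_eq_top ennreal_of_nat_eq_real_of_nat[symmetric])
  qed
  have "(\<integral>\<^sup>+w. hit C (spth y w) \<partial>P) = (\<integral>\<^sup>+w. (SUP n::nat. min (hit C (spth y w)) (ennreal n)) \<partial>P)"
    by (simp add: SUP)
  also have "... = (SUP n::nat. \<integral>\<^sup>+w. min (hit C (spth y w)) (ennreal n) \<partial>P)"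
  proof (rule nn_integral_monotone_convergence_SUP)
    show "incseq (%n w. min (hit C (spth y w)) (ennreal (real n)))"
      unfolding incseq_def le_fun_def by (intro allI impI min.mono order_refl ennreal_leI) simp
  qed measurable
  also have "... <= K" using assms by (intro SUP_least) (simp add: ennreal_htr)
  finally show ?thesis .
qed

lemma in_closure_before_hit:
  assumes "w \<in> space P" "y \<in> closure D" "0 <= t" "ennreal t <= hit C (spth y w)"
    "frontier D \<subseteq> C" "closed C" "C \<noteq> {}"
  shows "y + B t w \<in> closure D"
proof (rule in_closure_until_frontier[where f="%t. y + B t w"])
  fix s assume s: "0 <= s" "s < t"
  then have "ennreal s < ennreal t" by (simp add: ennreal_less_iff)
  then have "ennreal s < hit C (spth y w)" using assms(4) by order
  then have "y + B s w \<notin> C"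
    unfolding pth_def by (rule before_hit[OF assms(6,7) spth_continuous[OF assms(1)] s(1)])
  then show "y + B s w \<notin> frontier D" using assms(5) by blast
qed (use assms B_zero spth_continuous in auto)

lemma in_closure_at_htr:
  assumes "w \<in> space P" "y \<in> closure D" "0 <= T" "frontier D \<subseteq> C" "closed C" "C \<noteq> {}"
  shows "y + B (htr T C (spth y w)) w \<in> closure D"
  by (rule in_closure_before_hit[OF assms(1,2) _ _ assms(4-6)])
     (use assms(3) in \<open>auto simp: htr_bounds ennreal_htr\<close>)

end

section \<open>Leaving the unit ball\<close>

text \<open>Integrate \<open>f x\<close> and \<open>f y\<close> over pairs at distance less than
  \<open>\<eta>\<close> under the product of \<open>\<mu>\<close> and \<open>\<nu>\<close>. By
  invariance all balls of radius \<open>\<eta>\<close> around unit vectors have the same mass, so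
  the two integrals are multiples of the integrals of \<open>f\<close> against \<open>\<mu>\<close>
  and \<open>\<nu>\<close>; they differ by at most \<open>k * \<eta>\<close> times the mass of the
  pairs. Dividing and letting \<open>\<eta>\<close> tend to \<open>0\<close> gives equality.
  \<open>\<mu>\<close> is not normalised, since it will be an exit position restricted to an
  event.\<close>

lemma rotation_invariant_on_sphere:
  fixes \<mu> \<nu> :: "(real ^ 'd) measure"
  assumes \<mu>: "finite_measure \<mu>" "sets \<mu> = sets borel" "AE x in \<mu>. norm x = 1"
      "\<And>f. orthogonal_transformation f ==> distr \<mu> borel f = \<mu>"
    and \<nu>: "prob_space \<nu>" "sets \<nu> = sets borel" "AE x in \<nu>. norm x = 1"
      "\<And>f. orthogonal_transformation f ==> distr \<nu> borel f = \<nu>"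
  shows "\<mu> = density \<nu> (%_. ennreal (measure \<mu> UNIV))"
proof (rule measure_eqI_lipschitz)
  interpret M: finite_measure \<mu> by fact
  interpret N: prob_space \<nu> by fact
  interpret MN: pair_sigma_finite \<mu> \<nu> by unfold_locales
  note [measurable_cong] = \<mu>(2) \<nu>(2)
  have sp: "space \<mu> = UNIV" "space \<nu> = UNIV"
    using sets_eq_imp_space_eq[OF \<mu>(2)] sets_eq_imp_space_eq[OF \<nu>(2)] by simp_all
  show "finite_measure (density \<nu> (%_. ennreal (measure \<mu> UNIV)))"
    by (rule finite_measureI) (simp add: emeasure_density nn_integral_cmult_indicator sp N.emeasure_space_1[unfolded sp])
  show "finite_measure \<mu>" "sets \<mu> = sets borel" by fact+
  show "sets (density \<nu> (%_. ennreal (measure \<mu> UNIV))) = sets borel" using \<nu>(2) by simp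
  obtain x0 :: "real^'d" where x0: "norm x0 = 1" using vector_choose_size[of 1] by auto
  define c where "c \<eta> = measure \<nu> (ball x0 \<eta>)" for \<eta>
  define c' where "c' \<eta> = measure \<mu> (ball x0 \<eta>)" for \<eta>
  have const: "measure \<kappa> (ball x \<eta>) = measure \<kappa> (ball x0 \<eta>)"
    if x: "norm x = 1" and \<kappa>: "sets \<kappa> = sets borel" "\<And>f. orthogonal_transformation f ==> distr \<kappa> borel f = \<kappa>"
    for \<kappa> :: "(real^'d) measure" and x :: "real^'d" and \<eta>
  proof -
    have n: "norm x0 = norm x" using x x0 by simp
    obtain f :: "real^'d => real^'d" where f: "orthogonal_transformation f" "f x0 = x"
      by (rule orthogonal_transformation_exists[OF n]) (rule that)
    have fm: "f \<in> \<kappa> \<rightarrow>\<^sub>M borel"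
      using orthogonal_transformation_measurable[OF f(1)] measurable_cong_sets[OF \<kappa>(1) refl] by blast
    have sk: "space \<kappa> = UNIV" using sets_eq_imp_space_eq[OF \<kappa>(1)] by simp
    have "dist (f z) (f x0) = dist z x0" for z
      using orthogonal_transformation_norm[OF f(1), of "z - x0"] linear_diff[OF orthogonal_transformation_linear[OF f(1)]]
      by (simp add: dist_norm)
    then have "f -` ball x \<eta> = ball x0 \<eta>" using f(2) by (auto simp: dist_commute)
    moreover have "measure \<kappa> (ball x \<eta>) = measure (distr \<kappa> borel f) (ball x \<eta>)" using \<kappa>(2)[OF f(1)] by simp
    ultimately show ?thesis by (simp add: measure_distr[OF fm] sk)
  qed
  note constM = const[OF _ \<mu>(2,4)] and constN = const[OF _ \<nu>(2,4)]
  \<comment> \<open>Finitely many balls of radius \<open>\<eta>\<close> cover the sphere; if one of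
    them had mass zero, all would, and \<open>\<nu>\<close> would vanish.\<close>
  have cpos: "0 < c \<eta>" if \<eta>: "0 < \<eta>" for \<eta>
  proof (rule ccontr)
    assume "\<not> ?thesis"
    then have z: "measure \<nu> (ball x0 \<eta>) = 0" using measure_nonneg[of \<nu> "ball x0 \<eta>"] by (simp add: c_def)
    obtain k where k: "finite k" "k \<subseteq> sphere (0::real^'d) 1" "sphere 0 1 \<subseteq> (\<Union>x\<in>k. ball x \<eta>)"
      using seq_compact_imp_totally_bounded[OF compact_imp_seq_compact[OF compact_sphere[of "0::real^'d" 1]], rule_format, OF \<eta>]
      by (elim exE conjE) (rule that)
    have "emeasure \<nu> (\<Union>x\<in>k. ball x \<eta>) <= (\<Sum>x\<in>k. emeasure \<nu> (ball x \<eta>))"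
      using k(1) by (intro emeasure_subadditive_finite) (auto simp: \<nu>(2))
    also have "... = 0"
      using k(2) by (intro sum.neutral ballI) (auto simp: N.emeasure_eq_measure constN z)
    finally have "emeasure \<nu> (\<Union>x\<in>k. ball x \<eta>) = 0" by simp
    then have "(\<Union>x\<in>k. ball x \<eta>) \<in> null_sets \<nu>" using k(1) by (auto simp: null_sets_def \<nu>(2))
    then have "AE x in \<nu>. x \<notin> (\<Union>x\<in>k. ball x \<eta>)" by (rule AE_not_in)
    with \<nu>(3) have "AE x in \<nu>. False"
    proof eventually_elim
      case (elim x)
      then show ?case using k(3) by (auto simp: subset_iff)
    qed
    then show False using N.AE_False by simp
  qed
  fix f :: "real^'d => real" and k
  assume lip: "k-lipschitz_on UNIV f" and bnd: "\<And>x. 0 <= f x \<and> f x <= 1"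
  have k0: "0 <= k" using lip by (rule lipschitz_on_nonneg)
  have [measurable]: "f \<in> borel_measurable borel"
    by (intro borel_measurable_continuous_onI lipschitz_on_continuous_on[OF lip])
  let ?m = "measure \<mu> UNIV"
  have key: "\<bar>(\<integral>x. f x \<partial>\<mu>) - ?m * (\<integral>x. f x \<partial>\<nu>)\<bar> <= k * \<eta> * ?m" if \<eta>: "0 < \<eta>" for \<eta>
  proof -
    define K :: "real^'d => real^'d => real" where "K x y = (if dist x y < \<eta> then 1 else 0)" for x y
    have Km [measurable]: "(%p. K (fst p) (snd p)) \<in> borel_measurable (borel \<Otimes>\<^sub>M borel)"
      unfolding K_def by measurable
    have Km' [measurable]: "(%p. K (snd p) (fst p)) \<in> borel_measurable (borel \<Otimes>\<^sub>M borel)"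
      unfolding K_def by measurable
    have K01: "0 <= K x y \<and> K x y <= 1" for x y by (simp add: K_def)
    have [measurable]: "K x \<in> borel_measurable borel" "(%x. K x y) \<in> borel_measurable borel" for x y
      unfolding K_def by measurable
    have KN: "(\<integral>y. K x y \<partial>\<nu>) = c \<eta>" if "norm x = 1" for x
    proof -
      have "K x = indicator (ball x \<eta>)" by (auto simp: K_def indicator_def)
      then have "(\<integral>y. K x y \<partial>\<nu>) = measure \<nu> (ball x \<eta>)" by (simp add: sp)
      then show ?thesis using constN[OF that] by (simp add: c_def)
    qed
    have KM: "(\<integral>x. K x y \<partial>\<mu>) = c' \<eta>" if "norm y = 1" for y
    proof -
      have "(%x. K x y) = indicator (ball y \<eta>)" by (auto simp: K_def indicator_def dist_commute)
      then have "(\<integral>x. K x y \<partial>\<mu>) = measure \<mu> (ball y \<eta>)" by (simp add: sp)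
      then show ?thesis using constM[OF that] by (simp add: c'_def)
    qed
    interpret MNf: finite_measure "\<mu> \<Otimes>\<^sub>M \<nu>"
    proof (rule finite_measureI)
      have "emeasure (\<mu> \<Otimes>\<^sub>M \<nu>) (space \<mu> \<times> space \<nu>) = emeasure \<mu> (space \<mu>) * emeasure \<nu> (space \<nu>)"
        by (rule N.emeasure_pair_measure_Times) auto
      then show "emeasure (\<mu> \<Otimes>\<^sub>M \<nu>) (space (\<mu> \<Otimes>\<^sub>M \<nu>)) \<noteq> \<infinity>"
        unfolding space_pair_measure by (simp add: N.emeasure_space_1)
    qed
    have intb: "integrable (\<mu> \<Otimes>\<^sub>M \<nu>) g" if "g \<in> borel_measurable (\<mu> \<Otimes>\<^sub>M \<nu>)" "\<And>p. \<bar>g p\<bar> <= 1" for g :: "_ => real"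
      by (rule MNf.integrable_const_bound[of _ 1]) (use that in auto)
    have b: "\<bar>f x * K y z\<bar> <= 1" for x y z
      using bnd[of x] K01[of y z] by (simp add: abs_mult mult_le_one)
    have i1: "integrable (\<mu> \<Otimes>\<^sub>M \<nu>) (%(x, y). f x * K x y)" 
      and i2: "integrable (\<mu> \<Otimes>\<^sub>M \<nu>) (%(x, y). f y * K x y)"
      and i3: "integrable (\<mu> \<Otimes>\<^sub>M \<nu>) (%(x, y). K x y)"
      using b K01 by (auto intro!: intb simp: case_prod_beta')
    have a: "(\<integral>p. (case p of (x, y) => f x * K x y) \<partial>(\<mu> \<Otimes>\<^sub>M \<nu>)) = c \<eta> * (\<integral>x. f x \<partial>\<mu>)"
    proof -
      have "(\<integral>p. (case p of (x, y) => f x * K x y) \<partial>(\<mu> \<Otimes>\<^sub>M \<nu>)) = (\<integral>x. (\<integral>y. f x * K x y \<partial>\<nu>) \<partial>\<mu>)"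
        using MN.integral_fst[OF i1] by simp
      also have "... = (\<integral>x. c \<eta> * f x \<partial>\<mu>)"
      proof (rule integral_cong_AE)
        show "AE x in \<mu>. (\<integral>y. f x * K x y \<partial>\<nu>) = c \<eta> * f x"
          using \<mu>(3) by eventually_elim (simp add: KN)
      qed measurable
      finally show ?thesis by simp
    qed
    have a': "(\<integral>p. (case p of (x, y) => f y * K x y) \<partial>(\<mu> \<Otimes>\<^sub>M \<nu>)) = c' \<eta> * (\<integral>x. f x \<partial>\<nu>)"
    proof -
      have "(\<integral>p. (case p of (x, y) => f y * K x y) \<partial>(\<mu> \<Otimes>\<^sub>M \<nu>)) = (\<integral>y. (\<integral>x. f y * K x y \<partial>\<mu>) \<partial>\<nu>)"
        using MN.integral_snd[OF i2] by simp
      also have "... = (\<integral>x. c' \<eta> * f x \<partial>\<nu>)"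
      proof (rule integral_cong_AE)
        show "AE y in \<nu>. (\<integral>x. f y * K x y \<partial>\<mu>) = c' \<eta> * f y"
          using \<nu>(3) by eventually_elim (simp add: KM)
      qed measurable
      finally show ?thesis by simp
    qed
    \<comment> \<open>The total mass of the pairs, computed in both orders, identifies
      \<open>c' \<eta>\<close> as \<open>c \<eta>\<close> times the mass of
      \<open>\<mu>\<close>.\<close>
    have t1: "(\<integral>p. (case p of (x, y) => K x y) \<partial>(\<mu> \<Otimes>\<^sub>M \<nu>)) = c \<eta> * ?m"
    proof -
      have "(\<integral>p. (case p of (x, y) => K x y) \<partial>(\<mu> \<Otimes>\<^sub>M \<nu>)) = (\<integral>x. (\<integral>y. K x y \<partial>\<nu>) \<partial>\<mu>)"
        using MN.integral_fst[OF i3] by simp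
      also have "... = (\<integral>x. c \<eta> \<partial>\<mu>)"
      proof (rule integral_cong_AE)
        show "AE x in \<mu>. (\<integral>y. K x y \<partial>\<nu>) = c \<eta>"
          using \<mu>(3) by eventually_elim (simp add: KN)
      qed measurable
      finally show ?thesis by (simp add: sp)
    qed
    have t2: "(\<integral>p. (case p of (x, y) => K x y) \<partial>(\<mu> \<Otimes>\<^sub>M \<nu>)) = c' \<eta>"
    proof -
      have "(\<integral>p. (case p of (x, y) => K x y) \<partial>(\<mu> \<Otimes>\<^sub>M \<nu>)) = (\<integral>y. (\<integral>x. K x y \<partial>\<mu>) \<partial>\<nu>)"
        using MN.integral_snd[OF i3] by simp
      also have "... = (\<integral>x. c' \<eta> \<partial>\<nu>)"
      proof (rule integral_cong_AE)
        show "AE y in \<nu>. (\<integral>x. K x y \<partial>\<mu>) = c' \<eta>"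
          using \<nu>(3) by eventually_elim (simp add: KM)
      qed measurable
      finally show ?thesis by (simp add: N.prob_space)
    qed
    have "\<bar>c \<eta> * (\<integral>x. f x \<partial>\<mu>) - c' \<eta> * (\<integral>x. f x \<partial>\<nu>)\<bar>
        = \<bar>\<integral>p. (case p of (x, y) => f x * K x y) - (case p of (x, y) => f y * K x y) \<partial>(\<mu> \<Otimes>\<^sub>M \<nu>)\<bar>"
      unfolding a[symmetric] a'[symmetric] by (subst Bochner_Integration.integral_diff[OF i1 i2]) simp
    also have "... <= (\<integral>p. \<bar>(case p of (x, y) => f x * K x y) - (case p of (x, y) => f y * K x y)\<bar> \<partial>(\<mu> \<Otimes>\<^sub>M \<nu>))"
      by (rule integral_abs_bound)
    also have "... <= (\<integral>p. k * \<eta> * (case p of (x, y) => K x y) \<partial>(\<mu> \<Otimes>\<^sub>M \<nu>))"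
    proof (rule integral_mono)
      show "integrable (\<mu> \<Otimes>\<^sub>M \<nu>) (%p. \<bar>(case p of (x, y) => f x * K x y) - (case p of (x, y) => f y * K x y)\<bar>)"
        by (intro integrable_abs Bochner_Integration.integrable_diff i1 i2)
      show "integrable (\<mu> \<Otimes>\<^sub>M \<nu>) (%p. k * \<eta> * (case p of (x, y) => K x y))" using i3 by simp
      fix p :: "(real^'d) \<times> (real^'d)"
      obtain x y where p: "p = (x, y)" by (cases p)
      have "\<bar>f x - f y\<bar> <= k * dist x y" using lipschitz_onD[OF lip, of x y] by (simp add: dist_real_def)
      then have "\<bar>f x - f y\<bar> <= k * \<eta>" if "dist x y < \<eta>"
        using that k0 by (meson less_imp_le mult_left_mono order_trans)
      then show "\<bar>(case p of (x, y) => f x * K x y) - (case p of (x, y) => f y * K x y)\<bar> <= k * \<eta> * (case p of (x, y) => K x y)"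
        by (auto simp: p K_def)
    qed
    also have "... = k * \<eta> * (c \<eta> * ?m)" using t1 by simp
    finally have "\<bar>c \<eta> * (\<integral>x. f x \<partial>\<mu>) - c \<eta> * ?m * (\<integral>x. f x \<partial>\<nu>)\<bar> <= c \<eta> * (k * \<eta> * ?m)"
      using t1 t2 by (simp add: ac_simps)
    then have "c \<eta> * \<bar>(\<integral>x. f x \<partial>\<mu>) - ?m * (\<integral>x. f x \<partial>\<nu>)\<bar> <= c \<eta> * (k * \<eta> * ?m)"
      using cpos[OF \<eta>] by (simp add: abs_mult_pos' right_diff_distrib mult.assoc)
    then show ?thesis using cpos[OF \<eta>] by simp
  qed
  have "\<bar>(\<integral>x. f x \<partial>\<mu>) - ?m * (\<integral>x. f x \<partial>\<nu>)\<bar> <= 0"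
  proof (rule LIMSEQ_le_const)
    have "(%n. k * (1 / real (Suc n)) * ?m) \<longlonglongrightarrow> k * 0 * ?m"
      by (intro tendsto_intros LIMSEQ_Suc[OF lim_1_over_n])
    then show "(%n. k * (1 / real (Suc n)) * ?m) \<longlonglongrightarrow> 0" by simp
    show "\<exists>N. \<forall>n\<ge>N. \<bar>(\<integral>x. f x \<partial>\<mu>) - ?m * (\<integral>x. f x \<partial>\<nu>)\<bar> <= k * (1 / real (Suc n)) * ?m"
      by (intro exI[of _ 0] allI impI key) simp
  qed
  then show "(\<integral>x. f x \<partial>\<mu>) = (\<integral>x. f x \<partial>density \<nu> (%_. ennreal ?m))"
    by (subst integral_density) auto
qed

lemma sgn_orthogonal:
  fixes f :: "'a::real_inner => 'a"
  assumes "orthogonal_transformation f"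
  shows "f (sgn z) = sgn (f z)"
  using assms by (simp add: sgn_div_norm orthogonal_transformation_norm linear_cmul[OF orthogonal_transformation_linear])

lemma std_normal_vector_law:
  fixes Z :: "'w => real ^ 'd"
  assumes "std_normal_vector P Z"
  shows "Z \<in> borel_measurable P" "distr P borel Z = gauss 1"
proof -
  have d: "distributed P lborel Z (%x. ennreal (\<Prod>i\<in>UNIV. std_normal_density (x $ i)))"
    using assms by (simp add: std_normal_vector_def)
  show "Z \<in> borel_measurable P" using distributed_measurable[OF d] by simp
  have "distr P borel Z = distr P lborel Z" by (rule distr_cong) auto
  also have "... = gauss 1" using d by (simp add: distributed_def gauss_def)
  finally show "distr P borel Z = gauss 1" .
qed

lemma sgn_measurable: "sgn \<in> borel_measurable (borel :: ('a::euclidean_space) measure)"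
  unfolding sgn_div_norm[abs_def] by measurable

lemma sgn_gauss_law:
  fixes Z :: "'w => real ^ 'd"
  assumes P: "prob_space P" and Z: "std_normal_vector P Z"
  defines "\<nu> \<equiv> distr P borel (%w. sgn (Z w))"
  shows "prob_space \<nu>" "AE x in \<nu>. norm x = 1"
    "\<And>f. orthogonal_transformation f ==> distr \<nu> borel f = \<nu>"
proof -
  interpret prob_space P by fact
  note L = std_normal_vector_law[OF Z]
  note [measurable] = L(1) sgn_measurable
  show "prob_space \<nu>" unfolding \<nu>_def by (rule prob_space_distr) measurable
  have eq: "\<nu> = distr (gauss 1) borel sgn"
    unfolding \<nu>_def L(2)[symmetric] by (subst distr_distr) (auto simp: o_def)
  have "AE x in (lborel :: (real^'d) measure). x \<noteq> 0"
    by (rule AE_lborel_singleton)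
  then have "AE x in (gauss 1 :: (real^'d) measure). x \<noteq> 0"
    unfolding gauss_def by (simp add: AE_density) (auto elim: eventually_mono)
  then have "AE x in (gauss 1 :: (real^'d) measure). norm (sgn x) = 1"
    by eventually_elim (simp add: norm_sgn)
  then show "AE x in \<nu>. norm x = 1"
    unfolding eq by (subst AE_distr_iff) auto
  show "distr \<nu> borel f = \<nu>" if f: "orthogonal_transformation f" for f
  proof -
    note fm [measurable] = orthogonal_transformation_measurable[OF f]
    have "distr \<nu> borel f = distr (gauss 1) borel (%x. f (sgn x))"
      unfolding eq by (subst distr_distr) (auto simp: o_def)
    also have "... = distr (distr (gauss 1) borel f) borel sgn"
      by (subst distr_distr) (auto simp: o_def sgn_orthogonal[OF f])
    also have "... = \<nu>" by (simp add: gauss_orthogonal[OF f] eq)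
    finally show ?thesis .
  qed
qed

abbreviation outer :: "real => (real ^ 'd) set" where
  "outer r \<equiv> {y. r <= norm y}"

lemma outer_closed: "closed (outer r :: (real ^ 'd) set)"
  by (intro closed_Collect_le continuous_intros)

lemma outer_nonempty: "outer r \<noteq> ({} :: (real ^ 'd) set)"
proof -
  obtain x :: "real^'d" where "norm x = \<bar>r\<bar>" using vector_choose_size[of "\<bar>r\<bar>"] by auto
  then show ?thesis by (auto intro!: exI[of _ x])
qed

context brownian
begin

lemma spth_0: "spth 0 = pth B"
  by (simp add: pth_def)

abbreviation zeta :: "'w => real" where
  "zeta w \<equiv> enn2real (hit (outer 1) (pth B w))"

lemma ball_exit_time_eq: "w \<in> space P ==> ball_exit_time B w = zeta w"
  unfolding ball_exit_time_def
  by (rule hitting_time_eq_hit[OF outer_closed outer_nonempty B_continuous])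

text \<open>General starting points are kept because the motion will be restarted at a point inside
  the ball.\<close>

lemma nn_integral_ball_hit:
  assumes y: "norm y <= 1"
  shows "(\<integral>\<^sup>+w. hit (outer 1) (spth y w) \<partial>P) <= ennreal (1 / CARD('d))"
proof (rule nn_integral_hit_le)
  fix n :: nat
  have "(\<integral>\<^sup>+w. ennreal (htr n (outer 1) (spth y w)) \<partial>P) <= ennreal (1\<^sup>2 / CARD('d))"
  proof (rule stopped_mean_le_norm)
    show "stopping P B (%w. htr n (outer 1) (spth y w))" by (rule stopping_htr[OF outer_closed outer_nonempty]) simp
    show "htr n (outer 1) (spth y w) <= n" for w by (simp add: htr_bounds)
    fix w assume "w \<in> space P"
    then have "y + B (htr n (outer 1) (spth y w)) w \<in> closure (ball 0 1)"
      by (rule in_closure_at_htr) (use y outer_closed outer_nonempty in \<open>auto simp: frontier_ball\<close>)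
    then show "norm (y + B (htr n (outer 1) (spth y w)) w) <= 1" by simp
  qed
  then show "(\<integral>\<^sup>+w. ennreal (htr n (outer 1) (spth y w)) \<partial>P) <= ennreal (1 / CARD('d))" by simp
qed

lemma hit_outer_measurable [measurable]: "(%w. hit C (pth B w)) \<in> borel_measurable P"
  by (intro hit_measurable pth_B_measurable)

lemma zeta_measurable: "zeta \<in> borel_measurable P"
  by measurable

lemma zeta_finite: "AE w in P. hit (outer 1) (pth B w) < \<top>"
proof -
  have "(\<integral>\<^sup>+w. hit (outer 1) (pth B w) \<partial>P) \<noteq> \<infinity>"
    using nn_integral_ball_hit[of 0] by (auto simp: spth_0 top_unique)
  then have "AE w in P. hit (outer 1) (pth B w) \<noteq> \<infinity>" by (intro nn_integral_PInf_AE) measurable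
  then show ?thesis by (simp add: less_top)
qed

lemma B_zeta_measurable: "(%w. B (zeta w) w) \<in> borel_measurable P"
  by (rule B_at_measurable[OF zeta_measurable]) simp

lemma norm_B_zeta: "AE w in P. norm (B (zeta w) w) = 1"
  using zeta_finite AE_space
proof eventually_elim
  case (elim w)
  note h = hit_finite[OF outer_closed outer_nonempty B_continuous[OF elim(2)], of 1, folded pth_def, OF elim(1)]
  have "0 + B (zeta w) w \<in> closure (ball 0 1)"
    by (rule in_closure_before_hit[OF elim(2)])
       (use h outer_closed outer_nonempty in \<open>auto simp: frontier_ball spth_0\<close>)
  then show ?case using h(3) by simp
qed

text \<open>The rotated motion is again a Brownian motion and leaves the ball at the same time, so
  rotating affects only the exit position.\<close>

lemma zeta_rotation_law:
  assumes f: "orthogonal_transformation f"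
  shows "distr P borel (%w. (zeta w, f (B (zeta w) w))) = distr P borel (%w. (zeta w, B (zeta w) w))"
proof -
  let ?B = "%t w. f (B t w)"
  have B': "std_brownian_motion P ?B" by (rule std_brownian_motion_orthogonal[OF BM f])
  interpret R: brownian P ?B by unfold_locales (rule B')
  define \<Psi> where "\<Psi> b = (enn2real (hit (outer 1) b), ev b (enn2real (hit (outer 1) b)))" for b :: "rat => real^'d"
  have [measurable]: "(%b::rat => real^'d. hit (outer 1) b) \<in> borel_measurable borel" by (intro hit_measurable) simp
  have \<Psi>: "\<Psi> \<in> borel_measurable borel"
    unfolding \<Psi>_def by (intro borel_measurable_Pair ev_measurable) measurable
  have hit_eq: "hit (outer 1) (pth ?B w) = hit (outer 1) (pth B w)" if w: "w \<in> space P" for w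
    unfolding pth_def hit_eq_INF[OF outer_closed outer_nonempty B_continuous[OF w]]
      hit_eq_INF[OF outer_closed outer_nonempty R.B_continuous[OF w]]
    by (simp add: orthogonal_transformation_norm[OF f])
  have "distr P borel (%w. (zeta w, f (B (zeta w) w))) = distr P borel (%w. \<Psi> (pth ?B w))"
    by (rule distr_cong) (auto simp: \<Psi>_def hit_eq ev_pth[OF R.B_continuous])
  also have "... = distr (distr P borel (pth ?B)) borel \<Psi>"
    by (subst distr_distr[OF \<Psi> R.pth_B_measurable]) (simp add: o_def)
  also have "... = distr (distr P borel (pth B)) borel \<Psi>"
    by (simp add: std_brownian_motion_law[OF B' BM])
  also have "... = distr P borel (%w. \<Psi> (pth B w))"
    by (subst distr_distr[OF \<Psi> pth_B_measurable]) (simp add: o_def)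
  also have "... = distr P borel (%w. (zeta w, B (zeta w) w))"
    by (rule distr_cong) (auto simp: \<Psi>_def ev_pth[OF B_continuous])
  finally show ?thesis .
qed

text \<open>For each event in the exit time, the exit position restricted to it has a rotation
  invariant law on the sphere and is therefore a multiple of the uniform law; total masses show that
  the multiple is the probability of the event.\<close>

lemma zeta_law:
  assumes Z: "std_normal_vector P Z"
  shows "distr P borel (%w. (zeta w, B (zeta w) w)) = distr P borel zeta \<Otimes>\<^sub>M distr P borel (%w. sgn (Z w))"
proof -
  note [measurable] = zeta_measurable B_zeta_measurable
  let ?\<nu> = "distr P borel (%w. sgn (Z w))"
  note \<nu> = sgn_gauss_law[OF prob Z]
  have "distr P borel zeta \<Otimes>\<^sub>M ?\<nu> = distr P borel (%w. (zeta w, B (zeta w) w))"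
  proof (rule pair_measure_eqI)
    show "sigma_finite_measure (distr P borel zeta)" "sigma_finite_measure ?\<nu>"
      using \<nu>(1) by (auto intro!: prob_space_imp_sigma_finite prob_space_distr)
    show "sets (distr P borel zeta \<Otimes>\<^sub>M ?\<nu>) = sets (distr P borel (%w. (zeta w, B (zeta w) w)))"
      by (simp only: sets_distr borel_prod[symmetric]) (intro sets_pair_measure_cong; simp)
    fix A S assume "A \<in> sets (distr P borel zeta)" "S \<in> sets ?\<nu>"
    then have A [measurable]: "A \<in> sets borel" and S [measurable]: "S \<in> sets borel" by simp_all
    define E where "E = {w \<in> space P. zeta w \<in> A}"
    have E [measurable]: "E \<in> sets P" unfolding E_def by measurable
    define \<mu> where "\<mu> = distr (density P (indicator E)) borel (%w. B (zeta w) w)"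
    have \<mu>_em: "emeasure \<mu> T = emeasure P {w \<in> space P. zeta w \<in> A \<and> B (zeta w) w \<in> T}" if [measurable]: "T \<in> sets borel" for T
    proof -
      have "emeasure \<mu> T = emeasure (density P (indicator E)) ((%w. B (zeta w) w) -` T \<inter> space P)"
        unfolding \<mu>_def by (subst emeasure_distr) auto
      also have "... = (\<integral>\<^sup>+w. indicator E w * indicator ((%w. B (zeta w) w) -` T \<inter> space P) w \<partial>P)"
        by (rule emeasure_density) measurable
      also have "... = (\<integral>\<^sup>+w. indicator {w \<in> space P. zeta w \<in> A \<and> B (zeta w) w \<in> T} w \<partial>P)"
        by (intro nn_integral_cong) (auto simp: indicator_def E_def)
      also have "... = emeasure P {w \<in> space P. zeta w \<in> A \<and> B (zeta w) w \<in> T}" by (rule nn_integral_indicator) measurable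
      finally show ?thesis .
    qed
    have \<mu>_fin: "finite_measure \<mu>"
      by (rule finite_measureI) (use \<mu>_em[of UNIV] in \<open>simp add: \<mu>_def\<close>)
    have joint: "emeasure (distr P borel (%w. (zeta w, g w))) (A \<times> T) = emeasure P {w \<in> space P. zeta w \<in> A \<and> g w \<in> T}"
      if [measurable]: "g \<in> borel_measurable P" and T: "T \<in> sets borel" for g :: "'w => real^'d" and T
    proof (subst emeasure_distr)
      show "A \<times> T \<in> sets borel" by (subst borel_prod[symmetric]) (rule pair_measureI[OF A T])
      show "(%w. (zeta w, g w)) \<in> borel_measurable P" by (intro borel_measurable_Pair) measurable
    qed (auto intro!: arg_cong[where f="emeasure P"])
    have eq: "\<mu> = density ?\<nu> (%_. ennreal (measure \<mu> UNIV))"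
    proof (rule rotation_invariant_on_sphere)
      show "finite_measure \<mu>" by (rule \<mu>_fin)
      show "sets \<mu> = sets borel" by (simp add: \<mu>_def)
      have "AE w in density P (indicator E). norm (B (zeta w) w) = 1"
        using norm_B_zeta by (subst AE_density) (auto elim: eventually_mono)
      then show "AE x in \<mu>. norm x = 1" unfolding \<mu>_def by (subst AE_distr_iff) auto
      show "prob_space ?\<nu>" "AE x in ?\<nu>. norm x = 1" by (fact \<nu>)+
      show "distr ?\<nu> borel f = ?\<nu>" if "orthogonal_transformation f" for f by (rule \<nu>(3)[OF that])
      show "distr \<mu> borel f = \<mu>" if f: "orthogonal_transformation f" for f
      proof (rule measure_eqI)
        note fm [measurable] = orthogonal_transformation_measurable[OF f]
        fix T assume "T \<in> sets (distr \<mu> borel f)"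
        then have T [measurable]: "T \<in> sets borel" by simp
        have fT: "f -` T \<in> sets borel" using measurable_sets[OF fm T] by simp
        have "emeasure (distr \<mu> borel f) T = emeasure \<mu> (f -` T)"
          by (subst emeasure_distr) (auto simp: \<mu>_def)
        also have "... = emeasure P {w \<in> space P. zeta w \<in> A \<and> f (B (zeta w) w) \<in> T}"
          using \<mu>_em[OF fT] by simp
        also have "... = emeasure \<mu> T"
          using joint[of "%w. f (B (zeta w) w)" T] joint[of "%w. B (zeta w) w" T] zeta_rotation_law[OF f] \<mu>_em[OF T] T
          by simp
        finally show "emeasure (distr \<mu> borel f) T = emeasure \<mu> T" .
      qed (simp add: \<mu>_def)
    qed simp
    have "emeasure (distr P borel (%w. (zeta w, B (zeta w) w))) (A \<times> S) = emeasure \<mu> S"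
      using joint[of "%w. B (zeta w) w" S] \<mu>_em[OF S] S by simp
    also have "... = ennreal (measure \<mu> UNIV) * emeasure ?\<nu> S"
      by (subst eq) (simp add: emeasure_density nn_integral_cmult_indicator)
    also have "ennreal (measure \<mu> UNIV) = emeasure (distr P borel zeta) A"
    proof -
      have "ennreal (measure \<mu> UNIV) = emeasure \<mu> UNIV" using finite_measure.emeasure_eq_measure[OF \<mu>_fin] by simp
      also have "... = emeasure P {w \<in> space P. zeta w \<in> A}" using \<mu>_em[of UNIV] by simp
      also have "... = emeasure (distr P borel zeta) A"
        by (subst emeasure_distr) (auto intro!: arg_cong[where f="emeasure P"])
      finally show ?thesis .
    qed
    finally show "emeasure (distr P borel zeta) A * emeasure ?\<nu> S = emeasure (distr P borel (%w. (zeta w, B (zeta w) w))) (A \<times> S)" by simp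
  qed
  then show ?thesis by simp
qed

end

section \<open>The Dirichlet problem on a convex domain\<close>

locale exit_domain = brownian P B for P :: "'w measure" and B :: "real => 'w => real ^ 'd" +
  fixes D :: "(real ^ 'd) set"
  assumes D_nonempty: "D \<noteq> {}" and D_open: "open D" and D_bounded: "bounded D" and D_convex: "convex D"
begin

abbreviation R :: real where "R \<equiv> diameter D"

lemma frontier_nonempty: "frontier D \<noteq> {}"
  using D_nonempty D_bounded by (auto simp: frontier_eq_empty)

lemmas frontier_hit = frontier_closed[of D] frontier_nonempty

lemma dist_le_R: "x \<in> closure D ==> y \<in> closure D ==> dist x y <= R"
  using diameter_bounded_bound[of "closure D" x y] D_bounded by (simp add: diameter_closure bounded_closure)

lemma R_nonneg: "0 <= R"
  using diameter_ge_0[OF D_bounded] .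

abbreviation tau :: "real ^ 'd => 'w => real" where
  "tau y w \<equiv> enn2real (hit (frontier D) (spth y w))"

lemma boundary_time_eq: "w \<in> space P ==> boundary_time B D y w = tau y w"
  unfolding boundary_time_def
  by (rule hitting_time_eq_hit[OF frontier_hit spth_continuous])

lemma hit_frontier_measurable [measurable]: "(%w. hit (frontier D) (spth y w)) \<in> borel_measurable P"
  by (intro hit_measurable spth_measurable)

text \<open>The first bound sees \<open>D\<close> inside the ball of radius \<open>R\<close> around
  \<open>y\<close>. The second sees it inside a slab of width \<open>R\<close>, one face of which
  passes through the boundary point nearest to \<open>y\<close>.\<close>

lemma nn_integral_hit_frontier:
  assumes y: "y \<in> closure D"
  shows "(\<integral>\<^sup>+w. hit (frontier D) (spth y w) \<partial>P) <= ennreal (R\<^sup>2 / CARD('d))"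
    and "(\<integral>\<^sup>+w. hit (frontier D) (spth y w) \<partial>P) <= ennreal (R * infdist y (frontier D))"
proof -
  have st: "stopping P B (%w. htr (real n) (frontier D) (spth y w))" for n :: nat
    by (rule stopping_htr[OF frontier_hit]) simp
  have le: "htr (real n) (frontier D) (spth y w) <= real n" for n :: nat and w by (simp add: htr_bounds)
  have cl: "y + B (htr (real n) (frontier D) (spth y w)) w \<in> closure D" if "w \<in> space P" for n :: nat and w
    by (rule in_closure_at_htr[OF that y]) (use frontier_hit in auto)
  show "(\<integral>\<^sup>+w. hit (frontier D) (spth y w) \<partial>P) <= ennreal (R\<^sup>2 / CARD('d))"
  proof (rule nn_integral_hit_le, rule stopped_mean_le_norm[OF st le, where v=0])
    fix n :: nat and w assume "w \<in> space P"
    from dist_le_R[OF cl[OF this] y] 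
    show "norm (0 + B (htr (real n) (frontier D) (spth y w)) w) <= R" by (simp add: dist_norm)
  qed
  obtain p where p: "p \<in> frontier D" "infdist y (frontier D) = dist y p"
    by (rule infdist_attains_inf[OF frontier_hit])
  have p': "p \<in> closure D" "p \<notin> D" using p(1) D_open by (auto simp: frontier_def interior_open)
  \<comment> \<open>\<open>D\<close> is open, so \<open>p\<close> lies outside it and a hyperplane
    separates \<open>p\<close> from the convex set \<open>D\<close>; the closure stays on the same
    side.\<close>
  obtain a b where ab: "a \<noteq> 0" "\<forall>x\<in>{p}. a \<bullet> x <= b" "\<forall>x\<in>D. a \<bullet> x >= b"
    using separating_hyperplane_sets[of "{p}" D] D_convex D_nonempty p'(2) by auto
  have a: "a \<bullet> p <= a \<bullet> z" if "z \<in> closure D" for z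
  proof -
    have "closure D \<subseteq> {z. a \<bullet> z >= a \<bullet> p}"
      using ab by (intro closure_minimal closed_halfspace_ge) auto
    then show ?thesis using that by auto
  qed
  define e where "e = a /\<^sub>R norm a"
  have e: "norm e = 1" using ab(1) by (simp add: e_def)
  have e0: "0 <= (z - p) \<bullet> e" if "z \<in> closure D" for z
    using a[OF that] by (simp add: e_def inner_diff_left inner_diff_right inner_commute)
  have eR: "(z - p) \<bullet> e <= norm (z - p)" for z
    using norm_cauchy_schwarz[of "z - p" e] e by simp
  have "(\<integral>\<^sup>+w. hit (frontier D) (spth y w) \<partial>P) <= ennreal (R * ((y - p) \<bullet> e))"
  proof (rule nn_integral_hit_le, rule stopped_mean_le_slab[OF st le e])
    fix n :: nat and w assume "w \<in> space P"
    note c = cl[OF this, of n]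
    have eq: "y - p + B (htr (real n) (frontier D) (spth y w)) w = y + B (htr (real n) (frontier D) (spth y w)) w - p" by simp
    show "0 <= (y - p + B (htr (real n) (frontier D) (spth y w)) w) \<bullet> e \<and>
        (y - p + B (htr (real n) (frontier D) (spth y w)) w) \<bullet> e <= R"
      unfolding eq using e0[OF c] eR[of "y + B (htr (real n) (frontier D) (spth y w)) w"] dist_le_R[OF c p'(1)]
      by (simp add: dist_norm)
  qed
  also have "ennreal (R * ((y - p) \<bullet> e)) <= ennreal (R * infdist y (frontier D))"
    using eR[of y] R_nonneg p(2) by (intro ennreal_leI mult_left_mono) (auto simp: dist_norm)
  finally show "(\<integral>\<^sup>+w. hit (frontier D) (spth y w) \<partial>P) <= ennreal (R * infdist y (frontier D))" .
qed

definition mtau :: "real ^ 'd => real" where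
  "mtau y = expectation (tau y)"

lemma tau_finite:
  assumes y: "y \<in> closure D"
  shows "AE w in P. hit (frontier D) (spth y w) < \<top>"
proof -
  have "(\<integral>\<^sup>+w. hit (frontier D) (spth y w) \<partial>P) \<noteq> \<infinity>"
    using nn_integral_hit_frontier(1)[OF y] by (auto simp: top_unique)
  then have "AE w in P. hit (frontier D) (spth y w) \<noteq> \<infinity>" by (intro nn_integral_PInf_AE) measurable
  then show ?thesis by (simp add: less_top)
qed

lemma tau_measurable [measurable]: "tau y \<in> borel_measurable P" by measurable

lemma tau_integrable:
  assumes y: "y \<in> closure D"
  shows "integrable P (tau y)" "(\<integral>\<^sup>+w. hit (frontier D) (spth y w) \<partial>P) = ennreal (mtau y)"
    "0 <= mtau y" "mtau y <= R\<^sup>2 / CARD('d)" "mtau y <= R * infdist y (frontier D)"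
proof -
  have eq: "(\<integral>\<^sup>+w. ennreal (tau y w) \<partial>P) = (\<integral>\<^sup>+w. hit (frontier D) (spth y w) \<partial>P)"
    using tau_finite[OF y] by (intro nn_integral_cong_AE) (auto elim: eventually_mono)
  note le = nn_integral_hit_frontier[OF y]
  have fin: "(\<integral>\<^sup>+w. ennreal (tau y w) \<partial>P) < \<infinity>"
    unfolding eq using le(1) by (simp add: order_le_less_trans)
  show i: "integrable P (tau y)" by (rule integrableI_bounded) (use fin in simp_all)
  show eq2: "(\<integral>\<^sup>+w. hit (frontier D) (spth y w) \<partial>P) = ennreal (mtau y)"
    unfolding eq[symmetric] mtau_def by (rule nn_integral_eq_integral[OF i]) simp
  show "0 <= mtau y" unfolding mtau_def by (rule integral_nonneg_AE) simp
  show "mtau y <= R\<^sup>2 / CARD('d)" using le(1) unfolding eq2 by (subst (asm) ennreal_le_iff) auto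
  show "mtau y <= R * infdist y (frontier D)" using le(2) unfolding eq2
    by (subst (asm) ennreal_le_iff) (auto intro!: mult_nonneg_nonneg R_nonneg infdist_nonneg)
qed

lemma B_tau_measurable: "(%w. B (tau y w) w) \<in> borel_measurable P"
  by (rule B_at_measurable) auto

text \<open>\<open>tau\<close> is not bounded, so the exact identity is used for the capped times;
  Fatou's lemma passes to the limit and leaves an inequality.\<close>

lemma nn_integral_B_tau:
  assumes y: "y \<in> closure D"
  shows "(\<integral>\<^sup>+w. ennreal ((norm (B (tau y w) w))\<^sup>2) \<partial>P) <= ennreal (CARD('d) * mtau y)"
proof -
  let ?s = "%n w. htr (real n) (frontier D) (spth y w)"
  have st: "stopping P B (?s n)" for n :: nat by (rule stopping_htr[OF frontier_hit]) simp
  have le: "?s n w <= real n" for n :: nat and w by (simp add: htr_bounds)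
  have [measurable]: "(%w. B (?s n w) w) \<in> borel_measurable P" for n :: nat
    using st[of n] by (intro B_at_measurable) (auto simp: stopping_def)
  have "(\<integral>\<^sup>+w. ennreal ((norm (B (tau y w) w))\<^sup>2) \<partial>P) <= (\<integral>\<^sup>+w. liminf (%n. ennreal ((norm (B (?s n w) w))\<^sup>2)) \<partial>P)"
  proof (rule nn_integral_mono_AE)
    show "AE w in P. ennreal ((norm (B (tau y w) w))\<^sup>2) <= liminf (%n. ennreal ((norm (B (?s n w) w))\<^sup>2))"
      using tau_finite[OF y]
    proof eventually_elim
      case (elim w)
      then obtain h where h: "0 <= h" "hit (frontier D) (spth y w) = ennreal h" by (cases "hit (frontier D) (spth y w)") auto
      obtain N :: nat where "h <= real N" using real_arch_simple by blast
      \<comment> \<open>Once the cap exceeds the hitting time, the capped time no longer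
        changes.\<close>
      then have "eventually (%n. ennreal ((norm (B (?s n w) w))\<^sup>2) = ennreal ((norm (B (tau y w) w))\<^sup>2)) sequentially"
        unfolding eventually_sequentially using h
        by (intro exI[of _ N] allI impI) (simp add: htr_def min_absorb1 ennreal_leI)
      then have "(%n. ennreal ((norm (B (?s n w) w))\<^sup>2)) \<longlonglongrightarrow> ennreal ((norm (B (tau y w) w))\<^sup>2)"
        by (rule tendsto_eventually)
      then show ?case using lim_imp_Liminf[OF sequentially_bot] by (metis order_refl)
    qed
  qed
  also have "... <= liminf (%n. \<integral>\<^sup>+w. ennreal ((norm (B (?s n w) w))\<^sup>2) \<partial>P)"
    by (rule nn_integral_liminf) measurable
  also have "... <= liminf (%n::nat. ennreal (CARD('d) * mtau y))"
  proof (intro Liminf_mono always_eventually allI)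
    fix n :: nat
    have "(\<integral>\<^sup>+w. ennreal ((norm (B (?s n w) w))\<^sup>2) \<partial>P) = of_nat CARD('d) * (\<integral>\<^sup>+w. ennreal (?s n w) \<partial>P)"
      by (rule stopped_norm_sq[OF st le])
    also have "... <= of_nat CARD('d) * (\<integral>\<^sup>+w. hit (frontier D) (spth y w) \<partial>P)"
      by (intro mult_left_mono nn_integral_mono) (simp_all add: ennreal_htr)
    also have "... = ennreal (CARD('d) * mtau y)"
      by (simp add: tau_integrable(2)[OF y] ennreal_mult tau_integrable(3)[OF y] ennreal_of_nat_eq_real_of_nat)
    finally show "(\<integral>\<^sup>+w. ennreal ((norm (B (?s n w) w))\<^sup>2) \<partial>P) <= ennreal (CARD('d) * mtau y)" .
  qed
  also have "... = ennreal (CARD('d) * mtau y)" by (simp add: Liminf_const)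
  finally show ?thesis .
qed

text \<open>Jensen's inequality for the square, obtained from nonnegativity of the variance.\<close>

lemma expectation_norm_B_tau:
  assumes y: "y \<in> closure D"
  shows "integrable P (%w. norm (B (tau y w) w))" "expectation (%w. norm (B (tau y w) w)) <= sqrt (CARD('d) * mtau y)"
proof -
  note [measurable] = B_tau_measurable[of y]
  let ?X = "%w. norm (B (tau y w) w)"
  have "(\<integral>\<^sup>+w. ennreal (norm ((?X w)\<^sup>2)) \<partial>P) < \<infinity>"
    using nn_integral_B_tau[OF y] by (simp add: order_le_less_trans)
  then have i2: "integrable P (%w. (?X w)\<^sup>2)" by (intro integrableI_bounded) auto
  show i: "integrable P ?X" by (rule square_integrable_imp_integrable[OF _ i2]) simp
  have "ennreal (expectation (%w. (?X w)\<^sup>2)) <= ennreal (CARD('d) * mtau y)"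
    using nn_integral_B_tau[OF y] by (simp add: nn_integral_eq_integral[OF i2])
  then have e2: "expectation (%w. (?X w)\<^sup>2) <= CARD('d) * mtau y"
    by (subst (asm) ennreal_le_iff) (auto simp: tau_integrable(3)[OF y])
  have "0 <= variance ?X" by (rule variance_positive)
  then have "(expectation ?X)\<^sup>2 <= expectation (%w. (?X w)\<^sup>2)" by (simp add: variance_eq[OF i i2])
  then have "(expectation ?X)\<^sup>2 <= CARD('d) * mtau y" using e2 by simp
  then show "expectation ?X <= sqrt (CARD('d) * mtau y)" by (rule real_le_rsqrt)
qed

lemma tau_props:
  assumes y: "y \<in> closure D"
  shows "AE w in P. y + B (tau y w) w \<in> frontier D"
    and "AE w in P. \<forall>s. 0 <= s \<and> s <= tau y w \<longrightarrow> y + B s w \<in> closure D"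
proof -
  show "AE w in P. y + B (tau y w) w \<in> frontier D"
    using tau_finite[OF y] AE_space
  proof eventually_elim
    case (elim w)
    show ?case using hit_finite(3)[OF frontier_hit spth_continuous[OF elim(2)], of y] elim(1) by (simp add: pth_def)
  qed
  show "AE w in P. \<forall>s. 0 <= s \<and> s <= tau y w \<longrightarrow> y + B s w \<in> closure D"
    using tau_finite[OF y] AE_space
  proof eventually_elim
    case (elim w)
    show ?case
    proof (intro allI impI)
      fix s assume s: "0 <= s \<and> s <= tau y w"
      have "ennreal s <= ennreal (tau y w)" using s by (simp add: ennreal_leI)
      also have "... = hit (frontier D) (spth y w)" using elim(1) by simp
      finally show "y + B s w \<in> closure D"
        using s by (intro in_closure_before_hit[OF elim(2) y _ _ order_refl frontier_hit]) auto
    qed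
  qed
qed

end

section \<open>Running integrals and the stochastic representation of the solution\<close>

lemma borel_fst_measurable: "fst \<in> borel_measurable (borel :: ('a::topological_space \<times> 'b::topological_space) measure)"
  by (intro borel_measurable_continuous_onI continuous_intros)

lemma borel_snd_measurable: "snd \<in> borel_measurable (borel :: ('a::topological_space \<times> 'b::topological_space) measure)"
  by (intro borel_measurable_continuous_onI continuous_intros)

lemma integral_interval_split:
  fixes F :: "real => real"
  assumes F [measurable]: "F \<in> borel_measurable borel" and b: "\<And>s. \<bar>F s\<bar> <= K" and ab: "0 <= a" "a <= c"
  shows "(\<integral>s. indicator {0..c} s * F s \<partial>lborel) = (\<integral>s. indicator {0..a} s * F s \<partial>lborel) + (\<integral>s. indicator {0..c - a} s * F (a + s) \<partial>lborel)"
proof -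
  have int: "integrable lborel (%s. indicator {u..v} s * F s)" for u v :: real
  proof (rule Bochner_Integration.integrable_bound[of _ "%s. indicator {u..v} s * \<bar>K\<bar>"])
    show "integrable lborel (%s. indicator {u..v} s * \<bar>K\<bar>)" by (cases "u <= v") (auto simp: mult.commute)
    show "AE s in lborel. norm (indicator {u..v} s * F s) <= norm (indicator {u..v} s * \<bar>K\<bar>)"
      using b by (intro AE_I2) (auto simp: abs_mult indicator_def intro: order_trans[OF b abs_ge_self])
  qed measurable
  have "(\<integral>s. indicator {0..c} s * F s \<partial>lborel) = (\<integral>s. indicator {0..a} s * F s + indicator {a..c} s * F s \<partial>lborel)"
  proof (rule integral_cong_AE)
    \<comment> \<open>The two closed intervals overlap in the point \<open>a\<close>, a null
      set.\<close>
    have "AE s in lborel. s \<noteq> a" by (rule AE_lborel_singleton)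
    then show "AE s in lborel. indicator {0..c} s * F s = indicator {0..a} s * F s + indicator {a..c} s * F s"
      by eventually_elim (use ab in \<open>auto simp: indicator_def\<close>)
  qed measurable
  also have "... = (\<integral>s. indicator {0..a} s * F s \<partial>lborel) + (\<integral>s. indicator {a..c} s * F s \<partial>lborel)"
    by (rule Bochner_Integration.integral_add[OF int int])
  also have "(\<integral>s. indicator {a..c} s * F s \<partial>lborel) = (\<integral>s. indicator {a..c} (a + s) * F (a + s) \<partial>lborel)"
    using lborel_integral_real_affine[of 1 "%s. indicator {a..c} s * F s" a] by simp
  also have "... = (\<integral>s. indicator {0..c - a} s * F (a + s) \<partial>lborel)"
    by (intro Bochner_Integration.integral_cong refl) (auto simp: indicator_def)
  finally show ?thesis .
qed

lemma integral_interval_bound: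
  fixes F :: "real => real"
  assumes F [measurable]: "F \<in> borel_measurable borel" and b: "\<And>s. \<bar>F s\<bar> <= K" and c: "0 <= c"
  shows "\<bar>\<integral>s. indicator {0..c} s * F s \<partial>lborel\<bar> <= c * K"
proof -
  have K: "0 <= K" using b[of 0] by linarith
  have "\<bar>\<integral>s. indicator {0..c} s * F s \<partial>lborel\<bar> <= (\<integral>s. \<bar>indicator {0..c} s * F s\<bar> \<partial>lborel)"
    by (rule integral_abs_bound)
  also have "... <= (\<integral>s. indicator {0..c} s * K \<partial>lborel)"
  proof (rule integral_mono')
    show "integrable lborel (%s. indicator {0..c} s * K)" using c by (simp add: mult.commute)
  qed (use b K in \<open>auto simp: abs_mult indicator_def\<close>)
  also have "... = c * K" using c by simp
  finally show ?thesis .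
qed

text \<open>The data are total bounded functions on space-time, which keeps measurability on plain
  Borel spaces; Lipschitz bounds are asked for later and only on the closure of
  \<open>D\<close>.\<close>

locale dirichlet = exit_domain P B D for P :: "'w measure" and B :: "real => 'w => real ^ 'd" and D +
  fixes g0 g1 :: "real \<times> (real ^ 'd) => real" and K0 K1 :: real
  assumes g0_m [measurable]: "g0 \<in> borel_measurable borel" and g1_m [measurable]: "g1 \<in> borel_measurable borel"
    and g0_b: "\<And>x. \<bar>g0 x\<bar> <= K0" and g1_b: "\<And>x. \<bar>g1 x\<bar> <= K1"
begin

definition T :: "real ^ 'd => (rat => real ^ 'd) => real" where
  "T y b = enn2real (hit (frontier D) (%q. y + b q))"

text \<open>Boundary value plus running source as a Borel functional of start time, start point and
  encoded driving path. In this form a restarted path can be inserted for the original one.\<close>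

definition Phi :: "(real \<times> (real ^ 'd)) \<times> (rat => real ^ 'd) => real" where
  "Phi = (%((t, y), b). g0 (t + T y b, y + ev b (T y b))
     + (\<integral>s. indicator {0..T y b} s * g1 (t + s, y + ev b s) \<partial>lborel))"

text \<open>\<open>W t y\<close> is the solution at \<open>y\<close> with the clock started at \<open>t\<close>; the strong Markov property then
  makes \<open>W\<close> plus the accumulated source term a martingale along the walk.\<close>

definition W :: "real => real ^ 'd => real" where
  "W t y = (\<integral>w. Phi ((t, y), pth B w) \<partial>P)"

lemma T_measurable:
  assumes "y \<in> borel_measurable M" "b \<in> borel_measurable M"
  shows "(%x. T (y x) (b x)) \<in> borel_measurable M"
proof -
  have [measurable]: "(%x. hit (frontier D) (%q. y x + b x q)) \<in> borel_measurable M"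
    by (intro hit_measurable translate_measurable assms)
  show ?thesis unfolding T_def by measurable
qed

lemma T_eq: "T y (pth B w) = tau y w"
  unfolding T_def spth_eq ..

lemma T_nonneg: "0 <= T y b" by (simp add: T_def)

lemma g1_path_measurable: "(%s. g1 (t + s, y + ev b s)) \<in> borel_measurable borel"
  by (rule measurable_compose[OF _ g1_m]) (intro borel_measurable_Pair borel_measurable_add ev_measurable; simp)

lemma Phi_measurable: "Phi \<in> borel_measurable borel"
proof -
  let ?M = "borel :: ((real \<times> (real ^ 'd)) \<times> (rat => real ^ 'd)) measure"
  have t: "(%x. fst (fst x)) \<in> borel_measurable ?M" and y: "(%x. snd (fst x)) \<in> borel_measurable ?M" and b: "snd \<in> borel_measurable ?M"
    by (intro borel_measurable_continuous_onI continuous_intros)+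
  note Tm [measurable] = T_measurable[OF y b]
  have 1: "(%x. g0 (fst (fst x) + T (snd (fst x)) (snd x), snd (fst x) + ev (snd x) (T (snd (fst x)) (snd x)))) \<in> borel_measurable ?M"
    by (rule measurable_compose[OF _ g0_m]) (intro borel_measurable_Pair borel_measurable_add ev_measurable t y b Tm)
  have 2: "(%x. \<integral>s. indicator {0..T (snd (fst x)) (snd x)} s * g1 (fst (fst x) + s, snd (fst x) + ev (snd x) s) \<partial>lborel) \<in> borel_measurable ?M"
  proof (rule lborel.borel_measurable_lebesgue_integral)
    have t': "(%p. fst (fst (fst p))) \<in> borel_measurable (?M \<Otimes>\<^sub>M lborel)"
      and y': "(%p. snd (fst (fst p))) \<in> borel_measurable (?M \<Otimes>\<^sub>M lborel)"
      and b': "(%p. snd (fst p)) \<in> borel_measurable (?M \<Otimes>\<^sub>M lborel)"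
      and T' [measurable]: "(%p. T (snd (fst (fst p))) (snd (fst p))) \<in> borel_measurable (?M \<Otimes>\<^sub>M lborel)"
      by (rule measurable_compose[OF measurable_fst t] measurable_compose[OF measurable_fst y] measurable_compose[OF measurable_fst b]
          measurable_compose[OF measurable_fst Tm])+
    have s' [measurable]: "(%p. snd p) \<in> borel_measurable (?M \<Otimes>\<^sub>M lborel)"
      using measurable_snd[of ?M lborel] by simp
    have "(%p. g1 (fst (fst (fst p)) + snd p, snd (fst (fst p)) + ev (snd (fst p)) (snd p))) \<in> borel_measurable (?M \<Otimes>\<^sub>M lborel)"
      by (rule measurable_compose[OF _ g1_m]) (intro borel_measurable_Pair borel_measurable_add ev_measurable t' y' b' s')
    moreover have "(%p. indicator {0..T (snd (fst (fst p))) (snd (fst p))} (snd p) :: real) \<in> borel_measurable (?M \<Otimes>\<^sub>M lborel)"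
      unfolding indicator_def atLeastAtMost_iff by measurable
    ultimately show "(%(x, s). indicator {0..T (snd (fst x)) (snd x)} s * g1 (fst (fst x) + s, snd (fst x) + ev (snd x) s)) \<in> borel_measurable (?M \<Otimes>\<^sub>M lborel)"
      unfolding case_prod_beta' by (rule borel_measurable_times[rotated])
  qed
  show ?thesis unfolding Phi_def case_prod_beta' by (rule borel_measurable_add[OF 1 2])
qed

lemma Phi_bound: "\<bar>Phi ((t, y), b)\<bar> <= K0 + T y b * K1"
proof -
  have "\<bar>Phi ((t, y), b)\<bar> <= \<bar>g0 (t + T y b, y + ev b (T y b))\<bar> + \<bar>\<integral>s. indicator {0..T y b} s * g1 (t + s, y + ev b s) \<partial>lborel\<bar>"
    unfolding Phi_def by simp
  also have "... <= K0 + T y b * K1"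
    by (intro add_mono g0_b integral_interval_bound g1_path_measurable g1_b T_nonneg)
  finally show ?thesis .
qed

lemma Phi_path_measurable: "(%w. Phi ((t, y), pth B w)) \<in> borel_measurable P"
  by (rule measurable_compose[OF _ Phi_measurable]) (intro borel_measurable_Pair pth_B_measurable; simp)

lemma Phi_integrable:
  assumes y: "y \<in> closure D"
  shows "integrable P (%w. Phi ((t, y), pth B w))"
proof (rule Bochner_Integration.integrable_bound)
  show "integrable P (%w. K0 + tau y w * K1)" using tau_integrable(1)[OF y] by simp
  show "AE w in P. norm (Phi ((t, y), pth B w)) <= norm (K0 + tau y w * K1)"
  proof (rule AE_I2)
    fix w
    show "norm (Phi ((t, y), pth B w)) <= norm (K0 + tau y w * K1)"
      using Phi_bound[of t y "pth B w"] by (simp add: T_eq)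
  qed
qed (rule Phi_path_measurable)

lemma K_nonneg: "0 <= K0" "0 <= K1"
  using g0_b[of undefined] g1_b[of undefined] by linarith+

lemma W_bound:
  assumes y: "y \<in> closure D"
  shows "\<bar>W t y\<bar> <= K0 + mtau y * K1"
proof -
  have "\<bar>W t y\<bar> <= expectation (%w. K0 + tau y w * K1)"
    unfolding W_def
  proof (rule order_trans[OF integral_abs_bound], rule integral_mono)
    show "integrable P (%w. \<bar>Phi ((t, y), pth B w)\<bar>)" using Phi_integrable[OF y] by (rule integrable_abs)
    show "integrable P (%w. K0 + tau y w * K1)" using tau_integrable(1)[OF y] by simp
    show "\<bar>Phi ((t, y), pth B w)\<bar> <= K0 + tau y w * K1" for w using Phi_bound[of t y "pth B w"] by (simp add: T_eq)
  qed
  also have "... = K0 + mtau y * K1" using tau_integrable(1)[OF y] prob_space by (simp add: mtau_def)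
  finally show ?thesis .
qed

lemma W_measurable: "(%x. W (fst x) (snd x)) \<in> borel_measurable borel"
  unfolding W_def
proof (rule borel_measurable_lebesgue_integral)
  let ?N = "borel \<Otimes>\<^sub>M P :: ((real \<times> (real ^ 'd)) \<times> 'w) measure"
  have "(%p. (fst p, pth B (snd p))) \<in> borel_measurable ?N"
    by (intro borel_measurable_Pair measurable_compose[OF measurable_snd pth_B_measurable]) simp
  from measurable_compose[OF this Phi_measurable]
  show "(%(x, w). Phi ((fst x, snd x), pth B w)) \<in> borel_measurable ?N" by (simp add: case_prod_beta')
qed

lemma W_eq:
  assumes y: "y \<in> closure D"
  shows "W t y = (\<integral>w. g0 (t + tau y w, y + B (tau y w) w) \<partial>P)
     + (\<integral>w. (\<integral>s. indicator {0..tau y w} s * g1 (t + s, y + B s w) \<partial>lborel) \<partial>P)"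
proof -
  note [measurable] = B_tau_measurable[of y]
  have eq: "Phi ((t, y), pth B w) = g0 (t + tau y w, y + B (tau y w) w) + (\<integral>s. indicator {0..tau y w} s * g1 (t + s, y + B s w) \<partial>lborel)"
    if "w \<in> space P" for w
  proof -
    have e: "ev (pth B w) s = B s w" if "0 <= s" for s by (rule ev_pth[of B, OF B_continuous[OF \<open>w \<in> space P\<close>] that])
    have "(\<integral>s. indicator {0..tau y w} s * g1 (t + s, y + ev (pth B w) s) \<partial>lborel) = (\<integral>s. indicator {0..tau y w} s * g1 (t + s, y + B s w) \<partial>lborel)"
      by (intro Bochner_Integration.integral_cong refl) (auto simp: indicator_def e)
    then show ?thesis by (simp add: Phi_def T_eq e)
  qed
  have m0: "(%w. g0 (t + tau y w, y + B (tau y w) w)) \<in> borel_measurable P"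
    by (rule measurable_compose[OF _ g0_m]) (intro borel_measurable_Pair; measurable)
  have i0: "integrable P (%w. g0 (t + tau y w, y + B (tau y w) w))"
    by (rule integrable_const_bound[of _ K0]) (use g0_b m0 in auto)
  have "integrable P (%w. Phi ((t, y), pth B w) - g0 (t + tau y w, y + B (tau y w) w))"
    by (intro Bochner_Integration.integrable_diff Phi_integrable[OF y] i0)
  then have i1: "integrable P (%w. \<integral>s. indicator {0..tau y w} s * g1 (t + s, y + B s w) \<partial>lborel)"
    by (subst (asm) Bochner_Integration.integrable_cong[OF refl]) (auto simp: eq)
  show ?thesis unfolding W_def
    by (subst Bochner_Integration.integral_cong[OF refl eq]) (simp_all add: Bochner_Integration.integral_add[OF i0 i1])
qed

text \<open>Strong Markov property at the exit time of the ball of radius \<open>r\<close> around \<open>x\<close>.\<close>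

lemma W_mean_value:
  assumes x: "x \<in> closure D" and r: "0 < r" "r <= infdist x (frontier D)"
  defines "\<sigma> \<equiv> %w. enn2real (hit (outer r) (pth B w))"
  shows "W t x = (\<integral>w. \<integral>s. indicator {0..\<sigma> w} s * g1 (t + s, x + ev (pth B w) s) \<partial>lborel \<partial>P)
      + (\<integral>w. W (t + \<sigma> w) (x + B (\<sigma> w) w) \<partial>P)"
    and "AE w in P. x + B (\<sigma> w) w \<in> closure D"
proof -
  \<comment> \<open>The open ball of radius \<open>r\<close> around \<open>x\<close> contains no
    boundary point, so the motion leaves it no later than it meets the frontier of
    \<open>D\<close>.\<close>
  have le: "hit (outer r) (pth B w) <= hit (frontier D) (spth x w)" if w: "w \<in> space P" for w
  proof -
    have "r <= norm (B s w)" if "x + B s w \<in> frontier D" for s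
      using infdist_le[OF that, of x] r(2) by (simp add: dist_norm)
    then show ?thesis unfolding pth_def
        hit_eq_INF[OF outer_closed outer_nonempty B_continuous[OF w]]
        hit_eq_INF[OF frontier_hit spth_continuous[OF w]]
      by (intro INF_superset_mono) auto
  qed
  have fin: "AE w in P. hit (outer r) (pth B w) < \<top>"
    using tau_finite[OF x] AE_space by eventually_elim (use le order_le_less_trans in blast)
  have st: "stopping P B \<sigma>"
    unfolding \<sigma>_def using stopping_hit[OF outer_closed outer_nonempty, of r 0] fin by (simp add: spth_0)
  then have s_m [measurable]: "\<sigma> \<in> borel_measurable P" and s0: "\<And>w. 0 <= \<sigma> w" by (auto simp: stopping_def \<sigma>_def)
  have Bs_m: "(%w. B (\<sigma> w) w) \<in> borel_measurable P" by (rule B_at_measurable[OF s_m s0])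
  define F where "F w = pth (%t w. B (\<sigma> w + t) w - B (\<sigma> w) w) w" for w
  define Oc where "Oc w = (\<integral>s. indicator {0..\<sigma> w} s * g1 (t + s, x + ev (pth B w) s) \<partial>lborel)" for w
  show cl: "AE w in P. x + B (\<sigma> w) w \<in> closure D"
    using fin tau_finite[OF x] AE_space
  proof eventually_elim
    case (elim w)
    show ?case
    proof (rule in_closure_before_hit[OF elim(3) x _ _ order_refl frontier_hit])
      have "ennreal (\<sigma> w) = hit (outer r) (pth B w)" using elim(1) by (simp add: \<sigma>_def)
      then show "ennreal (\<sigma> w) <= hit (frontier D) (spth x w)" using le[OF elim(3)] by simp
    qed (rule s0)
  qed
  \<comment> \<open>Pathwise identity: up to \<open>\<sigma>\<close> the source is collected in
    \<open>Oc\<close>, afterwards the functional starts afresh at the exit point of the ball;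
    \<open>hit_shift\<close> accounts for the remaining exit time.\<close>
  have split: "AE w in P. Phi ((t, x), pth B w) = Oc w + Phi ((t + \<sigma> w, x + B (\<sigma> w) w), F w)"
    using fin tau_finite[OF x] AE_space
  proof eventually_elim
    case (elim w)
    have eh: "ennreal (\<sigma> w) <= hit (frontier D) (spth x w)"
      using elim(1) le[OF elim(3)] by (simp add: \<sigma>_def)
    then have st: "\<sigma> w <= tau x w" using elim(2)
      by (cases "hit (frontier D) (spth x w)") (auto simp: ennreal_le_iff)
    have "hit (frontier D) (spth x w) = ennreal (\<sigma> w) + hit (frontier D) (%q. x + B (\<sigma> w + real_of_rat \<bar>q\<bar>) w)"
      unfolding pth_def by (rule hit_shift[OF frontier_hit spth_continuous[OF elim(3)] s0]) (use eh in \<open>simp add: pth_def\<close>)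
    also have "(%q. x + B (\<sigma> w + real_of_rat \<bar>q\<bar>) w) = (%q. x + B (\<sigma> w) w + F w q)"
      by (auto simp: F_def pth_def)
    finally have "hit (frontier D) (spth x w) = ennreal (\<sigma> w) + hit (frontier D) (%q. x + B (\<sigma> w) w + F w q)" .
    then have T': "T (x + B (\<sigma> w) w) (F w) = tau x w - \<sigma> w"
      using elim(2) s0[of w] unfolding T_def
      by (cases "hit (frontier D) (%q. x + B (\<sigma> w) w + F w q)") (auto simp: ennreal_plus[symmetric] simp del: ennreal_plus)
    have evF: "ev (F w) s = ev (pth B w) (\<sigma> w + s) - B (\<sigma> w) w" if "0 <= s" for s
      unfolding F_def using ev_future[OF elim(3) s0 that] ev_pth[of B, OF B_continuous[OF elim(3)], of "\<sigma> w + s"] s0[of w] that by simp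
    have "(\<integral>s. indicator {0..tau x w} s * g1 (t + s, x + ev (pth B w) s) \<partial>lborel)
       = Oc w + (\<integral>s. indicator {0..tau x w - \<sigma> w} s * g1 (t + (\<sigma> w + s), x + ev (pth B w) (\<sigma> w + s)) \<partial>lborel)"
      unfolding Oc_def by (rule integral_interval_split[OF g1_path_measurable g1_b s0 st])
    also have "(\<integral>s. indicator {0..tau x w - \<sigma> w} s * g1 (t + (\<sigma> w + s), x + ev (pth B w) (\<sigma> w + s)) \<partial>lborel)
       = (\<integral>s. indicator {0..tau x w - \<sigma> w} s * g1 (t + \<sigma> w + s, x + B (\<sigma> w) w + ev (F w) s) \<partial>lborel)"
      by (intro Bochner_Integration.integral_cong refl) (auto simp: indicator_def evF add.assoc)
    finally show ?case using st
      by (simp add: Phi_def T_eq T' evF)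
  qed
  have F_m: "F \<in> borel_measurable P" unfolding F_def by (rule future_measurable[OF s_m s0])
  have PhiF_m: "(%w. Phi ((t + \<sigma> w, x + B (\<sigma> w) w), F w)) \<in> borel_measurable P"
    by (rule measurable_compose[OF _ Phi_measurable])
       (intro borel_measurable_Pair borel_measurable_add borel_measurable_const s_m Bs_m F_m)
  have O_m: "Oc \<in> borel_measurable P"
    unfolding Oc_def
  proof (rule lborel.borel_measurable_lebesgue_integral)
    have s' [measurable]: "(%p. snd p) \<in> borel_measurable (P \<Otimes>\<^sub>M lborel)" using measurable_snd[of P lborel] by simp
    have "(%p. g1 (t + snd p, x + ev (pth B (fst p)) (snd p))) \<in> borel_measurable (P \<Otimes>\<^sub>M lborel)"
      by (rule measurable_compose[OF _ g1_m])
         (intro borel_measurable_Pair borel_measurable_add borel_measurable_const ev_measurable s' measurable_compose[OF measurable_fst pth_B_measurable])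
    moreover have "(%p. indicator {0..\<sigma> (fst p)} (snd p) :: real) \<in> borel_measurable (P \<Otimes>\<^sub>M lborel)"
      unfolding indicator_def atLeastAtMost_iff by measurable
    ultimately show "(%(w, s). indicator {0..\<sigma> w} s * g1 (t + s, x + ev (pth B w) s)) \<in> borel_measurable (P \<Otimes>\<^sub>M lborel)"
      unfolding case_prod_beta' by (rule borel_measurable_times[rotated])
  qed
  have O_i: "integrable P Oc"
  proof (rule Bochner_Integration.integrable_bound[OF _ O_m])
    show "integrable P (%w. tau x w * K1)" using tau_integrable(1)[OF x] by simp
    show "AE w in P. norm (Oc w) <= norm (tau x w * K1)"
      using fin tau_finite[OF x] AE_space
    proof eventually_elim
      case (elim w)
      have "ennreal (\<sigma> w) <= hit (frontier D) (spth x w)"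
        using elim(1) le[OF elim(3)] by (simp add: \<sigma>_def)
      then have "\<sigma> w <= tau x w" using elim(2)
        by (cases "hit (frontier D) (spth x w)") (auto simp: ennreal_le_iff)
      moreover have "\<bar>Oc w\<bar> <= \<sigma> w * K1" unfolding Oc_def by (intro integral_interval_bound g1_path_measurable g1_b s0)
      ultimately have "\<bar>Oc w\<bar> <= tau x w * K1" using K_nonneg by (meson mult_right_mono order_trans)
      then show ?case by simp
    qed
  qed
  have "integrable P (%w. Phi ((t, x), pth B w) - Oc w)"
    by (intro Bochner_Integration.integrable_diff Phi_integrable[OF x] O_i)
  then have PhiF_i: "integrable P (%w. Phi ((t + \<sigma> w, x + B (\<sigma> w) w), F w))"
    by (rule integrable_cong_AE_imp[OF _ PhiF_m]) (use split in eventually_elim, simp)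
  define G where "G p = Phi ((t + fst (fst p), x + snd (fst p)), snd p)" for p :: "(real \<times> (real ^ 'd)) \<times> (rat => real ^ 'd)"
  have G_m: "G \<in> borel_measurable borel"
    unfolding G_def by (rule measurable_compose[OF _ Phi_measurable])
      (intro borel_measurable_continuous_onI continuous_intros)
  have "(\<integral>w. G ((\<sigma> w, B (\<sigma> w) w), F w) \<partial>P) = (\<integral>w. \<integral>w'. G ((\<sigma> w, B (\<sigma> w) w), pth B w') \<partial>P \<partial>P)"
    unfolding F_def by (rule strong_markov_integral(1)[OF st G_m]) (use PhiF_i in \<open>simp add: G_def F_def\<close>)
  then have sm: "(\<integral>w. Phi ((t + \<sigma> w, x + B (\<sigma> w) w), F w) \<partial>P) = (\<integral>w. W (t + \<sigma> w) (x + B (\<sigma> w) w) \<partial>P)"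
    by (simp add: G_def W_def)
  have "W t x = (\<integral>w. Oc w + Phi ((t + \<sigma> w, x + B (\<sigma> w) w), F w) \<partial>P)"
    unfolding W_def by (rule integral_cong_AE[OF _ _ split]) (use O_m PhiF_m Phi_path_measurable in auto)
  also have "... = (\<integral>w. Oc w \<partial>P) + (\<integral>w. W (t + \<sigma> w) (x + B (\<sigma> w) w) \<partial>P)"
    by (simp add: Bochner_Integration.integral_add[OF O_i PhiF_i] sm)
  finally show "W t x = (\<integral>w. \<integral>s. indicator {0..\<sigma> w} s * g1 (t + s, x + ev (pth B w) s) \<partial>lborel \<partial>P)
      + (\<integral>w. W (t + \<sigma> w) (x + B (\<sigma> w) w) \<partial>P)"
    unfolding Oc_def .
qed

end

section \<open>Occupation measure and moments of the exit time from the unit ball\<close>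

context brownian
begin

interpretation PL: pair_sigma_finite P lborel by unfold_locales

lemma snd_lborel_measurable: "(%p. snd p) \<in> borel_measurable (P \<Otimes>\<^sub>M (lborel :: real measure))"
  using measurable_snd[of P lborel] by simp

lemma pth_fst_measurable: "(%p. pth B (fst p)) \<in> borel_measurable (P \<Otimes>\<^sub>M (lborel :: real measure))"
  by (rule measurable_compose[OF measurable_fst pth_B_measurable])

lemma occ_measurable: "(%p. (snd p, ev (pth B (fst p)) (snd p))) \<in> borel_measurable (P \<Otimes>\<^sub>M lborel)"
  by (intro borel_measurable_Pair ev_measurable snd_lborel_measurable pth_fst_measurable)

lemma occ_indicator_measurable [measurable]:
  "(%p. indicator {0..zeta (fst p)} (snd p) :: ennreal) \<in> borel_measurable (P \<Otimes>\<^sub>M lborel)"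
  "(%p. indicator {0..zeta (fst p)} (snd p) :: real) \<in> borel_measurable (P \<Otimes>\<^sub>M lborel)"
proof -
  note [measurable] = snd_lborel_measurable measurable_compose[OF measurable_fst zeta_measurable]
  show "(%p. indicator {0..zeta (fst p)} (snd p) :: ennreal) \<in> borel_measurable (P \<Otimes>\<^sub>M lborel)"
    "(%p. indicator {0..zeta (fst p)} (snd p) :: real) \<in> borel_measurable (P \<Otimes>\<^sub>M lborel)"
    unfolding indicator_def atLeastAtMost_iff by measurable
qed

text \<open>Path and time together, weighted by the dimension on the stretch up to the ball exit.
  The image under time and position is the occupation law, so integrals over the draws
  \<open>V\<close>, \<open>Y\<close> become path integrals by Fubini.\<close>

definition occ :: "('w \<times> real) measure" where
  "occ = density (P \<Otimes>\<^sub>M lborel) (%p. of_nat CARD('d) * indicator {0..zeta (fst p)} (snd p))"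

lemma occupation_law_distr:
  assumes VY: "V \<in> borel_measurable P" "Y \<in> borel_measurable P"
    "\<forall>A\<in>sets borel. emeasure (distr P borel (%w. (V w, Y w))) A = occupation_law P B A"
  shows "distr P borel (%w. (V w, Y w)) = distr occ borel (%p. (snd p, ev (pth B (fst p)) (snd p)))"
proof (rule measure_eqI)
  let ?\<phi> = "%p. (snd p, ev (pth B (fst p)) (snd p))"
  fix A assume "A \<in> sets (distr P borel (%w. (V w, Y w)))"
  then have A [measurable]: "A \<in> sets borel" by simp
  have m: "?\<phi> \<in> borel_measurable occ" using occ_measurable by (simp add: occ_def)
  have sp: "space occ = space (P \<Otimes>\<^sub>M lborel)" by (simp add: occ_def)
  have iA [measurable]: "(%p. indicator A (?\<phi> p) :: ennreal) \<in> borel_measurable (P \<Otimes>\<^sub>M lborel)"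
    by (rule measurable_compose[OF occ_measurable]) measurable
  have "emeasure (distr occ borel ?\<phi>) A = emeasure occ (?\<phi> -` A \<inter> space (P \<Otimes>\<^sub>M lborel))"
    by (simp add: emeasure_distr[OF m A] sp)
  also have "... = (\<integral>\<^sup>+p. of_nat CARD('d) * indicator {0..zeta (fst p)} (snd p) * indicator (?\<phi> -` A \<inter> space (P \<Otimes>\<^sub>M lborel)) p \<partial>(P \<Otimes>\<^sub>M lborel))"
    unfolding occ_def by (rule emeasure_density) (use measurable_sets[OF occ_measurable A] in auto)
  also have "... = (\<integral>\<^sup>+p. of_nat CARD('d) * (indicator {0..zeta (fst p)} (snd p) * indicator A (?\<phi> p)) \<partial>(P \<Otimes>\<^sub>M lborel))"
    by (intro nn_integral_cong) (auto simp: indicator_def)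
  also have "... = of_nat CARD('d) * (\<integral>\<^sup>+p. indicator {0..zeta (fst p)} (snd p) * indicator A (?\<phi> p) \<partial>(P \<Otimes>\<^sub>M lborel))"
    by (rule nn_integral_cmult) measurable
  also have "(\<integral>\<^sup>+p. indicator {0..zeta (fst p)} (snd p) * indicator A (?\<phi> p) \<partial>(P \<Otimes>\<^sub>M lborel))
    = (\<integral>\<^sup>+w. (\<integral>\<^sup>+s. indicator {0..zeta w} s * indicator A (s, ev (pth B w) s) \<partial>lborel) \<partial>P)"
  proof -
    have "(%p. indicator {0..zeta (fst p)} (snd p) * indicator A (?\<phi> p) :: ennreal) \<in> borel_measurable (P \<Otimes>\<^sub>M lborel)"
      by measurable
    from lborel.nn_integral_fst[OF this] show ?thesis by simp
  qed
  also have "... = (\<integral>\<^sup>+w. (\<integral>\<^sup>+s. indicator {0..ball_exit_time B w} s * indicator A (s, B s w) \<partial>lborel) \<partial>P)"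
  proof (intro nn_integral_cong)
    fix w s assume w: "w \<in> space P"
    show "indicator {0..zeta w} s * indicator A (s, ev (pth B w) s) = (indicator {0..ball_exit_time B w} s * indicator A (s, B s w) :: ennreal)"
      using ev_pth[of B, OF B_continuous[OF w], of s] by (auto simp: indicator_def ball_exit_time_eq[OF w])
  qed
  finally show "emeasure (distr P borel (%w. (V w, Y w))) A = emeasure (distr occ borel ?\<phi>) A"
    using VY(3) A by (simp add: occupation_law_def)
qed simp

lemma occupation_nn_integral:
  assumes VY: "V \<in> borel_measurable P" "Y \<in> borel_measurable P"
    "\<forall>A\<in>sets borel. emeasure (distr P borel (%w. (V w, Y w))) A = occupation_law P B A"
    and g [measurable]: "g \<in> borel_measurable borel"
  shows "(\<integral>\<^sup>+w. g (V w, Y w) \<partial>P) = of_nat CARD('d) * (\<integral>\<^sup>+w. \<integral>\<^sup>+s. indicator {0..zeta w} s * g (s, ev (pth B w) s) \<partial>lborel \<partial>P)"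
proof -
  let ?\<phi> = "%p. (snd p, ev (pth B (fst p)) (snd p))"
  have gm [measurable]: "(%p. g (?\<phi> p)) \<in> borel_measurable (P \<Otimes>\<^sub>M lborel)" by (rule measurable_compose[OF occ_measurable g])
  have "(\<integral>\<^sup>+w. g (V w, Y w) \<partial>P) = (\<integral>\<^sup>+x. g x \<partial>distr P borel (%w. (V w, Y w)))"
    using VY(1,2) by (subst nn_integral_distr) auto
  also have "... = (\<integral>\<^sup>+p. g (?\<phi> p) \<partial>occ)"
    unfolding occupation_law_distr[OF VY(1-3)] by (rule nn_integral_distr) (use occ_measurable in \<open>simp_all add: occ_def\<close>)
  also have "... = (\<integral>\<^sup>+p. of_nat CARD('d) * indicator {0..zeta (fst p)} (snd p) * g (?\<phi> p) \<partial>(P \<Otimes>\<^sub>M lborel))"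
    unfolding occ_def by (rule nn_integral_density) measurable
  also have "... = of_nat CARD('d) * (\<integral>\<^sup>+p. indicator {0..zeta (fst p)} (snd p) * g (?\<phi> p) \<partial>(P \<Otimes>\<^sub>M lborel))"
    unfolding mult.assoc by (rule nn_integral_cmult) measurable
  also have "(\<integral>\<^sup>+p. indicator {0..zeta (fst p)} (snd p) * g (?\<phi> p) \<partial>(P \<Otimes>\<^sub>M lborel))
    = (\<integral>\<^sup>+w. (\<integral>\<^sup>+s. indicator {0..zeta w} s * g (s, ev (pth B w) s) \<partial>lborel) \<partial>P)"
  proof -
    have "(%p. indicator {0..zeta (fst p)} (snd p) * g (?\<phi> p)) \<in> borel_measurable (P \<Otimes>\<^sub>M lborel)" by measurable
    from lborel.nn_integral_fst[OF this] show ?thesis by simp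
  qed
  finally show ?thesis .
qed

lemma occupation_integral:
  fixes g :: "real \<times> (real ^ 'd) => real"
  assumes VY: "V \<in> borel_measurable P" "Y \<in> borel_measurable P"
    "\<forall>A\<in>sets borel. emeasure (distr P borel (%w. (V w, Y w))) A = occupation_law P B A"
    and g [measurable]: "g \<in> borel_measurable borel" and gb: "\<And>x. \<bar>g x\<bar> <= K"
  shows "(\<integral>w. g (V w, Y w) \<partial>P) = CARD('d) * (\<integral>w. \<integral>s. indicator {0..zeta w} s * g (s, ev (pth B w) s) \<partial>lborel \<partial>P)"
proof -
  let ?\<phi> = "%p. (snd p, ev (pth B (fst p)) (snd p))"
  have gm [measurable]: "(%p. g (?\<phi> p)) \<in> borel_measurable (P \<Otimes>\<^sub>M lborel)" by (rule measurable_compose[OF occ_measurable g])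
  have occ_eq: "occ = density (P \<Otimes>\<^sub>M lborel) (%p. ennreal (real CARD('d) * indicator {0..zeta (fst p)} (snd p)))"
    unfolding occ_def by (intro arg_cong2[where f=density] refl ext)
      (simp add: ennreal_mult ennreal_of_nat_eq_real_of_nat ennreal_indicator)
  have m: "?\<phi> \<in> borel_measurable occ" using occ_measurable by (simp add: occ_def)
  have VYm: "(%w. (V w, Y w)) \<in> borel_measurable P" using VY(1,2) by (intro borel_measurable_Pair)
  have "integrable P (%w. g (V w, Y w))"
    by (rule integrable_const_bound[of _ K]) (use gb measurable_compose[OF VYm g] in auto)
  then have "integrable (distr P borel (%w. (V w, Y w))) g" by (subst integrable_distr_eq[OF VYm]) auto
  then have "integrable occ (%p. g (?\<phi> p))"
    unfolding occupation_law_distr[OF VY(1-3)] by (subst (asm) integrable_distr_eq[OF m]) auto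
  then have int: "integrable (P \<Otimes>\<^sub>M lborel) (%p. real CARD('d) * indicator {0..zeta (fst p)} (snd p) * g (?\<phi> p))"
    unfolding occ_eq by (subst (asm) integrable_density) auto
  have "(\<integral>w. g (V w, Y w) \<partial>P) = (\<integral>x. g x \<partial>distr P borel (%w. (V w, Y w)))"
    by (rule integral_distr[OF VYm, symmetric]) simp
  also have "... = (\<integral>p. g (?\<phi> p) \<partial>occ)"
    unfolding occupation_law_distr[OF VY(1-3)] by (rule integral_distr[OF m]) simp
  also have "... = (\<integral>p. real CARD('d) * indicator {0..zeta (fst p)} (snd p) * g (?\<phi> p) \<partial>(P \<Otimes>\<^sub>M lborel))"
    unfolding occ_eq by (subst integral_density) auto
  also have "... = (\<integral>w. \<integral>s. real CARD('d) * indicator {0..zeta w} s * g (s, ev (pth B w) s) \<partial>lborel \<partial>P)"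
    using PL.integral_fst'[OF int] by simp
  finally show ?thesis by (simp add: mult.assoc)
qed

lemma zeta_expectation:
  "(\<integral>\<^sup>+w. ennreal (zeta w) \<partial>P) <= ennreal (1 / CARD('d))"
proof -
  have "(\<integral>\<^sup>+w. ennreal (zeta w) \<partial>P) = (\<integral>\<^sup>+w. hit (outer 1) (pth B w) \<partial>P)"
    using zeta_finite by (intro nn_integral_cong_AE) (auto elim: eventually_mono)
  also have "... <= ennreal (1 / CARD('d))" using nn_integral_ball_hit[of 0] by (simp add: spth_0)
  finally show ?thesis .
qed

text \<open>On the event that the ball has not been left by time \<open>s\<close>, the motion
  restarts from a point inside the ball, and from there the mean exit time is at most one over the
  dimension.\<close>

lemma zeta_residual:
  assumes s: "0 <= s"
  shows "(\<integral>\<^sup>+w. indicator {0..zeta w} s * ennreal (zeta w - s) \<partial>P) <= ennreal (1 / CARD('d)) * (\<integral>\<^sup>+w. indicator {0..zeta w} s \<partial>P)"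
proof -
  define \<sigma> where "\<sigma> w = htr s (outer 1) (spth 0 w)" for w
  have st: "stopping P B \<sigma>" unfolding \<sigma>_def by (rule stopping_htr[OF outer_closed outer_nonempty s])
  then have s_m [measurable]: "\<sigma> \<in> borel_measurable P" and s0: "\<And>w. 0 <= \<sigma> w"
    using htr_bounds(1)[OF s] by (auto simp: stopping_def \<sigma>_def)
  have Bs_m [measurable]: "(%w. B (\<sigma> w) w) \<in> borel_measurable P" by (rule B_at_measurable[OF s_m s0])
  note [measurable] = zeta_measurable
  define F where "F w = pth (%t w. B (\<sigma> w + t) w - B (\<sigma> w) w) w" for w
  \<comment> \<open>At the capped time a norm below \<open>1\<close> means that the cap
    \<open>s\<close> came before the exit. The indicator thus expresses survival through the stopped
    position alone.\<close>
  define G :: "(real \<times> (real ^ 'd)) \<times> (rat => real ^ 'd) => ennreal" where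
    "G = (%p. indicator {z. norm z < 1} (snd (fst p)) * hit (outer 1) (%q. snd (fst p) + snd p q))"
  have G_m: "G \<in> borel_measurable borel"
  proof -
    have z: "(%p::(real \<times> (real ^ 'd)) \<times> (rat => real ^ 'd). snd (fst p)) \<in> borel_measurable borel"
      and b: "snd \<in> borel_measurable (borel :: ((real \<times> (real ^ 'd)) \<times> (rat => real ^ 'd)) measure)"
      by (intro borel_measurable_continuous_onI continuous_intros)+
    have "open {z::real^'d. norm z < 1}" by (intro open_Collect_less continuous_intros)
    then have i: "(indicator {z::real^'d. norm z < 1} :: _ => ennreal) \<in> borel_measurable borel" by (intro borel_measurable_indicator borel_open)
    show ?thesis unfolding G_def
      by (rule borel_measurable_times_ennreal[OF measurable_compose[OF z i] hit_measurable[OF translate_measurable[OF z b]]])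
  qed
  have le1: "AE w in P. indicator {0..zeta w} s * ennreal (zeta w - s) <= G ((\<sigma> w, B (\<sigma> w) w), F w)"
    using zeta_finite AE_space
  proof eventually_elim
    case (elim w)
    show ?case
    proof (cases "s < zeta w")
      case True
      have h: "ennreal (zeta w) = hit (outer 1) (pth B w)" using elim(1) by simp
      have "ennreal s < ennreal (zeta w)" using True s by (simp add: ennreal_less_iff)
      then have lt: "ennreal s < hit (outer 1) (pth B w)" by (simp only: h)
      then have \<sigma>s: "\<sigma> w = s" unfolding \<sigma>_def htr_def spth_0 using s by (simp add: min_absorb2 less_imp_le)
      have "B s w \<notin> outer 1"
        by (rule before_hit[OF outer_closed outer_nonempty B_continuous[OF elim(2)] s]) (use lt in \<open>simp add: pth_def\<close>)
      then have n: "norm (B (\<sigma> w) w) < 1" by (simp add: \<sigma>s)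
      have "hit (outer 1) (pth B w) = ennreal s + hit (outer 1) (%q. B (s + real_of_rat \<bar>q\<bar>) w)"
        unfolding pth_def by (rule hit_shift[OF outer_closed outer_nonempty B_continuous[OF elim(2)] s]) (use lt in \<open>simp add: pth_def\<close>)
      also have "(%q. B (s + real_of_rat \<bar>q\<bar>) w) = (%q. B (\<sigma> w) w + F w q)" by (simp add: F_def pth_def \<sigma>s)
      finally have hh: "hit (outer 1) (pth B w) = ennreal s + hit (outer 1) (%q. B (\<sigma> w) w + F w q)" .
      have "ennreal (zeta w) = ennreal s + hit (outer 1) (%q. B (\<sigma> w) w + F w q)" by (rule trans[OF h hh])
      then have "ennreal (zeta w) - ennreal s = hit (outer 1) (%q. B (\<sigma> w) w + F w q)"
        by (simp only: ennreal_add_diff_cancel_left ennreal_neq_top not_False_eq_True)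
      then have "ennreal (zeta w - s) = hit (outer 1) (%q. B (\<sigma> w) w + F w q)"
        using s by (simp only: ennreal_minus)
      then show ?thesis using n by (simp add: G_def mult_left_le_one_le indicator_def)
    next
      case False
      then show ?thesis by (simp add: ennreal_neg)
    qed
  qed
  have le2: "AE w in P. indicator {z. norm z < 1} (B (\<sigma> w) w) <= (indicator {0..zeta w} s :: ennreal)"
    using zeta_finite AE_space
  proof eventually_elim
    case (elim w)
    show ?case
    proof (cases "s <= zeta w")
      case False
      have h: "ennreal (zeta w) = hit (outer 1) (pth B w)" using elim(1) by simp
      have "ennreal (zeta w) <= ennreal s" using False by (intro ennreal_leI) simp
      then have "hit (outer 1) (pth B w) <= ennreal s" by (simp only: h)
      then have "\<sigma> w = zeta w" unfolding \<sigma>_def htr_def spth_0 by (simp add: min_absorb1)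
      moreover have "B (zeta w) w \<in> outer 1"
        using hit_finite(3)[OF outer_closed outer_nonempty B_continuous[OF elim(2)], of 1] elim(1) by (simp add: pth_def)
      ultimately show ?thesis by simp
    qed (use s in \<open>simp add: indicator_def\<close>)
  qed
  have "(\<integral>\<^sup>+w. indicator {0..zeta w} s * ennreal (zeta w - s) \<partial>P) <= (\<integral>\<^sup>+w. G ((\<sigma> w, B (\<sigma> w) w), F w) \<partial>P)"
    by (rule nn_integral_mono_AE[OF le1])
  also have "... = (\<integral>\<^sup>+w. \<integral>\<^sup>+w'. G ((\<sigma> w, B (\<sigma> w) w), pth B w') \<partial>P \<partial>P)"
    unfolding F_def by (rule strong_markov_nn_integral[OF st G_m])
  also have "... <= (\<integral>\<^sup>+w. indicator {z. norm z < 1} (B (\<sigma> w) w) * ennreal (1 / CARD('d)) \<partial>P)"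
  proof (rule nn_integral_mono)
    fix w assume "w \<in> space P"
    have "(\<integral>\<^sup>+w'. G ((\<sigma> w, B (\<sigma> w) w), pth B w') \<partial>P)
      = (\<integral>\<^sup>+w'. indicator {z. norm z < 1} (B (\<sigma> w) w) * hit (outer 1) (spth (B (\<sigma> w) w) w') \<partial>P)"
      by (simp add: G_def spth_eq)
    also have "... = indicator {z. norm z < 1} (B (\<sigma> w) w) * (\<integral>\<^sup>+w'. hit (outer 1) (spth (B (\<sigma> w) w) w') \<partial>P)"
      by (intro nn_integral_cmult hit_measurable spth_measurable)
    also have "... <= indicator {z. norm z < 1} (B (\<sigma> w) w) * ennreal (1 / CARD('d))"
      using nn_integral_ball_hit[of "B (\<sigma> w) w"] by (auto simp: indicator_def)
    finally show "(\<integral>\<^sup>+w'. G ((\<sigma> w, B (\<sigma> w) w), pth B w') \<partial>P) <= indicator {z. norm z < 1} (B (\<sigma> w) w) * ennreal (1 / CARD('d))" .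
  qed
  also have "... <= (\<integral>\<^sup>+w. indicator {0..zeta w} s * ennreal (1 / CARD('d)) \<partial>P)"
    by (rule nn_integral_mono_AE) (use le2 in \<open>eventually_elim, auto intro: mult_right_mono\<close>)
  also have "... = ennreal (1 / CARD('d)) * (\<integral>\<^sup>+w. indicator {0..zeta w} s \<partial>P)"
    by (subst nn_integral_multc) (auto simp: mult.commute indicator_def[abs_def])
  finally show ?thesis .
qed

text \<open>Reflecting \<open>s\<close> to \<open>zeta w - s\<close> turns the integrand into the
  residual exit time; Tonelli and \<open>zeta_residual\<close> bound it by the mean exit time
  divided by the dimension. The quantity is half the second moment of the exit time.\<close>

lemma zeta_second_moment:
  "(\<integral>\<^sup>+w. \<integral>\<^sup>+s. indicator {0..zeta w} s * ennreal s \<partial>lborel \<partial>P) <= ennreal (1 / (CARD('d))\<^sup>2)"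
proof -
  note [measurable] = snd_lborel_measurable measurable_compose[OF measurable_fst zeta_measurable]
  have "(\<integral>\<^sup>+w. \<integral>\<^sup>+s. indicator {0..zeta w} s * ennreal s \<partial>lborel \<partial>P)
      = (\<integral>\<^sup>+w. \<integral>\<^sup>+s. indicator {0..zeta w} s * ennreal (zeta w - s) \<partial>lborel \<partial>P)"
  proof (rule nn_integral_cong)
    fix w
    have "(\<integral>\<^sup>+s. indicator {0..zeta w} s * ennreal s \<partial>lborel) = (\<integral>\<^sup>+s. indicator {0..zeta w} (zeta w + - 1 * s) * ennreal (zeta w + - 1 * s) \<partial>lborel)"
      by (subst nn_integral_real_affine[where c="-1" and t="zeta w"]) auto
    also have "... = (\<integral>\<^sup>+s. indicator {0..zeta w} s * ennreal (zeta w - s) \<partial>lborel)"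
      by (intro nn_integral_cong) (auto simp: indicator_def)
    finally show "(\<integral>\<^sup>+s. indicator {0..zeta w} s * ennreal s \<partial>lborel) = (\<integral>\<^sup>+s. indicator {0..zeta w} s * ennreal (zeta w - s) \<partial>lborel)" .
  qed
  also have "... = (\<integral>\<^sup>+s. \<integral>\<^sup>+w. indicator {0..zeta w} s * ennreal (zeta w - s) \<partial>P \<partial>lborel)"
    by (rule PL.Fubini'[symmetric]) (simp add: case_prod_beta')
  also have "... <= (\<integral>\<^sup>+s. ennreal (1 / CARD('d)) * (\<integral>\<^sup>+w. indicator {0..zeta w} s \<partial>P) \<partial>lborel)"
  proof (rule nn_integral_mono)
    fix s :: real
    show "(\<integral>\<^sup>+w. indicator {0..zeta w} s * ennreal (zeta w - s) \<partial>P) <= ennreal (1 / CARD('d)) * (\<integral>\<^sup>+w. indicator {0..zeta w} s \<partial>P)"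
      by (cases "0 <= s") (simp_all add: zeta_residual)
  qed
  also have "... = ennreal (1 / CARD('d)) * (\<integral>\<^sup>+s. \<integral>\<^sup>+w. indicator {0..zeta w} s \<partial>P \<partial>lborel)"
  proof (rule nn_integral_cmult)
    have "(%(w, s). indicator {0..zeta w} s :: ennreal) \<in> borel_measurable (P \<Otimes>\<^sub>M lborel)" by (simp add: case_prod_beta')
    from measurable_pair_swap[OF this]
    have "(%(s, w). indicator {0..zeta w} s :: ennreal) \<in> borel_measurable (lborel \<Otimes>\<^sub>M P)" by (simp add: case_prod_beta')
    then show "(%s. \<integral>\<^sup>+w. indicator {0..zeta w} s \<partial>P) \<in> borel_measurable lborel"
      by (rule borel_measurable_nn_integral)
  qed
  also have "(\<integral>\<^sup>+s. \<integral>\<^sup>+w. indicator {0..zeta w} s \<partial>P \<partial>lborel) = (\<integral>\<^sup>+w. \<integral>\<^sup>+s. indicator {0..zeta w} s \<partial>lborel \<partial>P)"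
    by (rule PL.Fubini') (simp add: case_prod_beta')
  also have "... = (\<integral>\<^sup>+w. ennreal (zeta w) \<partial>P)" by simp
  also have "... <= ennreal (1 / CARD('d))"
  proof -
    have "(\<integral>\<^sup>+w. ennreal (zeta w) \<partial>P) = (\<integral>\<^sup>+w. hit (outer 1) (pth B w) \<partial>P)"
      using zeta_finite by (intro nn_integral_cong_AE) (auto elim: eventually_mono)
    then show ?thesis using nn_integral_ball_hit[of 0] by (simp add: spth_0)
  qed
  finally show ?thesis by (simp add: mult_left_mono ennreal_mult[symmetric] power2_eq_square)
qed

lemma occupation_time_expectation:
  assumes VY: "V \<in> borel_measurable P" "Y \<in> borel_measurable P"
    "\<forall>A\<in>sets borel. emeasure (distr P borel (%w. (V w, Y w))) A = occupation_law P B A"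
  shows "(\<integral>\<^sup>+w. ennreal (V w) \<partial>P) <= ennreal (1 / CARD('d))"
proof -
  have "(\<integral>\<^sup>+w. ennreal (V w) \<partial>P) = of_nat CARD('d) * (\<integral>\<^sup>+w. \<integral>\<^sup>+s. indicator {0..zeta w} s * ennreal s \<partial>lborel \<partial>P)"
    using occupation_nn_integral[OF VY, of "%x. ennreal (fst x)"] measurable_compose[OF borel_fst_measurable measurable_ennreal] by simp
  also have "... <= of_nat CARD('d) * ennreal (1 / (CARD('d))\<^sup>2)"
    by (intro mult_left_mono zeta_second_moment) simp
  also have "... = ennreal (1 / CARD('d))"
    by (simp add: ennreal_of_nat_eq_real_of_nat ennreal_mult[symmetric] power2_eq_square)
  finally show ?thesis .
qed

lemma hit_scale:
  assumes r: "0 < r" and w: "w \<in> space P"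
  shows "hit (outer r) (pth (%t w. r *\<^sub>R B (t / r\<^sup>2) w) w) = ennreal (r\<^sup>2) * hit (outer 1) (pth B w)"
proof (rule ennreal_eqI_le)
  fix t :: real assume t: "0 <= t"
  have c: "continuous_on {0..} (%t. r *\<^sub>R B (t / r\<^sup>2) w)"
    using std_brownian_motionD(4)[OF std_brownian_motion_scale[OF BM r] w] .
  have "hit (outer r) (pth (%t w. r *\<^sub>R B (t / r\<^sup>2) w) w) <= ennreal t \<longleftrightarrow> (\<exists>s. 0 <= s \<and> s <= t \<and> r *\<^sub>R B (s / r\<^sup>2) w \<in> outer r)"
    unfolding pth_def by (rule hit_le_iff[OF outer_closed outer_nonempty c t])
  also have "... \<longleftrightarrow> (\<exists>s. 0 <= s \<and> s <= t / r\<^sup>2 \<and> B s w \<in> outer 1)"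
  proof
    assume "\<exists>s. 0 <= s \<and> s <= t \<and> r *\<^sub>R B (s / r\<^sup>2) w \<in> outer r"
    then obtain s where "0 <= s" "s <= t" "r *\<^sub>R B (s / r\<^sup>2) w \<in> outer r" by blast
    then show "\<exists>s. 0 <= s \<and> s <= t / r\<^sup>2 \<and> B s w \<in> outer 1"
      using r by (intro exI[of _ "s / r\<^sup>2"]) (auto intro: divide_right_mono)
  next
    assume "\<exists>s. 0 <= s \<and> s <= t / r\<^sup>2 \<and> B s w \<in> outer 1"
    then obtain s where "0 <= s" "s <= t / r\<^sup>2" "B s w \<in> outer 1" by blast
    then show "\<exists>s. 0 <= s \<and> s <= t \<and> r *\<^sub>R B (s / r\<^sup>2) w \<in> outer r"
      using r by (intro exI[of _ "s * r\<^sup>2"]) (auto simp: field_simps)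
  qed
  also have "... \<longleftrightarrow> hit (outer 1) (pth B w) <= ennreal (t / r\<^sup>2)"
    unfolding pth_def by (rule hit_le_iff[OF outer_closed outer_nonempty B_continuous[OF w], symmetric]) (use t in simp)
  also have "... \<longleftrightarrow> ennreal (r\<^sup>2) * hit (outer 1) (pth B w) <= ennreal t"
    using r t by (cases "hit (outer 1) (pth B w)")
      (auto simp: ennreal_le_iff ennreal_mult[symmetric] field_simps ennreal_mult_eq_top_iff top_unique)
  finally show "hit (outer r) (pth (%t w. r *\<^sub>R B (t / r\<^sup>2) w) w) <= ennreal t \<longleftrightarrow> ennreal (r\<^sup>2) * hit (outer 1) (pth B w) <= ennreal t" .
qed

lemma scaled_functional:
  fixes \<Psi> :: "(rat => real ^ 'd) => 'a"
  assumes r: "0 < r" and \<Psi>: "\<Psi> \<in> borel \<rightarrow>\<^sub>M N"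
  shows "distr P N (%w. \<Psi> (pth B w)) = distr P N (%w. \<Psi> (pth (%t w. r *\<^sub>R B (t / r\<^sup>2) w) w))"
proof -
  have B': "std_brownian_motion P (%t w. r *\<^sub>R B (t / r\<^sup>2) w)" by (rule std_brownian_motion_scale[OF BM r])
  have "distr (distr P borel (pth B)) N \<Psi> = distr (distr P borel (pth (%t w. r *\<^sub>R B (t / r\<^sup>2) w))) N \<Psi>"
    by (simp add: std_brownian_motion_law[OF BM B'])
  then show ?thesis
    by (simp add: distr_distr[OF \<Psi> pth_B_measurable] distr_distr[OF \<Psi> pth_measurable[OF std_brownian_motionD(2)[OF B']]] o_def)
qed

end

text \<open>Independence stated as factorisation of the joint Borel law. The components may live in
  different spaces, and Borel images and Fubini apply directly.\<close>

definition product_law :: "'w measure => ('w => 'a::topological_space) => ('w => 'b::topological_space) => bool" where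
  "product_law P U V \<longleftrightarrow> U \<in> borel_measurable P \<and> V \<in> borel_measurable P \<and>
     distr P borel (%w. (U w, V w)) = distr P borel U \<Otimes>\<^sub>M distr P borel V"

lemma product_law_map:
  fixes U :: "'w => 'a::second_countable_topology" and V :: "'w => 'b::second_countable_topology"
    and f :: "'a => 'c::second_countable_topology" and g :: "'b => 'e::second_countable_topology"
  assumes P: "prob_space P" and law: "product_law P U V"
    and f: "f \<in> borel_measurable borel" and g: "g \<in> borel_measurable borel"
  shows "product_law P (%w. f (U w)) (%w. g (V w))"
proof -
  interpret prob_space P by fact
  have U: "U \<in> borel_measurable P" and V: "V \<in> borel_measurable P" using law by (auto simp: product_law_def)
  have UV: "(%w. (U w, V w)) \<in> borel_measurable P" by (intro borel_measurable_Pair U V)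
  note gV = measurable_compose[OF V g]
  have fg: "(%x. (f (fst x), g (snd x))) \<in> borel_measurable borel"
    by (intro borel_measurable_Pair measurable_compose[OF _ f] measurable_compose[OF _ g] borel_measurable_continuous_onI continuous_intros)
  have "distr P borel (%w. f (U w)) \<Otimes>\<^sub>M distr P borel (%w. g (V w))
      = distr (distr P borel U) borel f \<Otimes>\<^sub>M distr (distr P borel V) borel g"
    by (simp add: distr_distr[OF f U] distr_distr[OF g V] o_def)
  also have "... = distr (distr P borel U \<Otimes>\<^sub>M distr P borel V) (borel \<Otimes>\<^sub>M borel) (%(x, y). (f x, g y))"
  proof (rule pair_measure_distr)
    show "sigma_finite_measure (distr (distr P borel V) borel g)"
      by (intro prob_space_imp_sigma_finite prob_space.prob_space_distr prob_space_distr V) (use g in simp)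
  qed (use f g in simp_all)
  also have "... = distr (distr P borel (%w. (U w, V w))) borel (%x. (f (fst x), g (snd x)))"
    using law by (simp add: product_law_def borel_prod case_prod_beta')
  also have "... = distr P borel (%w. (f (U w), g (V w)))"
    by (simp add: distr_distr[OF fg UV] o_def)
  finally show ?thesis using measurable_compose[OF U f] gV by (simp add: product_law_def)
qed

text \<open>The usual freezing argument: the inner integral is the conditional expectation given
  \<open>U\<close>.\<close>

lemma product_law_integral:
  fixes F :: "'a::second_countable_topology \<times> 'b::second_countable_topology => real"
  assumes P: "prob_space P" and law: "product_law P U V"
    and F: "F \<in> borel_measurable borel" and b: "\<And>x. \<bar>F x\<bar> <= K"
  shows "(\<integral>w. F (U w, V w) \<partial>P) = (\<integral>w. (\<integral>w'. F (U w, V w') \<partial>P) \<partial>P)"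
    and "(%w. \<integral>w'. F (U w, V w') \<partial>P) \<in> borel_measurable P"
proof -
  interpret prob_space P by fact
  interpret PP: pair_prob_space P P by unfold_locales
  have U: "U \<in> borel_measurable P" and V: "V \<in> borel_measurable P" using law by (auto simp: product_law_def)
  have UV: "(%w. (U w, V w)) \<in> borel_measurable P" by (intro borel_measurable_Pair U V)
  have UV': "(%p. (U (fst p), V (snd p))) \<in> borel_measurable (P \<Otimes>\<^sub>M P)"
    by (intro borel_measurable_Pair measurable_compose[OF measurable_fst U] measurable_compose[OF measurable_snd V])
  have "distr P borel U \<Otimes>\<^sub>M distr P borel V = distr (P \<Otimes>\<^sub>M P) (borel \<Otimes>\<^sub>M borel) (%(x, y). (U x, V y))"
    by (intro pair_measure_distr U V prob_space_imp_sigma_finite prob_space_distr)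
  then have eq: "distr P borel (%w. (U w, V w)) = distr (P \<Otimes>\<^sub>M P) borel (%p. (U (fst p), V (snd p)))"
    using law by (simp add: product_law_def borel_prod case_prod_beta')
  have int: "integrable (P \<Otimes>\<^sub>M P) (%p. F (U (fst p), V (snd p)))"
    by (rule PP.P.integrable_const_bound[of _ K]) (use b measurable_compose[OF UV' F] in auto)
  have "(\<integral>w. F (U w, V w) \<partial>P) = (\<integral>x. F x \<partial>distr P borel (%w. (U w, V w)))"
    by (rule integral_distr[OF UV F, symmetric])
  also have "... = (\<integral>p. F (U (fst p), V (snd p)) \<partial>(P \<Otimes>\<^sub>M P))"
    unfolding eq by (rule integral_distr[OF UV' F])
  also have "... = (\<integral>w. (\<integral>w'. F (U w, V w') \<partial>P) \<partial>P)"
    using PP.integral_fst'[OF int] by simp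
  finally show "(\<integral>w. F (U w, V w) \<partial>P) = (\<integral>w. (\<integral>w'. F (U w, V w') \<partial>P) \<partial>P)" .
  show "(%w. \<integral>w'. F (U w, V w') \<partial>P) \<in> borel_measurable P"
    using borel_measurable_integrable[OF PP.integrable_fst'[OF int]] by simp
qed

section \<open>One step of the walk as Brownian motion leaving a ball\<close>

context brownian
begin

lemma scaled_integral:
  fixes \<Psi> :: "(rat => real ^ 'd) => real"
  assumes r: "0 < r" and \<Psi>: "\<Psi> \<in> borel_measurable borel"
  shows "(\<integral>w. \<Psi> (pth B w) \<partial>P) = (\<integral>w. \<Psi> (pth (%t w. r *\<^sub>R B (t / r\<^sup>2) w) w) \<partial>P)"
proof -
  have m: "pth (%t w. r *\<^sub>R B (t / r\<^sup>2) w) \<in> borel_measurable P"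
    by (intro pth_measurable std_brownian_motionD(2)[OF std_brownian_motion_scale[OF BM r]])
  have "(\<integral>w. \<Psi> (pth B w) \<partial>P) = (\<integral>x. x \<partial>distr P borel (%w. \<Psi> (pth B w)))"
    by (subst integral_distr) (auto intro: measurable_compose[OF pth_B_measurable \<Psi>])
  also have "... = (\<integral>w. \<Psi> (pth (%t w. r *\<^sub>R B (t / r\<^sup>2) w) w) \<partial>P)"
    unfolding scaled_functional[OF r \<Psi>] by (subst integral_distr) (auto intro: measurable_compose[OF m \<Psi>])
  finally show ?thesis .
qed

text \<open>By \<open>zeta_law\<close> the joint law of exit time and exit point is itself a
  product, so drawing the two independently is exact.\<close>

lemma exit_pair_law:
  assumes \<rho>: "\<rho> \<in> borel_measurable P" "distr P borel \<rho> = distr P borel (ball_exit_time B)"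
    and Z: "std_normal_vector P Z" and ind: "product_law P \<rho> Z"
  shows "distr P borel (%w. (\<rho> w, sgn (Z w))) = distr P borel (%w. (zeta w, B (zeta w) w))"
proof -
  have "distr P borel (%w. (\<rho> w, sgn (Z w))) = distr P borel \<rho> \<Otimes>\<^sub>M distr P borel (%w. sgn (Z w))"
    using product_law_map[OF prob ind, of "%x. x" sgn] sgn_measurable by (simp add: product_law_def)
  also have "distr P borel \<rho> = distr P borel zeta"
    unfolding \<rho>(2) by (rule distr_cong) (auto simp: ball_exit_time_eq)
  finally show ?thesis using zeta_law[OF Z] by simp
qed

end

context exit_domain
begin

text \<open>Along the segment from \<open>x\<close> to \<open>x + v\<close> the frontier cannot be
  met before the end point; a step of full length may end on it, hence the closure.\<close>

lemma step_in_closure: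
  assumes x: "x \<in> closure D" and v: "norm v <= infdist x (frontier D)"
  shows "x + v \<in> closure D"
proof (cases "v = 0")
  case False
  have "x + (1::real) *\<^sub>R v \<in> closure D"
  proof (rule in_closure_until_frontier[where f="%t. x + t *\<^sub>R v"])
    fix s :: real assume s: "0 <= s" "s < 1"
    show "x + s *\<^sub>R v \<notin> frontier D"
    proof
      assume f: "x + s *\<^sub>R v \<in> frontier D"
      then have le: "infdist x (frontier D) <= s * norm v" using infdist_le[OF f, of x] s by (simp add: dist_norm)
      then have "norm v * (1 - s) <= 0" using v by (simp add: algebra_simps)
      then show False using s False by (simp add: mult_le_0_iff)
    qed
  qed (use x in \<open>auto intro!: continuous_intros\<close>)
  then show ?thesis by simp
qed (use x in simp)

end

context dirichlet
begin

text \<open>Brownian scaling reduces the ball of radius \<open>r\<close> to the unit ball. Time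
  scales by \<open>r\<^sup>2\<close>, so the source integral gains this factor, and the
  normalisation of the occupation law puts the dimension in the denominator. For radius zero the
  walk does not move and the identity is trivial.\<close>

lemma W_one_step:
  assumes x: "x \<in> closure D" and r: "0 <= r" "r <= infdist x (frontier D)"
    and \<rho>: "\<rho> \<in> borel_measurable P" "distr P borel \<rho> = distr P borel (ball_exit_time B)"
    and Z: "std_normal_vector P Z" and ind: "product_law P \<rho> Z"
    and VY: "V \<in> borel_measurable P" "Y \<in> borel_measurable P"
      "\<forall>A\<in>sets borel. emeasure (distr P borel (%w. (V w, Y w))) A = occupation_law P B A"
  shows "W t x = (\<integral>w. W (t + r\<^sup>2 * \<rho> w) (x + r *\<^sub>R sgn (Z w)) \<partial>P)
    + r\<^sup>2 / CARD('d) * (\<integral>w. g1 (t + r\<^sup>2 * V w, x + r *\<^sub>R Y w) \<partial>P)"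
proof (cases "r = 0")
  case True
  then show ?thesis using prob_space by simp
next
  case False
  then have r0: "0 < r" using r by simp
  note mv = W_mean_value(1)[OF x r0 r(2), of t]
  let ?B = "%t w. r *\<^sub>R B (t / r\<^sup>2) w"
  let ?S = "%b. enn2real (hit (outer r) b)"
  have cB: "continuous_on {0..} (%t. ?B t w)" if "w \<in> space P" for w
    using std_brownian_motionD(4)[OF std_brownian_motion_scale[OF BM r0] that] .
  have hS: "?S (pth ?B w) = r\<^sup>2 * zeta w" if "w \<in> space P" for w
    using hit_scale[OF r0 that] by (simp add: enn2real_mult)
  have S_m [measurable]: "?S \<in> borel_measurable (borel :: (rat => real^'d) measure)"
  proof -
    have [measurable]: "(%b::rat => real^'d. hit (outer r) b) \<in> borel_measurable borel" by (intro hit_measurable) simp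
    show ?thesis by measurable
  qed
  define \<Psi>1 where "\<Psi>1 = (%b. W (t + ?S b) (x + ev b (?S b)))"
  have \<Psi>1_m: "\<Psi>1 \<in> borel_measurable borel"
  proof -
    have "(%b. (t + ?S b, x + ev b (?S b))) \<in> borel_measurable borel"
      by (intro borel_measurable_Pair borel_measurable_add borel_measurable_const ev_measurable S_m measurable_ident_sets refl)
    from measurable_compose[OF this W_measurable] show ?thesis by (simp add: \<Psi>1_def)
  qed
  have "(\<integral>w. W (t + ?S (pth B w)) (x + B (?S (pth B w)) w) \<partial>P) = (\<integral>w. \<Psi>1 (pth B w) \<partial>P)"
    by (intro Bochner_Integration.integral_cong refl) (simp add: \<Psi>1_def ev_pth[of B, OF B_continuous])
  also have "... = (\<integral>w. \<Psi>1 (pth ?B w) \<partial>P)" by (rule scaled_integral[OF r0 \<Psi>1_m])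
  also have "... = (\<integral>w. W (t + r\<^sup>2 * zeta w) (x + r *\<^sub>R B (zeta w) w) \<partial>P)"
  proof (intro Bochner_Integration.integral_cong refl)
    fix w assume w: "w \<in> space P"
    have "ev (pth ?B w) (r\<^sup>2 * zeta w) = r *\<^sub>R B (zeta w) w"
      using ev_pth[of ?B, OF cB[OF w], of "r\<^sup>2 * zeta w"] r0 by simp
    then show "\<Psi>1 (pth ?B w) = W (t + r\<^sup>2 * zeta w) (x + r *\<^sub>R B (zeta w) w)"
      by (simp add: \<Psi>1_def hS[OF w])
  qed
  also have "... = (\<integral>w. W (t + r\<^sup>2 * \<rho> w) (x + r *\<^sub>R sgn (Z w)) \<partial>P)"
  proof -
    define H where "H = (%p::real \<times> (real^'d). W (t + r\<^sup>2 * fst p) (x + r *\<^sub>R snd p))"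
    have H_m: "H \<in> borel_measurable borel"
    proof -
      have "(%p::real \<times> (real^'d). (t + r\<^sup>2 * fst p, x + r *\<^sub>R snd p)) \<in> borel_measurable borel"
        by (intro borel_measurable_continuous_onI continuous_intros)
      from measurable_compose[OF this W_measurable] show ?thesis by (simp add: H_def)
    qed
    have m1: "(%w. (zeta w, B (zeta w) w)) \<in> borel_measurable P"
      by (intro borel_measurable_Pair zeta_measurable B_zeta_measurable)
    have m2: "(%w. (\<rho> w, sgn (Z w))) \<in> borel_measurable P"
      by (intro borel_measurable_Pair \<rho>(1) measurable_compose[OF std_normal_vector_law(1)[OF Z] sgn_measurable])
    have "(\<integral>w. H (zeta w, B (zeta w) w) \<partial>P) = (\<integral>p. H p \<partial>distr P borel (%w. (zeta w, B (zeta w) w)))"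
      by (rule integral_distr[OF m1 H_m, symmetric])
    also have "... = (\<integral>w. H (\<rho> w, sgn (Z w)) \<partial>P)"
      unfolding exit_pair_law[OF \<rho> Z ind, symmetric] by (rule integral_distr[OF m2 H_m])
    finally show ?thesis by (simp add: H_def)
  qed
  finally have e1: "(\<integral>w. W (t + ?S (pth B w)) (x + B (?S (pth B w)) w) \<partial>P) = (\<integral>w. W (t + r\<^sup>2 * \<rho> w) (x + r *\<^sub>R sgn (Z w)) \<partial>P)" .
  define \<Psi>2 where "\<Psi>2 = (%b. \<integral>s. indicator {0..?S b} s * g1 (t + s, x + ev b s) \<partial>lborel)"
  have \<Psi>2_m: "\<Psi>2 \<in> borel_measurable borel"
    unfolding \<Psi>2_def
  proof (rule lborel.borel_measurable_lebesgue_integral)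
    let ?M = "borel :: (rat => real ^ 'd) measure"
    have s' [measurable]: "(%p. snd p) \<in> borel_measurable (?M \<Otimes>\<^sub>M (lborel :: real measure))" using measurable_snd[of ?M lborel] by simp
    have S' [measurable]: "(%p. ?S (fst p)) \<in> borel_measurable (?M \<Otimes>\<^sub>M (lborel :: real measure))" by (rule measurable_compose[OF measurable_fst S_m])
    have "(%p. g1 (t + snd p, x + ev (fst p) (snd p))) \<in> borel_measurable (?M \<Otimes>\<^sub>M lborel)"
      by (rule measurable_compose[OF _ g1_m])
         (intro borel_measurable_Pair borel_measurable_add borel_measurable_const ev_measurable s' measurable_fst)
    moreover have "(%p. indicator {0..?S (fst p)} (snd p) :: real) \<in> borel_measurable (?M \<Otimes>\<^sub>M lborel)"
      unfolding indicator_def atLeastAtMost_iff by measurable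
    ultimately show "(%(b, s). indicator {0..?S b} s * g1 (t + s, x + ev b s)) \<in> borel_measurable (?M \<Otimes>\<^sub>M lborel)"
      unfolding case_prod_beta' by (rule borel_measurable_times[rotated])
  qed
  define g where "g = (%p. g1 (t + r\<^sup>2 * fst p, x + r *\<^sub>R snd p))"
  have g_m: "g \<in> borel_measurable borel"
    unfolding g_def by (rule measurable_compose[OF _ g1_m]) (intro borel_measurable_continuous_onI continuous_intros)
  have "(\<integral>w. \<Psi>2 (pth B w) \<partial>P) = (\<integral>w. \<Psi>2 (pth ?B w) \<partial>P)" by (rule scaled_integral[OF r0 \<Psi>2_m])
  also have "... = (\<integral>w. r\<^sup>2 * (\<integral>u. indicator {0..zeta w} u * g (u, ev (pth B w) u) \<partial>lborel) \<partial>P)"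
  proof (intro Bochner_Integration.integral_cong refl)
    fix w assume w: "w \<in> space P"
    have "\<Psi>2 (pth ?B w) = (\<integral>s. indicator {0..r\<^sup>2 * zeta w} s * g1 (t + s, x + ev (pth ?B w) s) \<partial>lborel)"
      by (simp add: \<Psi>2_def hS[OF w])
    also have "... = r\<^sup>2 * (\<integral>u. indicator {0..r\<^sup>2 * zeta w} (r\<^sup>2 * u) * g1 (t + r\<^sup>2 * u, x + ev (pth ?B w) (r\<^sup>2 * u)) \<partial>lborel)"
      using lborel_integral_real_affine[of "r\<^sup>2" "%s. indicator {0..r\<^sup>2 * zeta w} s * g1 (t + s, x + ev (pth ?B w) s)" 0] r0 by simp
    also have "(\<integral>u. indicator {0..r\<^sup>2 * zeta w} (r\<^sup>2 * u) * g1 (t + r\<^sup>2 * u, x + ev (pth ?B w) (r\<^sup>2 * u)) \<partial>lborel)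
       = (\<integral>u. indicator {0..zeta w} u * g (u, ev (pth B w) u) \<partial>lborel)"
    proof (intro Bochner_Integration.integral_cong refl)
      fix u :: real
      have "ev (pth ?B w) (r\<^sup>2 * u) = r *\<^sub>R ev (pth B w) u" if "0 <= u"
        using ev_pth[of ?B, OF cB[OF w], of "r\<^sup>2 * u"] ev_pth[of B, OF B_continuous[OF w] that] r0 that by simp
      then show "indicator {0..r\<^sup>2 * zeta w} (r\<^sup>2 * u) * g1 (t + r\<^sup>2 * u, x + ev (pth ?B w) (r\<^sup>2 * u)) = indicator {0..zeta w} u * g (u, ev (pth B w) u)"
        using r0 by (auto simp: indicator_def g_def zero_le_mult_iff)
    qed
    finally show "\<Psi>2 (pth ?B w) = r\<^sup>2 * (\<integral>u. indicator {0..zeta w} u * g (u, ev (pth B w) u) \<partial>lborel)" .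
  qed
  also have "... = r\<^sup>2 / CARD('d) * (\<integral>w. g (V w, Y w) \<partial>P)"
    using occupation_integral[OF VY g_m, of K1] g1_b by (simp add: g_def)
  finally have e2: "(\<integral>w. \<Psi>2 (pth B w) \<partial>P) = r\<^sup>2 / CARD('d) * (\<integral>w. g1 (t + r\<^sup>2 * V w, x + r *\<^sub>R Y w) \<partial>P)"
    by (simp add: g_def)
  show ?thesis unfolding mv using e1 e2 by (simp add: \<Psi>2_def)
qed

end

section \<open>The walk and its bias\<close>

lemma wos_pos_cong:
  assumes "\<And>j. 1 <= j ==> j <= k ==> z j = z' j"
  shows "wos_pos r z x k = wos_pos r z' x k"
  using assms by (induction k) auto

lemma wos_time_cong:
  assumes "\<And>j. 1 <= j ==> j <= k ==> z j = z' j" "\<And>j. 1 <= j ==> j <= k ==> \<rho> j = \<rho>' j"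
  shows "wos_time r z \<rho> x k = wos_time r z' \<rho>' x k"
  using assms
proof (induction k)
  case (Suc k)
  moreover have "wos_pos r z x k = wos_pos r z' x k" by (rule wos_pos_cong) (use Suc in auto)
  ultimately show ?case by simp
qed simp

lemma wos_pos_measurable:
  fixes z :: "nat => 'v => real ^ 'd"
  assumes r: "r \<in> borel_measurable borel" and z: "\<And>j. 1 <= j ==> j <= k ==> z j \<in> borel_measurable M"
  shows "(%w. wos_pos r (%j. z j w) x k) \<in> borel_measurable M"
  using z
proof (induction k)
  case (Suc k)
  then have IH: "(%w. wos_pos r (%j. z j w) x k) \<in> borel_measurable M" by auto
  have zk: "z (Suc k) \<in> borel_measurable M" using Suc by auto
  show ?case unfolding wos_pos.simps
    by (intro borel_measurable_add borel_measurable_scaleR IH measurable_compose[OF IH r] measurable_compose[OF zk sgn_measurable])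
qed simp

lemma wos_time_measurable:
  fixes z :: "nat => 'v => real ^ 'd"
  assumes r: "r \<in> borel_measurable borel" and z: "\<And>j. 1 <= j ==> j <= k ==> z j \<in> borel_measurable M"
    and \<rho>: "\<And>j. 1 <= j ==> j <= k ==> \<rho> j \<in> borel_measurable M"
  shows "(%w. wos_time r (%j. z j w) (%j. \<rho> j w) x k) \<in> borel_measurable M"
  using z \<rho>
proof (induction k)
  case (Suc k)
  then have IH: "(%w. wos_time r (%j. z j w) (%j. \<rho> j w) x k) \<in> borel_measurable M" by auto
  have p: "(%w. wos_pos r (%j. z j w) x k) \<in> borel_measurable M" by (rule wos_pos_measurable[OF r]) (use Suc in auto)
  have \<rho>k: "\<rho> (Suc k) \<in> borel_measurable M" using Suc by auto
  show ?case unfolding wos_time.simps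
    by (intro borel_measurable_add borel_measurable_times borel_measurable_power IH measurable_compose[OF p r] \<rho>k)
qed simp

lemma (in prob_space) abs_expectation_le:
  fixes f :: "'a => real"
  assumes "\<And>w. w \<in> space M ==> \<bar>f w\<bar> <= K" "0 <= K"
  shows "\<bar>expectation f\<bar> <= K"
proof -
  have "\<bar>expectation f\<bar> <= expectation (%w. \<bar>f w\<bar>)" by (rule integral_abs_bound)
  also have "... <= expectation (%_. K)" by (rule integral_mono') (use assms in auto)
  finally show ?thesis by (simp add: prob_space)
qed

text \<open>A single walk. The history after \<open>k\<close> steps is a total function, zero
  outside the indices \<open>1\<close> to \<open>k\<close>, so that it takes values in the same
  Borel space for every \<open>k\<close>; it lists the draws that drive clock and position.\<close>

locale walk = dirichlet P B D g0 g1 K0 K1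
  for P :: "'w measure" and B :: "real => 'w => real ^ 'd" and D g0 g1 K0 K1 +
  fixes rb :: "real ^ 'd => real" and \<rho> V :: "nat => 'w => real" and Z Y :: "nat => 'w => real ^ 'd"
  assumes rb_m: "rb \<in> borel_measurable borel" and rb_b: "\<And>x. 0 <= rb x \<and> rb x <= diameter D"
    and rb_le: "\<And>x. x \<in> closure D ==> rb x <= infdist x (frontier D)"
    and \<rho>_m: "\<And>k. 1 <= k ==> \<rho> k \<in> borel_measurable P"
    and \<rho>_nonneg: "\<And>k w. 1 <= k ==> w \<in> space P ==> 0 <= \<rho> k w"
    and \<rho>_law: "\<And>k. 1 <= k ==> distr P borel (\<rho> k) = distr P borel (ball_exit_time B)"
    and Z_normal: "\<And>k. 1 <= k ==> std_normal_vector P (Z k)"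
    and V_m: "\<And>k. 1 <= k ==> V k \<in> borel_measurable P" and Y_m: "\<And>k. 1 <= k ==> Y k \<in> borel_measurable P"
    and VY_law: "\<And>k. 1 <= k ==> \<forall>A\<in>sets borel. emeasure (distr P borel (%w. (V k w, Y k w))) A = occupation_law P B A"
    and \<rho>Z_indep: "\<And>k. 1 <= k ==> product_law P (\<rho> k) (Z k)"
    and hist_\<rho>Z: "\<And>k. product_law P (%w j. if 1 <= j \<and> j <= k then (\<rho> j w, Z j w) else (0, 0)) (%w. (\<rho> (Suc k) w, Z (Suc k) w))"
    and hist_VY: "\<And>k. product_law P (%w j. if 1 <= j \<and> j <= k then (\<rho> j w, Z j w) else (0, 0)) (%w. (V (Suc k) w, Y (Suc k) w))"
begin

lemma Z_m: "1 <= k ==> Z k \<in> borel_measurable P"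
  by (rule std_normal_vector_law(1)[OF Z_normal])

definition X :: "real ^ 'd => nat => 'w => real ^ 'd" where
  "X x k w = wos_pos rb (%j. Z j w) x k"

definition S :: "real ^ 'd => nat => 'w => real" where
  "S x k w = wos_time rb (%j. Z j w) (%j. \<rho> j w) x k"

text \<open>The whole past is tested and not only the current position: a walk that has once come
  near may wander off again. Testing all steps makes \<open>far\<close> decreasing in
  \<open>k\<close>, and walks that have been near are handled by the supermartingale bound
  \<open>mc_near\<close>.\<close>

definition far :: "real => real ^ 'd => nat => 'w => real" where
  "far \<delta> x k w = (if \<forall>j\<le>k. \<delta> <= infdist (X x j w) (frontier D) then 1 else 0)"

lemma X_0 [simp]: "X x 0 w = x" and X_Suc: "X x (Suc k) w = X x k w + rb (X x k w) *\<^sub>R sgn (Z (Suc k) w)"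
  and S_0 [simp]: "S x 0 w = 0" and S_Suc: "S x (Suc k) w = S x k w + (rb (X x k w))\<^sup>2 * \<rho> (Suc k) w"
  by (simp_all add: X_def S_def)

lemma X_m: "X x k \<in> borel_measurable P"
  unfolding X_def by (rule wos_pos_measurable[OF rb_m]) (rule Z_m)

lemma S_m: "S x k \<in> borel_measurable P"
  unfolding S_def by (rule wos_time_measurable[OF rb_m]) (auto intro: Z_m \<rho>_m)

lemma far_m: "far \<delta> x k \<in> borel_measurable P"
proof -
  have [measurable]: "(%w. infdist (X x j w) (frontier D)) \<in> borel_measurable P" for j
    by (rule measurable_compose[OF X_m]) (intro borel_measurable_continuous_onI continuous_intros)
  show ?thesis unfolding far_def by measurable
qed

lemma X_closure: "x \<in> closure D ==> X x k w \<in> closure D"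
proof (induction k)
  case (Suc k)
  have "norm (rb (X x k w) *\<^sub>R sgn (Z (Suc k) w)) <= rb (X x k w)"
    using rb_b by (simp add: norm_sgn)
  also have "... <= infdist (X x k w) (frontier D)" using Suc by (intro rb_le)
  finally show ?case unfolding X_Suc using Suc by (intro step_in_closure) auto
qed simp

lemma S_nonneg: "w \<in> space P ==> 0 <= S x k w"
  by (induction k) (auto simp: S_Suc \<rho>_nonneg)

text \<open>Being a Borel function of the history, the state inherits the independence of the next
  draws.\<close>

lemma state_of_history:
  obtains f :: "(nat => real \<times> (real ^ 'd)) => real \<times> (real \<times> (real ^ 'd))"
  where "f \<in> borel_measurable borel"
    "\<And>w. f (%j. if 1 <= j \<and> j <= k then (\<rho> j w, Z j w) else (0, 0)) = (far \<delta> x k w, (S x k w, X x k w))"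
proof
  let ?h = "%w j. if 1 <= j \<and> j <= k then (\<rho> j w, Z j w) else (0, 0)"
  define px where "px l e = wos_pos rb (%j. snd (e j)) x l" for l and e :: "nat => real \<times> (real ^ 'd)"
  define tx where "tx e = wos_time rb (%j. snd (e j)) (%j. fst (e j)) x k" for e :: "nat => real \<times> (real ^ 'd)"
  define ax where "ax e = (if \<forall>j\<le>k. \<delta> <= infdist (px j e) (frontier D) then 1 else 0 :: real)" for e
  have f1: "(%e::nat => real \<times> (real ^ 'd). fst (e j)) \<in> borel_measurable borel"
    and f2: "(%e::nat => real \<times> (real ^ 'd). snd (e j)) \<in> borel_measurable borel" for j
    by (rule measurable_compose[OF component_measurable borel_fst_measurable] measurable_compose[OF component_measurable borel_snd_measurable])+
  have pm: "px l \<in> borel_measurable borel" for l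
    unfolding px_def by (rule wos_pos_measurable[OF rb_m]) (rule f2)
  have tm: "tx \<in> borel_measurable borel"
    unfolding tx_def by (rule wos_time_measurable[OF rb_m]) (rule f1 f2)+
  have am: "ax \<in> borel_measurable borel"
  proof -
    have [measurable]: "(%e. infdist (px j e) (frontier D)) \<in> borel_measurable borel" for j
      by (rule measurable_compose[OF pm]) (intro borel_measurable_continuous_onI continuous_intros)
    show ?thesis unfolding ax_def by measurable
  qed
  show "(%e. (ax e, (tx e, px k e))) \<in> borel_measurable borel"
    by (intro borel_measurable_Pair am tm pm)
  have px: "px l (?h w) = X x l w" if "l <= k" for l w
    unfolding px_def X_def by (rule wos_pos_cong) (use that in auto)
  have tx: "tx (?h w) = S x k w" for w
    unfolding tx_def S_def by (rule wos_time_cong) auto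
  show "(%e. (ax e, (tx e, px k e))) (?h w) = (far \<delta> x k w, (S x k w, X x k w))" for w
    using px tx by (simp add: ax_def far_def)
qed

lemma state_law:
  shows "product_law P (%w. (far \<delta> x k w, (S x k w, X x k w))) (%w. (\<rho> (Suc k) w, Z (Suc k) w))"
    and "product_law P (%w. (far \<delta> x k w, (S x k w, X x k w))) (%w. (V (Suc k) w, Y (Suc k) w))"
proof -
  obtain f :: "(nat => real \<times> (real ^ 'd)) => real \<times> (real \<times> (real ^ 'd))" where f: "f \<in> borel_measurable borel"
    "\<And>w. f (%j. if 1 <= j \<and> j <= k then (\<rho> j w, Z j w) else (0, 0)) = (far \<delta> x k w, (S x k w, X x k w))"
    by (rule state_of_history[of k \<delta> x]) (rule that)
  show "product_law P (%w. (far \<delta> x k w, (S x k w, X x k w))) (%w. (\<rho> (Suc k) w, Z (Suc k) w))"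
    using product_law_map[OF prob hist_\<rho>Z[of k] f(1), of "%x. x"] unfolding f(2) by simp
  show "product_law P (%w. (far \<delta> x k w, (S x k w, X x k w))) (%w. (V (Suc k) w, Y (Suc k) w))"
    using product_law_map[OF prob hist_VY[of k] f(1), of "%x. x"] unfolding f(2) by simp
qed

text \<open>Cutting off outside the closure makes the solution bounded everywhere, by
  \<open>Kw\<close>; walks started in the closure never see the cut.\<close>

definition Wc :: "real \<times> (real ^ 'd) => real" where
  "Wc = (%(t, y). if y \<in> closure D then W t y else 0)"

definition Kw :: real where
  "Kw = K0 + R\<^sup>2 / CARD('d) * K1"

lemma Wc_bound: "\<bar>Wc p\<bar> <= Kw"
proof -
  obtain t y where p: "p = (t, y)" by (cases p)
  have Kw0: "0 <= Kw" unfolding Kw_def using K_nonneg by simp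
  show ?thesis
  proof (cases "y \<in> closure D")
    case True
    have "\<bar>W t y\<bar> <= K0 + mtau y * K1" by (rule W_bound[OF True])
    also have "... <= Kw" unfolding Kw_def by (intro add_left_mono mult_right_mono tau_integrable(4)[OF True] K_nonneg)
    finally show ?thesis using True by (simp add: Wc_def p)
  qed (use Kw0 in \<open>simp add: Wc_def p\<close>)
qed

lemma Wc_m: "Wc \<in> borel_measurable borel"
proof -
  note [measurable] = W_measurable borel_snd_measurable[where ?'a=real and ?'b="real^'d"]
  have [measurable]: "closure D \<in> sets borel" by (rule borel_closed) simp
  show ?thesis unfolding Wc_def case_prod_beta' by measurable
qed

lemma Wc_step:
  assumes y: "y \<in> closure D" and k: "1 <= k"
  shows "Wc (t, y) = (\<integral>w. Wc (t + (rb y)\<^sup>2 * \<rho> k w, y + rb y *\<^sub>R sgn (Z k w)) \<partial>P)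
    + 1 / CARD('d) * (\<integral>w. (rb y)\<^sup>2 * g1 (t + (rb y)\<^sup>2 * V k w, y + rb y *\<^sub>R Y k w) \<partial>P)"
proof -
  have cl: "y + rb y *\<^sub>R sgn (Z k w) \<in> closure D" for w
    using rb_le[OF y] rb_b[of y] by (intro step_in_closure[OF y]) (auto simp: norm_sgn)
  show ?thesis
    using W_one_step[OF y _ rb_le[OF y] \<rho>_m[OF k] \<rho>_law[OF k] Z_normal[OF k] \<rho>Z_indep[OF k] V_m[OF k] Y_m[OF k] VY_law[OF k], of t] rb_b[of y]
    by (simp add: Wc_def y cl)
qed

definition incr :: "real ^ 'd => nat => 'w => real" where
  "incr x k w = (rb (X x k w))\<^sup>2 * g1 (S x k w + (rb (X x k w))\<^sup>2 * V (Suc k) w, X x k w + rb (X x k w) *\<^sub>R Y (Suc k) w)"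

lemma rb_sq_le: "(rb y)\<^sup>2 <= R\<^sup>2"
  using rb_b[of y] by (intro power_mono) auto

lemma incr_bound: "\<bar>incr x k w\<bar> <= R\<^sup>2 * K1"
  unfolding incr_def abs_mult using rb_sq_le g1_b by (intro mult_mono) auto

lemma incr_m: "incr x k \<in> borel_measurable P"
  unfolding incr_def
  by (intro borel_measurable_times borel_measurable_power measurable_compose[OF X_m rb_m] measurable_compose[OF _ g1_m]
    borel_measurable_Pair borel_measurable_add borel_measurable_scaleR S_m X_m V_m Y_m) auto

text \<open>The state after \<open>k\<close> steps is frozen, being independent of the next draws,
  and the one-step identity is applied: in the mean, the solution at the state decreases exactly by
  the source collected in the step.\<close>

lemma Wc_recursion:
  assumes x: "x \<in> closure D"
  shows "(\<integral>w. Wc (S x k w, X x k w) \<partial>P) = (\<integral>w. Wc (S x (Suc k) w, X x (Suc k) w) \<partial>P) + 1 / CARD('d) * (\<integral>w. incr x k w \<partial>P)"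
proof -
  define F1 where "F1 = (%p :: (real \<times> (real \<times> (real ^ 'd))) \<times> (real \<times> (real ^ 'd)).
     Wc (fst (snd (fst p)) + (rb (snd (snd (fst p))))\<^sup>2 * fst (snd p), snd (snd (fst p)) + rb (snd (snd (fst p))) *\<^sub>R sgn (snd (snd p))))"
  define F2 where "F2 = (%p :: (real \<times> (real \<times> (real ^ 'd))) \<times> (real \<times> (real ^ 'd)).
     (rb (snd (snd (fst p))))\<^sup>2 * g1 (fst (snd (fst p)) + (rb (snd (snd (fst p))))\<^sup>2 * fst (snd p), snd (snd (fst p)) + rb (snd (snd (fst p))) *\<^sub>R snd (snd p)))"
  let ?M = "borel :: ((real \<times> (real \<times> (real ^ 'd))) \<times> (real \<times> (real ^ 'd))) measure"
  have s: "(%p. fst (snd (fst p))) \<in> borel_measurable ?M" and y: "(%p. snd (snd (fst p))) \<in> borel_measurable ?M"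
    and u: "(%p. fst (snd p)) \<in> borel_measurable ?M" and v: "(%p. snd (snd p)) \<in> borel_measurable ?M"
    by (intro borel_measurable_continuous_onI continuous_intros)+
  have F1_m: "F1 \<in> borel_measurable borel"
    unfolding F1_def
    by (rule measurable_compose[OF _ Wc_m]) (intro borel_measurable_Pair borel_measurable_add borel_measurable_times borel_measurable_power
        borel_measurable_scaleR s y u measurable_compose[OF y rb_m] measurable_compose[OF v sgn_measurable])
  have F2_m: "F2 \<in> borel_measurable borel"
    unfolding F2_def
    by (intro borel_measurable_times borel_measurable_power measurable_compose[OF y rb_m] measurable_compose[OF _ g1_m]
        borel_measurable_Pair borel_measurable_add borel_measurable_scaleR s y u v)
  have F1_b: "\<bar>F1 p\<bar> <= Kw" for p unfolding F1_def by (rule Wc_bound)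
  have F2_b: "\<bar>F2 p\<bar> <= R\<^sup>2 * K1" for p unfolding F2_def abs_mult using rb_sq_le g1_b by (intro mult_mono) auto
  note L1 = product_law_integral[OF prob state_law(1)[of 0 x k] F1_m F1_b]
  note L2 = product_law_integral[OF prob state_law(2)[of 0 x k] F2_m F2_b]
  let ?U = "%w. (far 0 x k w, (S x k w, X x k w))"
  have step: "Wc (S x k w, X x k w) = (\<integral>w'. F1 (?U w, (\<rho> (Suc k) w', Z (Suc k) w')) \<partial>P) + 1 / CARD('d) * (\<integral>w'. F2 (?U w, (V (Suc k) w', Y (Suc k) w')) \<partial>P)" for w
    using Wc_step[OF X_closure[OF x], of "Suc k" "S x k w" k w] by (simp add: F1_def F2_def)
  have b1: "\<bar>\<integral>w'. F1 (?U w, (\<rho> (Suc k) w', Z (Suc k) w')) \<partial>P\<bar> <= Kw" for w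
    by (rule abs_expectation_le[OF F1_b order_trans[OF abs_ge_zero F1_b[of undefined]]])
  have b2: "\<bar>\<integral>w'. F2 (?U w, (V (Suc k) w', Y (Suc k) w')) \<partial>P\<bar> <= R\<^sup>2 * K1" for w
    by (rule abs_expectation_le[OF F2_b order_trans[OF abs_ge_zero F2_b[of undefined]]])
  have i1: "integrable P (%w. \<integral>w'. F1 (?U w, (\<rho> (Suc k) w', Z (Suc k) w')) \<partial>P)"
    by (rule integrable_const_bound[of _ Kw]) (use L1(2) b1 in auto)
  have i2: "integrable P (%w. \<integral>w'. F2 (?U w, (V (Suc k) w', Y (Suc k) w')) \<partial>P)"
    by (rule integrable_const_bound[of _ "R\<^sup>2 * K1"]) (use L2(2) b2 in auto)
  have "(\<integral>w. Wc (S x k w, X x k w) \<partial>P)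
     = (\<integral>w. F1 (?U w, (\<rho> (Suc k) w, Z (Suc k) w)) \<partial>P) + 1 / CARD('d) * (\<integral>w. F2 (?U w, (V (Suc k) w, Y (Suc k) w)) \<partial>P)"
    unfolding step L1(1) L2(1) using i1 i2 by simp
  then show ?thesis by (simp add: F1_def F2_def incr_def S_Suc X_Suc)
qed

definition sample :: "real ^ 'd => nat => 'w => real" where
  "sample x M w = g0 (S x M w, X x M w) + 1 / CARD('d) * (\<Sum>k<M. incr x k w)"

lemma sample_m: "sample x M \<in> borel_measurable P"
  unfolding sample_def
  by (intro borel_measurable_add borel_measurable_times borel_measurable_const borel_measurable_sum incr_m
    measurable_compose[OF _ g0_m] borel_measurable_Pair S_m X_m)

lemma sample_bound: "\<bar>sample x M w\<bar> <= K0 + M * R\<^sup>2 * K1 / CARD('d)"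
proof -
  have "\<bar>\<Sum>k<M. incr x k w\<bar> <= (\<Sum>k<M. R\<^sup>2 * K1)"
    by (intro order_trans[OF sum_abs] sum_mono incr_bound)
  then have "\<bar>\<Sum>k<M. incr x k w\<bar> <= M * R\<^sup>2 * K1" by (simp add: mult.assoc)
  then have "\<bar>1 / CARD('d) * (\<Sum>k<M. incr x k w)\<bar> <= M * R\<^sup>2 * K1 / CARD('d)"
    by (simp add: abs_mult divide_right_mono)
  then show ?thesis unfolding sample_def using g0_b[of "(S x M w, X x M w)"] by linarith
qed

text \<open>Summing the recursion over the steps, everything cancels except the replacement of the
  solution by the boundary datum at the last state.\<close>

lemma sample_expectation:
  assumes x: "x \<in> closure D"
  shows "W 0 x - (\<integral>w. sample x M w \<partial>P) = (\<integral>w. Wc (S x M w, X x M w) - g0 (S x M w, X x M w) \<partial>P)"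
proof -
  have ii: "integrable P (incr x k)" for k
    by (rule integrable_const_bound[of _ "R\<^sup>2 * K1"]) (use incr_bound incr_m in auto)
  have SX: "(%w. (S x k w, X x k w)) \<in> borel_measurable P" for k by (intro borel_measurable_Pair S_m X_m)
  have iW: "integrable P (%w. Wc (S x k w, X x k w))" for k
    by (rule integrable_const_bound[of _ Kw]) (use Wc_bound measurable_compose[OF SX Wc_m] in auto)
  have ig: "integrable P (%w. g0 (S x k w, X x k w))" for k
    by (rule integrable_const_bound[of _ K0]) (use g0_b measurable_compose[OF SX g0_m] in auto)
  have "Wc (0, x) = (\<integral>w. Wc (S x M w, X x M w) \<partial>P) + 1 / CARD('d) * (\<Sum>k<M. \<integral>w. incr x k w \<partial>P)"
  proof (induction M)
    case (Suc M)
    then show ?case using Wc_recursion[OF x, of M] by (simp add: algebra_simps add_divide_distrib)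
  qed (simp add: prob_space)
  then have "W 0 x = (\<integral>w. Wc (S x M w, X x M w) \<partial>P) + 1 / CARD('d) * (\<Sum>k<M. \<integral>w. incr x k w \<partial>P)"
    using x by (simp add: Wc_def)
  moreover have "(\<integral>w. sample x M w \<partial>P) = (\<integral>w. g0 (S x M w, X x M w) \<partial>P) + 1 / CARD('d) * (\<Sum>k<M. \<integral>w. incr x k w \<partial>P)"
    unfolding sample_def using ig ii by (simp add: Bochner_Integration.integral_sum)
  ultimately show ?thesis using iW ig by simp
qed

end

section \<open>Mean exit times along the walk and the bias of a sample\<close>

context exit_domain
begin

text \<open>The mean exit time is the solution for boundary value \<open>0\<close> and source
  \<open>1\<close>, so the one-step identity applies to it as well.\<close>

lemma mtau_dirichlet:
  "dirichlet P B D (%_. 0) (%_. 1) 0 1"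
  by unfold_locales auto

lemma mtau_eq_W:
  assumes y: "y \<in> closure D"
  shows "dirichlet.W P B D (%_. 0) (%_. 1) t y = mtau y"
proof -
  interpret m: dirichlet P B D "%_. 0" "%_. 1" 0 1 by (rule mtau_dirichlet)
  show ?thesis using m.W_eq[OF y, of t] by (simp add: mtau_def)
qed

end

context dirichlet
begin

text \<open>Until the exit the arguments of \<open>g0\<close> move by \<open>tau\<close> in time and
  by the norm of \<open>B\<close> in space, whose mean is at most a square root of the mean exit
  time; the source adds at most \<open>K1\<close> times that time. The second bound uses only the
  sizes of the data and serves where the mean exit time is not small.\<close>

lemma W_minus_g0:
  assumes t: "0 <= t" and y: "y \<in> closure D" and L: "0 <= L1" "0 <= L2"
    and lip: "\<And>s t x y. 0 <= s ==> 0 <= t ==> x \<in> closure D ==> y \<in> closure D ==> \<bar>g0 (s, x) - g0 (t, y)\<bar> <= L1 * \<bar>s - t\<bar> + L2 * norm (x - y)"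
  shows "\<bar>W t y - g0 (t, y)\<bar> <= (L1 + K1) * mtau y + L2 * sqrt (CARD('d) * mtau y)"
    and "\<bar>W t y - g0 (t, y)\<bar> <= 2 * K0 + R\<^sup>2 / CARD('d) * K1"
proof -
  note [measurable] = B_tau_measurable[of y]
  have m0: "(%w. g0 (t + tau y w, y + B (tau y w) w)) \<in> borel_measurable P"
    by (rule measurable_compose[OF _ g0_m]) (intro borel_measurable_Pair; measurable)
  have i0: "integrable P (%w. g0 (t + tau y w, y + B (tau y w) w))"
    by (rule integrable_const_bound[of _ K0]) (use g0_b m0 in auto)
  have it: "integrable P (tau y)" by (rule tau_integrable(1)[OF y])
  note iB = expectation_norm_B_tau[OF y]
  define E0 where "E0 = (\<integral>w. g0 (t + tau y w, y + B (tau y w) w) \<partial>P)"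
  have "\<bar>E0 - g0 (t, y)\<bar> = \<bar>expectation (%w. g0 (t + tau y w, y + B (tau y w) w) - g0 (t, y))\<bar>"
    unfolding E0_def using i0 prob_space by simp
  also have "... <= expectation (%w. \<bar>g0 (t + tau y w, y + B (tau y w) w) - g0 (t, y)\<bar>)"
    by (rule integral_abs_bound)
  also have "... <= expectation (%w. L1 * tau y w + L2 * norm (B (tau y w) w))"
  proof (rule integral_mono_AE)
    show "AE w in P. \<bar>g0 (t + tau y w, y + B (tau y w) w) - g0 (t, y)\<bar> <= L1 * tau y w + L2 * norm (B (tau y w) w)"
      using tau_props(2)[OF y]
    proof eventually_elim
      case (elim w)
      have "y + B (tau y w) w \<in> closure D" using elim by simp
      from lip[OF _ t this y, of "t + tau y w"] show ?case using t by simp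
    qed
  qed (use i0 it iB in auto)
  also have "... = L1 * mtau y + L2 * expectation (%w. norm (B (tau y w) w))"
    using it iB by (simp add: mtau_def)
  also have "... <= L1 * mtau y + L2 * sqrt (CARD('d) * mtau y)"
    using iB(2) L by (intro add_left_mono mult_left_mono)
  finally have 1: "\<bar>E0 - g0 (t, y)\<bar> <= L1 * mtau y + L2 * sqrt (CARD('d) * mtau y)" .
  define E1 where "E1 = (\<integral>w. (\<integral>s. indicator {0..tau y w} s * g1 (t + s, y + B s w) \<partial>lborel) \<partial>P)"
  have WE: "W t y = E0 + E1" unfolding E0_def E1_def by (rule W_eq[OF y])
  have 2: "\<bar>E1\<bar> <= K1 * mtau y"
  proof -
    have pt: "\<bar>\<integral>s. indicator {0..tau y w} s * g1 (t + s, y + B s w) \<partial>lborel\<bar> <= tau y w * K1" if w: "w \<in> space P" for w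
    proof -
      have "(\<integral>s. indicator {0..tau y w} s * g1 (t + s, y + B s w) \<partial>lborel) = (\<integral>s. indicator {0..tau y w} s * g1 (t + s, y + ev (pth B w) s) \<partial>lborel)"
        by (intro Bochner_Integration.integral_cong refl) (auto simp: indicator_def ev_pth[of B, OF B_continuous[OF w]])
      then show ?thesis using integral_interval_bound[OF g1_path_measurable g1_b, of "tau y w"] by simp
    qed
    have "\<bar>E1\<bar> <= expectation (%w. \<bar>\<integral>s. indicator {0..tau y w} s * g1 (t + s, y + B s w) \<partial>lborel\<bar>)"
      unfolding E1_def by (rule integral_abs_bound)
    also have "... <= expectation (%w. tau y w * K1)"
      by (rule integral_mono') (use it pt K_nonneg in auto)
    also have "... = K1 * mtau y" by (simp add: mtau_def)
    finally show ?thesis .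
  qed
  show "\<bar>W t y - g0 (t, y)\<bar> <= (L1 + K1) * mtau y + L2 * sqrt (CARD('d) * mtau y)"
    using 1 2 unfolding WE by (simp add: algebra_simps)
  have "\<bar>E0\<bar> <= K0" unfolding E0_def by (rule abs_expectation_le) (use g0_b K_nonneg in auto)
  moreover have "K1 * mtau y <= R\<^sup>2 / CARD('d) * K1"
    using mult_left_mono[OF tau_integrable(4)[OF y] K_nonneg(2)] by (simp add: mult.commute)
  ultimately show "\<bar>W t y - g0 (t, y)\<bar> <= 2 * K0 + R\<^sup>2 / CARD('d) * K1"
    using g0_b[of "(t, y)"] 2 unfolding WE by linarith
qed

end

text \<open>Negation is orthogonal, so the law of the direction is symmetric.\<close>

lemma sgn_std_normal_mean_zero:
  assumes P: "prob_space P" and Z: "std_normal_vector P (Z :: 'w => real ^ 'd)"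
  shows "(\<integral>w. sgn (Z w) \<bullet> v \<partial>P) = 0"
proof -
  have m: "(%w. sgn (Z w)) \<in> borel_measurable P"
    by (rule measurable_compose[OF std_normal_vector_law(1)[OF Z] sgn_measurable])
  let ?\<nu> = "distr P borel (%w. sgn (Z w))"
  have o: "orthogonal_transformation (uminus :: real^'d => _)"
    by (simp add: orthogonal_transformation_neg orthogonal_transformation_id[unfolded id_def])
  have "(\<integral>x. x \<bullet> v \<partial>?\<nu>) = (\<integral>x. x \<bullet> v \<partial>distr ?\<nu> borel uminus)"
    using sgn_gauss_law(3)[OF P Z o] by simp
  also have "... = - (\<integral>x. x \<bullet> v \<partial>?\<nu>)" by (subst integral_distr) auto
  finally have "(\<integral>x. x \<bullet> v \<partial>?\<nu>) = 0" by simp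
  then show ?thesis by (subst (asm) integral_distr[OF m]) auto
qed

lemma std_normal_norm_sgn:
  assumes P: "prob_space P" and Z: "std_normal_vector P (Z :: 'w => real ^ 'd)"
  shows "AE w in P. norm (sgn (Z w)) = 1"
  using sgn_gauss_law(2)[OF P Z] measurable_compose[OF std_normal_vector_law(1)[OF Z] sgn_measurable]
  by (subst (asm) AE_distr_iff) auto

context walk
begin

lemma far_antimono: "far \<delta> x (Suc k) w <= far \<delta> x k w"
  by (auto simp: far_def)

lemma far_integrable: "integrable P (far \<delta> x k)"
  by (rule integrable_const_bound[of _ 1]) (use far_m in \<open>auto simp: far_def\<close>)

definition mc :: "real ^ 'd => real" where
  "mc y = (if y \<in> closure D then mtau y else 0)"

lemma mc_m: "mc \<in> borel_measurable borel"
proof -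
  interpret m: dirichlet P B D "%_. 0" "%_. 1" 0 1 by (rule mtau_dirichlet)
  have "(%y::real^'d. (0::real, y)) \<in> borel_measurable borel" by (intro borel_measurable_Pair) auto
  from measurable_compose[OF this m.W_measurable] have [measurable]: "m.W 0 \<in> borel_measurable borel" by simp
  have [measurable]: "closure D \<in> sets borel" by (rule borel_closed) simp
  have "mc = (%y. if y \<in> closure D then m.W 0 y else 0)" by (auto simp: mc_def mtau_eq_W)
  then show ?thesis by simp
qed

lemma mc_bounds: "0 <= mc y" "mc y <= R\<^sup>2 / CARD('d)"
  by (auto simp: mc_def tau_integrable)

text \<open>The source \<open>1\<close> contributes a nonnegative amount in each step; dropping it
  leaves a supermartingale inequality.\<close>

lemma mc_step:
  assumes y: "y \<in> closure D" and k: "1 <= k"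
  shows "(\<integral>w. mc (y + rb y *\<^sub>R sgn (Z k w)) \<partial>P) <= mc y"
proof -
  interpret m: dirichlet P B D "%_. 0" "%_. 1" 0 1 by (rule mtau_dirichlet)
  have cl: "y + rb y *\<^sub>R sgn (Z k w) \<in> closure D" for w
    using rb_le[OF y] rb_b[of y] by (intro step_in_closure[OF y]) (auto simp: norm_sgn)
  have "mtau y = (\<integral>w. mtau (y + rb y *\<^sub>R sgn (Z k w)) \<partial>P) + (rb y)\<^sup>2 / CARD('d)"
    using m.W_one_step[OF y _ rb_le[OF y] \<rho>_m[OF k] \<rho>_law[OF k] Z_normal[OF k] \<rho>Z_indep[OF k] V_m[OF k] Y_m[OF k] VY_law[OF k], of 0] rb_b[of y] prob_space
    by (simp add: mtau_eq_W y cl)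
  then show ?thesis by (simp add: mc_def y cl)
qed

text \<open>Freezing for integrands that look only at \<open>far\<close>, the position and the next
  direction.\<close>

lemma position_step:
  fixes \<phi> :: "real => real ^ 'd => real ^ 'd => real"
  assumes x: "x \<in> closure D" and \<phi>: "(%p. \<phi> (fst p) (fst (snd p)) (snd (snd p))) \<in> borel_measurable borel"
    and b: "\<And>a y z. \<bar>\<phi> a y z\<bar> <= K"
  shows "(\<integral>w. \<phi> (far \<delta> x k w) (X x k w) (Z (Suc k) w) \<partial>P)
    = (\<integral>w. (\<integral>w'. \<phi> (far \<delta> x k w) (X x k w) (Z (Suc k) w') \<partial>P) \<partial>P)"
    and "integrable P (%w. \<integral>w'. \<phi> (far \<delta> x k w) (X x k w) (Z (Suc k) w') \<partial>P)"
proof -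
  define F where "F = (%p :: (real \<times> (real \<times> (real ^ 'd))) \<times> (real \<times> (real ^ 'd)). \<phi> (fst (fst p)) (snd (snd (fst p))) (snd (snd p)))"
  have "(%p :: (real \<times> (real \<times> (real ^ 'd))) \<times> (real \<times> (real ^ 'd)). (fst (fst p), (snd (snd (fst p)), snd (snd p)))) \<in> borel_measurable borel"
    by (intro borel_measurable_continuous_onI continuous_intros)
  from measurable_compose[OF this \<phi>] have F_m: "F \<in> borel_measurable borel" by (simp add: F_def)
  have F_b: "\<bar>F p\<bar> <= K" for p by (simp add: F_def b)
  note L = product_law_integral[OF prob state_law(1)[of \<delta> x k] F_m F_b]
  show "(\<integral>w. \<phi> (far \<delta> x k w) (X x k w) (Z (Suc k) w) \<partial>P)
    = (\<integral>w. (\<integral>w'. \<phi> (far \<delta> x k w) (X x k w) (Z (Suc k) w') \<partial>P) \<partial>P)"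
    using L(1) by (simp add: F_def)
  have "\<bar>\<integral>w'. \<phi> (far \<delta> x k w) (X x k w) (Z (Suc k) w') \<partial>P\<bar> <= K" for w
    by (rule abs_expectation_le[OF b order_trans[OF abs_ge_zero b[of undefined undefined undefined]]])
  then show "integrable P (%w. \<integral>w'. \<phi> (far \<delta> x k w) (X x k w) (Z (Suc k) w') \<partial>P)"
    by (intro integrable_const_bound[of _ K]) (use L(2) in \<open>auto simp: F_def\<close>)
qed

text \<open>Induction over the steps: for walks that have been near before, the mean of
  \<open>mc\<close> does not grow, by \<open>mc_step\<close>; a walk that comes near for the first
  time has \<open>mc\<close> at most \<open>\<delta> * R\<close> by the slab bound.\<close>

lemma mc_near:
  assumes x: "x \<in> closure D" and \<delta>: "0 <= \<delta>"
  shows "(\<integral>w. (1 - far \<delta> x k w) * mc (X x k w) \<partial>P) <= \<delta> * R * (\<integral>w. 1 - far \<delta> x k w \<partial>P)"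
proof (induction k)
  have near: "mc y <= \<delta> * R" if "y \<in> closure D" "\<not> \<delta> <= infdist y (frontier D)" for y
  proof -
    have "mc y <= R * infdist y (frontier D)" using that tau_integrable(5) by (simp add: mc_def)
    also have "... <= R * \<delta>" using that R_nonneg by (intro mult_left_mono) auto
    finally show ?thesis by (simp add: mult.commute)
  qed
  {
    case 0
    show ?case using near[OF x] prob_space by (simp add: far_def)
  next
    case (Suc k)
    let ?a = "far \<delta> x k" and ?a' = "far \<delta> x (Suc k)"
    have iX: "integrable P (%w. (1 - far \<delta> x j w) * mc (X x l w))" for j l
    proof (rule integrable_const_bound[of _ "R\<^sup>2 / CARD('d)"])
      show "AE w in P. norm ((1 - far \<delta> x j w) * mc (X x l w)) <= R\<^sup>2 / CARD('d)"
        using mc_bounds by (intro AE_I2) (auto simp: far_def)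
      show "(%w. (1 - far \<delta> x j w) * mc (X x l w)) \<in> borel_measurable P"
        by (intro borel_measurable_times borel_measurable_diff borel_measurable_const far_m measurable_compose[OF X_m mc_m])
    qed
    have i1: "integrable P (%w. 1 - far \<delta> x j w)" for j using far_integrable by simp
    define \<phi> where "\<phi> a y z = (if a = 1 then 0 else 1) * mc (y + rb y *\<^sub>R sgn z)" for a :: real and y z
    have \<phi>_b: "\<bar>\<phi> a y z\<bar> <= R\<^sup>2 / CARD('d)" for a y z using mc_bounds by (simp add: \<phi>_def)
    have \<phi>_m: "(%p. \<phi> (fst p) (fst (snd p)) (snd (snd p))) \<in> borel_measurable borel"
    proof -
      have a [measurable]: "(%p::real \<times> (real^'d) \<times> (real^'d). fst p) \<in> borel_measurable borel"
        and y: "(%p::real \<times> (real^'d) \<times> (real^'d). fst (snd p)) \<in> borel_measurable borel"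
        and z: "(%p::real \<times> (real^'d) \<times> (real^'d). snd (snd p)) \<in> borel_measurable borel"
        by (intro borel_measurable_continuous_onI continuous_intros)+
      have "(%p::real \<times> (real^'d) \<times> (real^'d). if fst p = 1 then 0 else 1 :: real) \<in> borel_measurable borel" by measurable
      then show ?thesis unfolding \<phi>_def
        by (intro borel_measurable_times measurable_compose[OF _ mc_m] borel_measurable_add borel_measurable_scaleR y measurable_compose[OF y rb_m] measurable_compose[OF z sgn_measurable])
    qed
    have \<phi>_eq: "(1 - ?a w) * mc (X x (Suc k) w) = \<phi> (?a w) (X x k w) (Z (Suc k) w)" for w
      by (simp add: \<phi>_def X_Suc far_def)
    have "(\<integral>w. (1 - ?a' w) * mc (X x (Suc k) w) \<partial>P)
       <= (\<integral>w. (1 - ?a w) * mc (X x (Suc k) w) + \<delta> * R * (?a w - ?a' w) \<partial>P)"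
    proof (rule integral_mono)
      fix w
      show "(1 - ?a' w) * mc (X x (Suc k) w) <= (1 - ?a w) * mc (X x (Suc k) w) + \<delta> * R * (?a w - ?a' w)"
        using near[OF X_closure[OF x, of "Suc k" w]] by (auto simp: far_def le_Suc_eq)
    qed (use iX far_integrable in auto)
    also have "... = (\<integral>w. (1 - ?a w) * mc (X x (Suc k) w) \<partial>P) + \<delta> * R * (\<integral>w. ?a w - ?a' w \<partial>P)"
      using iX far_integrable by simp
    also have "(\<integral>w. (1 - ?a w) * mc (X x (Suc k) w) \<partial>P) = (\<integral>w. (\<integral>w'. \<phi> (?a w) (X x k w) (Z (Suc k) w') \<partial>P) \<partial>P)"
      unfolding \<phi>_eq by (rule position_step(1)[OF x \<phi>_m \<phi>_b])
    also have "... <= (\<integral>w. (1 - ?a w) * mc (X x k w) \<partial>P)"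
    proof (rule integral_mono[OF position_step(2)[OF x \<phi>_m \<phi>_b] iX])
      fix w
      show "(\<integral>w'. \<phi> (?a w) (X x k w) (Z (Suc k) w') \<partial>P) <= (1 - ?a w) * mc (X x k w)"
        using mc_step[OF X_closure[OF x, of k w], of "Suc k"] by (simp add: \<phi>_def far_def)
    qed
    also have "... <= \<delta> * R * (\<integral>w. 1 - ?a w \<partial>P)" by (rule Suc)
    also have "\<delta> * R * (\<integral>w. 1 - ?a w \<partial>P) + \<delta> * R * (\<integral>w. ?a w - ?a' w \<partial>P) = \<delta> * R * (\<integral>w. 1 - ?a' w \<partial>P)"
      using far_integrable by (simp add: distrib_left[symmetric])
    finally show ?case by simp
  }
qed

text \<open>\<open>2 R\<^sup>2 - |y - x|\<^sup>2\<close> lies between \<open>R\<^sup>2\<close> and \<open>2 R\<^sup>2\<close> on \<open>D\<close>, and its mean drops by at least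
  \<open>\<beta>\<^sup>2 \<delta>\<^sup>2\<close> in every step that starts at distance at least \<open>\<delta>\<close> from the boundary.\<close>

lemma far_decay:
  assumes x: "x \<in> closure D" and \<delta>: "0 < \<delta>" and \<beta>: "0 < \<beta>" and R: "0 < R"
    and low: "\<And>y. y \<in> D ==> \<delta> <= infdist y (frontier D) ==> \<beta> * infdist y (frontier D) <= rb y"
  defines "q \<equiv> 1 - \<beta>\<^sup>2 * \<delta>\<^sup>2 / (2 * R\<^sup>2)"
  shows "(\<integral>w. far \<delta> x (Suc k) w \<partial>P) <= 2 * (1 / (1 + \<beta>\<^sup>2 * \<delta>\<^sup>2 / (2 * R\<^sup>2))) ^ Suc k"
proof -
  define f where "f y = 2 * R\<^sup>2 - (norm (y - x))\<^sup>2" for y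
  have f_b: "R\<^sup>2 <= f y \<and> f y <= 2 * R\<^sup>2" if "y \<in> closure D" for y
  proof -
    have "norm (y - x) <= R" using dist_le_R[OF that x] by (simp add: dist_norm)
    then have "(norm (y - x))\<^sup>2 <= R\<^sup>2" by (intro power_mono) auto
    then show ?thesis by (simp add: f_def)
  qed
  have f_m: "f \<in> borel_measurable borel" unfolding f_def by (intro borel_measurable_continuous_onI continuous_intros)
  define fc where "fc y = (if y \<in> closure D then f y else 0)" for y
  have fc_m: "fc \<in> borel_measurable borel"
  proof -
    note [measurable] = f_m
    have [measurable]: "closure D \<in> sets borel" by (rule borel_closed) simp
    show ?thesis unfolding fc_def by measurable
  qed
  have fc_b: "0 <= fc y \<and> fc y <= 2 * R\<^sup>2" for y using f_b[of y] zero_le_power2[of R] by (auto simp: fc_def intro: order_trans)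
  have fstep: "(\<integral>w. fc (y + rb y *\<^sub>R sgn (Z k w)) \<partial>P) <= q * fc y"
    if y: "y \<in> closure D" and k: "1 <= k" and d: "\<delta> <= infdist y (frontier D)" for y k
  proof -
    have cl: "y + rb y *\<^sub>R sgn (Z k w) \<in> closure D" for w
      using rb_le[OF y] rb_b[of y] by (intro step_in_closure[OF y]) (auto simp: norm_sgn)
    have "y \<notin> frontier D" using d \<delta> by auto
    then have yD: "y \<in> D" using y closure_Un_frontier by fastforce
    have "\<beta> * \<delta> <= \<beta> * infdist y (frontier D)" using d \<beta> by simp
    then have "\<beta> * \<delta> <= rb y" using low[OF yD d] by simp
    then have "(\<beta> * \<delta>)\<^sup>2 <= (rb y)\<^sup>2" using \<beta> \<delta> by (intro power_mono) auto
    then have r2: "\<beta>\<^sup>2 * \<delta>\<^sup>2 <= (rb y)\<^sup>2" by (simp add: power_mult_distrib)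
    let ?u = "%w. sgn (Z k w)"
    have um: "?u \<in> borel_measurable P" by (rule measurable_compose[OF Z_m[OF k] sgn_measurable])
    have iu: "integrable P (%w. ?u w \<bullet> (y - x))"
    proof (rule integrable_const_bound[of _ "norm (y - x)"])
      show "AE w in P. norm (?u w \<bullet> (y - x)) <= norm (y - x)"
      proof (rule AE_I2)
        fix w
        have "\<bar>?u w \<bullet> (y - x)\<bar> <= norm (?u w) * norm (y - x)" by (rule Cauchy_Schwarz_ineq2)
        also have "... <= 1 * norm (y - x)" by (intro mult_right_mono) (auto simp: norm_sgn)
        finally show "norm (?u w \<bullet> (y - x)) <= norm (y - x)" by simp
      qed
    qed (use um in simp)
    have "(\<integral>w. fc (y + rb y *\<^sub>R ?u w) \<partial>P) = (\<integral>w. f y - (rb y)\<^sup>2 - 2 * rb y * (?u w \<bullet> (y - x)) \<partial>P)"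
    proof (rule integral_cong_AE)
      show "AE w in P. fc (y + rb y *\<^sub>R ?u w) = f y - (rb y)\<^sup>2 - 2 * rb y * (?u w \<bullet> (y - x))"
        using std_normal_norm_sgn[OF prob Z_normal[OF k]]
      proof eventually_elim
        case (elim w)
        have "(norm (y + rb y *\<^sub>R ?u w - x))\<^sup>2 = (norm ((y - x) + rb y *\<^sub>R ?u w))\<^sup>2" by (simp add: algebra_simps)
        also have "... = (norm (y - x))\<^sup>2 + 2 * rb y * (?u w \<bullet> (y - x)) + (rb y)\<^sup>2 * (norm (?u w))\<^sup>2"
          by (simp only: power2_norm_eq_inner) (simp add: inner_add_left inner_add_right inner_commute power2_eq_square algebra_simps)
        finally show ?case using cl[of w] elim by (simp add: fc_def f_def)
      qed
      show "(%w. fc (y + rb y *\<^sub>R ?u w)) \<in> borel_measurable P"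
        by (rule measurable_compose[OF _ fc_m]) (use um in simp)
    qed (use um in simp)
    also have "... = f y - (rb y)\<^sup>2"
      using iu sgn_std_normal_mean_zero[OF prob Z_normal[OF k], of "y - x"] prob_space by simp
    also have "... <= f y - \<beta>\<^sup>2 * \<delta>\<^sup>2" using r2 by simp
    also have "... <= q * f y"
    proof -
      have "\<beta>\<^sup>2 * \<delta>\<^sup>2 / (2 * R\<^sup>2) * f y <= \<beta>\<^sup>2 * \<delta>\<^sup>2 / (2 * R\<^sup>2) * (2 * R\<^sup>2)"
        using f_b[OF y] by (intro mult_left_mono) auto
      also have "... = \<beta>\<^sup>2 * \<delta>\<^sup>2" using R by simp
      finally show ?thesis unfolding q_def by (simp add: left_diff_distrib)
    qed
    finally show ?thesis using y by (simp add: fc_def)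
  qed
  have iX: "integrable P (%w. far \<delta> x j w * fc (X x l w))" for j l
  proof (rule integrable_const_bound[of _ "2 * R\<^sup>2"])
    show "AE w in P. norm (far \<delta> x j w * fc (X x l w)) <= 2 * R\<^sup>2"
      using fc_b by (intro AE_I2) (auto simp: far_def)
    show "(%w. far \<delta> x j w * fc (X x l w)) \<in> borel_measurable P"
      by (intro borel_measurable_times far_m measurable_compose[OF X_m fc_m])
  qed
  define \<phi> where "\<phi> a y z = (if a = 1 then 1 else 0) * fc (y + rb y *\<^sub>R sgn z)" for a :: real and y z
  have \<phi>_b: "\<bar>\<phi> a y z\<bar> <= 2 * R\<^sup>2" for a y z using fc_b by (simp add: \<phi>_def)
  have \<phi>_m: "(%p. \<phi> (fst p) (fst (snd p)) (snd (snd p))) \<in> borel_measurable borel"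
  proof -
    have a [measurable]: "(%p::real \<times> (real^'d) \<times> (real^'d). fst p) \<in> borel_measurable borel"
      and y: "(%p::real \<times> (real^'d) \<times> (real^'d). fst (snd p)) \<in> borel_measurable borel"
      and z: "(%p::real \<times> (real^'d) \<times> (real^'d). snd (snd p)) \<in> borel_measurable borel"
      by (intro borel_measurable_continuous_onI continuous_intros)+
    have "(%p::real \<times> (real^'d) \<times> (real^'d). if fst p = 1 then 1 else 0 :: real) \<in> borel_measurable borel" by measurable
    then show ?thesis unfolding \<phi>_def
      by (intro borel_measurable_times measurable_compose[OF _ fc_m] borel_measurable_add borel_measurable_scaleR y measurable_compose[OF y rb_m] measurable_compose[OF z sgn_measurable])
  qed
  have step: "(\<integral>w. far \<delta> x k w * fc (X x (Suc k) w) \<partial>P) <= q * (\<integral>w. far \<delta> x k w * fc (X x k w) \<partial>P)" for k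
  proof -
    have eq: "far \<delta> x k w * fc (X x (Suc k) w) = \<phi> (far \<delta> x k w) (X x k w) (Z (Suc k) w)" for w
      by (simp add: \<phi>_def X_Suc far_def)
    have "(\<integral>w. far \<delta> x k w * fc (X x (Suc k) w) \<partial>P) = (\<integral>w. (\<integral>w'. \<phi> (far \<delta> x k w) (X x k w) (Z (Suc k) w') \<partial>P) \<partial>P)"
      unfolding eq by (rule position_step(1)[OF x \<phi>_m \<phi>_b])
    also have "... <= (\<integral>w. q * (far \<delta> x k w * fc (X x k w)) \<partial>P)"
    proof (rule integral_mono[OF position_step(2)[OF x \<phi>_m \<phi>_b]])
      fix w
      show "(\<integral>w'. \<phi> (far \<delta> x k w) (X x k w) (Z (Suc k) w') \<partial>P) <= q * (far \<delta> x k w * fc (X x k w))"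
        using fstep[OF X_closure[OF x, of k w], of "Suc k"] by (simp add: \<phi>_def far_def)
    qed (use iX in simp)
    finally show ?thesis by simp
  qed
  \<comment> \<open>For \<open>\<delta>\<close> large compared with \<open>R\<close> the number
    \<open>q\<close> may be negative, and its powers would be useless. If the walk starts far,
    however, \<open>q * fc x\<close> dominates the mean of a nonnegative function and
    \<open>fc x\<close> is positive.\<close>
  have q0: "0 <= q" if "(\<integral>w. far \<delta> x 0 w \<partial>P) \<noteq> 0"
  proof -
    have "\<delta> <= infdist x (frontier D)"
    proof (rule ccontr)
      assume "\<not> ?thesis"
      then have "far \<delta> x 0 = (%_. 0)" by (auto simp: far_def)
      then show False using that by simp
    qed
    then have "(\<integral>w. fc (x + rb x *\<^sub>R sgn (Z 1 w)) \<partial>P) <= q * fc x" by (intro fstep[OF x]) auto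
    moreover have "0 <= (\<integral>w. fc (x + rb x *\<^sub>R sgn (Z 1 w)) \<partial>P)" using fc_b by (intro integral_nonneg_AE) auto
    ultimately have "0 <= q * fc x" by linarith
    moreover have "0 < fc x" using x R by (simp add: fc_def f_def)
    ultimately show ?thesis by (simp add: zero_le_mult_iff)
  qed
  have zero: "far \<delta> x k w = 0" if "(\<integral>w. far \<delta> x 0 w \<partial>P) = 0" for k w
    using that prob_space by (auto simp: far_def split: if_splits)
  have main: "(\<integral>w. far \<delta> x k w * fc (X x (Suc k) w) \<partial>P) <= 2 * R\<^sup>2 * q ^ Suc k" if nz: "(\<integral>w. far \<delta> x 0 w \<partial>P) \<noteq> 0" for k
  proof (induction k)
    case 0
    have "(\<integral>w. far \<delta> x 0 w * fc (X x 0 w) \<partial>P) <= (\<integral>w. 2 * R\<^sup>2 \<partial>P)"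
      by (rule integral_mono[OF iX]) (use fc_b in \<open>auto simp: far_def\<close>)
    then show ?case using step[of 0] mult_left_mono[OF _ q0[OF nz]] prob_space by (fastforce simp: mult.commute intro: order_trans)
  next
    case (Suc k)
    have "(\<integral>w. far \<delta> x (Suc k) w * fc (X x (Suc k) w) \<partial>P) <= (\<integral>w. far \<delta> x k w * fc (X x (Suc k) w) \<partial>P)"
      by (rule integral_mono[OF iX iX]) (use fc_b far_antimono in \<open>auto intro: mult_right_mono\<close>)
    also have "... <= 2 * R\<^sup>2 * q ^ Suc k" by (rule Suc)
    finally have "q * (\<integral>w. far \<delta> x (Suc k) w * fc (X x (Suc k) w) \<partial>P) <= q * (2 * R\<^sup>2 * q ^ Suc k)"
      using q0[OF nz] by (rule mult_left_mono)
    then show ?case using step[of "Suc k"] by (simp add: mult.commute mult.left_commute)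
  qed
  show ?thesis
  proof (cases "(\<integral>w. far \<delta> x 0 w \<partial>P) = 0")
    case True
    then show ?thesis by (simp add: zero)
  next
    case False
    have "R\<^sup>2 * (\<integral>w. far \<delta> x (Suc k) w \<partial>P) = (\<integral>w. far \<delta> x (Suc k) w * R\<^sup>2 \<partial>P)" by simp
    also have "... <= (\<integral>w. far \<delta> x k w * fc (X x (Suc k) w) \<partial>P)"
    proof (rule integral_mono[OF _ iX])
      fix w
      have "R\<^sup>2 <= fc (X x (Suc k) w)" using f_b[OF X_closure[OF x]] X_closure[OF x] by (simp add: fc_def)
      then show "far \<delta> x (Suc k) w * R\<^sup>2 <= far \<delta> x k w * fc (X x (Suc k) w)"
        using far_antimono[of \<delta> x k w] by (intro mult_mono) (auto simp: far_def)
    qed (use far_integrable in simp)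
    also have "... <= 2 * R\<^sup>2 * q ^ Suc k" by (rule main[OF False])
    finally have "(\<integral>w. far \<delta> x (Suc k) w \<partial>P) <= 2 * q ^ Suc k" using R by (simp add: mult.commute mult.left_commute)
    \<comment> \<open>\<open>1 - a\<close> is at most \<open>1 / (1 + a)\<close>; the latter is the
      form whose logarithm appears in \<open>wos_steps\<close>.\<close>
    also have "q ^ Suc k <= (1 / (1 + \<beta>\<^sup>2 * \<delta>\<^sup>2 / (2 * R\<^sup>2))) ^ Suc k"
    proof (rule power_mono[OF _ q0[OF False]])
      define a where "a = \<beta>\<^sup>2 * \<delta>\<^sup>2 / (2 * R\<^sup>2)"
      have "0 <= a" by (simp add: a_def)
      moreover have "(1 - a) * (1 + a) <= 1" by (simp add: algebra_simps)
      ultimately have "1 - a <= 1 / (1 + a)" by (simp add: field_simps)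
      then show "q <= 1 / (1 + \<beta>\<^sup>2 * \<delta>\<^sup>2 / (2 * R\<^sup>2))" by (simp add: q_def a_def)
    qed
    finally show ?thesis by simp
  qed
qed

text \<open>The final state is split by \<open>far\<close>. If the walk has been near, the Lipschitz
  bound of \<open>W_minus_g0\<close> applies, with means controlled by \<open>mc_near\<close>;
  otherwise the crude bound is multiplied by the geometrically small probability of
  \<open>far_decay\<close>.\<close>

lemma sample_bias:
  assumes x: "x \<in> closure D" and \<delta>: "0 < \<delta>" and \<beta>: "0 < \<beta>" and R: "0 < R"
    and low: "\<And>y. y \<in> D ==> \<delta> <= infdist y (frontier D) ==> \<beta> * infdist y (frontier D) <= rb y"
    and L: "0 <= L1" "0 <= L2"
    and lip: "\<And>s t x y. 0 <= s ==> 0 <= t ==> x \<in> closure D ==> y \<in> closure D ==> \<bar>g0 (s, x) - g0 (t, y)\<bar> <= L1 * \<bar>s - t\<bar> + L2 * norm (x - y)"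
    and M: "1 <= M"
  shows "\<bar>W 0 x - (\<integral>w. sample x M w \<partial>P)\<bar> <= (L1 + K1) * (\<delta> * R) + L2 * sqrt (CARD('d) * (\<delta> * R))
    + (2 * K0 + R\<^sup>2 / CARD('d) * K1) * (2 * (1 / (1 + \<beta>\<^sup>2 * \<delta>\<^sup>2 / (2 * R\<^sup>2))) ^ M)"
proof -
  let ?a = "far \<delta> x M" and ?X = "X x M"
  let ?d = "real CARD('d)"
  let ?C = "2 * K0 + R\<^sup>2 / ?d * K1"
  have C0: "0 <= ?C" using K_nonneg by simp
  have am: "?a \<in> borel_measurable P" by (rule far_m)
  have mm: "(%w. mc (?X w)) \<in> borel_measurable P" by (rule measurable_compose[OF X_m mc_m])
  have SX: "(%w. (S x M w, ?X w)) \<in> borel_measurable P" by (intro borel_measurable_Pair S_m X_m)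
  have b: "\<bar>(1 - ?a w) * mc (?X w)\<bar> <= R\<^sup>2 / ?d" for w
    using mc_bounds[of "?X w"] by (simp add: far_def)
  have i1: "integrable P (%w. (1 - ?a w) * mc (?X w))"
    by (rule integrable_const_bound[of _ "R\<^sup>2 / ?d"]) (use b am mm in auto)
  have i2: "integrable P (%w. (1 - ?a w) * sqrt (?d * mc (?X w)))"
  proof (rule integrable_const_bound[of _ "R"])
    show "AE w in P. norm ((1 - ?a w) * sqrt (?d * mc (?X w))) <= R"
    proof (rule AE_I2)
      fix w
      have "?d * mc (?X w) <= R\<^sup>2" using mc_bounds(2)[of "?X w"] by (simp add: field_simps)
      then have "sqrt (?d * mc (?X w)) <= R" using R by (intro real_le_lsqrt) (auto simp: mc_bounds)
      then show "norm ((1 - ?a w) * sqrt (?d * mc (?X w))) <= R"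
        using R by (auto simp: far_def mc_bounds)
    qed
  qed (use am mm in measurable)
  have near: "(\<integral>w. (1 - ?a w) * mc (?X w) \<partial>P) <= \<delta> * R"
  proof -
    have "(\<integral>w. (1 - ?a w) * mc (?X w) \<partial>P) <= \<delta> * R * (\<integral>w. 1 - ?a w \<partial>P)"
      using mc_near[OF x, of \<delta>] \<delta> by simp
    also have "... <= \<delta> * R * 1"
    proof (rule mult_left_mono)
      have "\<bar>\<integral>w. 1 - ?a w \<partial>P\<bar> <= 1" by (rule abs_expectation_le) (auto simp: far_def)
      then show "(\<integral>w. 1 - ?a w \<partial>P) <= 1" by simp
    qed (use \<delta> R in simp)
    finally show ?thesis by simp
  qed
  \<comment> \<open>Jensen's inequality for the square root; \<open>1 - far\<close> takes only the
    values \<open>0\<close> and \<open>1\<close> and so equals its own square.\<close>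
  have near2: "(\<integral>w. (1 - ?a w) * sqrt (?d * mc (?X w)) \<partial>P) <= sqrt (?d * (\<delta> * R))"
  proof -
    let ?Y = "%w. (1 - ?a w) * sqrt (?d * mc (?X w))"
    have sq: "(?Y w)\<^sup>2 = ?d * ((1 - ?a w) * mc (?X w))" for w
      by (auto simp: far_def mc_bounds)
    have isq: "integrable P (%w. (?Y w)\<^sup>2)" unfolding sq using i1 by simp
    have "0 <= variance ?Y" by (rule variance_positive)
    then have "(expectation ?Y)\<^sup>2 <= expectation (%w. (?Y w)\<^sup>2)" by (simp add: variance_eq[OF i2 isq])
    also have "... = ?d * expectation (%w. (1 - ?a w) * mc (?X w))" unfolding sq by simp
    also have "... <= ?d * (\<delta> * R)" using near by (intro mult_left_mono) auto
    finally show ?thesis by (rule real_le_rsqrt)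
  qed
  obtain M' where M': "M = Suc M'" using M by (cases M) auto
  have dec: "(\<integral>w. ?a w \<partial>P) <= 2 * (1 / (1 + \<beta>\<^sup>2 * \<delta>\<^sup>2 / (2 * R\<^sup>2))) ^ M"
    unfolding M' by (rule far_decay[OF x \<delta> \<beta> R low])
  have pt: "\<bar>Wc (S x M w, ?X w) - g0 (S x M w, ?X w)\<bar>
     <= (L1 + K1) * ((1 - ?a w) * mc (?X w)) + L2 * ((1 - ?a w) * sqrt (?d * mc (?X w))) + ?C * ?a w" if w: "w \<in> space P" for w
    using W_minus_g0[OF S_nonneg[OF w, of x M] X_closure[OF x, of M w] L lip] X_closure[OF x, of M w]
    by (auto simp: far_def Wc_def mc_def)
  have "\<bar>W 0 x - (\<integral>w. sample x M w \<partial>P)\<bar> <= (\<integral>w. \<bar>Wc (S x M w, ?X w) - g0 (S x M w, ?X w)\<bar> \<partial>P)"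
    unfolding sample_expectation[OF x] by (rule integral_abs_bound)
  also have "... <= (\<integral>w. (L1 + K1) * ((1 - ?a w) * mc (?X w)) + L2 * ((1 - ?a w) * sqrt (?d * mc (?X w))) + ?C * ?a w \<partial>P)"
  proof (rule integral_mono'[OF _ pt])
    show "integrable P (%w. (L1 + K1) * ((1 - ?a w) * mc (?X w)) + L2 * ((1 - ?a w) * sqrt (?d * mc (?X w))) + ?C * ?a w)"
      by (intro Bochner_Integration.integrable_add integrable_mult_right i1 i2 far_integrable)
    show "0 <= (L1 + K1) * ((1 - ?a w) * mc (?X w)) + L2 * ((1 - ?a w) * sqrt (?d * mc (?X w))) + ?C * ?a w" if "w \<in> space P" for w
      using pt[OF that] by (rule order_trans[OF abs_ge_zero])
  qed
  also have "... = (L1 + K1) * (\<integral>w. (1 - ?a w) * mc (?X w) \<partial>P) + L2 * (\<integral>w. (1 - ?a w) * sqrt (?d * mc (?X w)) \<partial>P) + ?C * (\<integral>w. ?a w \<partial>P)"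
    using i1 i2 far_integrable[of \<delta> x M]
    by (subst Bochner_Integration.integral_add Bochner_Integration.integral_add; (intro Bochner_Integration.integrable_add integrable_mult_right i1 i2 far_integrable)?)+ simp
  also have "... <= (L1 + K1) * (\<delta> * R) + L2 * sqrt (?d * (\<delta> * R)) + ?C * (2 * (1 / (1 + \<beta>\<^sup>2 * \<delta>\<^sup>2 / (2 * R\<^sup>2))) ^ M)"
    using near near2 dec L K_nonneg C0 by (intro add_mono mult_left_mono) auto
  finally show ?thesis .
qed

end

section \<open>Uniform Monte Carlo estimates\<close>

text \<open>Jensen's inequality for the logarithm in tangent form: \<open>ln z <= z - 1\<close>,
  with \<open>z\<close> the exponential divided by \<open>K\<close>, bounds every term by
  \<open>(ln K - 1) / l\<close> plus a common sum whose mean is at most \<open>1 / l\<close>. The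
  factor \<open>2\<close> in the logarithm counts the two signs.\<close>

lemma (in prob_space) nn_integral_Max_le_mgf:
  fixes X :: "'j => 'a => real"
  assumes N: "finite N" "N \<noteq> {}" and m [measurable]: "\<And>j. j \<in> N ==> X j \<in> borel_measurable M" and l: "0 < l"
    and mgf: "\<And>j. j \<in> N ==> (\<integral>\<^sup>+w. ennreal (exp (l * X j w)) \<partial>M) <= ennreal (exp \<kappa>)"
      "\<And>j. j \<in> N ==> (\<integral>\<^sup>+w. ennreal (exp (l * - X j w)) \<partial>M) <= ennreal (exp \<kappa>)"
    and \<kappa>: "0 <= \<kappa>"
  shows "(\<integral>\<^sup>+w. ennreal (Max ((%j. \<bar>X j w\<bar>) ` N)) \<partial>M) <= ennreal ((ln (2 * card N) + \<kappa>) / l)"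
proof -
  define c where "c = real (card N)"
  have c: "1 <= c" using N by (simp add: c_def Suc_leI card_gt_0_iff)
  define K where "K = 2 * c * exp \<kappa>"
  have K: "0 < K" using c by (simp add: K_def)
  have lnK: "ln K = ln (2 * c) + \<kappa>" using c by (simp add: K_def ln_mult)
  have "exp 0 <= exp \<kappa>" using \<kappa> by simp
  then have "2 * 1 * 1 <= 2 * c * exp \<kappa>" using c by (intro mult_mono) auto
  then have "exp (ln K) >= 2" using K by (simp add: K_def)
  then have K2: "2 <= K" using K by simp
  let ?s = "%w. \<Sum>j\<in>N. exp (l * X j w) + exp (l * - X j w)"
  have pt: "Max ((%j. \<bar>X j w\<bar>) ` N) <= (ln K - 1) / l + ?s w / (K * l)" for w
  proof -
    have "\<bar>X j w\<bar> <= (ln K - 1) / l + ?s w / (K * l)" if j: "j \<in> N" for j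
    proof -
      have "exp (l * \<bar>X j w\<bar>) <= exp (l * X j w) + exp (l * - X j w)"
        by (cases "0 <= X j w") (auto simp: add_increasing add_increasing2)
      also have "... <= ?s w" using j N(1) by (intro member_le_sum) (auto intro: add_nonneg_nonneg)
      finally have e: "exp (l * \<bar>X j w\<bar>) <= ?s w" .
      have "l * \<bar>X j w\<bar> - ln K = ln (exp (l * \<bar>X j w\<bar>) / K)" using K by (simp add: ln_div)
      also have "... <= exp (l * \<bar>X j w\<bar>) / K - 1" using K by (intro ln_le_minus_one) simp
      also have "... <= ?s w / K - 1" using e K by (simp add: divide_right_mono)
      finally have "l * \<bar>X j w\<bar> <= (ln K - 1) + ?s w / K" by simp
      then have "\<bar>X j w\<bar> <= ((ln K - 1) + ?s w / K) / l" using l by (simp add: field_simps)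
      also have "... = (ln K - 1) / l + ?s w / (K * l)" by (simp add: add_divide_distrib)
      finally show ?thesis .
    qed
    then show ?thesis using N by simp
  qed
  have sm [measurable]: "?s \<in> borel_measurable M" by measurable
  have int_s: "(\<integral>\<^sup>+w. ennreal (?s w) \<partial>M) <= ennreal K"
  proof -
    have "(\<integral>\<^sup>+w. ennreal (?s w) \<partial>M) = (\<integral>\<^sup>+w. (\<Sum>j\<in>N. ennreal (exp (l * X j w)) + ennreal (exp (l * - X j w))) \<partial>M)"
      by (simp add: sum_ennreal[symmetric] add_nonneg_nonneg)
    also have "... = (\<Sum>j\<in>N. (\<integral>\<^sup>+w. ennreal (exp (l * X j w)) \<partial>M) + (\<integral>\<^sup>+w. ennreal (exp (l * - X j w)) \<partial>M))"
      by (subst nn_integral_sum) (auto intro!: sum.cong nn_integral_add)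
    also have "... <= (\<Sum>j\<in>N. ennreal (exp \<kappa>) + ennreal (exp \<kappa>))"
      by (intro sum_mono add_mono mgf)
    also have "... = (\<Sum>j\<in>N. ennreal (2 * exp \<kappa>))" by (simp add: ennreal_plus[symmetric] del: ennreal_plus)
    also have "... = ennreal K" by (subst sum_ennreal) (auto simp: K_def c_def)
    finally show ?thesis .
  qed
  show ?thesis
  proof (cases "1 <= ln K")
    case True
    have "(\<integral>\<^sup>+w. ennreal (Max ((%j. \<bar>X j w\<bar>) ` N)) \<partial>M) <= (\<integral>\<^sup>+w. ennreal ((ln K - 1) / l) + ennreal (1 / (K * l)) * ennreal (?s w) \<partial>M)"
    proof (rule nn_integral_mono)
      fix w
      have s0: "0 <= ?s w" by (intro sum_nonneg add_nonneg_nonneg) auto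
      have "ennreal (Max ((%j. \<bar>X j w\<bar>) ` N)) <= ennreal ((ln K - 1) / l + ?s w / (K * l))" by (intro ennreal_leI pt)
      also have "... = ennreal ((ln K - 1) / l) + ennreal (1 / (K * l)) * ennreal (?s w)"
        using True l K s0 by (subst ennreal_plus) (auto simp: ennreal_mult[symmetric] s0)
      finally show "ennreal (Max ((%j. \<bar>X j w\<bar>) ` N)) <= ennreal ((ln K - 1) / l) + ennreal (1 / (K * l)) * ennreal (?s w)" .
    qed
    also have "... = ennreal ((ln K - 1) / l) + ennreal (1 / (K * l)) * (\<integral>\<^sup>+w. ennreal (?s w) \<partial>M)"
      by (subst nn_integral_add) (auto simp: nn_integral_cmult emeasure_space_1)
    also have "... <= ennreal ((ln K - 1) / l) + ennreal (1 / (K * l)) * ennreal K"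
      by (intro add_left_mono mult_left_mono int_s) simp
    also have "ennreal (1 / (K * l)) * ennreal K = ennreal (1 / l)" using K l by (simp add: ennreal_mult[symmetric])
    also have "ennreal ((ln K - 1) / l) + ennreal (1 / l) = ennreal ((ln K - 1) / l + 1 / l)"
      by (rule ennreal_plus[symmetric]) (use True l in auto)
    also have "(ln K - 1) / l + 1 / l = ln K / l" by (simp add: diff_divide_distrib)
    finally show ?thesis by (simp add: lnK c_def)
  next
    \<comment> \<open>Here \<open>ln K - 1\<close> is negative and has no counterpart in
      \<open>ennreal\<close>, so it is moved to the other side; \<open>2 <= K\<close> keeps
      \<open>ln K\<close> nonnegative.\<close>
    case False
    have b: "\<bar>X j w\<bar> <= ?s w / (K * l) + (ln K - 1) / l" if "j \<in> N" for j w
    proof -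
      have "\<bar>X j w\<bar> <= Max ((%j. \<bar>X j w\<bar>) ` N)" using that N by (intro Max_ge) auto
      then show ?thesis using pt[of w] by linarith
    qed
    have M0: "0 <= Max ((%j. \<bar>X j w\<bar>) ` N)" for w
    proof -
      obtain j where "j \<in> N" using N by auto
      then have "\<bar>X j w\<bar> <= Max ((%j. \<bar>X j w\<bar>) ` N)" using N by (intro Max_ge) auto
      then show ?thesis by linarith
    qed
    have "(\<integral>\<^sup>+w. ennreal (Max ((%j. \<bar>X j w\<bar>) ` N)) \<partial>M) + ennreal ((1 - ln K) / l) = (\<integral>\<^sup>+w. ennreal (Max ((%j. \<bar>X j w\<bar>) ` N)) + ennreal ((1 - ln K) / l) \<partial>M)"
    proof (subst nn_integral_add)
      show "(%w. ennreal (Max ((%j. \<bar>X j w\<bar>) ` N))) \<in> borel_measurable M"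
        using borel_measurable_Max[OF N(1), of "%j w. \<bar>X j w\<bar>" M] by simp
    qed (auto simp: emeasure_space_1)
    also have "... <= (\<integral>\<^sup>+w. ennreal (1 / (K * l)) * ennreal (?s w) \<partial>M)"
    proof (rule nn_integral_mono)
      fix w
      have s0: "0 <= ?s w" by (intro sum_nonneg add_nonneg_nonneg) auto
      have "ennreal (Max ((%j. \<bar>X j w\<bar>) ` N)) + ennreal ((1 - ln K) / l) = ennreal (Max ((%j. \<bar>X j w\<bar>) ` N) + (1 - ln K) / l)"
        using M0 False l by (subst ennreal_plus) auto
      also have "... <= ennreal (?s w / (K * l))"
        using pt[of w] by (intro ennreal_leI) (simp add: diff_divide_distrib)
      also have "... = ennreal (1 / (K * l)) * ennreal (?s w)" using s0 K l by (simp add: ennreal_mult[symmetric])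
      finally show "ennreal (Max ((%j. \<bar>X j w\<bar>) ` N)) + ennreal ((1 - ln K) / l) <= ennreal (1 / (K * l)) * ennreal (?s w)" .
    qed
    also have "... = ennreal (1 / (K * l)) * (\<integral>\<^sup>+w. ennreal (?s w) \<partial>M)"
      by (rule nn_integral_cmult) measurable
    also have "... <= ennreal (1 / (K * l)) * ennreal K"
      by (intro mult_left_mono int_s) simp
    also have "... = ennreal (1 / l)" using K l by (simp add: ennreal_mult[symmetric])
    also have "... = ennreal (ln K / l) + ennreal ((1 - ln K) / l)"
      using K2 False l by (simp add: ennreal_plus[symmetric] add_divide_distrib[symmetric] ln_ge_zero del: ennreal_plus)
    finally have "(\<integral>\<^sup>+w. ennreal (Max ((%j. \<bar>X j w\<bar>) ` N)) \<partial>M) <= ennreal (ln K / l)"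
      by (simp add: add.commute[of _ "ennreal ((1 - ln K) / l)"] ennreal_add_left_cancel_le)
    then show ?thesis by (simp add: lnK c_def)
  qed
qed

lemma prod_le_ennreal:
  fixes f g :: "'i => ennreal"
  assumes "finite I" "\<And>i. i \<in> I ==> f i <= g i"
  shows "prod f I <= prod g I"
  using assms by (induction I rule: finite_induct) (auto intro: mult_mono)

text \<open>Hoeffding's lemma for each summand, whose range has width \<open>2 * H\<close>, and
  independence: the exponent is \<open>n * (l / n)\<^sup>2 * (2 * H)\<^sup>2 / 8\<close>.\<close>

lemma (in prob_space) mean_mgf_le:
  fixes A :: "nat => 'a => real"
  assumes ind: "indep_vars (%_. borel) A {1..n}" and n: "0 < n" and H: "\<And>i w. i \<in> {1..n} ==> w \<in> space M ==> \<bar>A i w\<bar> <= H"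
    and l: "0 < l"
  shows "(\<integral>\<^sup>+w. ennreal (exp (l * (1 / n * (\<Sum>i=1..n. A i w - expectation (A i))))) \<partial>M) <= ennreal (exp (l\<^sup>2 * H\<^sup>2 / (2 * real n)))"
proof -
  have A_m: "A i \<in> borel_measurable M" if "i \<in> {1..n}" for i using ind that unfolding indep_vars_def by blast
  have ind': "indep_vars (%_. borel) (%i w. ennreal (exp (l / n * (A i w - expectation (A i))))) {1..n}"
    by (rule indep_vars_compose2[OF ind, of "%i x. ennreal (exp (l / n * (x - expectation (A i))))"]) measurable
  have one: "(\<integral>\<^sup>+w. ennreal (exp (l / n * (A i w - expectation (A i)))) \<partial>M) <= ennreal (exp ((l / n)\<^sup>2 * (2 * H)\<^sup>2 / 8))"
    if i: "i \<in> {1..n}" for i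
  proof -
    interpret iv: interval_bounded_random_variable M "A i" "- H" H
    proof unfold_locales
      show "A i \<in> borel_measurable M" by (rule A_m[OF i])
      show "AE w in M. A i w \<in> {- H..H}"
      proof (rule AE_I2)
        fix w assume "w \<in> space M"
        from H[OF i this] show "A i w \<in> {- H..H}" unfolding atLeastAtMost_iff by linarith
      qed
    qed
    have "(\<integral>\<^sup>+w. ennreal (exp (l / n * (A i w - expectation (A i)))) \<partial>M) <= ennreal (exp ((l / n)\<^sup>2 * (H - - H)\<^sup>2 / 8))"
      by (rule iv.Hoeffdings_lemma_nn_integral) (use l n in simp)
    then show ?thesis by simp
  qed
  have "(\<integral>\<^sup>+w. ennreal (exp (l * (1 / n * (\<Sum>i=1..n. A i w - expectation (A i))))) \<partial>M)
      = (\<integral>\<^sup>+w. (\<Prod>i=1..n. ennreal (exp (l / n * (A i w - expectation (A i))))) \<partial>M)"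
    by (intro nn_integral_cong) (simp add: prod_ennreal exp_sum[symmetric] sum_distrib_left)
  also have "... = (\<Prod>i=1..n. \<integral>\<^sup>+w. ennreal (exp (l / n * (A i w - expectation (A i)))) \<partial>M)"
    by (rule indep_vars_nn_integral[OF _ ind']) auto
  also have "... <= (\<Prod>i=1..n. ennreal (exp ((l / n)\<^sup>2 * (2 * H)\<^sup>2 / 8)))"
    by (rule prod_le_ennreal) (use one in auto)
  also have "... = ennreal (exp ((l / n)\<^sup>2 * (2 * H)\<^sup>2 / 8) ^ n)" by (simp add: prod_constant ennreal_power)
  also have "exp ((l / n)\<^sup>2 * (2 * H)\<^sup>2 / 8) ^ n = exp (l\<^sup>2 * H\<^sup>2 / (2 * real n))"
    using n by (simp add: exp_of_nat_mult[symmetric] power_divide power_mult_distrib power2_eq_square field_simps)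
  finally show ?thesis .
qed

text \<open>A cube of side \<open>diameter D\<close> containing \<open>D\<close> is cut into
  \<open>m\<close> parts in each direction, and one point of \<open>D\<close> is chosen from every
  cell that meets \<open>D\<close>. The points have to lie in \<open>D\<close>, where the estimator
  is studied; the price is the diameter of a whole cell.\<close>

lemma grid_cover:
  fixes D :: "(real ^ 'd) set"
  assumes D: "D \<noteq> {}" "bounded D" and R: "0 < diameter D" and m: "1 <= m"
  obtains N where "finite N" "N \<noteq> {}" "N \<subseteq> D" "card N <= m ^ CARD('d)"
    "\<And>x. x \<in> D ==> \<exists>y\<in>N. norm (x - y) <= sqrt CARD('d) * diameter D / m"
proof -
  let ?R = "diameter D"
  define a where "a i = Inf ((%x. x $ i) ` D)" for i
  have bdd: "bounded ((%x. x $ i) ` D)" for i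
    by (rule bounded_linear_image[OF D(2) bounded_linear_vec_nth])
  have a_le: "a i <= x $ i" if "x \<in> D" for x i
    unfolding a_def using that bounded_imp_bdd_below[OF bdd] by (intro cInf_lower) auto
  have le_a: "x $ i - a i <= ?R" if "x \<in> D" for x i
  proof -
    have "x $ i - ?R <= a i"
      unfolding a_def
    proof (rule cInf_greatest)
      fix z assume "z \<in> (%x. x $ i) ` D"
      then obtain y where y: "y \<in> D" "z = y $ i" by auto
      have "\<bar>(x - y) $ i\<bar> <= norm (x - y)" by (rule component_le_norm_cart)
      also have "... <= ?R" using diameter_bounded_bound[OF D(2) that y(1)] by (simp add: dist_norm)
      finally show "x $ i - ?R <= z" using y by simp
    qed (use D in auto)
    then show ?thesis by simp
  qed
  \<comment> \<open>The minimum assigns the upper face of the cube to the last cell.\<close>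
  define \<kappa> where "\<kappa> x i = min (nat \<lfloor>(x $ i - a i) * m / ?R\<rfloor>) (m - 1)" for x :: "real^'d" and i
  have cell: "real (\<kappa> x i) * ?R / m <= x $ i - a i \<and> x $ i - a i <= (real (\<kappa> x i) + 1) * ?R / m" if x: "x \<in> D" for x i
  proof -
    define u where "u = (x $ i - a i) * m / ?R"
    have u0: "0 <= u" using a_le[OF x, of i] R by (simp add: u_def)
    have um: "u <= m"
    proof -
      have "(x $ i - a i) * m <= ?R * m" using le_a[OF x, of i] by (intro mult_right_mono) auto
      then show ?thesis using R by (simp add: u_def field_simps)
    qed
    have k: "real (\<kappa> x i) <= u \<and> u <= real (\<kappa> x i) + 1"
    proof (cases "nat \<lfloor>u\<rfloor> <= m - 1")
      case True
      then have "\<kappa> x i = nat \<lfloor>u\<rfloor>" by (simp add: \<kappa>_def u_def)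
      then show ?thesis using u0 by (simp add: of_nat_nat)
    next
      case False
      then have "\<kappa> x i = m - 1" by (simp add: \<kappa>_def u_def)
      moreover have "real (m - 1) <= u" using False u0 by linarith
      ultimately show ?thesis using um m by (simp add: of_nat_diff)
    qed
    have "x $ i - a i = u * ?R / m" using R m by (simp add: u_def)
    then show ?thesis using k R by (auto intro!: divide_right_mono mult_right_mono)
  qed
  define rep where "rep c = (SOME x. x \<in> D \<and> \<kappa> x = c)" for c
  have rep: "rep (\<kappa> x) \<in> D \<and> \<kappa> (rep (\<kappa> x)) = \<kappa> x" if "x \<in> D" for x
    unfolding rep_def by (rule someI[of _ x]) (use that in simp)
  have sub: "\<kappa> ` D \<subseteq> (PiE UNIV (%_. {..<m}))" using m by (auto simp: \<kappa>_def)
  have finE: "finite (PiE (UNIV :: 'd set) (%_. {..<m}))" by (intro finite_PiE) auto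
  have fin: "finite (\<kappa> ` D)" using finite_subset[OF sub finE] .
  show ?thesis
  proof (rule that[of "rep ` \<kappa> ` D"])
    show "finite (rep ` \<kappa> ` D)" using fin by simp
    show "rep ` \<kappa> ` D \<noteq> {}" "rep ` \<kappa> ` D \<subseteq> D" using D rep by auto
    have "card (rep ` \<kappa> ` D) <= card (\<kappa> ` D)" by (rule card_image_le[OF fin])
    also have "... <= card (PiE (UNIV :: 'd set) (%_. {..<m}))" by (rule card_mono[OF finE sub])
    also have "... = m ^ CARD('d)" by (simp add: card_PiE)
    finally show "card (rep ` \<kappa> ` D) <= m ^ CARD('d)" .
    fix x assume x: "x \<in> D"
    let ?y = "rep (\<kappa> x)"
    have comp: "\<bar>(x - ?y) $ i\<bar> <= ?R / m" for i
      using cell[OF x, of i] cell[of ?y i] rep[OF x] by (simp add: add_divide_distrib distrib_right abs_le_iff)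
    have "(norm (x - ?y))\<^sup>2 = (\<Sum>i\<in>UNIV. ((x - ?y) $ i)\<^sup>2)" by (simp add: norm_vec_def L2_set_def sum_nonneg)
    also have "... <= (\<Sum>i\<in>(UNIV::'d set). (?R / m)\<^sup>2)"
      using comp by (intro sum_mono abs_le_square_iff[THEN iffD1]) (use R in auto)
    also have "... = (sqrt CARD('d) * ?R / m)\<^sup>2" by (simp add: power_mult_distrib power_divide)
    finally have "norm (x - ?y) <= sqrt CARD('d) * ?R / m" by (rule power2_le_imp_le) (use R in simp)
    then show "\<exists>y\<in>rep ` \<kappa> ` D. norm (x - y) <= sqrt CARD('d) * ?R / m" using x by auto
  qed
qed

locale walk_lipschitz = walk P B D g0 g1 K0 K1 rb \<rho> V Z Y
  for P :: "'w measure" and B :: "real => 'w => real ^ 'd" and D g0 g1 K0 K1 rb \<rho> V Z Y +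
  fixes L L10 L20 L11 L21 :: real
  assumes V_nonneg: "\<And>k w. 1 <= k ==> w \<in> space P ==> 0 <= V k w"
    and Y_le: "\<And>k w. 1 <= k ==> w \<in> space P ==> norm (Y k w) <= 1"
    and L_nonneg: "0 <= L" "0 <= L10" "0 <= L20" "0 <= L11" "0 <= L21"
    and rb_lip: "\<And>x y. x \<in> closure D ==> y \<in> closure D ==> \<bar>rb x - rb y\<bar> <= L * norm (x - y)"
    and g0_lip: "\<And>s t x y. 0 <= s ==> 0 <= t ==> x \<in> closure D ==> y \<in> closure D ==> \<bar>g0 (s, x) - g0 (t, y)\<bar> <= L10 * \<bar>s - t\<bar> + L20 * norm (x - y)"
    and g1_lip: "\<And>s t x y. 0 <= s ==> 0 <= t ==> x \<in> closure D ==> y \<in> closure D ==> \<bar>g1 (s, x) - g1 (t, y)\<bar> <= L11 * \<bar>s - t\<bar> + L21 * norm (x - y)"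
begin

text \<open>Walks from different starting points are coupled by the same directions; each step then
  expands distances by at most \<open>1 + L\<close>.\<close>

lemma X_lip:
  assumes x: "x \<in> closure D" and y: "y \<in> closure D"
  shows "norm (X x k w - X y k w) <= (1 + L) ^ k * norm (x - y)"
proof (induction k)
  case (Suc k)
  have "X x (Suc k) w - X y (Suc k) w = (X x k w - X y k w) + (rb (X x k w) - rb (X y k w)) *\<^sub>R sgn (Z (Suc k) w)"
    by (simp add: X_Suc algebra_simps)
  also have "norm ... <= norm (X x k w - X y k w) + \<bar>rb (X x k w) - rb (X y k w)\<bar> * norm (sgn (Z (Suc k) w))"
    by (rule norm_triangle_le) simp
  also have "... <= norm (X x k w - X y k w) + \<bar>rb (X x k w) - rb (X y k w)\<bar> * 1"
    by (intro add_left_mono mult_left_mono) (auto simp: norm_sgn)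
  also have "... <= norm (X x k w - X y k w) + L * norm (X x k w - X y k w)"
    using rb_lip[OF X_closure[OF x] X_closure[OF y], of k w k w] by simp
  also have "... = (1 + L) * norm (X x k w - X y k w)" by (simp add: algebra_simps)
  also have "... <= (1 + L) * ((1 + L) ^ k * norm (x - y))" using Suc L_nonneg by (intro mult_left_mono) auto
  finally show ?case by (simp add: mult.assoc)
qed simp

lemma rb_X_lip:
  assumes x: "x \<in> closure D" and y: "y \<in> closure D"
  shows "\<bar>rb (X x k w) - rb (X y k w)\<bar> <= L * (1 + L) ^ k * norm (x - y)"
proof -
  have "\<bar>rb (X x k w) - rb (X y k w)\<bar> <= L * norm (X x k w - X y k w)" by (rule rb_lip[OF X_closure[OF x] X_closure[OF y]])
  also have "... <= L * ((1 + L) ^ k * norm (x - y))" using X_lip[OF x y] L_nonneg by (intro mult_left_mono)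
  finally show ?thesis by (simp add: mult.assoc)
qed

lemma rb_sq_lip:
  assumes x: "x \<in> closure D" and y: "y \<in> closure D"
  shows "\<bar>(rb (X x k w))\<^sup>2 - (rb (X y k w))\<^sup>2\<bar> <= 2 * R * (L * (1 + L) ^ k) * norm (x - y)"
proof -
  let ?a = "rb (X x k w)" and ?b = "rb (X y k w)"
  have "\<bar>?a\<^sup>2 - ?b\<^sup>2\<bar> = \<bar>?a + ?b\<bar> * \<bar>?a - ?b\<bar>" by (simp add: abs_mult[symmetric] power2_eq_square algebra_simps)
  also have "... <= (2 * R) * (L * (1 + L) ^ k * norm (x - y))"
    using rb_b[of "X x k w"] rb_b[of "X y k w"] rb_X_lip[OF x y] by (intro mult_mono) auto
  finally show ?thesis by (simp add: mult.assoc)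
qed

text \<open>Random weight of the clock: per unit of initial distance the radius in step
  \<open>j\<close> changes by at most \<open>L * (1 + L) ^ j\<close>, and its square by at most
  \<open>2 * R\<close> times as much. The exit times enter as they are, so the Lipschitz constant of
  a sample is random and is controlled in mean.\<close>

definition Q :: "nat => 'w => real" where
  "Q k w = (\<Sum>j<k. L * (1 + L) ^ j * \<rho> (Suc j) w)"

lemma S_lip:
  assumes x: "x \<in> closure D" and y: "y \<in> closure D" and w: "w \<in> space P"
  shows "\<bar>S x k w - S y k w\<bar> <= 2 * R * Q k w * norm (x - y)"
proof (induction k)
  case (Suc k)
  have \<rho>0: "0 <= \<rho> (Suc k) w" by (rule \<rho>_nonneg[OF _ w]) simp
  have "\<bar>S x (Suc k) w - S y (Suc k) w\<bar> = \<bar>(S x k w - S y k w) + ((rb (X x k w))\<^sup>2 - (rb (X y k w))\<^sup>2) * \<rho> (Suc k) w\<bar>"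
    by (simp add: S_Suc algebra_simps)
  also have "... <= \<bar>S x k w - S y k w\<bar> + \<bar>(rb (X x k w))\<^sup>2 - (rb (X y k w))\<^sup>2\<bar> * \<rho> (Suc k) w"
    using \<rho>0 by (intro order_trans[OF abs_triangle_ineq]) (simp add: abs_mult)
  also have "... <= 2 * R * Q k w * norm (x - y) + 2 * R * (L * (1 + L) ^ k) * norm (x - y) * \<rho> (Suc k) w"
    using \<rho>0 by (intro add_mono Suc mult_right_mono rb_sq_lip[OF x y])
  also have "... = 2 * R * Q (Suc k) w * norm (x - y)" by (simp add: Q_def algebra_simps)
  finally show ?case .
qed (simp add: Q_def)

text \<open>Product rule for squared radius times source: the first summand varies the radius, the
  second the time and space arguments of the source.\<close>

definition lam_incr :: "nat => 'w => real" where
  "lam_incr k w = 2 * R * (L * (1 + L) ^ k) * K1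
     + R\<^sup>2 * (L11 * (2 * R * Q k w + 2 * R * (L * (1 + L) ^ k) * V (Suc k) w) + L21 * (1 + L) ^ Suc k)"

lemma incr_lip:
  assumes x: "x \<in> closure D" and y: "y \<in> closure D" and w: "w \<in> space P"
  shows "\<bar>incr x k w - incr y k w\<bar> <= lam_incr k w * norm (x - y)"
proof -
  have V0: "0 <= V (Suc k) w" by (rule V_nonneg[OF _ w]) simp
  have Y1: "norm (Y (Suc k) w) <= 1" by (rule Y_le[OF _ w]) simp
  let ?a = "rb (X x k w)" and ?b = "rb (X y k w)"
  let ?px = "S x k w + ?a\<^sup>2 * V (Suc k) w" and ?qx = "X x k w + ?a *\<^sub>R Y (Suc k) w"
  let ?py = "S y k w + ?b\<^sup>2 * V (Suc k) w" and ?qy = "X y k w + ?b *\<^sub>R Y (Suc k) w"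
  have q: "X z k w + rb (X z k w) *\<^sub>R Y (Suc k) w \<in> closure D" if z: "z \<in> closure D" for z
  proof (rule step_in_closure[OF X_closure[OF z]])
    have "norm (rb (X z k w) *\<^sub>R Y (Suc k) w) <= rb (X z k w) * 1"
      using rb_b[of "X z k w"] Y1 by (simp add: mult_left_le)
    then show "norm (rb (X z k w) *\<^sub>R Y (Suc k) w) <= infdist (X z k w) (frontier D)"
      using rb_le[OF X_closure[OF z], of k w] by simp
  qed
  have p0: "0 <= ?px" "0 <= ?py" using V0 S_nonneg[OF w] by (auto intro!: add_nonneg_nonneg)
  have dp: "\<bar>?px - ?py\<bar> <= (2 * R * Q k w + 2 * R * (L * (1 + L) ^ k) * V (Suc k) w) * norm (x - y)"
  proof -
    have "\<bar>?px - ?py\<bar> = \<bar>(S x k w - S y k w) + (?a\<^sup>2 - ?b\<^sup>2) * V (Suc k) w\<bar>" by (simp add: algebra_simps)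
    also have "... <= \<bar>S x k w - S y k w\<bar> + \<bar>?a\<^sup>2 - ?b\<^sup>2\<bar> * V (Suc k) w"
      using V0 by (intro order_trans[OF abs_triangle_ineq]) (simp add: abs_mult)
    also have "... <= 2 * R * Q k w * norm (x - y) + 2 * R * (L * (1 + L) ^ k) * norm (x - y) * V (Suc k) w"
      using V0 by (intro add_mono S_lip[OF x y w] mult_right_mono rb_sq_lip[OF x y])
    finally show ?thesis by (simp add: algebra_simps)
  qed
  have dq: "norm (?qx - ?qy) <= (1 + L) ^ Suc k * norm (x - y)"
  proof -
    have "?qx - ?qy = (X x k w - X y k w) + (?a - ?b) *\<^sub>R Y (Suc k) w" by (simp add: algebra_simps)
    also have "norm ... <= norm (X x k w - X y k w) + \<bar>?a - ?b\<bar> * norm (Y (Suc k) w)"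
      by (rule norm_triangle_le) simp
    also have "... <= norm (X x k w - X y k w) + \<bar>?a - ?b\<bar> * 1"
      using Y1 by (intro add_left_mono mult_left_mono) auto
    also have "... <= (1 + L) ^ k * norm (x - y) + L * (1 + L) ^ k * norm (x - y)"
      using X_lip[OF x y, of k w] rb_X_lip[OF x y, of k w] by simp
    finally show ?thesis by (simp add: algebra_simps)
  qed
  have dg: "\<bar>g1 (?px, ?qx) - g1 (?py, ?qy)\<bar> <= (L11 * (2 * R * Q k w + 2 * R * (L * (1 + L) ^ k) * V (Suc k) w) + L21 * (1 + L) ^ Suc k) * norm (x - y)"
  proof -
    have "\<bar>g1 (?px, ?qx) - g1 (?py, ?qy)\<bar> <= L11 * \<bar>?px - ?py\<bar> + L21 * norm (?qx - ?qy)"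
      by (rule g1_lip[OF p0 q[OF x] q[OF y]])
    also have "... <= L11 * ((2 * R * Q k w + 2 * R * (L * (1 + L) ^ k) * V (Suc k) w) * norm (x - y)) + L21 * ((1 + L) ^ Suc k * norm (x - y))"
      using L_nonneg dp dq by (intro add_mono mult_left_mono)
    finally show ?thesis by (simp add: algebra_simps)
  qed
  have "incr x k w - incr y k w = (?a\<^sup>2 - ?b\<^sup>2) * g1 (?px, ?qx) + ?b\<^sup>2 * (g1 (?px, ?qx) - g1 (?py, ?qy))"
    by (simp add: incr_def algebra_simps)
  then have "\<bar>incr x k w - incr y k w\<bar> <= \<bar>?a\<^sup>2 - ?b\<^sup>2\<bar> * \<bar>g1 (?px, ?qx)\<bar> + ?b\<^sup>2 * \<bar>g1 (?px, ?qx) - g1 (?py, ?qy)\<bar>"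
    by (simp only:) (rule order_trans[OF abs_triangle_ineq], simp add: abs_mult)
  also have "... <= (2 * R * (L * (1 + L) ^ k) * norm (x - y)) * K1
      + R\<^sup>2 * ((L11 * (2 * R * Q k w + 2 * R * (L * (1 + L) ^ k) * V (Suc k) w) + L21 * (1 + L) ^ Suc k) * norm (x - y))"
    using R_nonneg L_nonneg by (intro add_mono mult_mono rb_sq_lip[OF x y] g1_b rb_sq_le dg) auto
  also have "... = lam_incr k w * norm (x - y)" by (simp add: lam_incr_def algebra_simps)
  finally show ?thesis .
qed

definition lam :: "nat => 'w => real" where
  "lam M w = L10 * (2 * R * Q M w) + L20 * (1 + L) ^ M + 1 / CARD('d) * (\<Sum>k<M. lam_incr k w)"

lemma sample_lip:
  assumes x: "x \<in> closure D" and y: "y \<in> closure D" and w: "w \<in> space P"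
  shows "\<bar>sample x M w - sample y M w\<bar> <= lam M w * norm (x - y)"
proof -
  let ?g = "%x. g0 (S x M w, X x M w)"
  have g: "\<bar>?g x - ?g y\<bar> <= (L10 * (2 * R * Q M w) + L20 * (1 + L) ^ M) * norm (x - y)"
  proof -
    have "\<bar>?g x - ?g y\<bar> <= L10 * \<bar>S x M w - S y M w\<bar> + L20 * norm (X x M w - X y M w)"
      by (rule g0_lip[OF S_nonneg[OF w] S_nonneg[OF w] X_closure[OF x] X_closure[OF y]])
    also have "... <= L10 * (2 * R * Q M w * norm (x - y)) + L20 * ((1 + L) ^ M * norm (x - y))"
      using L_nonneg S_lip[OF x y w] X_lip[OF x y] by (intro add_mono mult_left_mono)
    finally show ?thesis by (simp add: algebra_simps)
  qed
  have s: "\<bar>(\<Sum>k<M. incr x k w) - (\<Sum>k<M. incr y k w)\<bar> <= (\<Sum>k<M. lam_incr k w) * norm (x - y)"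
    unfolding sum_subtractf[symmetric] sum_distrib_right
    by (intro order_trans[OF sum_abs] sum_mono incr_lip x y w)
  have eq: "sample x M w - sample y M w = (?g x - ?g y) + 1 / CARD('d) * ((\<Sum>k<M. incr x k w) - (\<Sum>k<M. incr y k w))"
    by (simp add: sample_def algebra_simps diff_divide_distrib)
  have "\<bar>sample x M w - sample y M w\<bar> <= \<bar>?g x - ?g y\<bar> + 1 / CARD('d) * \<bar>(\<Sum>k<M. incr x k w) - (\<Sum>k<M. incr y k w)\<bar>"
    unfolding eq by (rule order_trans[OF abs_triangle_ineq]) (simp add: abs_mult)
  also have "... <= (L10 * (2 * R * Q M w) + L20 * (1 + L) ^ M) * norm (x - y) + 1 / CARD('d) * ((\<Sum>k<M. lam_incr k w) * norm (x - y))"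
    by (intro add_mono mult_left_mono g s) simp
  finally show ?thesis by (simp add: lam_def algebra_simps)
qed

lemma rho_expectation:
  assumes k: "1 <= k"
  shows "integrable P (\<rho> k)" "expectation (\<rho> k) <= 1 / CARD('d)"
proof -
  note m [measurable] = \<rho>_m[OF k]
  have "(\<integral>\<^sup>+w. ennreal (\<rho> k w) \<partial>P) = (\<integral>\<^sup>+x. ennreal x \<partial>distr P borel (\<rho> k))" by (subst nn_integral_distr) auto
  also have "... = (\<integral>\<^sup>+x. ennreal x \<partial>distr P borel zeta)"
    unfolding \<rho>_law[OF k] by (intro arg_cong[where f="%M. integral\<^sup>N M _"] distr_cong) (auto simp: ball_exit_time_eq)
  also have "... = (\<integral>\<^sup>+w. ennreal (zeta w) \<partial>P)" by (subst nn_integral_distr) auto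
  also have "... <= ennreal (1 / CARD('d))" by (rule zeta_expectation)
  finally have le: "(\<integral>\<^sup>+w. ennreal (\<rho> k w) \<partial>P) <= ennreal (1 / CARD('d))" .
  have "(\<integral>\<^sup>+w. ennreal (norm (\<rho> k w)) \<partial>P) = (\<integral>\<^sup>+w. ennreal (\<rho> k w) \<partial>P)"
    by (intro nn_integral_cong) (simp add: \<rho>_nonneg[OF k])
  then show i: "integrable P (\<rho> k)" using le by (intro integrableI_bounded) (auto simp: order_le_less_trans)
  have "(\<integral>\<^sup>+w. ennreal (\<rho> k w) \<partial>P) = ennreal (expectation (\<rho> k))"
    by (rule nn_integral_eq_integral[OF i]) (auto simp: \<rho>_nonneg[OF k])
  then show "expectation (\<rho> k) <= 1 / CARD('d)" using le by (simp add: ennreal_le_iff)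
qed

lemma V_expectation:
  assumes k: "1 <= k"
  shows "integrable P (V k)" "expectation (V k) <= 1 / CARD('d)"
proof -
  note m [measurable] = V_m[OF k]
  have le: "(\<integral>\<^sup>+w. ennreal (V k w) \<partial>P) <= ennreal (1 / CARD('d))"
    by (rule occupation_time_expectation[OF V_m[OF k] Y_m[OF k] VY_law[OF k]])
  have "(\<integral>\<^sup>+w. ennreal (norm (V k w)) \<partial>P) = (\<integral>\<^sup>+w. ennreal (V k w) \<partial>P)"
    by (intro nn_integral_cong) (simp add: V_nonneg[OF k])
  then show i: "integrable P (V k)" using le by (intro integrableI_bounded) (auto simp: order_le_less_trans)
  have "(\<integral>\<^sup>+w. ennreal (V k w) \<partial>P) = ennreal (expectation (V k))"
    by (rule nn_integral_eq_integral[OF i]) (auto simp: V_nonneg[OF k])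
  then show "expectation (V k) <= 1 / CARD('d)" using le by (simp add: ennreal_le_iff)
qed

lemma geometric_L: "(\<Sum>j<k. L * (1 + L) ^ j) = (1 + L) ^ k - 1"
  by (induction k) (auto simp: algebra_simps)

lemma Q_expectation: "integrable P (Q k)" "expectation (Q k) <= ((1 + L) ^ k - 1) / CARD('d)"
proof -
  have i: "integrable P (%w. L * (1 + L) ^ j * \<rho> (Suc j) w)" for j using rho_expectation(1)[of "Suc j"] by simp
  show "integrable P (Q k)" unfolding Q_def by (rule Bochner_Integration.integrable_sum) (rule i)
  have "expectation (Q k) = (\<Sum>j<k. L * (1 + L) ^ j * expectation (\<rho> (Suc j)))"
    unfolding Q_def using i by (subst Bochner_Integration.integral_sum) auto
  also have "... <= (\<Sum>j<k. L * (1 + L) ^ j * (1 / CARD('d)))"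
    using L_nonneg by (intro sum_mono mult_left_mono rho_expectation) auto
  also have "... = ((1 + L) ^ k - 1) / CARD('d)" unfolding sum_distrib_right[symmetric] geometric_L by simp
  finally show "expectation (Q k) <= ((1 + L) ^ k - 1) / CARD('d)" .
qed

text \<open>The weights sum geometrically to \<open>(1 + L) ^ k - 1\<close>, so a single power
  \<open>(1 + L) ^ M\<close> survives, and a factor \<open>M\<close> comes from adding up the steps.
  The bracket is the one that opens \<open>wos_C\<close>.\<close>

lemma lam_expectation:
  assumes M: "1 <= M"
  shows "integrable P (lam M)"
    and "expectation (lam M) <= real M * (1 + L) ^ M * (L20 + 2 * L10 * R / CARD('d)
        + 1 / CARD('d) * (2 * R * K1 + R\<^sup>2 * (L21 + 2 * L11 * R / CARD('d))))"
proof -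
  let ?d = "real CARD('d)"
  let ?g = "%k. (1 + L) ^ k"
  have gm: "?g k <= ?g M" if "k <= M" for k using that L_nonneg by (intro power_increasing) auto
  have g1: "1 <= ?g M" using L_nonneg by (intro one_le_power) auto
  have ii: "integrable P (lam_incr k)" for k
    unfolding lam_incr_def using Q_expectation(1) V_expectation(1)[of "Suc k"] by simp
  show "integrable P (lam M)" unfolding lam_def using Q_expectation(1) ii by simp
  have ei: "expectation (lam_incr k) <= 2 * R * (L * ?g k) * K1 + R\<^sup>2 * (L11 * (2 * R / ?d * ?g M) + L21 * ?g M)" if k: "k < M" for k
  proof -
    have "expectation (lam_incr k) = 2 * R * (L * ?g k) * K1 + R\<^sup>2 * (L11 * (2 * R * expectation (Q k) + 2 * R * (L * ?g k) * expectation (V (Suc k))) + L21 * ?g (Suc k))"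
      unfolding lam_incr_def using Q_expectation(1) V_expectation(1)[of "Suc k"] prob_space by simp
    also have "... <= 2 * R * (L * ?g k) * K1 + R\<^sup>2 * (L11 * (2 * R * ((?g k - 1) / ?d) + 2 * R * (L * ?g k) * (1 / ?d)) + L21 * ?g M)"
      using R_nonneg L_nonneg k Q_expectation(2) V_expectation(2)[of "Suc k"] gm[of "Suc k"]
      by (intro add_left_mono mult_left_mono add_mono) auto
    \<comment> \<open>Clock error and occupation time error combine exactly into the next power,
      since \<open>?g k + L * ?g k = ?g (Suc k)\<close>.\<close>
    also have "2 * R * ((?g k - 1) / ?d) + 2 * R * (L * ?g k) * (1 / ?d) = 2 * R / ?d * (?g (Suc k) - 1)"
      by (simp add: field_simps)
    also have "2 * R * (L * ?g k) * K1 + R\<^sup>2 * (L11 * (2 * R / ?d * (?g (Suc k) - 1)) + L21 * ?g M)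
      <= 2 * R * (L * ?g k) * K1 + R\<^sup>2 * (L11 * (2 * R / ?d * ?g M) + L21 * ?g M)"
      using R_nonneg L_nonneg gm[of "Suc k"] k by (intro add_left_mono add_right_mono mult_left_mono) auto
    finally show ?thesis .
  qed
  have sum_le: "(\<Sum>k<M. expectation (lam_incr k)) <= 2 * R * ?g M * K1 + M * (R\<^sup>2 * (L11 * (2 * R / ?d * ?g M) + L21 * ?g M))"
  proof -
    have "(\<Sum>k<M. expectation (lam_incr k)) <= (\<Sum>k<M. 2 * R * K1 * (L * ?g k) + R\<^sup>2 * (L11 * (2 * R / ?d * ?g M) + L21 * ?g M))"
      using ei by (intro sum_mono) (auto simp: mult.commute mult.left_commute)
    also have "... = 2 * R * K1 * (?g M - 1) + M * (R\<^sup>2 * (L11 * (2 * R / ?d * ?g M) + L21 * ?g M))"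
      using geometric_L[of M] by (simp add: sum.distrib sum_distrib_left[symmetric])
    also have "2 * R * K1 * (?g M - 1) <= 2 * R * K1 * ?g M" using R_nonneg K_nonneg by (intro mult_left_mono) auto
    finally show ?thesis by (simp add: mult.commute mult.left_commute)
  qed
  have "expectation (lam M) = L10 * (2 * R * expectation (Q M)) + L20 * ?g M + 1 / ?d * (\<Sum>k<M. expectation (lam_incr k))"
    unfolding lam_def using Q_expectation(1) ii prob_space by (simp add: Bochner_Integration.integral_sum)
  also have "... <= L10 * (2 * R * ((?g M - 1) / ?d)) + L20 * ?g M + 1 / ?d * (2 * R * ?g M * K1 + M * (R\<^sup>2 * (L11 * (2 * R / ?d * ?g M) + L21 * ?g M)))"
    using R_nonneg L_nonneg Q_expectation(2) sum_le by (intro add_mono mult_left_mono) auto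
  also have "... <= L10 * (2 * R * (?g M / ?d)) + L20 * ?g M + 1 / ?d * (2 * R * ?g M * K1 + M * (R\<^sup>2 * (L11 * (2 * R / ?d * ?g M) + L21 * ?g M)))"
    using R_nonneg L_nonneg by (intro add_right_mono mult_left_mono divide_right_mono) auto
  also have "... = ?g M * (L20 + 2 * L10 * R / ?d + 1 / ?d * (2 * R * K1)) + M * (?g M * (1 / ?d * (R\<^sup>2 * (L21 + 2 * L11 * R / ?d))))"
    by (simp add: field_simps)
  also have "... <= M * (?g M * (L20 + 2 * L10 * R / ?d + 1 / ?d * (2 * R * K1))) + M * (?g M * (1 / ?d * (R\<^sup>2 * (L21 + 2 * L11 * R / ?d))))"
  proof (intro add_right_mono)
    have "0 <= ?g M * (L20 + 2 * L10 * R / ?d + 1 / ?d * (2 * R * K1))"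
      using R_nonneg L_nonneg K_nonneg by (intro mult_nonneg_nonneg add_nonneg_nonneg) auto
    then have "1 * (?g M * (L20 + 2 * L10 * R / ?d + 1 / ?d * (2 * R * K1))) <= real M * (?g M * (L20 + 2 * L10 * R / ?d + 1 / ?d * (2 * R * K1)))"
      using M by (intro mult_right_mono) auto
    then show "?g M * (L20 + 2 * L10 * R / ?d + 1 / ?d * (2 * R * K1)) <= M * (?g M * (L20 + 2 * L10 * R / ?d + 1 / ?d * (2 * R * K1)))" by simp
  qed
  also have "... = real M * (1 + L) ^ M * (L20 + 2 * L10 * R / ?d + 1 / ?d * (2 * R * K1 + R\<^sup>2 * (L21 + 2 * L11 * R / ?d)))"
    by (simp add: distrib_left mult.assoc)
  finally show "expectation (lam M) <= real M * (1 + L) ^ M * (L20 + 2 * L10 * R / CARD('d)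
        + 1 / CARD('d) * (2 * R * K1 + R\<^sup>2 * (L21 + 2 * L11 * R / CARD('d))))" .
qed

end

section \<open>Polynomial work\<close>

text \<open>Calculus for bounds by a power of \<open>T\<close>. Nonnegativity is included so that
  products of bounded quantities are again bounded.\<close>

definition poly_bounded :: "'p set => ('p => real) => ('p => real) => bool" where
  "poly_bounded A T f \<longleftrightarrow> (\<exists>c k. 0 <= c \<and> (\<forall>p\<in>A. 0 <= f p \<and> f p <= c * T p ^ (k::nat)))"

lemma poly_bounded_mono:
  assumes "poly_bounded A T g" "\<And>p. p \<in> A ==> 0 <= f p \<and> f p <= g p"
  shows "poly_bounded A T f"
  using assms unfolding poly_bounded_def by (meson order_trans)

lemma poly_bounded_const: "0 <= c ==> poly_bounded A T (%_. c)"
  unfolding poly_bounded_def by (intro exI[of _ c] exI[of _ 0]) simp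

lemma poly_bounded_le_T:
  assumes "\<And>p. p \<in> A ==> 0 <= f p \<and> f p <= T p"
  shows "poly_bounded A T f"
  unfolding poly_bounded_def using assms by (intro exI[of _ 1] exI[of _ 1]) simp

lemma poly_bounded_add:
  assumes T: "\<And>p. p \<in> A ==> 1 <= T p" and f: "poly_bounded A T f" and g: "poly_bounded A T g"
  shows "poly_bounded A T (%p. f p + g p)"
proof -
  obtain c k where c: "0 <= c" "\<And>p. p \<in> A ==> 0 <= f p \<and> f p <= c * T p ^ k" using f unfolding poly_bounded_def by blast
  obtain c' k' where c': "0 <= c'" "\<And>p. p \<in> A ==> 0 <= g p \<and> g p <= c' * T p ^ k'" using g unfolding poly_bounded_def by blast
  show ?thesis unfolding poly_bounded_def
  proof (intro exI[of _ "c + c'"] exI[of _ "k + k'"] conjI ballI)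
    fix p assume p: "p \<in> A"
    have "T p ^ k <= T p ^ (k + k')" "T p ^ k' <= T p ^ (k + k')" using T[OF p] by (auto intro: power_increasing)
    then have "c * T p ^ k <= c * T p ^ (k + k')" "c' * T p ^ k' <= c' * T p ^ (k + k')"
      using c(1) c'(1) by (auto intro: mult_left_mono)
    then show "f p + g p <= (c + c') * T p ^ (k + k')" using c(2)[OF p] c'(2)[OF p] by (simp add: distrib_right)
    show "0 <= f p + g p" using c(2)[OF p] c'(2)[OF p] by simp
  qed (use c(1) c'(1) in simp)
qed

lemma poly_bounded_mult:
  assumes f: "poly_bounded A T f" and g: "poly_bounded A T g"
  shows "poly_bounded A T (%p. f p * g p)"
proof -
  obtain c k where c: "0 <= c" "\<And>p. p \<in> A ==> 0 <= f p \<and> f p <= c * T p ^ k" using f unfolding poly_bounded_def by blast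
  obtain c' k' where c': "0 <= c'" "\<And>p. p \<in> A ==> 0 <= g p \<and> g p <= c' * T p ^ k'" using g unfolding poly_bounded_def by blast
  show ?thesis unfolding poly_bounded_def
  proof (intro exI[of _ "c * c'"] exI[of _ "k + k'"] conjI ballI)
    fix p assume p: "p \<in> A"
    have "0 <= c * T p ^ k" using c(2)[OF p] by linarith
    then have "f p * g p <= (c * T p ^ k) * (c' * T p ^ k')" using c(2)[OF p] c'(2)[OF p] by (intro mult_mono) auto
    then show "f p * g p <= c * c' * T p ^ (k + k')" by (simp add: power_add mult.commute mult.left_commute)
    show "0 <= f p * g p" using c(2)[OF p] c'(2)[OF p] by simp
  qed (use c(1) c'(1) in simp)
qed

lemma poly_bounded_power:
  assumes "poly_bounded A T f"
  shows "poly_bounded A T (%p. f p ^ n)"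
  using assms by (induction n) (auto intro: poly_bounded_mult poly_bounded_const)

lemma sqrt_le_add_1: "0 <= x ==> sqrt x <= 1 + x"
  by (rule real_le_lsqrt) (auto simp: power2_eq_square algebra_simps)

lemma poly_bounded_sqrt:
  assumes T: "\<And>p. p \<in> A ==> 1 <= T p" and f: "poly_bounded A T f"
  shows "poly_bounded A T (%p. sqrt (f p))"
proof (rule poly_bounded_mono)
  show "poly_bounded A T (%p. 1 + f p)" by (intro poly_bounded_add[OF T] poly_bounded_const f) simp_all
  show "0 <= sqrt (f p) \<and> sqrt (f p) <= 1 + f p" if "p \<in> A" for p
    using f that sqrt_le_add_1 by (auto simp: poly_bounded_def)
qed

lemma poly_bounded_divide:
  assumes f: "poly_bounded A T f" and g: "\<And>p. p \<in> A ==> 1 <= g p"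
  shows "poly_bounded A T (%p. f p / g p)"
proof (rule poly_bounded_mono[OF f])
  fix p assume p: "p \<in> A"
  then have f0: "0 <= f p" using f by (auto simp: poly_bounded_def)
  have "f p * 1 <= f p * g p" using f0 g[OF p] by (rule mult_left_mono[rotated])
  then show "0 <= f p / g p \<and> f p / g p <= f p" using f0 g[OF p] by (simp add: pos_divide_le_eq)
qed

lemma poly_bounded_ln:
  assumes f: "poly_bounded A T f" and g: "\<And>p. p \<in> A ==> 1 <= f p"
  shows "poly_bounded A T (%p. ln (f p))"
proof (rule poly_bounded_mono[OF f])
  fix p assume "p \<in> A"
  from g[OF this] show "0 <= ln (f p) \<and> ln (f p) <= f p" using ln_le_minus_one[of "f p"] by (simp add: ln_ge_zero)
qed

text \<open>Follows from \<open>x / (1 + x) <= ln (1 + x)\<close>. It turns the logarithm in the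
  denominator of the step number into a rational quantity.\<close>

lemma inverse_ln_le:
  assumes "0 < (x::real)"
  shows "1 / ln (1 + x) <= 1 + 1 / x"
proof -
  have "x / (1 + x) <= ln (1 + x)"
    using ln_le_minus_one[of "1 / (1 + x)"] assms by (simp add: ln_div field_simps)
  moreover have "0 < x / (1 + x)" using assms by simp
  ultimately have "1 / ln (1 + x) <= 1 / (x / (1 + x))" by (intro divide_left_mono mult_pos_pos) linarith+
  also have "... = 1 + 1 / x" using assms by (simp add: field_simps)
  finally show ?thesis .
qed

text \<open>A parameter point \<open>(d, v)\<close> lists \<open>L, L10, L20, L11, L21, H0, H1, \<beta>, R, \<epsilon>\<close> as \<open>v 0, ..., v 9\<close>.\<close>

definition pars :: "(nat \<times> (nat => real)) set" where
  "pars = {(d, v). 1 <= d \<and> (\<forall>i\<le>6. 0 <= v i) \<and> 0 < v 7 \<and> v 7 <= 1 \<and> 0 < v 8 \<and> 0 < v 9 \<and> v 9 < 1}"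

definition pars_sum :: "nat \<times> (nat => real) => real" where
  "pars_sum p = (\<Sum>i\<le>6. snd p i) + 1 / snd p 7 + snd p 8 + real (fst p)"

text \<open>One number, at least \<open>1\<close>, that dominates all parameters and also
  \<open>1 / \<beta>\<close> and \<open>1 / \<epsilon>\<close>; a bound by one of its powers is the
  polynomial bound sought.\<close>

definition pars_T :: "nat \<times> (nat => real) => real" where
  "pars_T p = (1 + pars_sum p) / snd p 9"

abbreviation pars_delta :: "nat \<times> (nat => real) => real" where
  "pars_delta p \<equiv> wos_delta (fst p) (snd p 1) (snd p 2) (snd p 6) (snd p 8) (snd p 9)"

abbreviation pars_M :: "nat \<times> (nat => real) => nat" where
  "pars_M p \<equiv> wos_steps (fst p) (snd p 5) (snd p 6) (snd p 7) (snd p 8) (pars_delta p) (snd p 9)"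

abbreviation pars_C :: "nat \<times> (nat => real) => real" where
  "pars_C p \<equiv> wos_C (fst p) (pars_M p) (snd p 0) (snd p 1) (snd p 2) (snd p 3) (snd p 4) (snd p 5) (snd p 6) (snd p 8)"

abbreviation pars_bounded :: "(nat \<times> (nat => real) => real) => bool" where
  "pars_bounded \<equiv> poly_bounded pars pars_T"

lemma parsD:
  assumes "p \<in> pars"
  shows "1 <= real (fst p)" "\<And>i. i <= 6 ==> 0 <= snd p i" "0 < snd p 7" "snd p 7 <= 1" "0 < snd p 8" "0 < snd p 9" "snd p 9 < 1"
  using assms by (auto simp: pars_def)

lemma pars_sum_ge:
  assumes p: "p \<in> pars"
  shows "\<And>i. i <= 6 ==> snd p i <= pars_sum p" "1 / snd p 7 <= pars_sum p" "snd p 8 <= pars_sum p" "real (fst p) <= pars_sum p" "1 <= pars_sum p"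
proof -
  note D = parsD[OF p]
  have s: "snd p i <= (\<Sum>i\<le>6. snd p i)" if "i <= 6" for i
    using that D(2) by (intro member_le_sum) auto
  have s0: "0 <= (\<Sum>i\<le>6. snd p i)" using D(2) by (intro sum_nonneg) auto
  show "snd p i <= pars_sum p" if "i <= 6" for i 
  proof -
    have "0 <= 1 / snd p 7" using D(3) by simp
    then show ?thesis unfolding pars_sum_def using s[OF that] D(1,5) by linarith
  qed
  show "1 / snd p 7 <= pars_sum p" "snd p 8 <= pars_sum p" "real (fst p) <= pars_sum p" "1 <= pars_sum p"
  proof -
    have "0 <= 1 / snd p 7" using D(3) by simp
    then show "1 / snd p 7 <= pars_sum p" "snd p 8 <= pars_sum p" "real (fst p) <= pars_sum p" "1 <= pars_sum p"
      unfolding pars_sum_def using s0 D(1,5) by linarith+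
  qed
qed

lemma pars_T_ge:
  assumes p: "p \<in> pars"
  shows "1 + pars_sum p <= pars_T p" "1 / snd p 9 <= pars_T p" "1 <= pars_T p"
proof -
  note D = parsD[OF p] and S = pars_sum_ge[OF p]
  have e: "1 <= 1 / snd p 9" using D by simp
  have "(1 + pars_sum p) * 1 <= (1 + pars_sum p) * (1 / snd p 9)" using S e by (intro mult_left_mono) auto
  then show a: "1 + pars_sum p <= pars_T p" by (simp add: pars_T_def)
  show "1 / snd p 9 <= pars_T p" unfolding pars_T_def using S D by (intro divide_right_mono) auto
  show "1 <= pars_T p" using a S by simp
qed

lemma pars_bounded_component: "i <= 6 ==> pars_bounded (%p. snd p i)"
proof (rule poly_bounded_le_T)
  fix p assume i: "i <= 6" and p: "p \<in> pars"
  show "0 <= snd p i \<and> snd p i <= pars_T p"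
    using parsD(2)[OF p i] pars_sum_ge(1)[OF p i] pars_T_ge(1)[OF p] by linarith
qed

lemma pars_bounded_atoms:
  "pars_bounded (%p. snd p 0)" "pars_bounded (%p. snd p 1)" "pars_bounded (%p. snd p 2)" "pars_bounded (%p. snd p 3)"
  "pars_bounded (%p. snd p 4)" "pars_bounded (%p. snd p 5)" "pars_bounded (%p. snd p 6)"
  by (rule pars_bounded_component, simp)+

lemma pars_bounded_others:
  "pars_bounded (%p. 1 / snd p 7)" "pars_bounded (%p. snd p 8)"
  "pars_bounded (%p. 1 / snd p 9)" "pars_bounded (%p. real (fst p))"
proof -
  have "0 <= 1 / snd p 7 \<and> 1 / snd p 7 <= pars_T p" "0 <= snd p 8 \<and> snd p 8 <= pars_T p"
    "0 <= 1 / snd p 9 \<and> 1 / snd p 9 <= pars_T p" "0 <= real (fst p) \<and> real (fst p) <= pars_T p" if p: "p \<in> pars" for p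
  proof -
    have "0 <= 1 / snd p 7" "0 <= 1 / snd p 9" using parsD(3,6)[OF p] by simp_all
    then show "0 <= 1 / snd p 7 \<and> 1 / snd p 7 <= pars_T p" "0 <= snd p 8 \<and> snd p 8 <= pars_T p"
      "0 <= 1 / snd p 9 \<and> 1 / snd p 9 <= pars_T p" "0 <= real (fst p) \<and> real (fst p) <= pars_T p"
      using parsD(1,5)[OF p] pars_sum_ge(2,3,4)[OF p] pars_T_ge(1,2)[OF p] by linarith+
  qed
  then show "pars_bounded (%p. 1 / snd p 7)" "pars_bounded (%p. snd p 8)"
    "pars_bounded (%p. 1 / snd p 9)" "pars_bounded (%p. real (fst p))"
    by (auto intro: poly_bounded_le_T)
qed

lemmas pars_add = poly_bounded_add[OF pars_T_ge(3)]
lemmas pars_sqrt = poly_bounded_sqrt[OF pars_T_ge(3)]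
lemmas pars_intros = pars_bounded_atoms pars_bounded_others poly_bounded_const pars_add poly_bounded_mult poly_bounded_power

lemma delta_pos: "p \<in> pars ==> 0 < pars_delta p"
proof -
  assume "p \<in> pars"
  then have "0 < snd p 9" by (rule parsD(6))
  then show ?thesis unfolding wos_delta_def Let_def by (simp add: zero_less_mult_iff)
qed

text \<open>A minimum with \<open>1\<close> has reciprocal at most \<open>1\<close> plus the
  reciprocal of the other argument, and roots are removed by \<open>sqrt_le_add_1\<close>. If the
  denominator in the definition of \<open>\<delta>\<close> vanishes, \<open>\<delta>\<close> is
  \<open>1\<close>.\<close>

lemma inverse_delta_bounded: "pars_bounded (%p. 1 / pars_delta p)"
proof (rule poly_bounded_mono)
  show "pars_bounded (%p. 1 + 9 * ((snd p 1 + snd p 6) * snd p 8 + snd p 2 * (1 + real (fst p)) * (1 + snd p 8))\<^sup>2 * (1 / snd p 9)\<^sup>2)"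
    by (intro pars_intros) simp_all
  fix p assume p: "p \<in> pars"
  note D = parsD[OF p]
  let ?u = "(snd p 1 + snd p 6) * snd p 8 + snd p 2 * sqrt (real (fst p)) * sqrt (snd p 8)"
  let ?w = "(snd p 1 + snd p 6) * snd p 8 + snd p 2 * (1 + real (fst p)) * (1 + snd p 8)"
  have uw: "0 <= ?u \<and> ?u <= ?w"
  proof
    have nn: "0 <= snd p 1" "0 <= snd p 2" "0 <= snd p 6" "0 <= snd p 8" "0 <= real (fst p)" using D(2)[of 1] D(2)[of 2] D(2)[of 6] D(5) by simp_all
    then show "0 <= ?u" by simp
    have "snd p 2 * sqrt (real (fst p)) * sqrt (snd p 8) <= snd p 2 * (1 + real (fst p)) * (1 + snd p 8)"
      using nn by (intro mult_mono mult_left_mono sqrt_le_add_1 mult_nonneg_nonneg) simp_all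
    then show "?u <= ?w" by simp
  qed
  then have u2: "?u\<^sup>2 <= ?w\<^sup>2" by (intro power_mono) auto
  have "1 / pars_delta p <= 1 + 9 * ?u\<^sup>2 * (1 / snd p 9)\<^sup>2"
  proof (cases "9 * ?u\<^sup>2 = 0")
    case True
    then show ?thesis by (simp add: wos_delta_def Let_def)
  next
    case False
    define v where "v = (snd p 9)\<^sup>2 / (9 * ?u\<^sup>2)"
    have "0 < ?u\<^sup>2" using False by simp
    then have v: "0 < v" using D by (simp add: v_def)
    have d: "pars_delta p = min 1 v" using False by (simp add: wos_delta_def Let_def v_def)
    have "1 / min 1 v <= 1 + 1 / v" using v by (simp add: min_def)
    also have "1 / v = 9 * ?u\<^sup>2 * (1 / snd p 9)\<^sup>2" by (simp add: v_def power_divide)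
    finally show ?thesis unfolding d .
  qed
  also have "... <= 1 + 9 * ?w\<^sup>2 * (1 / snd p 9)\<^sup>2" using u2 by (intro add_left_mono mult_right_mono mult_left_mono) auto
  finally show "0 <= 1 / pars_delta p \<and> 1 / pars_delta p <= 1 + 9 * ?w\<^sup>2 * (1 / snd p 9)\<^sup>2"
    using delta_pos[OF p] by simp
qed

lemma M_ge_1: "1 <= pars_M p"
  by (simp add: wos_steps_def Let_def)

text \<open>The logarithms in the numerator are bounded by their arguments, the one in the
  denominator by \<open>inverse_ln_le\<close>; the additive \<open>2\<close> pays for the rounding
  and the maximum with \<open>1\<close>.\<close>

lemma M_bounded: "pars_bounded (%p. real (pars_M p))"
proof (rule poly_bounded_mono)
  let ?x = "%p. 2 * (snd p 8)\<^sup>2 * (1 / snd p 7)\<^sup>2 * (1 / pars_delta p)\<^sup>2"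
  let ?a = "%p. 6 * (2 * snd p 5 * real (fst p) + (snd p 8)\<^sup>2 * snd p 6)"
  show "pars_bounded (%p. 2 + (?a p + 1 / snd p 9) * (1 + ?x p))"
    by (intro inverse_delta_bounded pars_intros) simp_all
  fix p assume p: "p \<in> pars"
  note D = parsD[OF p]
  have \<delta>: "0 < pars_delta p" by (rule delta_pos[OF p])
  have a0: "0 <= ?a p" using D by simp
  have x0: "0 <= ?x p" by simp
  have prod0: "0 <= (?a p + 1 / snd p 9) * (1 + ?x p)" using a0 x0 D by (intro mult_nonneg_nonneg add_nonneg_nonneg) auto
  have "real (pars_M p) <= 2 + (?a p + 1 / snd p 9) * (1 + ?x p)"
  proof (cases "?a p = 0")
    case True
    then show ?thesis using prod0 by (simp add: wos_steps_def Let_def)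
  next
    case False
    then have apos: "0 < ?a p" using a0 by simp
    define y where "y = (snd p 7)\<^sup>2 * (pars_delta p)\<^sup>2 / (2 * (snd p 8)\<^sup>2)"
    define num where "num = ln (?a p) - ln (real (fst p)) + ln (1 / snd p 9)"
    have y: "0 < y" using D \<delta> by (simp add: y_def)
    have M: "pars_M p = max 1 (nat \<lceil>num / ln (1 + y)\<rceil>)" using False by (simp add: wos_steps_def Let_def num_def y_def)
    have "ln (?a p) <= ?a p" using apos ln_le_minus_one[of "?a p"] by linarith
    moreover have "0 <= ln (real (fst p))" using D by simp
    moreover have "ln (1 / snd p 9) <= 1 / snd p 9" using D ln_le_minus_one[of "1 / snd p 9"] by simp
    ultimately have num: "num <= ?a p + 1 / snd p 9" unfolding num_def by linarith
    have "num / ln (1 + y) <= (?a p + 1 / snd p 9) * (1 / ln (1 + y))" using num y by (simp add: divide_right_mono)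
    also have "... <= (?a p + 1 / snd p 9) * (1 + 1 / y)"
      using inverse_ln_le[OF y] a0 D by (intro mult_left_mono) auto
    also have "1 / y = ?x p" using D \<delta> by (simp add: y_def power_divide)
    finally have q: "num / ln (1 + y) <= (?a p + 1 / snd p 9) * (1 + ?x p)" .
    have "real (nat \<lceil>num / ln (1 + y)\<rceil>) <= max 0 (num / ln (1 + y) + 1)" by linarith
    then show ?thesis unfolding M using q prod0 by simp
  qed
  then show "0 <= real (pars_M p) \<and> real (pars_M p) <= 2 + (?a p + 1 / snd p 9) * (1 + ?x p)" by simp
qed

text \<open>All four summands of \<open>wos_C\<close> are nonnegative. The two on the left pay for
  the grid spacing and for the fluctuation on the grid.\<close>

lemma wos_C_ge:
  assumes "1 <= M" "0 <= L" "0 <= L10" "0 <= L20" "0 <= L11" "0 <= L21" "0 <= H0" "0 <= H1" "0 <= R"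
  shows "(L20 + 2 * L10 * R / real d + 1 / real d * (2 * R * H1 + R\<^sup>2 * (L21 + 2 * L11 * R / real d))) * sqrt (real d) * R
      + 3 * sqrt 2 * (1 + sqrt (real d) + sqrt (real d * (2 * ln (real M) + real M * ln (1 + L)) + ln 2)) * (H0 + real M * R\<^sup>2 * H1 / real d)
     <= wos_C d M L L10 L20 L11 L21 H0 H1 R"
    and "0 <= wos_C d M L L10 L20 L11 L21 H0 H1 R"
proof -
  let ?t1 = "(L20 + 2 * L10 * R / real d + 1 / real d * (2 * R * H1 + R\<^sup>2 * (L21 + 2 * L11 * R / real d))) * sqrt (real d) * R"
  let ?t2 = "(L20 + (2 * real M * R * H1 + L21 * real M * R\<^sup>2) / real d) * (sqrt (real d) * R / (real M)\<^sup>2)"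
  let ?t3 = "3 * sqrt 2 * (1 + sqrt (real d) + sqrt (real d * (2 * ln (real M) + real M * ln (1 + L)) + ln 2)) * (H0 + real M * R\<^sup>2 * H1 / real d)"
  let ?t4 = "12 * R\<^sup>2 * (L10 * real d + L11 * R\<^sup>2 * real M) * (ln 6 + 3 + ln (real M)) / (real d powr (3 / 2) * real M)"
  have ln: "0 <= ln (real M)" "0 <= ln (1 + L)" "0 <= ln (6::real)" using assms by simp_all
  have "0 <= ?t1" using assms by simp
  moreover have "0 <= ?t2" using assms by simp
  moreover have "0 <= ?t3" using assms ln by simp
  moreover have "0 <= ?t4" using assms ln by simp
  ultimately show "?t1 + ?t3 <= wos_C d M L L10 L20 L11 L21 H0 H1 R" "0 <= wos_C d M L L10 L20 L11 L21 H0 H1 R"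
    unfolding wos_C_def by linarith+
qed

lemma C_bounded: "pars_bounded pars_C"
proof -
  have d: "1 <= real (fst p)" and L: "1 <= 1 + snd p 0" and M: "1 <= real (pars_M p)" if "p \<in> pars" for p
    using parsD(1)[OF that] parsD(2)[OF that, of 0] M_ge_1[of p] by simp_all
  have M2: "1 <= (real (pars_M p))\<^sup>2" if "p \<in> pars" for p by (rule one_le_power[OF M[OF that]])
  have dM: "1 <= real (fst p) powr (3 / 2) * real (pars_M p)" if "p \<in> pars" for p
  proof -
    have "1 <= real (fst p) powr (3 / 2)" using d[OF that] by (intro ge_one_powr_ge_zero) auto
    from mult_mono[OF this M[OF that]] show ?thesis by simp
  qed
  show ?thesis unfolding wos_C_def
    by (intro pars_add poly_bounded_mult poly_bounded_divide[OF _ d] poly_bounded_divide[OF _ M2] poly_bounded_divide[OF _ dM]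
      poly_bounded_power pars_sqrt poly_bounded_ln[OF _ M] poly_bounded_ln[OF _ L] M_bounded pars_bounded_atoms pars_bounded_others poly_bounded_const)
      simp_all
qed

lemma work_bounded: "pars_bounded (%p. real (max (wos_samples (pars_C p) (snd p 9)) (pars_M p)))"
proof (rule poly_bounded_mono)
  show "pars_bounded (%p. 1 + (1 + 9 * (pars_C p)\<^sup>2 * (1 / snd p 9)\<^sup>2)\<^sup>2 + real (pars_M p))"
    by (intro C_bounded M_bounded pars_intros) simp_all
  fix p assume "p \<in> pars"
  define u where "u = 9 * (pars_C p)\<^sup>2 / (snd p 9)\<^sup>2"
  have u0: "0 <= u" by (simp add: u_def)
  have "real (nat \<lceil>u\<rceil>) <= 1 + u" using u0 by linarith
  then have sq: "(real (nat \<lceil>u\<rceil>))\<^sup>2 <= (1 + u)\<^sup>2" by (intro power_mono) auto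
  have u: "u = 9 * (pars_C p)\<^sup>2 * (1 / snd p 9)\<^sup>2" by (simp add: u_def power_divide)
  have s: "wos_samples (pars_C p) (snd p 9) = max 1 ((nat \<lceil>u\<rceil>)\<^sup>2)" unfolding wos_samples_def u_def ..
  have "real (max (max 1 a) b) <= 1 + real a + real b" for a b :: nat by simp
  from this[of "(nat \<lceil>u\<rceil>)\<^sup>2" "pars_M p"] have "real (max (wos_samples (pars_C p) (snd p 9)) (pars_M p)) <= 1 + (1 + u)\<^sup>2 + real (pars_M p)"
    using sq unfolding s of_nat_power by linarith
  then show "0 <= real (max (wos_samples (pars_C p) (snd p 9)) (pars_M p))
    \<and> real (max (wos_samples (pars_C p) (snd p 9)) (pars_M p)) <= 1 + (1 + 9 * (pars_C p)\<^sup>2 * (1 / snd p 9)\<^sup>2)\<^sup>2 + real (pars_M p)"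
    unfolding u[symmetric] by simp
qed

text \<open>Quantifying over all parameter values after \<open>q\<close> and \<open>c\<close> are
  fixed is what makes \<open>q\<close> absolute and \<open>c\<close> a function of the listed
  quantities alone.\<close>

lemma wos_work_polynomial:
  "\<exists>q>0. \<exists>c. at_most_polynomial 10 c
     \<and> (\<forall>(d'::nat) L' L10' L20' L11' L21' H0' H1' \<beta>' R' \<epsilon>'.
          1 <= d' \<and> 0 <= L' \<and> 0 <= L10' \<and> 0 <= L20' \<and> 0 <= L11' \<and> 0 <= L21' \<and> 0 <= H0' \<and> 0 <= H1'
          \<and> 0 < \<beta>' \<and> \<beta>' <= 1 \<and> 0 < R' \<and> 0 < \<epsilon>' \<and> \<epsilon>' < 1 \<longrightarrow>
          (let \<delta>' = wos_delta d' L10' L20' H1' R' \<epsilon>';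
               M' = wos_steps d' H0' H1' \<beta>' R' \<delta>' \<epsilon>';
               n' = wos_samples (wos_C d' M' L' L10' L20' L11' L21' H0' H1' R') \<epsilon>'
           in real (max n' M') <= c [L', L10', L20', L11', L21', H0', H1', 1 / \<beta>', R', real d']
                                 * real d' powr q * \<epsilon>' powr (- q)))"
proof -
  obtain A k where A: "0 <= A" and Ak: "\<And>p. p \<in> pars ==> real (max (wos_samples (pars_C p) (snd p 9)) (pars_M p)) <= A * pars_T p ^ k"
    using work_bounded unfolding poly_bounded_def by blast
  \<comment> \<open>One number serves as factor and exponent of \<open>c\<close> and as the exponent
    \<open>q\<close>: the bases \<open>1 + ?s\<close>, \<open>1 / \<epsilon>'\<close> and
    \<open>d'\<close> are all at least \<open>1\<close>, so enlarging an exponent only weakens the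
    bound.\<close>
  define a where "a = 1 + A + real k"
  have a: "0 < a" "A <= a" "real k <= a" using A by (auto simp: a_def)
  define c where "c qs = a * (1 + (\<Sum>q\<leftarrow>qs. \<bar>q\<bar>)) powr a" for qs :: "real list"
  have sum0: "0 <= (\<Sum>q\<leftarrow>qs. \<bar>q\<bar>)" for qs :: "real list" by (induction qs) auto
  have c: "at_most_polynomial 10 c"
    unfolding at_most_polynomial_def
  proof (intro exI[of _ a] conjI allI impI)
    show "0 < c qs" for qs
    proof -
      have "0 < 1 + (\<Sum>q\<leftarrow>qs. \<bar>q\<bar>)" using sum0[of qs] by linarith
      then show ?thesis using a by (simp add: c_def)
    qed
  qed (use a in \<open>auto simp: c_def\<close>)
  show ?thesis
  proof (intro exI[of _ a] conjI exI[of _ c] c allI impI)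
    fix d' :: nat and L' L10' L20' L11' L21' H0' H1' \<beta>' R' \<epsilon>' :: real
    assume h: "1 <= d' \<and> 0 <= L' \<and> 0 <= L10' \<and> 0 <= L20' \<and> 0 <= L11' \<and> 0 <= L21' \<and> 0 <= H0' \<and> 0 <= H1'
          \<and> 0 < \<beta>' \<and> \<beta>' <= 1 \<and> 0 < R' \<and> 0 < \<epsilon>' \<and> \<epsilon>' < 1"
    define v where "v i = [L', L10', L20', L11', L21', H0', H1', \<beta>', R', \<epsilon>'] ! i" for i
    have v: "v 0 = L'" "v 1 = L10'" "v (Suc 0) = L10'" "v 2 = L20'" "v 3 = L11'" "v 4 = L21'" "v 5 = H0'" "v 6 = H1'" "v 7 = \<beta>'" "v 8 = R'" "v 9 = \<epsilon>'"
      by (simp_all add: v_def)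
    have all6: "(\<forall>i\<le>6. P i) \<longleftrightarrow> P 0 \<and> P 1 \<and> P 2 \<and> P 3 \<and> P 4 \<and> P 5 \<and> P (6::nat)" for P
    proof -
      have "{..6::nat} = {0, 1, 2, 3, 4, 5, 6}" by auto
      then show ?thesis by (metis (no_types, lifting) atMost_iff insert_iff empty_iff)
    qed
    have p: "(d', v) \<in> pars" unfolding pars_def using h by (simp add: all6 v)
    let ?s = "L' + L10' + L20' + L11' + L21' + H0' + H1' + 1 / \<beta>' + R' + real d'"
    have set6: "{..6::nat} = {0, 1, 2, 3, 4, 5, 6}" by auto
    have ps: "pars_sum (d', v) = ?s" unfolding pars_sum_def set6 by (simp add: v)
    have qs: "1 + (\<Sum>q\<leftarrow>[L', L10', L20', L11', L21', H0', H1', 1 / \<beta>', R', real d']. \<bar>q\<bar>) = 1 + ?s" using h by simp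
    have s1: "1 <= 1 + ?s" using h by (auto intro!: add_nonneg_nonneg)
    have e: "0 < \<epsilon>'" "\<epsilon>' < 1" using h by auto
    have "A * pars_T (d', v) ^ k = A * ((1 + ?s) ^ k * (1 / \<epsilon>') ^ k)"
      unfolding pars_T_def ps by (simp add: v power_divide)
    also have "... = A * ((1 + ?s) powr real k * \<epsilon>' powr (- real k))"
      using s1 e by (simp add: powr_realpow powr_minus power_divide inverse_eq_divide)
    also have "... <= a * ((1 + ?s) powr a * \<epsilon>' powr (- a))"
    proof (intro mult_mono)
      show "(1 + ?s) powr real k <= (1 + ?s) powr a" using s1 a by (intro powr_mono) auto
      show "\<epsilon>' powr (- real k) <= \<epsilon>' powr (- a)" using e a by (intro powr_mono') auto
    qed (use a A in auto)
    also have "... <= a * ((1 + ?s) powr a * \<epsilon>' powr (- a)) * real d' powr a"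
    proof -
      have d1: "1 <= real d' powr a" using h a by (intro ge_one_powr_ge_zero) auto
      have "0 <= a * ((1 + ?s) powr a * \<epsilon>' powr (- a))" using a by simp
      from mult_left_mono[OF d1 this] show ?thesis by simp
    qed
    finally have "A * pars_T (d', v) ^ k <= c [L', L10', L20', L11', L21', H0', H1', 1 / \<beta>', R', real d'] * real d' powr a * \<epsilon>' powr (- a)"
      unfolding c_def qs by (simp add: mult.assoc mult.commute mult.left_commute)
    from order_trans[OF Ak[OF p] this]
    show "let \<delta>' = wos_delta d' L10' L20' H1' R' \<epsilon>';
               M' = wos_steps d' H0' H1' \<beta>' R' \<delta>' \<epsilon>';
               n' = wos_samples (wos_C d' M' L' L10' L20' L11' L21' H0' H1' R') \<epsilon>'
           in real (max n' M') <= c [L', L10', L20', L11', L21', H0', H1', 1 / \<beta>', R', real d'] * real d' powr a * \<epsilon>' powr (- a)"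
      by (simp add: Let_def v)
  qed (use a in simp)
qed

section \<open>The estimator\<close>

text \<open>By continuity in \<open>x\<close> the supremum may be taken over a countable dense
  subset.\<close>

lemma SUP_abs_measurable_of_continuous:
  fixes f :: "'x::metric_space => 'w => real" and D :: "'x set"
  assumes sep: "countable C" "C \<subseteq> D" "D \<subseteq> closure C"
    and m: "\<And>x. x \<in> D ==> f x \<in> borel_measurable P"
    and c: "\<And>w. w \<in> space P ==> continuous_on D (%x. f x w)"
  shows "(%w. SUP x\<in>D. ennreal \<bar>f x w\<bar>) \<in> borel_measurable P"
proof -
  have eq: "(SUP x\<in>D. ennreal \<bar>f x w\<bar>) = (SUP x\<in>C. ennreal \<bar>f x w\<bar>)" if w: "w \<in> space P" for w
  proof (rule antisym)
    show "(SUP x\<in>D. ennreal \<bar>f x w\<bar>) <= (SUP x\<in>C. ennreal \<bar>f x w\<bar>)"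
    proof (rule SUP_least)
      fix x assume x: "x \<in> D"
      then obtain s where s: "\<And>n. s n \<in> C" "s \<longlonglongrightarrow> x" using sep(3) closure_sequential by blast
      have "(%n. f (s n) w) \<longlonglongrightarrow> f x w"
        by (rule continuous_on_tendsto_compose[OF c[OF w] s(2) x]) (use s(1) sep(2) in \<open>simp add: subset_iff\<close>)
      then have "(%n. ennreal \<bar>f (s n) w\<bar>) \<longlonglongrightarrow> ennreal \<bar>f x w\<bar>" by (intro tendsto_ennrealI tendsto_rabs)
      then show "ennreal \<bar>f x w\<bar> <= (SUP x\<in>C. ennreal \<bar>f x w\<bar>)"
        by (rule LIMSEQ_le_const2) (intro exI[of _ 0] allI impI SUP_upper s(1))
    qed
    show "(SUP x\<in>C. ennreal \<bar>f x w\<bar>) <= (SUP x\<in>D. ennreal \<bar>f x w\<bar>)" by (rule SUP_subset_mono[OF sep(2)]) simp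
  qed
  have mC: "(%w. ennreal \<bar>f x w\<bar>) \<in> borel_measurable P" if "x \<in> C" for x
    using m[of x] that sep(2) by auto
  have "(%w. SUP x\<in>C. ennreal \<bar>f x w\<bar>) \<in> borel_measurable P"
    by (rule borel_measurable_SUP[OF sep(1) mC])
  then show ?thesis by (subst measurable_cong[OF eq])
qed

text \<open>Moving from \<open>x\<close> to a nearby grid point changes the centred mean by at most
  the spacing times the average of \<open>lam i + \<Lambda>\<close>, whose mean is at most
  \<open>2 * \<Lambda>\<close>. On the grid, which has at most \<open>m ^ CARD('d)\<close> points,
  the maximal inequality applies.\<close>

lemma (in prob_space) monte_carlo_sup:
  fixes A :: "nat => real ^ 'd => 'a => real" and lam :: "nat => 'a => real"
  assumes D: "D \<noteq> {}" "bounded D" "0 < diameter D" and n: "0 < n" and m: "1 <= m"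
    and ind: "\<And>x. x \<in> D ==> indep_vars (%_. borel) (%i. A i x) {1..n}"
    and H: "\<And>i x w. i \<in> {1..n} ==> x \<in> D ==> w \<in> space M ==> \<bar>A i x w\<bar> <= H"
    and lip: "\<And>i x y w. i \<in> {1..n} ==> x \<in> D ==> y \<in> D ==> w \<in> space M ==> \<bar>A i x w - A i y w\<bar> <= lam i w * norm (x - y)"
    and lam: "\<And>i. i \<in> {1..n} ==> integrable M (lam i)" "\<And>i. i \<in> {1..n} ==> expectation (lam i) <= \<Lambda>"
  shows "(\<integral>\<^sup>+w. (SUP x\<in>D. ennreal \<bar>1 / n * (\<Sum>i=1..n. A i x w - expectation (A i x))\<bar>) \<partial>M)
    <= ennreal (2 * \<Lambda> * (sqrt CARD('d) * diameter D / m) + H * sqrt (2 * ln (2 * real m ^ CARD('d)) / n))"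
proof -
  define \<eta> where "\<eta> = sqrt CARD('d) * diameter D / m"
  have \<eta>0: "0 <= \<eta>" using D by (simp add: \<eta>_def)
  obtain N where N: "finite N" "N \<noteq> {}" "N \<subseteq> D" "card N <= m ^ CARD('d)"
    and near: "\<And>x. x \<in> D ==> \<exists>y\<in>N. norm (x - y) <= \<eta>"
    unfolding \<eta>_def using grid_cover[OF D m] by blast
  define G where "G x w = 1 / n * (\<Sum>i=1..n. A i x w - expectation (A i x))" for x w
  have A_m: "A i x \<in> borel_measurable M" if "i \<in> {1..n}" "x \<in> D" for i x
    using ind[OF that(2)] that(1) unfolding indep_vars_def by blast
  have G_m: "G x \<in> borel_measurable M" if "x \<in> D" for x
    unfolding G_def by (intro borel_measurable_times borel_measurable_const borel_measurable_sum borel_measurable_diff A_m) (use that in auto)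
  have A_int: "integrable M (A i x)" if "i \<in> {1..n}" "x \<in> D" for i x
    by (rule integrable_const_bound[of _ H]) (use that H A_m in auto)
  \<comment> \<open>Comparing the samples at two distinct points of \<open>D\<close> forces
    \<open>lam\<close> to be nonnegative.\<close>
  obtain a b where ab: "a \<in> D" "b \<in> D" "0 < norm (a - b)"
  proof -
    obtain a b where "a \<in> D" "b \<in> D" "diameter D / 2 < dist a b"
      using diameter_lower_bounded[OF D(2), of "diameter D / 2"] D(3) by auto
    moreover from this have "0 < dist a b" using D(3) by linarith
    ultimately show ?thesis using that[of a b] by (simp add: dist_norm)
  qed
  have lam0: "0 <= lam i w" if "i \<in> {1..n}" "w \<in> space M" for i w
  proof -
    have "0 <= lam i w * norm (a - b)" using lip[OF that(1) ab(1,2) that(2)] by (rule order_trans[OF abs_ge_zero])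
    then show ?thesis using ab(3) by (simp add: zero_le_mult_iff)
  qed
  have E_lip: "\<bar>expectation (A i x) - expectation (A i y)\<bar> <= \<Lambda> * norm (x - y)" if i: "i \<in> {1..n}" and xy: "x \<in> D" "y \<in> D" for i x y
  proof -
    have "\<bar>expectation (A i x) - expectation (A i y)\<bar> = \<bar>expectation (%w. A i x w - A i y w)\<bar>"
      by (simp add: A_int[OF i] xy)
    also have "... <= expectation (%w. \<bar>A i x w - A i y w\<bar>)" by (rule integral_abs_bound)
    also have "... <= expectation (%w. lam i w * norm (x - y))"
      by (rule integral_mono) (use A_int[OF i] lam(1)[OF i] lip[OF i] xy in auto)
    also have "... <= \<Lambda> * norm (x - y)" using lam(2)[OF i] by (simp add: mult_right_mono)
    finally show ?thesis .
  qed
  define J where "J w = 1 / n * (\<Sum>i=1..n. lam i w + \<Lambda>)" for w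
  define Mx where "Mx w = Max ((%y. \<bar>G y w\<bar>) ` N)" for w
  have Mx_m: "Mx \<in> borel_measurable M" unfolding Mx_def
    by (intro borel_measurable_Max N(1)) (use G_m N(3) in auto)
  have \<Lambda>0: "0 <= \<Lambda>"
  proof -
    have "0 <= expectation (lam 1)" by (rule Bochner_Integration.integral_nonneg) (use lam0[of 1] n in auto)
    also have "... <= \<Lambda>" using lam(2)[of 1] n by simp
    finally show ?thesis .
  qed
  have J0: "0 <= J w" if "w \<in> space M" for w
    unfolding J_def using lam0[OF _ that] \<Lambda>0 by (intro mult_nonneg_nonneg sum_nonneg add_nonneg_nonneg) auto
  have pt: "(SUP x\<in>D. ennreal \<bar>G x w\<bar>) <= ennreal (Mx w) + ennreal (J w * \<eta>)" if w: "w \<in> space M" for w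
  proof (rule SUP_least)
    fix x assume x: "x \<in> D"
    obtain y where y: "y \<in> N" "norm (x - y) <= \<eta>" using near[OF x] by blast
    have yD: "y \<in> D" using y N by auto
    have "G x w - G y w = 1 / n * (\<Sum>i=1..n. (A i x w - A i y w) - (expectation (A i x) - expectation (A i y)))"
      unfolding G_def right_diff_distrib[symmetric] sum_subtractf[symmetric] by (simp add: algebra_simps)
    then have "\<bar>G x w - G y w\<bar> = 1 / n * \<bar>\<Sum>i=1..n. (A i x w - A i y w) - (expectation (A i x) - expectation (A i y))\<bar>"
      by (simp add: abs_mult)
    also have "... <= 1 / n * (\<Sum>i=1..n. (lam i w + \<Lambda>) * norm (x - y))"
    proof (intro mult_left_mono order_trans[OF sum_abs] sum_mono)
      fix i assume i: "i \<in> {1..n}"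
      show "\<bar>(A i x w - A i y w) - (expectation (A i x) - expectation (A i y))\<bar> <= (lam i w + \<Lambda>) * norm (x - y)"
        using lip[OF i x yD w] E_lip[OF i x yD] unfolding distrib_right by linarith
    qed simp
    also have "... = J w * norm (x - y)" by (simp add: J_def sum_distrib_right)
    also have "... <= J w * \<eta>" using J0[OF w] y by (intro mult_left_mono)
    finally have d: "\<bar>G x w - G y w\<bar> <= J w * \<eta>" .
    have mx: "\<bar>G y w\<bar> <= Mx w" unfolding Mx_def using y N by (intro Max_ge) auto
    have "\<bar>G x w\<bar> <= Mx w + J w * \<eta>" using d mx by linarith
    then have "ennreal \<bar>G x w\<bar> <= ennreal (Mx w + J w * \<eta>)" by (rule ennreal_leI)
    also have "... = ennreal (Mx w) + ennreal (J w * \<eta>)" using mx J0[OF w] \<eta>0 by (intro ennreal_plus) auto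
    finally show "ennreal \<bar>G x w\<bar> <= ennreal (Mx w) + ennreal (J w * \<eta>)" .
  qed
  have J_int: "integrable M (%w. J w * \<eta>)" unfolding J_def
    by (intro integrable_mult_left integrable_mult_right Bochner_Integration.integrable_sum Bochner_Integration.integrable_add lam) auto
  have "expectation J = 1 / n * (\<Sum>i=1..n. expectation (lam i) + \<Lambda>)"
    unfolding J_def using lam(1) by (subst integral_mult_right_zero, subst Bochner_Integration.integral_sum) (auto simp: prob_space)
  also have "... <= 1 / n * (\<Sum>i=1..n. \<Lambda> + \<Lambda>)" using lam(2) by (intro mult_left_mono sum_mono add_right_mono) auto
  also have "... = 2 * \<Lambda>" using n by simp
  finally have EJ: "expectation J <= 2 * \<Lambda>" .
  have J_le: "(\<integral>\<^sup>+w. ennreal (J w * \<eta>) \<partial>M) <= ennreal (2 * \<Lambda> * \<eta>)"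
  proof -
    have "(\<integral>\<^sup>+w. ennreal (J w * \<eta>) \<partial>M) = ennreal (expectation (%w. J w * \<eta>))"
      by (rule nn_integral_eq_integral[OF J_int], rule AE_I2) (intro mult_nonneg_nonneg J0 \<eta>0)
    also have "... <= ennreal (2 * \<Lambda> * \<eta>)" using EJ \<eta>0 by (intro ennreal_leI) (simp add: mult_right_mono)
    finally show ?thesis .
  qed
  define q where "q = ln (2 * real m ^ CARD('d))"
  have m1: "1 <= real m ^ CARD('d)" using m by (intro one_le_power) simp
  then have q0: "0 < q" unfolding q_def by (intro ln_gt_zero) linarith
  have M_le: "(\<integral>\<^sup>+w. ennreal (Mx w) \<partial>M) <= ennreal (H * sqrt (2 * q / n))"
  proof (cases "0 < H")
    case True
    \<comment> \<open>This \<open>l\<close> balances the maximal inequality: the exponent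
      \<open>l\<^sup>2 * H\<^sup>2 / (2 * n)\<close> becomes equal to \<open>q\<close>, the bound
      for the logarithmic term.\<close>
    define l where "l = sqrt (2 * real n * q) / H"
    have l: "0 < l" using q0 n True by (simp add: l_def)
    have l2: "l\<^sup>2 * H\<^sup>2 / (2 * real n) = q" using q0 n True by (simp add: l_def power_divide)
    have up: "(\<integral>\<^sup>+w. ennreal (exp (l * G y w)) \<partial>M) <= ennreal (exp q)" if "y \<in> N" for y
    proof -
      have yD: "y \<in> D" using that N by auto
      show ?thesis using mean_mgf_le[OF ind[OF yD] n H[OF _ yD] l] unfolding l2 G_def by simp
    qed
    have dn: "(\<integral>\<^sup>+w. ennreal (exp (l * - G y w)) \<partial>M) <= ennreal (exp q)" if "y \<in> N" for y
    proof -
      have yD: "y \<in> D" using that N by auto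
      have ind': "indep_vars (%_. borel) (%i w. - A i y w) {1..n}"
        using indep_vars_compose2[OF ind[OF yD], of "%_ x. - x" "%_. borel"] by simp
      have b: "\<bar>- A i y w\<bar> <= H" if "i \<in> {1..n}" "w \<in> space M" for i w using H[OF that(1) yD that(2)] by simp
      have "- G y w = 1 / n * (\<Sum>i=1..n. - A i y w - expectation (%w. - A i y w))" for w
        unfolding G_def mult_minus_right[symmetric] sum_negf[symmetric] by simp
      then show ?thesis using mean_mgf_le[OF ind' n b l] unfolding l2 by simp
    qed
    have cN: "0 < card N" using N by (simp add: card_gt_0_iff)
    have "(\<integral>\<^sup>+w. ennreal (Mx w) \<partial>M) <= ennreal ((ln (2 * card N) + q) / l)"
      unfolding Mx_def
      by (rule nn_integral_Max_le_mgf[OF N(1,2) _ l up dn]) (use G_m N(3) q0 in auto)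
    also have "... <= ennreal ((q + q) / l)"
    proof (intro ennreal_leI divide_right_mono add_right_mono)
      have "real (card N) <= real m ^ CARD('d)" using N(4) by (metis of_nat_le_iff of_nat_power)
      moreover have "0 < real (card N)" using cN by simp
      ultimately show "ln (2 * card N) <= q" unfolding q_def of_nat_mult by (intro ln_mono) linarith+
    qed (use l in simp)
    also have "(q + q) / l = H * sqrt (2 * q / n)"
    proof -
      have q2: "q = sqrt q * sqrt q" using q0 by simp
      have "(q + q) / l = H * (2 * q / (sqrt 2 * sqrt n * sqrt q))" using True by (simp add: l_def real_sqrt_mult)
      also have "2 * q / (sqrt 2 * sqrt n * sqrt q) = sqrt (2 * q / n)"
      proof -
        have "2 * q / (sqrt 2 * sqrt n * sqrt q) = (sqrt 2 * sqrt 2) * (sqrt q * sqrt q) / (sqrt 2 * sqrt n * sqrt q)" using q0 by simp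
        also have "... = sqrt 2 * sqrt q / sqrt n"
        proof -
          have "(a * a) * (b * b) / (a * c * b) = a * b / c" if "a \<noteq> 0" "b \<noteq> 0" "c \<noteq> 0" for a b c :: real
            using that by (simp add: field_simps)
          from this[of "sqrt 2" "sqrt q" "sqrt n"] show ?thesis by (rule) (use q0 n in simp_all)
        qed
        finally show ?thesis by (simp add: real_sqrt_mult real_sqrt_divide)
      qed
      finally show ?thesis .
    qed
    finally show ?thesis .
  next
    \<comment> \<open>With \<open>H\<close> not positive all samples vanish, and the choice of
      \<open>l\<close> above would divide by zero or have the wrong sign.\<close>
    case False
    have "Mx w = 0" if w: "w \<in> space M" for w
    proof -
      have A0: "A i y w' = 0" if "i \<in> {1..n}" "y \<in> D" "w' \<in> space M" for i y w' using H[OF that] False by simp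
      have E0: "expectation (A i y) = 0" if "i \<in> {1..n}" "y \<in> D" for i y
        using A0[OF that] by (subst Bochner_Integration.integral_cong[OF refl, of _ _ "%_. 0"]) auto
      have "G y w = 0" if "y \<in> N" for y
        unfolding G_def using A0[OF _ _ w] E0 that N(3) by (subst sum.neutral) auto
      then have "(%y. \<bar>G y w\<bar>) ` N = {0}" using N(2) by auto
      then show ?thesis by (simp add: Mx_def)
    qed
    then have "(\<integral>\<^sup>+w. ennreal (Mx w) \<partial>M) = 0" by (subst nn_integral_cong[of _ _ "%_. 0"]) auto
    then show ?thesis by simp
  qed
  obtain w\<^sub>0 where w\<^sub>0: "w\<^sub>0 \<in> space M" using not_empty by (meson ex_in_conv)
  have "1 \<in> {1..n}" using n by simp
  from order_trans[OF abs_ge_zero H[OF this ab(1) w\<^sub>0]] have H0: "0 <= H" .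
  have "(\<integral>\<^sup>+w. (SUP x\<in>D. ennreal \<bar>G x w\<bar>) \<partial>M) <= (\<integral>\<^sup>+w. ennreal (Mx w) + ennreal (J w * \<eta>) \<partial>M)"
    by (intro nn_integral_mono pt)
  also have "... = (\<integral>\<^sup>+w. ennreal (Mx w) \<partial>M) + (\<integral>\<^sup>+w. ennreal (J w * \<eta>) \<partial>M)"
    by (intro nn_integral_add measurable_compose[OF Mx_m measurable_ennreal]
      measurable_compose[OF borel_measurable_integrable[OF J_int] measurable_ennreal])
  also have "... <= ennreal (H * sqrt (2 * q / n)) + ennreal (2 * \<Lambda> * \<eta>)" by (intro add_mono M_le J_le)
  also have "... = ennreal (2 * \<Lambda> * \<eta> + H * sqrt (2 * q / n))"
    using H0 \<Lambda>0 \<eta>0 q0 by (subst ennreal_plus[symmetric]) (auto simp: add.commute)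
  finally show ?thesis unfolding G_def \<eta>_def q_def .
qed

section \<open>Independence of the simulated walks\<close>

lemma (in prob_space) product_law_of_indep:
  fixes f :: "('s => 'v::topological_space) => 'b::second_countable_topology" and g :: "('s => 'v) => 'c::second_countable_topology"
  assumes ind: "indep_vars (%_. borel) X I" and AB: "A \<inter> B = {}" "A \<subseteq> I" "B \<subseteq> I"
    and f: "f \<in> borel_measurable (PiM A (%_. borel))" and g: "g \<in> borel_measurable (PiM B (%_. borel))"
  shows "product_law M (%w. f (restrict (%s. X s w) A)) (%w. g (restrict (%s. X s w) B))"
proof -
  let ?A = "%w. restrict (%s. X s w) A" and ?B = "%w. restrict (%s. X s w) B"
  let ?SA = "PiM A (%_. borel)" and ?SB = "PiM B (%_. borel)"
  have "indep_var ?SA ?A ?SB ?B" by (rule indep_var_restrict[OF ind AB])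
  then have rA: "?A \<in> measurable M ?SA" and rB: "?B \<in> measurable M ?SB"
    and eq: "distr M ?SA ?A \<Otimes>\<^sub>M distr M ?SB ?B = distr M (?SA \<Otimes>\<^sub>M ?SB) (%w. (?A w, ?B w))"
    unfolding indep_var_distribution_eq by blast+
  have fA: "(%w. f (?A w)) \<in> borel_measurable M" and gB: "(%w. g (?B w)) \<in> borel_measurable M"
    by (rule measurable_compose[OF rA f] measurable_compose[OF rB g])+
  have fg: "(%(x, y). (f x, g y)) \<in> measurable (?SA \<Otimes>\<^sub>M ?SB) (borel \<Otimes>\<^sub>M borel)"
    unfolding case_prod_beta' by (intro measurable_Pair measurable_compose[OF measurable_fst f] measurable_compose[OF measurable_snd g])
  have "distr M borel (%w. f (?A w)) \<Otimes>\<^sub>M distr M borel (%w. g (?B w))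
      = distr (distr M ?SA ?A) borel f \<Otimes>\<^sub>M distr (distr M ?SB ?B) borel g"
    by (simp add: distr_distr[OF f rA] distr_distr[OF g rB] o_def)
  also have "... = distr (distr M ?SA ?A \<Otimes>\<^sub>M distr M ?SB ?B) (borel \<Otimes>\<^sub>M borel) (%(x, y). (f x, g y))"
  proof (rule pair_measure_distr)
    show "sigma_finite_measure (distr (distr M ?SB ?B) borel g)"
      by (intro prob_space_imp_sigma_finite prob_space.prob_space_distr prob_space_distr rB) (use g in simp)
  qed (use f g in simp_all)
  also have "... = distr M (borel \<Otimes>\<^sub>M borel) ((%(x, y). (f x, g y)) \<circ> (%w. (?A w, ?B w)))"
    unfolding eq by (rule distr_distr[OF fg measurable_Pair[OF rA rB]])
  also have "... = distr M borel (%w. (f (?A w), g (?B w)))" by (simp add: borel_prod o_def)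
  finally show ?thesis using fA gB by (simp add: product_law_def)
qed

definition sources :: "source set" where
  "sources = (\<Union>i\<in>{1..}. \<Union>k\<in>{1..}. {Occupation i k, Exit_Time i k, Gaussian i k})"

text \<open>All draws are padded with zeros into one common space, so that \<open>indep_vars\<close>
  with a single value type applies; the padding leaves the generated
  \<open>\<sigma>\<close>-algebras unchanged. \<open>Path\<close> receives a dummy value.\<close>

definition source_value ::
    "(nat => nat => 'w => real) => (nat => nat => 'w => real ^ 'd) => (nat => nat => 'w => real) =>
     (nat => nat => 'w => real ^ 'd) => source => 'w => real \<times> (real ^ 'd)" where
  "source_value V Y \<rho> Z s w = (case s of Path => (0, 0) | Occupation i k => (V i k w, Y i k w)
     | Exit_Time i k => (\<rho> i k w, 0) | Gaussian i k => (0, Z i k w))"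

lemma source_value_indep:
  fixes B :: "real => 'w => real ^ 'd"
  assumes P: "prob_space P" and ind: "sources_independent P B V Y \<rho> Z"
    and m: "\<And>i k. 1 <= i ==> 1 <= k ==> V i k \<in> borel_measurable P" "\<And>i k. 1 <= i ==> 1 <= k ==> Y i k \<in> borel_measurable P"
      "\<And>i k. 1 <= i ==> 1 <= k ==> \<rho> i k \<in> borel_measurable P" "\<And>i k. 1 <= i ==> 1 <= k ==> Z i k \<in> borel_measurable P"
  shows "prob_space.indep_vars P (%_. borel) (source_value V Y \<rho> Z) sources"
proof -
  interpret prob_space P by fact
  have vm: "source_value V Y \<rho> Z s \<in> borel_measurable P" if "s \<in> sources" for s
    using that m unfolding sources_def by (auto simp: source_value_def[abs_def] intro!: borel_measurable_Pair)
  have ev: "{source_value V Y \<rho> Z s -` A \<inter> space P |A. A \<in> sets borel} \<subseteq> source_events P B V Y \<rho> Z s" if s: "s \<in> sources" for s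
  proof safe
    fix A :: "(real \<times> (real ^ 'd)) set" assume A: "A \<in> sets borel"
    have f: "(%r. (r, 0::real ^ 'd)) -` A \<in> sets borel" "(%z::real ^ 'd. (0::real, z)) -` A \<in> sets borel"
      using measurable_sets[OF _ A, of "%r. (r, 0::real ^ 'd)" borel] measurable_sets[OF _ A, of "%z::real ^ 'd. (0::real, z)" borel]
      by (simp_all add: borel_measurable_Pair)
    from s consider (o) i k where "s = Occupation i k" | (e) i k where "s = Exit_Time i k" | (g) i k where "s = Gaussian i k"
      by (auto simp: sources_def)
    then show "source_value V Y \<rho> Z s -` A \<inter> space P \<in> source_events P B V Y \<rho> Z s"
    proof cases
      case o
      have "(%w. (V i k w, Y i k w)) -` A \<inter> space P \<in> sets (vimage_algebra (space P) (%w. (V i k w, Y i k w)) borel)"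
        by (rule in_vimage_algebra[OF A])
      then show ?thesis by (simp add: o source_events_def source_value_def[abs_def])
    next
      case e
      have "\<rho> i k -` ((%r. (r, 0::real ^ 'd)) -` A) \<inter> space P \<in> sets (vimage_algebra (space P) (\<rho> i k) borel)"
        by (rule in_vimage_algebra[OF f(1)])
      then show ?thesis by (simp add: e source_events_def source_value_def[abs_def] vimage_def)
    next
      case g
      have "Z i k -` ((%z. (0, z)) -` A) \<inter> space P \<in> sets (vimage_algebra (space P) (Z i k) borel)"
        by (rule in_vimage_algebra[OF f(2)])
      then show ?thesis by (simp add: g source_events_def source_value_def[abs_def] vimage_def)
    qed
  qed
  have "indep_sets (%s. {source_value V Y \<rho> Z s -` A \<inter> space P |A. A \<in> sets borel}) sources"
    by (rule indep_sets_mono[OF ind[unfolded sources_independent_def] _ ev]) (auto simp: sources_def)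
  then show ?thesis unfolding indep_vars_def2 using vm by simp
qed

locale sampled_walks = dirichlet P B D g0 g1 K0 K1
  for P :: "'w measure" and B :: "real => 'w => real ^ 'd" and D g0 g1 K0 K1 +
  fixes rb :: "real ^ 'd => real" and \<rho> V :: "nat => nat => 'w => real" and Z Y :: "nat => nat => 'w => real ^ 'd"
    and L L10 L20 L11 L21 :: real
  assumes rb_m: "rb \<in> borel_measurable borel" and rb_b: "\<And>x. 0 <= rb x \<and> rb x <= diameter D"
    and rb_le: "\<And>x. x \<in> closure D ==> rb x <= infdist x (frontier D)"
    and \<rho>: "\<forall>i\<ge>1. \<forall>k\<ge>1. \<rho> i k \<in> borel_measurable P \<and> (\<forall>w\<in>space P. 0 <= \<rho> i k w) \<and>
           distr P borel (\<rho> i k) = distr P borel (ball_exit_time B)"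
    and Z: "\<forall>i\<ge>1. \<forall>k\<ge>1. std_normal_vector P (Z i k)"
    and VY: "\<forall>i\<ge>1. \<forall>k\<ge>1. V i k \<in> borel_measurable P \<and> Y i k \<in> borel_measurable P \<and>
           (\<forall>w\<in>space P. 0 <= V i k w \<and> norm (Y i k w) <= 1) \<and>
           (\<forall>A\<in>sets borel. emeasure (distr P borel (%w. (V i k w, Y i k w))) A = occupation_law P B A)"
    and indep: "sources_independent P B V Y \<rho> Z"
    and L_nonneg: "0 <= L" "0 <= L10" "0 <= L20" "0 <= L11" "0 <= L21"
    and rb_lip: "\<And>x y. x \<in> closure D ==> y \<in> closure D ==> \<bar>rb x - rb y\<bar> <= L * norm (x - y)"
    and g0_lip: "\<And>s t x y. 0 <= s ==> 0 <= t ==> x \<in> closure D ==> y \<in> closure D ==> \<bar>g0 (s, x) - g0 (t, y)\<bar> <= L10 * \<bar>s - t\<bar> + L20 * norm (x - y)"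
    and g1_lip: "\<And>s t x y. 0 <= s ==> 0 <= t ==> x \<in> closure D ==> y \<in> closure D ==> \<bar>g1 (s, x) - g1 (t, y)\<bar> <= L11 * \<bar>s - t\<bar> + L21 * norm (x - y)"
begin

abbreviation val :: "source => 'w => real \<times> (real ^ 'd)" where
  "val \<equiv> source_value V Y \<rho> Z"

lemma val_indep: "indep_vars (%_. borel) val sources"
proof (rule source_value_indep[OF prob indep])
  fix i k :: nat assume ik: "1 <= i" "1 <= k"
  show "V i k \<in> borel_measurable P" "Y i k \<in> borel_measurable P" "\<rho> i k \<in> borel_measurable P" using \<rho> VY ik by simp_all
  show "Z i k \<in> borel_measurable P" by (rule std_normal_vector_law(1)) (use Z ik in simp)
qed

lemma coordinate_measurable:
  assumes "s \<in> A"
  shows "(%e. fst (e s)) \<in> borel_measurable (PiM A (%_. borel :: (real \<times> (real ^ 'd)) measure))"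
    and "(%e. snd (e s)) \<in> borel_measurable (PiM A (%_. borel :: (real \<times> (real ^ 'd)) measure))"
proof -
  have c: "(%e. e s) \<in> measurable (PiM A (%_. borel :: (real \<times> (real ^ 'd)) measure)) borel"
    using assms by (rule measurable_component_singleton)
  show "(%e. fst (e s)) \<in> borel_measurable (PiM A (%_. borel :: (real \<times> (real ^ 'd)) measure))"
    "(%e. snd (e s)) \<in> borel_measurable (PiM A (%_. borel :: (real \<times> (real ^ 'd)) measure))"
    by (rule measurable_compose[OF c borel_fst_measurable] measurable_compose[OF c borel_snd_measurable])+
qed

text \<open>The history of walk \<open>i\<close> reads the block of its own exit times and
  directions up to step \<open>k\<close>; a group \<open>C\<close> of sources disjoint from this
  block is independent of it.\<close>

lemma history_law:
  fixes g :: "(source => real \<times> (real ^ 'd)) => 'c::second_countable_topology"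
  assumes i: "1 <= i" and B: "C \<subseteq> sources" "\<And>j. j <= k ==> Exit_Time i j \<notin> C \<and> Gaussian i j \<notin> C"
    and g: "g \<in> borel_measurable (PiM C (%_. borel))"
  shows "product_law P (%w j. if 1 <= j \<and> j <= k then (\<rho> i j w, Z i j w) else (0, 0)) (%w. g (restrict (%s. val s w) C))"
proof -
  let ?A = "(\<Union>j\<in>{1..k}. {Exit_Time i j, Gaussian i j})"
  define f :: "(source => real \<times> (real ^ 'd)) => nat => real \<times> (real ^ 'd)"
    where "f e j = (if 1 <= j \<and> j <= k then (fst (e (Exit_Time i j)), snd (e (Gaussian i j))) else (0, 0))" for e j
  have f: "f \<in> borel_measurable (PiM ?A (%_. borel))"
  proof (rule measurable_coordinatewise_then_product)
    fix j
    show "(%e. f e j) \<in> borel_measurable (PiM ?A (%_. borel))"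
    proof (cases "1 <= j \<and> j <= k")
      case True
      then have "Exit_Time i j \<in> ?A" "Gaussian i j \<in> ?A" by auto
      then show ?thesis unfolding f_def using True by (simp add: borel_measurable_Pair coordinate_measurable)
    next
      case False
      then have "(%e. f e j) = (%_. (0, 0))" unfolding f_def by auto
      then show ?thesis by simp
    qed
  qed
  have AC: "?A \<inter> C = {}" using B(2) by auto
  have AI: "?A \<subseteq> sources" using i by (auto simp: sources_def)
  have "f (restrict (%s. val s w) ?A) = (%j. if 1 <= j \<and> j <= k then (\<rho> i j w, Z i j w) else (0, 0))" for w
    by (rule ext) (simp add: f_def source_value_def)
  then show ?thesis using product_law_of_indep[OF val_indep AC AI B(1) f g] by simp
qed

text \<open>Sample numbers start at \<open>1\<close> while the locale instances are indexed by all
  naturals, hence the shift: instance \<open>i\<close> is sample \<open>Suc i\<close>.\<close>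

lemma walk_family: "walk_lipschitz P B D g0 g1 K0 K1 rb (\<rho> (Suc i)) (V (Suc i)) (Z (Suc i)) (Y (Suc i)) L L10 L20 L11 L21"
proof
  fix k :: nat
  let ?h = "%w j. if 1 <= j \<and> j <= k then (\<rho> (Suc i) j w, Z (Suc i) j w) else (0, 0)"
  show "product_law P ?h (%w. (\<rho> (Suc i) (Suc k) w, Z (Suc i) (Suc k) w))"
  proof -
    let ?C = "{Exit_Time (Suc i) (Suc k), Gaussian (Suc i) (Suc k)}"
    have g: "(%e. (fst (e (Exit_Time (Suc i) (Suc k))), snd (e (Gaussian (Suc i) (Suc k)))))
        \<in> borel_measurable (PiM ?C (%_. borel :: (real \<times> (real ^ 'd)) measure))"
      by (intro borel_measurable_Pair coordinate_measurable) simp_all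
    have "product_law P ?h (%w. (%e. (fst (e (Exit_Time (Suc i) (Suc k))), snd (e (Gaussian (Suc i) (Suc k))))) (restrict (%s. val s w) ?C))"
      by (rule history_law[OF _ _ _ g]) (auto simp: sources_def)
    then show ?thesis by (simp add: source_value_def)
  qed
  show "product_law P ?h (%w. (V (Suc i) (Suc k) w, Y (Suc i) (Suc k) w))"
  proof -
    let ?C = "{Occupation (Suc i) (Suc k)}"
    have g: "(%e. e (Occupation (Suc i) (Suc k))) \<in> borel_measurable (PiM ?C (%_. borel :: (real \<times> (real ^ 'd)) measure))"
      by (rule measurable_component_singleton) simp
    have "product_law P ?h (%w. (%e. e (Occupation (Suc i) (Suc k))) (restrict (%s. val s w) ?C))"
      by (rule history_law[OF _ _ _ g]) (auto simp: sources_def)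
    then show ?thesis by (simp add: source_value_def)
  qed
  assume k: "1 <= k"
  show "product_law P (\<rho> (Suc i) k) (Z (Suc i) k)"
  proof -
    have m: "(%e. fst (e (Exit_Time (Suc i) k))) \<in> borel_measurable (PiM {Exit_Time (Suc i) k} (%_. borel :: (real \<times> (real ^ 'd)) measure))"
      "(%e. snd (e (Gaussian (Suc i) k))) \<in> borel_measurable (PiM {Gaussian (Suc i) k} (%_. borel :: (real \<times> (real ^ 'd)) measure))"
      by (rule coordinate_measurable, simp)+
    have "{Exit_Time (Suc i) k} \<subseteq> sources" "{Gaussian (Suc i) k} \<subseteq> sources" using k by (auto simp: sources_def)
    from product_law_of_indep[OF val_indep _ this m] show ?thesis by (simp add: source_value_def)
  qed
  show "\<rho> (Suc i) k \<in> borel_measurable P" "distr P borel (\<rho> (Suc i) k) = distr P borel (ball_exit_time B)"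
    "std_normal_vector P (Z (Suc i) k)" "V (Suc i) k \<in> borel_measurable P" "Y (Suc i) k \<in> borel_measurable P"
    "\<forall>A\<in>sets borel. emeasure (distr P borel (%w. (V (Suc i) k w, Y (Suc i) k w))) A = occupation_law P B A"
    using \<rho> Z VY k by simp_all
  fix w assume w: "w \<in> space P"
  show "0 <= \<rho> (Suc i) k w" "0 <= V (Suc i) k w" "norm (Y (Suc i) k w) <= 1" using \<rho> VY k w by simp_all
next
  show "rb \<in> borel_measurable borel" "\<And>x. 0 <= rb x \<and> rb x <= R" "\<And>x. x \<in> closure D ==> rb x <= infdist x (frontier D)"
    by (rule rb_m rb_b rb_le, assumption?)+
  show "0 <= L" "0 <= L10" "0 <= L20" "0 <= L11" "0 <= L21" by (rule L_nonneg)+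
qed (rule rb_lip g0_lip g1_lip; assumption)+

sublocale wk: walk_lipschitz P B D g0 g1 K0 K1 rb "\<rho> (Suc i)" "V (Suc i)" "Z (Suc i)" "Y (Suc i)" L L10 L20 L11 L21 for i
  by (rule walk_family)

text \<open>Each sample is a Borel function of its own block \<open>K i\<close> of sources, and the
  blocks are disjoint.\<close>

lemma samples_indep: "indep_vars (%_. borel) (%i. wk.sample (i - 1) x M) {1..n}"
proof -
  define K where "K i = (\<Union>k\<in>{1..}. {Occupation i k, Exit_Time i k, Gaussian i k})" for i :: nat
  define z :: "nat => nat => (source => real \<times> (real ^ 'd)) => real ^ 'd" where "z i j e = snd (e (Gaussian i j))" for i j e
  define r :: "nat => nat => (source => real \<times> (real ^ 'd)) => real" where "r i j e = fst (e (Exit_Time i j))" for i j e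
  define v :: "nat => nat => (source => real \<times> (real ^ 'd)) => real" where "v i j e = fst (e (Occupation i j))" for i j e
  define u :: "nat => nat => (source => real \<times> (real ^ 'd)) => real ^ 'd" where "u i j e = snd (e (Occupation i j))" for i j e
  define px where "px i k e = wos_pos rb (%j. z i j e) x k" for i k e
  define tx where "tx i k e = wos_time rb (%j. z i j e) (%j. r i j e) x k" for i k e
  define f where "f i e = g0 (tx i M e, px i M e) + 1 / CARD('d) * (\<Sum>k<M. (rb (px i k e))\<^sup>2 *
      g1 (tx i k e + (rb (px i k e))\<^sup>2 * v i (Suc k) e, px i k e + rb (px i k e) *\<^sub>R u i (Suc k) e))" for i e
  have ind: "indep_vars (%i. PiM (K i) (%_. borel)) (%i w. restrict (%s. val s w) (K i)) {1..n}"
    by (rule indep_vars_restrict[OF val_indep]) (auto simp: K_def sources_def disjoint_family_on_def)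
  have f: "f i \<in> borel_measurable (PiM (K i) (%_. borel))" for i
  proof -
    have K: "Gaussian i j \<in> K i" "Exit_Time i j \<in> K i" "Occupation i j \<in> K i" if "1 <= j" for j using that by (auto simp: K_def)
    have zm: "z i j \<in> borel_measurable (PiM (K i) (%_. borel))" and rm: "r i j \<in> borel_measurable (PiM (K i) (%_. borel))"
      and vm: "v i j \<in> borel_measurable (PiM (K i) (%_. borel))" and um: "u i j \<in> borel_measurable (PiM (K i) (%_. borel))" if "1 <= j" for j
      unfolding z_def r_def v_def u_def by (rule coordinate_measurable[OF K(1)[OF that]] coordinate_measurable[OF K(2)[OF that]] coordinate_measurable[OF K(3)[OF that]])+
    have pm: "px i k \<in> borel_measurable (PiM (K i) (%_. borel))" for k
      unfolding px_def by (rule wos_pos_measurable[OF rb_m]) (rule zm)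
    have tm: "tx i k \<in> borel_measurable (PiM (K i) (%_. borel))" for k
      unfolding tx_def by (rule wos_time_measurable[OF rb_m]) (rule zm rm, assumption)+
    show ?thesis unfolding f_def
      by (intro borel_measurable_add borel_measurable_times borel_measurable_const borel_measurable_sum borel_measurable_power
        measurable_compose[OF _ g0_m] measurable_compose[OF _ g1_m] borel_measurable_Pair borel_measurable_scaleR
        measurable_compose[OF pm rb_m] tm pm vm um) simp_all
  qed
  have eq: "f i (restrict (%s. val s w) (K i)) = wk.sample (i - 1) x M w" if i: "i \<in> {1..n}" for i w
  proof -
    have Si: "Suc (i - 1) = i" using i by simp
    let ?e = "restrict (%s. val s w) (K i)"
    have e: "z i j ?e = Z i j w" "r i j ?e = \<rho> i j w" "v i j ?e = V i j w" "u i j ?e = Y i j w" if "1 <= j" for j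
      using that by (auto simp: z_def r_def v_def u_def K_def source_value_def)
    have p: "px i k ?e = wk.X (i - 1) x k w" for k
      unfolding px_def wk.X_def unfolding Si by (rule wos_pos_cong) (rule e)
    have t: "tx i k ?e = wk.S (i - 1) x k w" for k
      unfolding tx_def wk.S_def unfolding Si by (rule wos_time_cong) (rule e, assumption)+
    show ?thesis unfolding f_def wk.sample_def wk.incr_def p t unfolding Si using e(3,4) by simp
  qed
  have "indep_vars (%_. borel) (%i w. f i (restrict (%s. val s w) (K i))) {1..n}"
    by (rule indep_vars_compose2[OF ind f])
  moreover have "indep_vars (%_. borel) (%i w. f i (restrict (%s. val s w) (K i))) {1..n}
      \<longleftrightarrow> indep_vars (%_. borel) (%i. wk.sample (i - 1) x M) {1..n}"
    by (rule indep_vars_cong) (use eq in auto)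
  ultimately show ?thesis by blast
qed

end

text \<open>Holds for every path: if the boundary is never met, \<open>tau\<close> is
  \<open>0\<close> and only the starting point is concerned.\<close>

lemma (in exit_domain) in_closure_until_tau:
  assumes w: "w \<in> space P" and y: "y \<in> closure D" and s: "0 <= s" "s <= tau y w"
  shows "y + B s w \<in> closure D"
proof (cases "hit (frontier D) (spth y w) = \<top>")
  case True
  then have "s = 0" using s by simp
  then show ?thesis using B_zero[OF w] y by simp
next
  case False
  have "ennreal s <= ennreal (tau y w)" using s by (simp add: ennreal_leI)
  also have "... = hit (frontier D) (spth y w)" using False by (simp add: less_top)
  finally show ?thesis using s by (intro in_closure_before_hit[OF w y _ _ order_refl frontier_hit]) auto
qed

section \<open>The parameters meet the error budget\<close>

lemma wos_steps_ge_1: "1 <= wos_steps d H0 H1 \<beta> R \<delta> \<epsilon>"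
  by (simp add: wos_steps_def Let_def)

text \<open>As \<open>\<delta> <= 1\<close>, it is at most its own square root, so both terms
  together are bounded by \<open>sqrt \<delta> * a\<close>. This explains the minimum with
  \<open>1\<close> and the denominator \<open>9 * a\<^sup>2\<close> in
  \<open>wos_delta\<close>.\<close>

lemma time_error_le:
  assumes nn: "0 <= L10" "0 <= L20" "0 <= H1" "0 < R" and \<epsilon>: "0 < \<epsilon>"
    and \<delta>: "\<delta> = wos_delta d L10 L20 H1 R \<epsilon>"
  shows "(L10 + H1) * (\<delta> * R) + L20 * sqrt (real d * (\<delta> * R)) <= \<epsilon> / 3"
proof -
  define a where "a = (L10 + H1) * R + L20 * sqrt (real d) * sqrt R"
  have a0: "0 <= a" using nn by (simp add: a_def)
  have \<delta>': "\<delta> = (if 9 * a\<^sup>2 = 0 then 1 else min 1 (\<epsilon>\<^sup>2 / (9 * a\<^sup>2)))" unfolding \<delta> wos_delta_def Let_def a_def ..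
  have \<delta>01: "0 <= \<delta>" "\<delta> <= 1" unfolding \<delta>' by auto
  have "\<delta> = sqrt \<delta> * sqrt \<delta>" using \<delta>01 by simp
  also have "... <= sqrt \<delta> * 1" using \<delta>01 by (intro mult_left_mono) auto
  finally have "\<delta> <= sqrt \<delta>" by simp
  then have "\<delta> * ((L10 + H1) * R) <= sqrt \<delta> * ((L10 + H1) * R)" using nn by (intro mult_right_mono) auto
  then have "(L10 + H1) * (\<delta> * R) + L20 * sqrt (real d * (\<delta> * R)) <= sqrt \<delta> * a"
    by (simp add: a_def real_sqrt_mult algebra_simps)
  also have "... <= \<epsilon> / 3"
  proof (cases "a = 0")
    case False
    then have a: "0 < a" using a0 by simp
    have "\<delta> <= \<epsilon>\<^sup>2 / (9 * a\<^sup>2)" using a unfolding \<delta>' by simp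
    also have "... = (\<epsilon> / (3 * a))\<^sup>2" by (simp add: power_divide power_mult_distrib)
    finally have "sqrt \<delta> <= \<epsilon> / (3 * a)" using a \<epsilon> by (intro real_le_lsqrt) auto
    then have "sqrt \<delta> * a <= \<epsilon> / (3 * a) * a" using a by (intro mult_right_mono) auto
    then show ?thesis using a by simp
  qed (use \<epsilon> in simp)
  finally show ?thesis .
qed

text \<open>With \<open>a\<close> and \<open>y\<close> as in the proof, the prefactor is
  \<open>a / (6 * d)\<close>, and for positive \<open>a\<close> the choice of \<open>M\<close> gives
  \<open>(1 + y) ^ M >= a / (d * \<epsilon>)\<close>; hence the \<open>6\<close> in
  \<open>wos_steps\<close>.\<close>

lemma truncation_error_le:
  assumes nn: "0 <= H0" "0 <= H1" "0 < R" "0 < \<beta>" "0 < \<delta>" and d: "1 <= d" and \<epsilon>: "0 < \<epsilon>"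
    and M: "M = wos_steps d H0 H1 \<beta> R \<delta> \<epsilon>"
  shows "(2 * H0 + R\<^sup>2 / real d * H1) * (2 * (1 / (1 + \<beta>\<^sup>2 * \<delta>\<^sup>2 / (2 * R\<^sup>2))) ^ M) <= \<epsilon> / 3"
proof -
  define a where "a = 6 * (2 * H0 * real d + R\<^sup>2 * H1)"
  define y where "y = \<beta>\<^sup>2 * \<delta>\<^sup>2 / (2 * R\<^sup>2)"
  have y: "0 < y" using nn by (simp add: y_def)
  have d0: "0 < real d" using d by simp
  have C: "2 * H0 + R\<^sup>2 / real d * H1 = a / (6 * real d)" using d0 by (simp add: a_def field_simps)
  have a0: "0 <= a" using nn by (simp add: a_def)
  show ?thesis
  proof (cases "a = 0")
    case True
    then show ?thesis unfolding C using \<epsilon> by simp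
  next
    case False
    then have a: "0 < a" using a0 by simp
    have "M = max 1 (nat \<lceil>(ln a - ln (real d) + ln (1 / \<epsilon>)) / ln (1 + y)\<rceil>)"
      using False unfolding M wos_steps_def Let_def a_def y_def by simp
    then have "(ln a - ln (real d) + ln (1 / \<epsilon>)) / ln (1 + y) <= real M" by linarith
    moreover have l: "0 < ln (1 + y)" using y by simp
    ultimately have "ln a - ln (real d) + ln (1 / \<epsilon>) <= real M * ln (1 + y)" by (simp add: pos_divide_le_eq)
    then have "ln (a / (real d * \<epsilon>)) <= ln ((1 + y) ^ M)"
      using a d0 \<epsilon> y by (simp add: ln_div ln_mult ln_realpow)
    then have g: "a / (real d * \<epsilon>) <= (1 + y) ^ M" using a d0 \<epsilon> y by (subst (asm) ln_le_cancel_iff) auto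
    have p: "0 < (1 + y) ^ M" using y by simp
    have "a * (2 * (1 / (1 + y)) ^ M) / (6 * real d) = (a / (3 * real d)) / (1 + y) ^ M" by (simp add: power_divide)
    also have "... <= \<epsilon> / 3"
    proof -
      have "a <= (1 + y) ^ M * (real d * \<epsilon>)" using g d0 \<epsilon> by (simp add: pos_divide_le_eq)
      then have "a / (3 * real d) <= \<epsilon> / 3 * (1 + y) ^ M" using d0 by (simp add: field_simps)
      then show ?thesis unfolding pos_divide_le_eq[OF p] .
    qed
    finally show ?thesis unfolding C y_def[symmetric] by simp
  qed
qed

text \<open>Since \<open>C <= \<epsilon> / 3 * sqrt s\<close>, it suffices to bound the two error
  terms by \<open>T1 / sqrt s\<close> and \<open>T3 / sqrt s\<close>, whose sum is at most
  \<open>C / sqrt s\<close>. The grid number \<open>m\<close> is about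
  \<open>M * (1 + L) ^ M * s\<close>: this cancels the growth of the Lipschitz constant and still
  leaves a factor \<open>1 / s\<close>, while \<open>ln m\<close> is covered by the root term of
  \<open>wos_C\<close> up to \<open>ln s\<close>.\<close>

lemma sampling_error_le:
  assumes d: "1 <= d" and M: "1 <= M"
    and nn: "0 <= L" "0 <= L10" "0 <= L20" "0 <= L11" "0 <= L21" "0 <= H0" "0 <= H1" "0 < R" and \<epsilon>: "0 < \<epsilon>"
    and n: "n = wos_samples (wos_C d M L L10 L20 L11 L21 H0 H1 R) \<epsilon>"
  defines "Cl \<equiv> L20 + 2 * L10 * R / real d + 1 / real d * (2 * R * H1 + R\<^sup>2 * (L21 + 2 * L11 * R / real d))"
    and "H \<equiv> H0 + real M * R\<^sup>2 * H1 / real d"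
  shows "2 * H <= \<epsilon> / 3 \<or> (\<exists>m\<ge>1. 2 * (real M * (1 + L) ^ M * Cl) * (sqrt (real d) * R / real m) + H * sqrt (2 * ln (2 * real m ^ d) / real n) <= \<epsilon> / 3)"
proof -
  define C where "C = wos_C d M L L10 L20 L11 L21 H0 H1 R"
  define g where "g = real d * (2 * ln (real M) + real M * ln (1 + L)) + ln 2"
  have d0: "1 <= real d" and M0: "1 <= real M" using d M by simp_all
  have ln0: "0 <= ln (real M)" "0 <= ln (1 + L)" "0 <= ln (2::real)" using M0 nn by simp_all
  have g0: "0 <= g" using ln0 by (simp add: g_def)
  have Cl0: "0 <= Cl" using nn by (simp add: Cl_def)
  have H0': "0 <= H" using nn by (simp add: H_def)
  define T1 where "T1 = Cl * sqrt (real d) * R"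
  define T3 where "T3 = 3 * sqrt 2 * (1 + sqrt (real d) + sqrt g) * H"
  have T1: "0 <= T1" using Cl0 nn by (simp add: T1_def)
  have C: "T1 + T3 <= C" "0 <= C"
    unfolding T1_def T3_def C_def g_def Cl_def H_def by (rule wos_C_ge; use M nn in simp)+
  define s where "s = nat \<lceil>9 * C\<^sup>2 / \<epsilon>\<^sup>2\<rceil>"
  have n': "n = max 1 (s\<^sup>2)" unfolding n wos_samples_def s_def C_def ..
  have "9 * C\<^sup>2 / \<epsilon>\<^sup>2 <= real s" unfolding s_def by linarith
  then have "(3 * C / \<epsilon>)\<^sup>2 <= real s" by (simp add: power_divide power_mult_distrib)
  then have "3 * C / \<epsilon> <= sqrt (real s)" by (rule real_le_rsqrt)
  then have Cs: "C <= \<epsilon> / 3 * sqrt (real s)" using \<epsilon> by (simp add: pos_divide_le_eq mult.commute)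
  show ?thesis
  \<comment> \<open>For \<open>s < 4\<close> no grid is used:
    \<open>6 * H <= C <= 2 * \<epsilon> / 3\<close>, and \<open>2 * H\<close> bounds the deviation
    of a sample from its mean. For \<open>s >= 4\<close> the factor \<open>2\<close> in the grid
    term is absorbed by \<open>2 <= sqrt s\<close>.\<close>
  proof (cases "s < 4")
    case True
    have "sqrt (real s) <= sqrt (2\<^sup>2)" using True by (intro real_sqrt_le_mono) simp
    then have "sqrt (real s) <= 2" by simp
    then have "C <= \<epsilon> / 3 * 2" using \<epsilon> by (intro order_trans[OF Cs] mult_left_mono) auto
    moreover have "3 * 1 * (1 + 1 + 0) * H <= T3" unfolding T3_def
      using d0 g0 H0' by (intro mult_right_mono mult_mono add_mono) auto
    then have "6 * H <= T3" by simp
    ultimately have "2 * H <= \<epsilon> / 3" using C T1 \<epsilon> by argo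
    then show ?thesis by blast
  next
    case False
    have s4: "4 <= real s" using False by simp
    then have "sqrt (2\<^sup>2) <= sqrt (real s)" by (intro real_sqrt_le_mono) simp
    then have q2: "2 <= sqrt (real s)" by simp
    have ss: "sqrt (real s) * sqrt (real s) = real s" by simp
    have n2: "real n = (real s)\<^sup>2"
    proof -
      have "1 <= s\<^sup>2" using False by (intro one_le_power) simp
      then show ?thesis unfolding n' by simp
    qed
    define K where "K = real M * (1 + L) ^ M"
    have K1: "1 <= K"
    proof -
      have "1 * 1 <= K" unfolding K_def using M0 nn by (intro mult_mono one_le_power) auto
      then show ?thesis by simp
    qed
    define m where "m = nat \<lceil>K * real s\<rceil>"
    have Ks: "4 <= K * real s" using mult_mono[OF K1 s4] K1 by simp
    have m: "K * real s <= real m" "real m <= 2 * (K * real s)" unfolding m_def using Ks by linarith+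
    have m1: "1 <= m" using m Ks by linarith
    have lip: "2 * (K * Cl) * (sqrt (real d) * R / real m) <= T1 / sqrt (real s)"
    proof -
      have "2 * (K * Cl) * (sqrt (real d) * R / real m) = 2 * T1 * (K / real m)" by (simp add: T1_def)
      also have "... <= 2 * T1 * (1 / real s)"
        using m Ks s4 K1 T1 by (intro mult_left_mono) (auto simp: field_simps)
      also have "... <= T1 / sqrt (real s)"
      proof -
        have "2 * (1 / real s) <= 1 / sqrt (real s)"
        proof -
          have "2 * (1 / real s) = 2 / sqrt (real s) * (1 / sqrt (real s))" using ss by (simp add: field_simps)
          also have "... <= 1 * (1 / sqrt (real s))"
          proof (rule mult_right_mono)
            have "0 < sqrt (real s)" using q2 by linarith
            then show "2 / sqrt (real s) <= 1" unfolding pos_divide_le_eq[OF \<open>0 < sqrt (real s)\<close>] using q2 by simp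
          qed simp
          finally show ?thesis by simp
        qed
        from mult_left_mono[OF this T1] show ?thesis by (simp add: mult.commute mult.left_commute)
      qed
      finally show ?thesis .
    qed
    have stat: "H * sqrt (2 * ln (2 * real m ^ d) / real n) <= T3 / sqrt (real s)"
    proof -
      have mpos: "0 < real m" using m1 by simp
      have "ln (real m) <= ln (2 * (K * real s))" using m mpos by (intro ln_mono) auto
      also have "... = ln 2 + (ln (real M) + real M * ln (1 + L)) + ln (real s)"
        unfolding K_def using M0 nn s4 by (simp add: ln_mult ln_realpow)
      finally have lm: "ln (real m) <= ln 2 + (ln (real M) + real M * ln (1 + L)) + ln (real s)" .
      \<comment> \<open>The crude bound by \<open>s\<close> is affordable, because the fluctuation
        carries \<open>1 / s\<close> and only \<open>1 / sqrt s\<close> has to remain.\<close>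
      have ls: "ln 2 + ln (real s) <= real s"
        using ln_le_minus_one[of "real s"] ln_le_minus_one[of "2::real"] s4 by linarith
      have "ln (2 * real m ^ d) = ln 2 + real d * ln (real m)" using mpos by (simp add: ln_mult ln_realpow)
      also have "... <= ln 2 + real d * (2 * ln (real M) + real M * ln (1 + L) + real s)"
        using lm ls ln0 by (intro add_left_mono mult_left_mono) auto
      also have "... = g + real d * real s" by (simp add: g_def algebra_simps)
      finally have "sqrt (2 * ln (2 * real m ^ d)) <= sqrt (2 * (g + real d * real s))" by simp
      also have "... <= sqrt 2 * (sqrt g + sqrt (real d) * sqrt (real s))"
      proof -
        have "sqrt (g + real d * real s) <= sqrt g + sqrt (real d) * sqrt (real s)"
          using sqrt_add_le_add_sqrt[of g "real d * real s"] g0 by (simp add: real_sqrt_mult)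
        then show ?thesis unfolding real_sqrt_mult[of 2 "g + real d * real s"] by (rule mult_left_mono) simp
      qed
      also have "... <= sqrt 2 * (sqrt g * sqrt (real s) + sqrt (real d) * sqrt (real s))"
      proof -
        have "sqrt g * 1 <= sqrt g * sqrt (real s)" using s4 g0 by (intro mult_left_mono) auto
        then show ?thesis by simp
      qed
      also have "... = sqrt 2 * (sqrt g + sqrt (real d)) * sqrt (real s)" by (simp add: algebra_simps)
      also have "... <= (3 * sqrt 2 * (1 + sqrt (real d) + sqrt g)) * sqrt (real s)"
      proof (rule mult_right_mono)
        have "sqrt 2 * (sqrt g + sqrt (real d)) <= sqrt 2 * (3 * (1 + sqrt (real d) + sqrt g))"
          using g0 by (intro mult_left_mono) auto
        then show "sqrt 2 * (sqrt g + sqrt (real d)) <= 3 * sqrt 2 * (1 + sqrt (real d) + sqrt g)" by (simp add: algebra_simps)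
      qed simp
      finally have b: "sqrt (2 * ln (2 * real m ^ d)) <= (3 * sqrt 2 * (1 + sqrt (real d) + sqrt g)) * sqrt (real s)" .
      have "sqrt (2 * ln (2 * real m ^ d) / real n) = sqrt (2 * ln (2 * real m ^ d)) / real s"
        unfolding n2 by (simp add: real_sqrt_divide)
      also have "... <= (3 * sqrt 2 * (1 + sqrt (real d) + sqrt g)) * sqrt (real s) / real s"
        using b by (rule divide_right_mono) simp
      also have "... = 3 * sqrt 2 * (1 + sqrt (real d) + sqrt g) / sqrt (real s)"
      proof -
        have "x * q / (q * q) = x / q" if "q \<noteq> 0" for x q :: real using that by simp
        from this[of "sqrt (real s)" "3 * sqrt 2 * (1 + sqrt (real d) + sqrt g)"] show ?thesis using s4 unfolding ss by simp
      qed
      finally have "H * sqrt (2 * ln (2 * real m ^ d) / real n) <= H * (3 * sqrt 2 * (1 + sqrt (real d) + sqrt g) / sqrt (real s))"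
        using H0' by (rule mult_left_mono)
      then show ?thesis by (simp add: T3_def mult.commute mult.left_commute)
    qed
    have "2 * (K * Cl) * (sqrt (real d) * R / real m) + H * sqrt (2 * ln (2 * real m ^ d) / real n) <= (T1 + T3) / sqrt (real s)"
      using lip stat by (simp add: add_divide_distrib)
    also have "... <= (\<epsilon> / 3 * sqrt (real s)) / sqrt (real s)" using C Cs by (intro divide_right_mono) auto
    also have "... = \<epsilon> / 3" using s4 by simp
    finally show ?thesis using m1 unfolding K_def by (intro disjI2 exI[of _ m] conjI)
  qed
qed

context sampled_walks begin

definition estimate :: "nat => nat => real ^ 'd => 'w => real" where
  "estimate n M x w = 1 / real n * (\<Sum>i=1..n. wk.sample (i - 1) x M w)"

lemma estimate_measurable: "estimate n M x \<in> borel_measurable P"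
  unfolding estimate_def by (intro borel_measurable_times borel_measurable_const borel_measurable_sum wk.sample_m)

lemma estimate_continuous:
  assumes w: "w \<in> space P"
  shows "continuous_on D (%x. estimate n M x w)"
proof -
  have "continuous_on D (%x. wk.sample i x M w)" for i
  proof (rule continuous_on_subset[OF lipschitz_on_continuous_on closure_subset])
    show "\<bar>wk.lam i M w\<bar>-lipschitz_on (closure D) (%x. wk.sample i x M w)"
    proof (rule lipschitz_onI)
      fix x y assume xy: "x \<in> closure D" "y \<in> closure D"
      have "\<bar>wk.sample i x M w - wk.sample i y M w\<bar> <= wk.lam i M w * norm (x - y)" by (rule wk.sample_lip[OF xy w])
      also have "... <= \<bar>wk.lam i M w\<bar> * norm (x - y)" by (intro mult_right_mono) auto
      finally show "dist (wk.sample i x M w) (wk.sample i y M w) <= \<bar>wk.lam i M w\<bar> * dist x y" by (simp add: dist_norm)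
    qed simp
  qed
  then show ?thesis unfolding estimate_def by (intro continuous_intros)
qed

text \<open>The error is the averaged bias plus the centred mean \<open>G\<close>. For
  \<open>G\<close>, either the trivial bound by twice the maximal sample suffices, or the uniform
  estimate on a grid of some number \<open>m\<close> applies.\<close>

lemma estimate_error:
  assumes R: "0 < R" and n: "0 < n" and M: "1 <= M" and b0: "0 <= b" and e0: "0 <= e"
    and bias: "\<And>i x. x \<in> D ==> \<bar>W 0 x - expectation (wk.sample i x M)\<bar> <= b"
    and mc: "2 * (K0 + real M * R\<^sup>2 * K1 / real CARD('d)) <= e \<or>
      (\<exists>m\<ge>1. 2 * (real M * (1 + L) ^ M * (L20 + 2 * L10 * R / real CARD('d) + 1 / real CARD('d) * (2 * R * K1 + R\<^sup>2 * (L21 + 2 * L11 * R / real CARD('d)))))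
          * (sqrt (real CARD('d)) * R / real m) + (K0 + real M * R\<^sup>2 * K1 / real CARD('d)) * sqrt (2 * ln (2 * real m ^ CARD('d)) / real n) <= e)"
  shows "(\<integral>\<^sup>+w. (SUP x\<in>D. ennreal \<bar>W 0 x - estimate n M x w\<bar>) \<partial>P) <= ennreal (b + e)"
proof -
  let ?A = "%i x. wk.sample (i - 1) x M"
  let ?H = "K0 + real M * R\<^sup>2 * K1 / real CARD('d)"
  define G where "G x w = 1 / real n * (\<Sum>i=1..n. ?A i x w - expectation (?A i x))" for x w
  have A_b: "\<bar>?A i x w\<bar> <= ?H" for i x w by (rule wk.sample_bound)
  have pt: "(SUP x\<in>D. ennreal \<bar>W 0 x - estimate n M x w\<bar>) <= ennreal b + (SUP x\<in>D. ennreal \<bar>G x w\<bar>)" for w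
  proof (rule SUP_least)
    fix x assume x: "x \<in> D"
    have c: "W 0 x = 1 / real n * (\<Sum>i=1..n. W 0 x)" using n by simp
    have "W 0 x - estimate n M x w = 1 / real n * (\<Sum>i=1..n. W 0 x - expectation (?A i x)) - G x w"
      by (subst c) (simp add: G_def estimate_def sum_subtractf algebra_simps)
    moreover have "\<bar>1 / real n * (\<Sum>i=1..n. W 0 x - expectation (?A i x))\<bar> <= b"
    proof -
      have "\<bar>\<Sum>i=1..n. W 0 x - expectation (?A i x)\<bar> <= (\<Sum>i=1..n. b)"
        by (intro order_trans[OF sum_abs] sum_mono bias x)
      then show ?thesis using n by (simp add: abs_mult pos_divide_le_eq mult.commute)
    qed
    ultimately have "\<bar>W 0 x - estimate n M x w\<bar> <= b + \<bar>G x w\<bar>" by linarith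
    then have "ennreal \<bar>W 0 x - estimate n M x w\<bar> <= ennreal b + ennreal \<bar>G x w\<bar>"
      unfolding ennreal_plus[OF b0 abs_ge_zero, symmetric] by (rule ennreal_leI)
    also have "... <= ennreal b + (SUP x\<in>D. ennreal \<bar>G x w\<bar>)" by (intro add_left_mono SUP_upper x)
    finally show "ennreal \<bar>W 0 x - estimate n M x w\<bar> <= ennreal b + (SUP x\<in>D. ennreal \<bar>G x w\<bar>)" .
  qed
  have G: "(\<integral>\<^sup>+w. ennreal b + (SUP x\<in>D. ennreal \<bar>G x w\<bar>) \<partial>P) <= ennreal b + ennreal e"
    using mc
  proof (elim disjE exE conjE)
    assume h: "2 * ?H <= e"
    have "\<bar>G x w\<bar> <= e" for x w
    proof -
      have "\<bar>?A i x w - expectation (?A i x)\<bar> <= 2 * ?H" for i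
      proof -
        have "\<bar>expectation (?A i x)\<bar> <= ?H" by (rule abs_expectation_le) (use A_b order_trans[OF abs_ge_zero A_b] in auto)
        moreover have "\<bar>u - v\<bar> <= 2 * h" if "\<bar>u\<bar> <= h" "\<bar>v\<bar> <= h" for u v h :: real using that by linarith
        ultimately show ?thesis using A_b by blast
      qed
      then have "\<bar>\<Sum>i=1..n. ?A i x w - expectation (?A i x)\<bar> <= (\<Sum>i=1..n. 2 * ?H)"
        by (intro order_trans[OF sum_abs] sum_mono)
      then have "\<bar>G x w\<bar> <= 2 * ?H" using n by (simp add: G_def abs_mult pos_divide_le_eq mult.commute)
      then show ?thesis using h by linarith
    qed
    then have "(SUP x\<in>D. ennreal \<bar>G x w\<bar>) <= ennreal e" for w by (intro SUP_least ennreal_leI)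
    then have "(\<integral>\<^sup>+w. ennreal b + (SUP x\<in>D. ennreal \<bar>G x w\<bar>) \<partial>P) <= (\<integral>\<^sup>+w. ennreal b + ennreal e \<partial>P)"
      by (intro nn_integral_mono add_left_mono)
    then show ?thesis by (simp add: emeasure_space_1)
  next
    fix m :: nat
    let ?e = "2 * (real M * (1 + L) ^ M * (L20 + 2 * L10 * R / real CARD('d) + 1 / real CARD('d) * (2 * R * K1 + R\<^sup>2 * (L21 + 2 * L11 * R / real CARD('d)))))
          * (sqrt (real CARD('d)) * R / real m) + ?H * sqrt (2 * ln (2 * real m ^ CARD('d)) / real n)"
    assume m: "1 <= m" and e: "?e <= e"
    have "(\<integral>\<^sup>+w. (SUP x\<in>D. ennreal \<bar>G x w\<bar>) \<partial>P) <= ennreal ?e"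
      unfolding G_def
    proof (rule monte_carlo_sup[OF D_nonempty D_bounded R n m samples_indep A_b])
      fix i x y w assume "x \<in> D" "y \<in> D" "w \<in> space P"
      then show "\<bar>?A i x w - ?A i y w\<bar> <= wk.lam (i - 1) M w * norm (x - y)"
        using closure_subset by (intro wk.sample_lip) auto
    qed (rule wk.lam_expectation[OF M])+
    also have "... <= ennreal e" by (rule ennreal_leI[OF e])
    finally have G_le: "(\<integral>\<^sup>+w. (SUP x\<in>D. ennreal \<bar>G x w\<bar>) \<partial>P) <= ennreal e" .
    \<comment> \<open>The integral of the sum is split using measurability of the supremum, which
      comes from a dense sequence and the continuity of \<open>G\<close> in
      \<open>x\<close>.\<close>
    obtain T where T: "countable T" "T \<subseteq> D" "D \<subseteq> closure T" by (rule separable)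
    have "(\<integral>\<^sup>+w. ennreal b + (SUP x\<in>D. ennreal \<bar>G x w\<bar>) \<partial>P) = ennreal b + (\<integral>\<^sup>+w. (SUP x\<in>D. ennreal \<bar>G x w\<bar>) \<partial>P)"
    proof (subst nn_integral_add)
      show "(%w. SUP x\<in>D. ennreal \<bar>G x w\<bar>) \<in> borel_measurable P"
      proof (rule SUP_abs_measurable_of_continuous[OF T])
        show "G x \<in> borel_measurable P" for x
          unfolding G_def by (intro borel_measurable_times borel_measurable_const borel_measurable_sum borel_measurable_diff wk.sample_m)
        fix w assume w: "w \<in> space P"
        have G_eq: "G x w = estimate n M x w - 1 / real n * (\<Sum>i=1..n. expectation (?A i x))" for x
          by (simp add: G_def estimate_def sum_subtractf algebra_simps)
        have "continuous_on D (%x. expectation (wk.sample i x M))" for i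
        proof (rule continuous_on_subset[OF lipschitz_on_continuous_on closure_subset])
          show "\<bar>expectation (wk.lam i M)\<bar>-lipschitz_on (closure D) (%x. expectation (wk.sample i x M))"
          proof (rule lipschitz_onI)
            fix x y assume xy: "x \<in> closure D" "y \<in> closure D"
            have int: "integrable P (wk.sample i x M)" for x
              by (rule integrable_const_bound[of _ ?H]) (use wk.sample_bound wk.sample_m in auto)
            have "\<bar>expectation (wk.sample i x M) - expectation (wk.sample i y M)\<bar> = \<bar>expectation (%w. wk.sample i x M w - wk.sample i y M w)\<bar>"
              by (simp add: int)
            also have "... <= expectation (%w. \<bar>wk.sample i x M w - wk.sample i y M w\<bar>)" by (rule integral_abs_bound)
            also have "... <= expectation (%w. wk.lam i M w * norm (x - y))"
              by (rule integral_mono) (use int wk.lam_expectation(1)[OF M] wk.sample_lip[OF xy] in auto)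
            also have "... = expectation (wk.lam i M) * norm (x - y)" by simp
            also have "... <= \<bar>expectation (wk.lam i M)\<bar> * norm (x - y)" by (intro mult_right_mono) auto
            finally show "dist (expectation (wk.sample i x M)) (expectation (wk.sample i y M)) <= \<bar>expectation (wk.lam i M)\<bar> * dist x y"
              by (simp add: dist_norm)
          qed simp
        qed
        then show "continuous_on D (%x. G x w)" unfolding G_eq using estimate_continuous[OF w] by (intro continuous_intros)
      qed
    qed (simp_all add: emeasure_space_1)
    also have "... <= ennreal b + ennreal e" by (intro add_left_mono G_le)
    finally show ?thesis .
  qed
  have "(\<integral>\<^sup>+w. (SUP x\<in>D. ennreal \<bar>W 0 x - estimate n M x w\<bar>) \<partial>P) <= (\<integral>\<^sup>+w. ennreal b + (SUP x\<in>D. ennreal \<bar>G x w\<bar>) \<partial>P)"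
    by (intro nn_integral_mono pt)
  also note G
  finally show ?thesis using b0 e0 by simp
qed

end

text \<open>At a boundary point the extension by zero is continuous because \<open>r\<close> is at
  most the distance to the frontier; letting interior points approach it carries the Lipschitz bound
  over with the same constant.\<close>

lemma lipschitz_distance_closure:
  fixes D :: "(real ^ 'd) set"
  assumes D: "open D" and L: "0 <= L"
    and r0: "\<And>x. x \<in> D ==> 0 <= r x" and r_le: "\<And>x. x \<in> D ==> r x <= infdist x (frontier D)" and fr: "\<And>x. x \<in> frontier D ==> r x = 0"
    and lip: "\<And>x y. x \<in> D ==> y \<in> D ==> \<bar>r x - r y\<bar> <= L * norm (x - y)"
    and x: "x \<in> closure D" and y: "y \<in> closure D"
  shows "\<bar>r x - r y\<bar> <= L * norm (x - y)"
proof -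
  have c: "z \<in> D \<or> z \<in> frontier D" if "z \<in> closure D" for z using that D by (auto simp: frontier_def interior_open)
  have main: "r x <= L * norm (x - y)" if x: "x \<in> D" and y: "y \<in> frontier D" for x y
  proof -
    have "y \<in> closure D" using y by (simp add: frontier_def)
    then obtain s where s: "\<And>n. s n \<in> D" "s \<longlonglongrightarrow> y" using closure_sequential by blast
    have le: "r x <= norm (s n - y) + L * norm (x - s n)" for n
    proof -
      have "r (s n) <= norm (s n - y)" using r_le[OF s(1)] infdist_le[OF y, of "s n"] by (force simp: dist_norm intro: order_trans)
      then show ?thesis using lip[OF x s(1), of n] by linarith
    qed
    have "(%n. norm (s n - y) + L * norm (x - s n)) \<longlonglongrightarrow> norm (y - y) + L * norm (x - y)"
      by (intro tendsto_intros s(2))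
    then have "r x <= norm (y - y) + L * norm (x - y)"
      by (rule LIMSEQ_le_const) (intro exI[of _ 0] allI impI le)
    then show ?thesis by simp
  qed
  from c[OF x] c[OF y] show ?thesis
  proof (elim disjE)
    assume "x \<in> D" "y \<in> frontier D"
    then show ?thesis using main[of x y] r0[of x] fr[of y] by simp
  next
    assume "x \<in> frontier D" "y \<in> D"
    then show ?thesis using main[of y x] r0[of y] fr[of x] by (simp add: norm_minus_commute)
  qed (use lip L fr in auto)
qed

lemma abs_le_sup_norm_on:
  assumes "bounded ((%(t, x). h t x) ` A)" "(t, x) \<in> A"
  shows "\<bar>h t x\<bar> <= sup_norm_on A h"
proof -
  obtain K where K: "\<And>z. z \<in> (%(t, x). h t x) ` A ==> \<bar>z\<bar> <= K" using assms(1) unfolding bounded_iff by auto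
  have "bdd_above ((%(t, x). \<bar>h t x\<bar>) ` A)"
  proof (rule bdd_aboveI)
    fix z assume "z \<in> (%(t, x). \<bar>h t x\<bar>) ` A"
    then obtain t x where "(t, x) \<in> A" "z = \<bar>h t x\<bar>" by auto
    then show "z <= K" using K[of "h t x"] by force
  qed
  from cSUP_upper[OF assms(2) this] show ?thesis by (simp add: sup_norm_on_def)
qed

lemma extension_measurable:
  fixes h :: "real => real ^ 'd => real" and A :: "(real \<times> (real ^ 'd)) set"
  assumes "(%(t, x). h t x) \<in> borel_measurable (restrict_space borel A)" "A \<in> sets borel"
  shows "(%p. if p \<in> A then h (fst p) (snd p) else 0) \<in> borel_measurable borel"
proof -
  have "(%p. indicator A p *\<^sub>R (case p of (t, x) => h t x)) \<in> borel_measurable borel"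
    using assms by (subst borel_measurable_restrict_space_iff[symmetric]) auto
  also have "(%p. indicator A p *\<^sub>R (case p of (t, x) => h t x)) = (%p. if p \<in> A then h (fst p) (snd p) else 0)"
    by (auto simp: fun_eq_iff)
  finally show ?thesis .
qed

text \<open>The distance and the data are extended by \<open>0\<close>, and all positions of the walk stay in the closure
  of \<open>D\<close>. If the boundary is never hit, the hitting time has the junk value \<open>0\<close>, for which the
  integrands are still evaluated inside \<open>D\<close>.\<close>

theorem corollary4p10:
  fixes P :: "'w measure"
    and B :: "real \<Rightarrow> 'w \<Rightarrow> real ^ 'd"
    and D :: "(real ^ 'd) set"
    and rbar :: "real ^ 'd \<Rightarrow> real"
    and \<rho> V :: "nat \<Rightarrow> nat \<Rightarrow> 'w \<Rightarrow> real"
    and Z Y :: "nat \<Rightarrow> nat \<Rightarrow> 'w \<Rightarrow> real ^ 'd"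
    and h0 h1 :: "real \<Rightarrow> real ^ 'd \<Rightarrow> real"
    and w :: "real ^ 'd \<Rightarrow> real"
    and wbar :: "real ^ 'd \<Rightarrow> 'w \<Rightarrow> real"
    and \<beta> \<delta> \<epsilon> L L10 L20 L11 L21 H0 H1 R :: real
    and d M n :: nat
  assumes dim: "d = CARD('d)"
    and D: "D \<noteq> {}" "open D" "bounded D" "convex D"
    and prob: "prob_space P"
    and BM: "std_brownian_motion P B"
    and \<beta>: "0 < \<beta>" "\<beta> \<le> 1"
    and \<delta>: "0 < \<delta>"
    and rbar: "is_distance \<beta> \<delta> D rbar" "\<forall>x\<in>frontier D. rbar x = 0"
    and \<rho>: "\<forall>i\<ge>1. \<forall>k\<ge>1. \<rho> i k \<in> borel_measurable P \<and> (\<forall>\<omega>\<in>space P. 0 \<le> \<rho> i k \<omega>) \<and>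
           distr P borel (\<rho> i k) = distr P borel (ball_exit_time B)"
    and Z: "\<forall>i\<ge>1. \<forall>k\<ge>1. std_normal_vector P (Z i k)"
    and VY: "\<forall>i\<ge>1. \<forall>k\<ge>1. V i k \<in> borel_measurable P \<and> Y i k \<in> borel_measurable P \<and>
           (\<forall>\<omega>\<in>space P. 0 \<le> V i k \<omega> \<and> norm (Y i k \<omega>) \<le> 1) \<and>
           (\<forall>A\<in>sets borel. emeasure (distr P borel (\<lambda>\<omega>. (V i k \<omega>, Y i k \<omega>))) A = occupation_law P B A)"
    and indep: "sources_independent P B V Y \<rho> Z"
    and h0_meas: "(\<lambda>(t, x). h0 t x) \<in> borel_measurable (restrict_space borel ({0..} \<times> closure D))"
    and h1_meas: "(\<lambda>(t, x). h1 t x) \<in> borel_measurable (restrict_space borel ({0..} \<times> closure D))"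
    and h0_bdd: "bounded ((\<lambda>(t, x). h0 t x) ` ({0..} \<times> closure D))"
    and h1_bdd: "bounded ((\<lambda>(t, x). h1 t x) ` ({0..} \<times> closure D))"
    and H: "H0 = sup_norm_on ({0..} \<times> closure D) h0" "H1 = sup_norm_on ({0..} \<times> closure D) h1"
    and R: "R = diameter D"
    and L_nonneg: "0 \<le> L" "0 \<le> L10" "0 \<le> L20" "0 \<le> L11" "0 \<le> L21"
    and h0_lip: "\<forall>s\<ge>0. \<forall>t\<ge>0. \<forall>x\<in>closure D. \<forall>y\<in>closure D.
           \<bar>h0 s x - h0 t y\<bar> \<le> L10 * \<bar>s - t\<bar> + L20 * norm (x - y)"
    and h1_lip: "\<forall>s\<ge>0. \<forall>t\<ge>0. \<forall>x\<in>closure D. \<forall>y\<in>closure D.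
           \<bar>h1 s x - h1 t y\<bar> \<le> L11 * \<bar>s - t\<bar> + L21 * norm (x - y)"
    and rbar_lip: "\<forall>x\<in>D. \<forall>y\<in>D. \<bar>rbar x - rbar y\<bar> \<le> L * norm (x - y)"
    and w_cont: "continuous_on D w"
    and w: "\<forall>x\<in>D. w x =
           (\<integral>\<omega>. h0 (boundary_time B D x \<omega>) (x + B (boundary_time B D x \<omega>) \<omega>) \<partial>P)
           + (\<integral>\<omega>. (LINT s:{0..boundary_time B D x \<omega>}|lborel. h1 s (x + B s \<omega>)) \<partial>P)"
    and wbar: "\<forall>x\<in>D. \<forall>\<omega>\<in>space P. wbar x \<omega> =
           1 / real n * (\<Sum>i=1..n.
             (let X = wos_pos rbar (\<lambda>k. Z i k \<omega>) x;
                  T = wos_time rbar (\<lambda>k. Z i k \<omega>) (\<lambda>k. \<rho> i k \<omega>) x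
              in h0 (T M) (X M)
                 + 1 / real d * (\<Sum>k=1..M. (rbar (X (k - 1)))\<^sup>2 *
                     h1 (T (k - 1) + (rbar (X (k - 1)))\<^sup>2 * V i k \<omega>)
                        (X (k - 1) + rbar (X (k - 1)) *\<^sub>R Y i k \<omega>))))"
    and \<epsilon>: "0 < \<epsilon>" "\<epsilon> < 1"
    and \<delta>_eq: "\<delta> = wos_delta d L10 L20 H1 R \<epsilon>"
    and M_eq: "M = wos_steps d H0 H1 \<beta> R \<delta> \<epsilon>"
    and n_eq: "n = wos_samples (wos_C d M L L10 L20 L11 L21 H0 H1 R) \<epsilon>"
  shows "(\<lambda>\<omega>. SUP x\<in>D. ennreal \<bar>w x - wbar x \<omega>\<bar>) \<in> borel_measurable P
       \<and> (\<integral>\<^sup>+ \<omega>. (SUP x\<in>D. ennreal \<bar>w x - wbar x \<omega>\<bar>) \<partial>P) \<le> ennreal \<epsilon>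
       \<and> (\<exists>q>0. \<exists>c. at_most_polynomial 10 c
            \<and> real (max n M) \<le> c [L, L10, L20, L11, L21, H0, H1, 1 / \<beta>, R, real d]
                                 * real d powr q * \<epsilon> powr (- q)
            \<and> (\<forall>(d'::nat) L' L10' L20' L11' L21' H0' H1' \<beta>' R' \<epsilon>'.
                 1 \<le> d' \<and> 0 \<le> L' \<and> 0 \<le> L10' \<and> 0 \<le> L20' \<and> 0 \<le> L11' \<and> 0 \<le> L21' \<and> 0 \<le> H0' \<and> 0 \<le> H1'
                 \<and> 0 < \<beta>' \<and> \<beta>' \<le> 1 \<and> 0 < R' \<and> 0 < \<epsilon>' \<and> \<epsilon>' < 1 \<longrightarrow>
                 (let \<delta>' = wos_delta d' L10' L20' H1' R' \<epsilon>';
                      M' = wos_steps d' H0' H1' \<beta>' R' \<delta>' \<epsilon>';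
                      n' = wos_samples (wos_C d' M' L' L10' L20' L11' L21' H0' H1' R') \<epsilon>'
                  in real (max n' M') \<le> c [L', L10', L20', L11', L21', H0', H1', 1 / \<beta>', R', real d']
                                        * real d' powr q * \<epsilon>' powr (- q))))"
proof -
  let ?A = "{0::real..} \<times> closure D"
  define g0 where "g0 p = (if p \<in> ?A then h0 (fst p) (snd p) else 0)" for p
  define g1 where "g1 p = (if p \<in> ?A then h1 (fst p) (snd p) else 0)" for p
  define rb where "rb x = (if x \<in> closure D then rbar x else 0)" for x
  have d1: "1 <= d" unfolding dim by simp
  have Rpos: "0 < diameter D"
  proof -
    obtain x e where xe: "x \<in> D" "0 < e" "cball x e \<subseteq> D" using D(1,2) open_contains_cball by blast
    have "diameter (cball x e) <= diameter D" by (rule diameter_subset[OF xe(3) D(3)])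
    then show ?thesis using xe(2) by (simp add: diameter_cball)
  qed
  have A: "?A \<in> sets borel" by (intro borel_closed closed_Times) auto
  have g0_m: "g0 \<in> borel_measurable borel" and g1_m: "g1 \<in> borel_measurable borel"
    unfolding g0_def g1_def by (rule extension_measurable[OF h0_meas A] extension_measurable[OF h1_meas A])+
  have H0b: "\<bar>h0 t x\<bar> <= H0" and H1b: "\<bar>h1 t x\<bar> <= H1" if "(t, x) \<in> ?A" for t x
    unfolding H by (rule abs_le_sup_norm_on[OF h0_bdd that] abs_le_sup_norm_on[OF h1_bdd that])+
  obtain x0 where x0: "x0 \<in> D" using D(1) by blast
  have x0': "(0, x0) \<in> ?A" using x0 closure_subset by auto
  have H0: "0 <= H0" and H1: "0 <= H1" using H0b[OF x0'] H1b[OF x0'] by linarith+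
  have g0_b: "\<bar>g0 p\<bar> <= H0" and g1_b: "\<bar>g1 p\<bar> <= H1" for p
    using H0b[of "fst p" "snd p"] H1b[of "fst p" "snd p"] H0 H1 by (auto simp: g0_def g1_def)
  have fr: "frontier D \<noteq> {}" using D(1,3) by (auto simp: frontier_eq_empty)
  have cl: "x \<in> D \<or> x \<in> frontier D" if "x \<in> closure D" for x using that D(2) by (auto simp: frontier_def interior_open)
  have rD: "0 <= rbar x" "rbar x <= infdist x (frontier D)" if "x \<in> D" for x
    using rbar(1) that unfolding is_distance_def by auto
  have rfr: "rbar x = 0" if "x \<in> frontier D" for x using rbar(2) that by blast
  have rc: "0 <= rbar x" "rbar x <= infdist x (frontier D)" if "x \<in> closure D" for x
    using cl[OF that] rD[of x] rfr[of x] infdist_nonneg[of x "frontier D"] by auto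
  have r_lip: "\<bar>rbar x - rbar y\<bar> <= L * norm (x - y)" if "x \<in> closure D" "y \<in> closure D" for x y
    by (rule lipschitz_distance_closure[OF D(2) L_nonneg(1) rD rfr _ that]) (use rbar_lip in auto)
  have rb_b: "0 <= rb x \<and> rb x <= diameter D" for x
  proof (cases "x \<in> closure D")
    case True
    obtain z where z: "z \<in> frontier D" using fr by blast
    have "infdist x (frontier D) <= dist x z" by (rule infdist_le[OF z])
    also have "... <= diameter (closure D)"
      using True z by (intro diameter_bounded_bound bounded_closure D(3)) (auto simp: frontier_def)
    finally show ?thesis using rc[OF True] True by (simp add: rb_def diameter_closure[OF D(3)])
  qed (use Rpos in \<open>simp add: rb_def\<close>)
  have rb_m: "rb \<in> borel_measurable borel"
    unfolding rb_def
  proof (rule borel_measurable_continuous_on_if)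
    have "L-lipschitz_on (closure D) rbar"
      by (rule lipschitz_onI) (use r_lip L_nonneg in \<open>auto simp: dist_norm\<close>)
    then show "continuous_on (closure D) rbar" by (rule lipschitz_on_continuous_on)
  qed auto
  interpret sampled_walks P B D g0 g1 H0 H1 rb \<rho> V Z Y L L10 L20 L11 L21
  proof (intro sampled_walks.intro dirichlet.intro exit_domain.intro brownian.intro dirichlet_axioms.intro exit_domain_axioms.intro sampled_walks_axioms.intro)
    show "\<bar>rb x - rb y\<bar> <= L * norm (x - y)" if "x \<in> closure D" "y \<in> closure D" for x y using r_lip[OF that] that by (simp add: rb_def)
    show "rb x <= infdist x (frontier D)" if "x \<in> closure D" for x using rc[OF that] that by (simp add: rb_def)
    show "\<bar>g0 (s, x) - g0 (t, y)\<bar> <= L10 * \<bar>s - t\<bar> + L20 * norm (x - y)"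
      "\<bar>g1 (s, x) - g1 (t, y)\<bar> <= L11 * \<bar>s - t\<bar> + L21 * norm (x - y)"
      if "0 <= s" "0 <= t" "x \<in> closure D" "y \<in> closure D" for s t x y
      using h0_lip h1_lip that by (auto simp: g0_def g1_def)
  qed (fact BM D g0_m g1_m g0_b g1_b rb_m rb_b \<rho> Z VY indep L_nonneg)+
  have w_eq: "w x = W 0 x" if x: "x \<in> D" for x
  proof -
    have xc: "x \<in> closure D" using x closure_subset by auto
    have "(\<integral>\<omega>. h0 (boundary_time B D x \<omega>) (x + B (boundary_time B D x \<omega>) \<omega>) \<partial>P) = (\<integral>\<omega>. g0 (0 + tau x \<omega>, x + B (tau x \<omega>) \<omega>) \<partial>P)"
    proof (rule Bochner_Integration.integral_cong[OF refl])
      fix \<omega> assume \<omega>: "\<omega> \<in> space P"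
      show "h0 (boundary_time B D x \<omega>) (x + B (boundary_time B D x \<omega>) \<omega>) = g0 (0 + tau x \<omega>, x + B (tau x \<omega>) \<omega>)"
        using in_closure_until_tau[OF \<omega> xc enn2real_nonneg order_refl] unfolding boundary_time_eq[OF \<omega>] by (simp add: g0_def)
    qed
    moreover have "(\<integral>\<omega>. (LINT s:{0..boundary_time B D x \<omega>}|lborel. h1 s (x + B s \<omega>)) \<partial>P)
        = (\<integral>\<omega>. (\<integral>s. indicator {0..tau x \<omega>} s * g1 (0 + s, x + B s \<omega>) \<partial>lborel) \<partial>P)"
    proof (rule Bochner_Integration.integral_cong[OF refl])
      fix \<omega> assume \<omega>: "\<omega> \<in> space P"
      show "(LINT s:{0..boundary_time B D x \<omega>}|lborel. h1 s (x + B s \<omega>)) = (\<integral>s. indicator {0..tau x \<omega>} s * g1 (0 + s, x + B s \<omega>) \<partial>lborel)"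
        unfolding set_lebesgue_integral_def boundary_time_eq[OF \<omega>]
      proof (rule Bochner_Integration.integral_cong[OF refl])
        fix s :: real
        show "indicator {0..tau x \<omega>} s *\<^sub>R h1 s (x + B s \<omega>) = indicator {0..tau x \<omega>} s * g1 (0 + s, x + B s \<omega>)"
          using in_closure_until_tau[OF \<omega> xc, of s] by (simp add: g1_def indicator_def)
      qed
    qed
    ultimately show ?thesis using w x unfolding W_eq[OF xc] by simp
  qed
  have wbar_eq: "wbar x \<omega> = estimate n M x \<omega>" if x: "x \<in> D" and \<omega>: "\<omega> \<in> space P" for x \<omega>
  proof -
    have xc: "x \<in> closure D" using x closure_subset by auto
    have s: "(let X = wos_pos rbar (%k. Z i k \<omega>) x; T = wos_time rbar (%k. Z i k \<omega>) (%k. \<rho> i k \<omega>) x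
              in h0 (T M) (X M) + 1 / real d * (\<Sum>k=1..M. (rbar (X (k - 1)))\<^sup>2 *
                     h1 (T (k - 1) + (rbar (X (k - 1)))\<^sup>2 * V i k \<omega>) (X (k - 1) + rbar (X (k - 1)) *\<^sub>R Y i k \<omega>)))
        = wk.sample (i - 1) x M \<omega>" if i: "i \<in> {1..n}" for i
    proof -
      have Si: "Suc (i - 1) = i" using i by simp
      let ?X = "%k. wk.X (i - 1) x k \<omega>" and ?S = "%k. wk.S (i - 1) x k \<omega>"
      have Xc: "?X k \<in> closure D" for k by (rule wk.X_closure[OF xc])
      have rX: "rb (?X k) = rbar (?X k)" for k using Xc by (simp add: rb_def)
      have p: "wos_pos rbar (%k. Z i k \<omega>) x k = ?X k" for k
      proof (induction k)
        case (Suc k)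
        show ?case unfolding wos_pos.simps Suc.IH wk.X_Suc rX unfolding Si ..
      qed simp
      have t: "wos_time rbar (%k. Z i k \<omega>) (%k. \<rho> i k \<omega>) x k = ?S k" for k
      proof (induction k)
        case (Suc k)
        show ?case unfolding wos_time.simps Suc.IH wk.S_Suc rX p unfolding Si ..
      qed simp
      have S0: "0 <= ?S k" for k by (rule wk.S_nonneg[OF \<omega>])
      have inc: "(rbar (?X k))\<^sup>2 * h1 (?S k + (rbar (?X k))\<^sup>2 * V i (Suc k) \<omega>) (?X k + rbar (?X k) *\<^sub>R Y i (Suc k) \<omega>) = wk.incr (i - 1) x k \<omega>" for k
      proof -
        have VYk: "0 <= V i (Suc k) \<omega>" "norm (Y i (Suc k) \<omega>) <= 1" using VY i \<omega> by auto
        have "norm (rbar (?X k) *\<^sub>R Y i (Suc k) \<omega>) <= rbar (?X k) * 1"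
          using rc(1)[OF Xc] VYk(2) by (simp add: mult_left_le)
        also have "... <= infdist (?X k) (frontier D)" using rc(2)[OF Xc] by simp
        finally have "?X k + rbar (?X k) *\<^sub>R Y i (Suc k) \<omega> \<in> closure D" by (rule step_in_closure[OF Xc])
        moreover have "0 <= ?S k + (rbar (?X k))\<^sup>2 * V i (Suc k) \<omega>" using S0 VYk(1) by simp
        ultimately show ?thesis unfolding wk.incr_def rX unfolding Si by (simp add: g1_def)
      qed
      \<comment> \<open>Steps are counted from \<open>1\<close> in the estimator and from
        \<open>0\<close> in \<open>wk.incr\<close>.\<close>
      have "(\<Sum>k=1..M. (rbar (?X (k - 1)))\<^sup>2 * h1 (?S (k - 1) + (rbar (?X (k - 1)))\<^sup>2 * V i k \<omega>) (?X (k - 1) + rbar (?X (k - 1)) *\<^sub>R Y i k \<omega>))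
          = (\<Sum>k<M. wk.incr (i - 1) x k \<omega>)"
      proof -
        have "{1..M} = {Suc 0..<Suc M}" by auto
        then show ?thesis unfolding inc[symmetric] by (simp only: sum.shift_bounds_Suc_ivl diff_Suc_1 atLeast0LessThan)
      qed
      moreover have "h0 (?S M) (?X M) = g0 (?S M, ?X M)" using S0 Xc by (simp add: g0_def)
      ultimately show ?thesis unfolding Let_def p t wk.sample_def dim by (simp only:)
    qed
    have "wbar x \<omega> = 1 / real n * (\<Sum>i=1..n. wk.sample (i - 1) x M \<omega>)"
      using wbar x \<omega> s by (simp only: sum.cong[OF refl s])
    then show ?thesis unfolding estimate_def .
  qed
  have sup_eq: "(SUP x\<in>D. ennreal \<bar>w x - wbar x \<omega>\<bar>) = (SUP x\<in>D. ennreal \<bar>w x - estimate n M x \<omega>\<bar>)" if "\<omega> \<in> space P" for \<omega>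
    by (intro SUP_cong refl) (simp add: wbar_eq[OF _ that])
  have sup_eq': "(SUP x\<in>D. ennreal \<bar>w x - wbar x \<omega>\<bar>) = (SUP x\<in>D. ennreal \<bar>W 0 x - estimate n M x \<omega>\<bar>)" if "\<omega> \<in> space P" for \<omega>
    by (intro SUP_cong refl) (simp add: wbar_eq[OF _ that] w_eq)
  have M1: "1 <= M" unfolding M_eq by (rule wos_steps_ge_1)
  have n0: "0 < n" unfolding n_eq wos_samples_def by simp
  have "(%\<omega>. SUP x\<in>D. ennreal \<bar>w x - wbar x \<omega>\<bar>) \<in> borel_measurable P"
  proof -
    obtain T where T: "countable T" "T \<subseteq> D" "D \<subseteq> closure T" by (rule separable)
    have "(%\<omega>. SUP x\<in>D. ennreal \<bar>w x - estimate n M x \<omega>\<bar>) \<in> borel_measurable P"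
      by (rule SUP_abs_measurable_of_continuous[OF T])
        (intro borel_measurable_diff borel_measurable_const estimate_measurable continuous_on_diff w_cont estimate_continuous; assumption)+
    then show ?thesis by (subst measurable_cong[OF sup_eq])
  qed
  moreover have "(\<integral>\<^sup>+ \<omega>. (SUP x\<in>D. ennreal \<bar>w x - wbar x \<omega>\<bar>) \<partial>P) <= ennreal \<epsilon>"
  proof -
    have "(\<integral>\<^sup>+ \<omega>. (SUP x\<in>D. ennreal \<bar>w x - wbar x \<omega>\<bar>) \<partial>P) = (\<integral>\<^sup>+ \<omega>. (SUP x\<in>D. ennreal \<bar>W 0 x - estimate n M x \<omega>\<bar>) \<partial>P)"
      by (rule nn_integral_cong) (rule sup_eq')
    \<comment> \<open>Two shares of the budget for the bias, namely nearness to the boundary and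
      truncation, and one for the fluctuation.\<close>
    also have "... <= ennreal (2 * \<epsilon> / 3 + \<epsilon> / 3)"
    proof (rule estimate_error[OF Rpos n0 M1])
      fix i x assume x: "x \<in> D"
      then have xc: "x \<in> closure D" using closure_subset by auto
      have low: "\<beta> * infdist y (frontier D) <= rb y" if "y \<in> D" "\<delta> <= infdist y (frontier D)" for y
      proof -
        have "\<beta> * infdist y (frontier D) <= rbar y" using rbar(1) that unfolding is_distance_def by blast
        then show ?thesis using that(1) closure_subset by (auto simp: rb_def)
      qed
      have "\<bar>W 0 x - expectation (wk.sample i x M)\<bar> <= (L10 + H1) * (\<delta> * diameter D) + L20 * sqrt (real CARD('d) * (\<delta> * diameter D))
        + (2 * H0 + (diameter D)\<^sup>2 / real CARD('d) * H1) * (2 * (1 / (1 + \<beta>\<^sup>2 * \<delta>\<^sup>2 / (2 * (diameter D)\<^sup>2))) ^ M)"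
        by (rule wk.sample_bias[OF xc \<delta> \<beta>(1) Rpos low L_nonneg(2,3) g0_lip M1])
      also have "... <= \<epsilon> / 3 + \<epsilon> / 3"
      proof (rule add_mono)
        show "(L10 + H1) * (\<delta> * diameter D) + L20 * sqrt (real CARD('d) * (\<delta> * diameter D)) <= \<epsilon> / 3"
          by (rule time_error_le[OF L_nonneg(2,3) H1 Rpos \<epsilon>(1)]) (use \<delta>_eq in \<open>simp add: dim R\<close>)
        show "(2 * H0 + (diameter D)\<^sup>2 / real CARD('d) * H1) * (2 * (1 / (1 + \<beta>\<^sup>2 * \<delta>\<^sup>2 / (2 * (diameter D)\<^sup>2))) ^ M) <= \<epsilon> / 3"
          by (rule truncation_error_le[OF H0 H1 Rpos \<beta>(1) \<delta> _ \<epsilon>(1)]) (use M_eq in \<open>simp_all add: dim R Suc_leI\<close>)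
      qed
      finally show "\<bar>W 0 x - expectation (wk.sample i x M)\<bar> <= 2 * \<epsilon> / 3" by simp
    next
      show "2 * (H0 + real M * (diameter D)\<^sup>2 * H1 / real CARD('d)) <= \<epsilon> / 3 \<or>
        (\<exists>m\<ge>1. 2 * (real M * (1 + L) ^ M * (L20 + 2 * L10 * diameter D / real CARD('d) + 1 / real CARD('d) * (2 * diameter D * H1 + (diameter D)\<^sup>2 * (L21 + 2 * L11 * diameter D / real CARD('d)))))
          * (sqrt (real CARD('d)) * diameter D / real m) + (H0 + real M * (diameter D)\<^sup>2 * H1 / real CARD('d)) * sqrt (2 * ln (2 * real m ^ CARD('d)) / real n) <= \<epsilon> / 3)"
        by (rule sampling_error_le[OF d1[unfolded dim] M1 L_nonneg H0 H1 Rpos \<epsilon>(1) n_eq[unfolded dim R]])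
    qed (use \<epsilon> in simp_all)
    finally show ?thesis by simp
  qed
  moreover obtain q c where q: "0 < q" and c: "at_most_polynomial 10 c"
    and all: "\<forall>(d'::nat) L' L10' L20' L11' L21' H0' H1' \<beta>' R' \<epsilon>'.
                 1 <= d' \<and> 0 <= L' \<and> 0 <= L10' \<and> 0 <= L20' \<and> 0 <= L11' \<and> 0 <= L21' \<and> 0 <= H0' \<and> 0 <= H1'
                 \<and> 0 < \<beta>' \<and> \<beta>' <= 1 \<and> 0 < R' \<and> 0 < \<epsilon>' \<and> \<epsilon>' < 1 \<longrightarrow>
                 (let \<delta>' = wos_delta d' L10' L20' H1' R' \<epsilon>';
                      M' = wos_steps d' H0' H1' \<beta>' R' \<delta>' \<epsilon>';
                      n' = wos_samples (wos_C d' M' L' L10' L20' L11' L21' H0' H1' R') \<epsilon>'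
                  in real (max n' M') <= c [L', L10', L20', L11', L21', H0', H1', 1 / \<beta>', R', real d']
                                        * real d' powr q * \<epsilon>' powr (- q))"
    using wos_work_polynomial by blast
  moreover have "real (max n M) <= c [L, L10, L20, L11, L21, H0, H1, 1 / \<beta>, R, real d] * real d powr q * \<epsilon> powr (- q)"
  proof -
    have pr: "1 <= d \<and> 0 <= L \<and> 0 <= L10 \<and> 0 <= L20 \<and> 0 <= L11 \<and> 0 <= L21 \<and> 0 <= H0 \<and> 0 <= H1
        \<and> 0 < \<beta> \<and> \<beta> <= 1 \<and> 0 < R \<and> 0 < \<epsilon> \<and> \<epsilon> < 1"
      using d1 L_nonneg H0 H1 \<beta> \<epsilon> Rpos by (simp add: R)
    from all[THEN spec, THEN spec, THEN spec, THEN spec, THEN spec, THEN spec, THEN spec, THEN spec, THEN spec, THEN spec, THEN spec, THEN mp, OF pr]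
    show ?thesis unfolding Let_def n_eq M_eq \<delta>_eq .
  qed
  ultimately show ?thesis by blast
qed

end
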